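(* Let $\mathcal B$ be a unital Banach algebra, $U\subseteq\mathbb C$ open, $\mathcal B_U:=\{a\in\mathcal B:\sigma(a)\subseteq U\}$, $k\in\mathbb N$, $f:U\to\mathbb C$ holomorphic, and $\mathbf a=(a_1,\ldots,a_{k+1})\in\mathcal B_U^{k+1}$. Set $\tilde a_i:=1^{\otimes(i-1)}\otimes a_i\otimes1^{\otimes(k+1-i)}\in\mathcal B^{\hat\otimes_\pi(k+1)}$ for $i=1,\ldots,k+1$, and let $$f^{[k]}_{\otimes}(\mathbf a):=f^{[k]}(\tilde a_1,\ldots,\tilde a_{k+1})\in\mathcal B^{\hat\otimes_\pi(k+1)}$$ be defined via the multivariate holomorphic functional calculus for the commuting elements $\tilde a_1,\dots,\tilde a_{k+1}$. Then $$f^{[k]}_{\otimes}(\mathbf a)=\frac1{2\pi i}\int_\Gamma f(z)\,(z-\tilde a_1)^{-1}\cdots(z-\tilde a_{k+1})^{-1}\,dz$$ for any cycle $\Gamma$ surrounding $\sigma(a_1)\cup\cdots\cup\sigma(a_{k+1})=\sigma(\tilde a_1)\cup\cdots\cup\sigma(\tilde a_{k+1})$ in $U$. In particular, if $f_{\mathcal B}:\mathcal B_U\to\mathcal B$ is the map $a\mapsto f(a)$ induced by the holomorphic functional calculus, then $$\partial_{b_k}\cdots\partial_{b_1}f_{\mathcal B}(a)=\sum_{\pi\in S_k}f^{[k]}_{\otimes}(\underbrace{a,\ldots,a}_{k+1\text{ times}})\,\#\,[b_{\pi(1)},\ldots,b_{\pi(k)}]$$ for all $a\in\mathcal B_U$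 and $b_1,\ldots,b_k\in\mathcal B$.
   Context: $\sigma(\cdot)$ denotes spectrum, $S_k$ the symmetric group on $k$ letters, $\hat\otimes_\pi$ the Banach-space projective tensor product; $\mathcal B^{\hat\otimes_\pi(k+1)}$ is a unital Banach algebra under componentwise multiplication. The bounded linear map $\#:\mathcal B^{\hat\otimes_\pi(k+1)}\to B_k(\mathcal B^k;\mathcal B)$ (bounded $k$-linear maps), written $u\# b$, is determined by $(a_1\otimes\cdots\otimes a_{k+1})\#[b_1,\ldots,b_k]=a_1b_1\cdots a_kb_ka_{k+1}$. A cycle in $U$ is a finite collection of closed piecewise $C^1$ curves in $U$; $\Gamma$ surrounds $S\subseteq U$ in $U$ if its winding number is $0$ around every $z\in\mathbb C\setminus U$ and $1$ around every $z\in S$. $\partial_b$ is the directional derivative in direction $b$. For one variable, $f(a)=\frac1{2\pi i}\int_\Gamma f(z)(z-a)^{-1}dz$ with $\Gamma$ surrounding $\sigma(a)$ in $U$. Divided differences: $f^{[0]}:=f$ and, for distinct $s_1,\ldots,s_{k+1}\in U$, $f^{[k]}(s_1,\ldots,s_{k+1})=\frac{f^{[k-1]}(s_1,\ldots,s_k)-f^{[k-1]}(s_1,\ldots,s_{k-1},s_{k+1})}{s_k-s_{k+1}}$; since $f$ is holomorphic on $U$, $f^{[k]}$ extends uniquely to a holomorphic function on $U^{k+1}$, denoted the same way. Multivariate holomorphic functional calculus: let $\mathrm{Hol}_0(U^{k+1})$ be the closure, in the space of holomorphic functions on $U^{k+1}$ with the topology of locally uniform convergence, of the linear span of the functions $(z_1,\ldots,z_{k+1})\mapsto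 r_1(z_1)\cdots r_{k+1}(z_{k+1})$ with each $r_i$ a rational function with poles outside $U$; one has $f^{[k]}\in\mathrm{Hol}_0(U^{k+1})$. For pairwise commuting elements $c_1,\ldots,c_{k+1}$ of a unital Banach algebra $\mathcal D$ with $\sigma(c_i)\subseteq U$, $\varphi\mapsto\varphi(c_1,\ldots,c_{k+1})$ is the unique continuous unital algebra homomorphism $\mathrm{Hol}_0(U^{k+1})\to\mathcal D$ sending the $i$-th coordinate function to $c_i$ for each $i$. *)

theory Defs
  imports
    "HOL-Complex_Analysis.Complex_Analysis"
    "HOL-Computational_Algebra.Polynomial"
    "HOL-Combinatorics.Permutations"
    "HOL-Library.Poly_Mapping"
begin

section \<open>Unital complex Banach algebras\<close>

class complex_algebra_1 = real_algebra_1 +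
  fixes scaleC :: "complex \<Rightarrow> 'a \<Rightarrow> 'a"  (infixr \<open>*\<^sub>C\<close> 75)
  assumes scaleC_add_right: "c *\<^sub>C (x + y) = c *\<^sub>C x + c *\<^sub>C y"
    and scaleC_add_left: "(c + d) *\<^sub>C x = c *\<^sub>C x + d *\<^sub>C x"
    and scaleC_scaleC: "c *\<^sub>C d *\<^sub>C x = (c * d) *\<^sub>C x"
    and scaleC_of_real: "complex_of_real r *\<^sub>C x = r *\<^sub>R x"
    and mult_scaleC_left: "(c *\<^sub>C x) * y = c *\<^sub>C (x * y)"
    and mult_scaleC_right: "x * (c *\<^sub>C y) = c *\<^sub>C (x * y)"

lemma scaleC_one [simp]: "1 *\<^sub>C x = (x :: 'a::complex_algebra_1)"
  using scaleC_of_real[of 1 x] by (simp add: scaleR_one)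

lemma scaleC_zero_left [simp]: "0 *\<^sub>C x = (0 :: 'a::complex_algebra_1)"
  using scaleC_add_left[of 0 0 x] by simp

lemma scaleC_zero_right [simp]: "c *\<^sub>C 0 = (0 :: 'a::complex_algebra_1)"
  using scaleC_add_right[of c 0 0] by simp

lemma scaleC_minus_left: "(- c) *\<^sub>C x = - (c *\<^sub>C (x :: 'a::complex_algebra_1))"
  using scaleC_add_left[of c "- c" x] by (simp add: eq_neg_iff_add_eq_0 add.commute)

lemma scaleC_minus_right: "c *\<^sub>C (- x) = - (c *\<^sub>C (x :: 'a::complex_algebra_1))"
  using scaleC_add_right[of c x "- x"] by (simp add: eq_neg_iff_add_eq_0 add.commute)

lemma scaleC_diff_right: "c *\<^sub>C (x - y :: 'a::complex_algebra_1) = c *\<^sub>C x - c *\<^sub>C y"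
  using scaleC_add_right[of c "x - y" y] by (simp add: eq_diff_eq)

lemma scaleC_minus_one: "(- 1) *\<^sub>C x = - (x :: 'a::complex_algebra_1)"
  by (simp add: scaleC_minus_left)

lemma scaleC_sum_right: "c *\<^sub>C (\<Sum>i\<in>A. g i :: 'a::complex_algebra_1) = (\<Sum>i\<in>A. c *\<^sub>C g i)"
  by (induction A rule: infinite_finite_induct) (auto simp: scaleC_add_right)

class complex_banach_algebra_1 = complex_algebra_1 + real_normed_algebra_1 + banach +
  assumes norm_scaleC: "norm (c *\<^sub>C x) = cmod c * norm x"

instantiation complex :: complex_banach_algebra_1
begin

definition scaleC_complex :: "complex \<Rightarrow> complex \<Rightarrow> complex" where
  "scaleC_complex c x = c * x"

instance
  by standard (auto simp: scaleC_complex_def algebra_simps scaleR_conv_of_real norm_mult)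

end


section \<open>The completion of a seminormed algebra\<close>

class complex_seminormed_algebra_1 = complex_algebra_1 +
  fixes seminorm :: "'a \<Rightarrow> real"
  assumes seminorm_triangle: "seminorm (x + y) \<le> seminorm x + seminorm y"
    and seminorm_scaleC: "seminorm (c *\<^sub>C x) = cmod c * seminorm x"
    and seminorm_mult: "seminorm (x * y) \<le> seminorm x * seminorm y"
    and seminorm_one: "seminorm 1 = 1"

lemma seminorm_zero [simp]: "seminorm (0 :: 'a::complex_seminormed_algebra_1) = 0"
  using seminorm_scaleC[of 0 "0 :: 'a"] by simp

lemma seminorm_minus [simp]: "seminorm (- x) = seminorm x"
  using seminorm_scaleC[of "- 1" x] by (simp add: scaleC_minus_one)

lemma seminorm_minus_commute: "seminorm (x - y) = seminorm (y - x)"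
  using seminorm_minus[of "x - y"] by simp

lemma seminorm_nonneg [simp]: "0 \<le> seminorm x"
  using seminorm_triangle[of x "- x"] by simp

lemma seminorm_triangle_diff: "seminorm (x - z) \<le> seminorm (x - y) + seminorm (y - z)"
  using seminorm_triangle[of "x - y" "y - z"] by simp

lemma seminorm_abs_diff: "\<bar>seminorm x - seminorm y\<bar> \<le> seminorm (x - y)"
  using seminorm_triangle[of "x - y" y] seminorm_triangle[of "y - x" x]
    seminorm_minus_commute[of x y] by simp

definition seminorm_Cauchy :: "(nat \<Rightarrow> 'a::complex_seminormed_algebra_1) \<Rightarrow> bool" where
  "seminorm_Cauchy X \<longleftrightarrow> (\<forall>e>0. \<exists>M. \<forall>m\<ge>M. \<forall>n\<ge>M. seminorm (X m - X n) < e)"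

text \<open>Two Cauchy sequences are identified if their difference is null for the seminorm; in
  particular the null space of the seminorm is factored out.\<close>

definition completion_rel :: "(nat \<Rightarrow> 'a::complex_seminormed_algebra_1) \<Rightarrow> (nat \<Rightarrow> 'a) \<Rightarrow> bool" where
  "completion_rel X Y \<longleftrightarrow> seminorm_Cauchy X \<and> seminorm_Cauchy Y \<and>
     (\<lambda>n. seminorm (X n - Y n)) \<longlonglongrightarrow> 0"

lemma null_le:
  assumes "\<And>n. 0 \<le> h n" "\<And>n. h n \<le> (g n :: real)" "g \<longlonglongrightarrow> 0"
  shows "h \<longlonglongrightarrow> 0"
  by (rule tendsto_sandwich[of "\<lambda>_. 0" h sequentially g 0]) (use assms in auto)

lemma seminorm_Cauchy_const: "seminorm_Cauchy (\<lambda>n. x)"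
  by (simp add: seminorm_Cauchy_def)

lemma completion_rel_refl: "completion_rel X X \<longleftrightarrow> seminorm_Cauchy X"
  by (simp add: completion_rel_def)

lemma part_equivp_completion_rel: "part_equivp completion_rel"
proof (rule part_equivpI)
  show "\<exists>X. completion_rel X X"
    using seminorm_Cauchy_const by (auto simp: completion_rel_refl)
  show "symp completion_rel"
    by (auto simp: symp_def completion_rel_def seminorm_minus_commute)
  show "transp completion_rel"
  proof (rule transpI)
    fix X Y Z assume XY: "completion_rel X Y" and YZ: "completion_rel Y Z"
    have "(\<lambda>n. seminorm (X n - Y n) + seminorm (Y n - Z n)) \<longlonglongrightarrow> 0"
      using tendsto_add[of "\<lambda>n. seminorm (X n - Y n)" 0 sequentially "\<lambda>n. seminorm (Y n - Z n)" 0]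
        XY YZ by (simp add: completion_rel_def)
    then have "(\<lambda>n. seminorm (X n - Z n)) \<longlonglongrightarrow> 0"
      by (rule null_le[rotated 2]) (auto intro: seminorm_triangle_diff)
    then show "completion_rel X Z"
      using XY YZ by (simp add: completion_rel_def)
  qed
qed

lemma seminorm_Cauchy_add:
  assumes "seminorm_Cauchy X" "seminorm_Cauchy Y"
  shows "seminorm_Cauchy (\<lambda>n. X n + Y n)"
  unfolding seminorm_Cauchy_def
proof (intro allI impI)
  fix e :: real assume "e > 0"
  then have "e / 2 > 0" by simp
  then obtain M1 M2 where
    M: "\<And>m n. m \<ge> M1 \<Longrightarrow> n \<ge> M1 \<Longrightarrow> seminorm (X m - X n) < e / 2"
       "\<And>m n. m \<ge> M2 \<Longrightarrow> n \<ge> M2 \<Longrightarrow> seminorm (Y m - Y n) < e / 2"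
    using assms unfolding seminorm_Cauchy_def by meson
  have "seminorm (X m + Y m - (X n + Y n)) < e" if "m \<ge> max M1 M2" "n \<ge> max M1 M2" for m n
  proof -
    have "X m + Y m - (X n + Y n) = (X m - X n) + (Y m - Y n)"
      by (simp add: algebra_simps)
    then have "seminorm (X m + Y m - (X n + Y n)) \<le> seminorm (X m - X n) + seminorm (Y m - Y n)"
      using seminorm_triangle[of "X m - X n" "Y m - Y n"] by (simp only:)
    then show ?thesis
      using M(1)[of m n] M(2)[of m n] that by simp
  qed
  then show "\<exists>M. \<forall>m\<ge>M. \<forall>n\<ge>M. seminorm (X m + Y m - (X n + Y n)) < e"
    by blast
qed

lemma seminorm_Cauchy_scaleC:
  assumes "seminorm_Cauchy X"
  shows "seminorm_Cauchy (\<lambda>n. c *\<^sub>C X n)"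
  unfolding seminorm_Cauchy_def
proof (intro allI impI)
  fix e :: real assume "e > 0"
  then have "e / (cmod c + 1) > 0" 
    by (simp add: add_nonneg_pos)
  then obtain M where
    M: "\<And>m n. m \<ge> M \<Longrightarrow> n \<ge> M \<Longrightarrow> seminorm (X m - X n) < e / (cmod c + 1)"
    using assms unfolding seminorm_Cauchy_def by meson
  have "seminorm (c *\<^sub>C X m - c *\<^sub>C X n) < e" if "m \<ge> M" "n \<ge> M" for m n
  proof -
    have "seminorm (c *\<^sub>C X m - c *\<^sub>C X n) = cmod c * seminorm (X m - X n)"
      by (simp add: scaleC_diff_right[symmetric] seminorm_scaleC)
    also have "\<dots> \<le> (cmod c + 1) * seminorm (X m - X n)"
      by (simp add: mult_right_mono)
    also have "\<dots> < e"
      using M[OF that] by (simp add: pos_less_divide_eq add_nonneg_pos mult.commute)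
    finally show ?thesis .
  qed
  then show "\<exists>M. \<forall>m\<ge>M. \<forall>n\<ge>M. seminorm (c *\<^sub>C X m - c *\<^sub>C X n) < e"
    by blast
qed

lemma seminorm_Cauchy_bounded:
  assumes "seminorm_Cauchy X"
  obtains B where "B > 0" "\<And>n. seminorm (X n) \<le> B"
proof -
  obtain M where M: "\<And>m n. m \<ge> M \<Longrightarrow> n \<ge> M \<Longrightarrow> seminorm (X m - X n) < 1"
    using assms unfolding seminorm_Cauchy_def by (meson zero_less_one)
  define B where "B = (\<Sum>i\<le>M. seminorm (X i)) + 1"
  have le: "seminorm (X n) \<le> (\<Sum>i\<le>M. seminorm (X i))" if "n \<le> M" for n
    using that by (intro member_le_sum) auto
  have "seminorm (X n) \<le> B" for n
  proof (cases "n \<le> M")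
    case True
    then show ?thesis using le[OF True] by (simp add: B_def)
  next
    case False
    then show ?thesis
      using seminorm_triangle[of "X n - X M" "X M"] M[of n M] le[of M] by (simp add: B_def)
  qed
  moreover have "B > 0"
    by (simp add: B_def add_nonneg_pos sum_nonneg)
  ultimately show ?thesis using that by blast
qed

lemma seminorm_mult_diff:
  "seminorm (x * y - x' * y') \<le> seminorm x * seminorm (y - y') + seminorm (x - x') * seminorm y'"
proof -
  have "x * y - x' * y' = x * (y - y') + (x - x') * y'"
    by (simp add: algebra_simps)
  then show ?thesis
    using seminorm_triangle[of "x * (y - y')" "(x - x') * y'"]
      seminorm_mult[of x "y - y'"] seminorm_mult[of "x - x'" y'] by simp
qed

lemma seminorm_Cauchy_mult:
  assumes "seminorm_Cauchy X" "seminorm_Cauchy Y"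
  shows "seminorm_Cauchy (\<lambda>n. X n * Y n)"
  unfolding seminorm_Cauchy_def
proof (intro allI impI)
  fix e :: real assume e: "e > 0"
  obtain B1 where B1: "B1 > 0" "\<And>n. seminorm (X n) \<le> B1"
    using seminorm_Cauchy_bounded[OF assms(1)] by blast
  obtain B2 where B2: "B2 > 0" "\<And>n. seminorm (Y n) \<le> B2"
    using seminorm_Cauchy_bounded[OF assms(2)] by blast
  have "e / (2 * B1) > 0" "e / (2 * B2) > 0" using e B1 B2 by auto
  then obtain M1 M2 where
    M: "\<And>m n. m \<ge> M1 \<Longrightarrow> n \<ge> M1 \<Longrightarrow> seminorm (X m - X n) < e / (2 * B2)"
       "\<And>m n. m \<ge> M2 \<Longrightarrow> n \<ge> M2 \<Longrightarrow> seminorm (Y m - Y n) < e / (2 * B1)"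
    using assms unfolding seminorm_Cauchy_def by meson
  have "seminorm (X m * Y m - X n * Y n) < e" if "m \<ge> max M1 M2" "n \<ge> max M1 M2" for m n
  proof -
    have "seminorm (X m * Y m - X n * Y n)
            \<le> seminorm (X m) * seminorm (Y m - Y n) + seminorm (X m - X n) * seminorm (Y n)"
      by (rule seminorm_mult_diff)
    also have "\<dots> \<le> B1 * seminorm (Y m - Y n) + seminorm (X m - X n) * B2"
      by (intro add_mono mult_right_mono mult_left_mono B1 B2) auto
    also have "\<dots> < B1 * (e / (2 * B1)) + e / (2 * B2) * B2"
      using M(1)[of m n] M(2)[of m n] that B1 B2
      by (intro add_strict_mono mult_strict_left_mono mult_strict_right_mono) auto
    also have "\<dots> = e" using B1 B2 by (simp add: field_simps)
    finally show ?thesis .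
  qed
  then show "\<exists>M. \<forall>m\<ge>M. \<forall>n\<ge>M. seminorm (X m * Y m - X n * Y n) < e"
    by blast
qed

lemma completion_rel_add:
  assumes "completion_rel X X'" "completion_rel Y Y'"
  shows "completion_rel (\<lambda>n. X n + Y n) (\<lambda>n. X' n + Y' n)"
proof -
  have "(\<lambda>n. seminorm (X n - X' n) + seminorm (Y n - Y' n)) \<longlonglongrightarrow> 0"
    using tendsto_add[of "\<lambda>n. seminorm (X n - X' n)" 0 sequentially "\<lambda>n. seminorm (Y n - Y' n)" 0]
      assms by (simp add: completion_rel_def)
  moreover have "seminorm (X n + Y n - (X' n + Y' n))
                   \<le> seminorm (X n - X' n) + seminorm (Y n - Y' n)" for n
    using seminorm_triangle[of "X n - X' n" "Y n - Y' n"] by (simp add: algebra_simps)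
  ultimately have "(\<lambda>n. seminorm (X n + Y n - (X' n + Y' n))) \<longlonglongrightarrow> 0"
    by - (rule null_le[of _ "\<lambda>n. seminorm (X n - X' n) + seminorm (Y n - Y' n)"], auto)
  then show ?thesis
    using assms by (auto simp: completion_rel_def intro!: seminorm_Cauchy_add)
qed

lemma completion_rel_scaleC:
  assumes "completion_rel X X'"
  shows "completion_rel (\<lambda>n. c *\<^sub>C X n) (\<lambda>n. c *\<^sub>C X' n)"
proof -
  have "(\<lambda>n. cmod c * seminorm (X n - X' n)) \<longlonglongrightarrow> 0"
    using tendsto_mult[of "\<lambda>n. cmod c" "cmod c" sequentially "\<lambda>n. seminorm (X n - X' n)" 0]
      assms by (simp add: completion_rel_def)
  then show ?thesis
    using assms
    by (auto simp: completion_rel_def scaleC_diff_right[symmetric] seminorm_scaleC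
        intro!: seminorm_Cauchy_scaleC)
qed

lemma completion_rel_minus:
  assumes "completion_rel X X'"
  shows "completion_rel (\<lambda>n. - X n) (\<lambda>n. - X' n)"
  using completion_rel_scaleC[OF assms, of "- 1"] by (simp add: scaleC_minus_one)

lemma completion_rel_mult:
  assumes "completion_rel X X'" "completion_rel Y Y'"
  shows "completion_rel (\<lambda>n. X n * Y n) (\<lambda>n. X' n * Y' n)"
proof -
  have cau: "seminorm_Cauchy X" "seminorm_Cauchy Y'" 
    using assms by (auto simp: completion_rel_def)
  obtain B1 where B1: "B1 > 0" "\<And>n. seminorm (X n) \<le> B1"
    using seminorm_Cauchy_bounded[OF cau(1)] by blast
  obtain B2 where B2: "B2 > 0" "\<And>n. seminorm (Y' n) \<le> B2"
    using seminorm_Cauchy_bounded[OF cau(2)] by blast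
  have "(\<lambda>n. B1 * seminorm (Y n - Y' n)) \<longlonglongrightarrow> B1 * 0"
       "(\<lambda>n. seminorm (X n - X' n) * B2) \<longlonglongrightarrow> 0 * B2"
    by (intro tendsto_mult tendsto_const conjunct2[OF conjunct2[OF assms(1)[unfolded completion_rel_def]]]
        conjunct2[OF conjunct2[OF assms(2)[unfolded completion_rel_def]]])+
  then have "(\<lambda>n. B1 * seminorm (Y n - Y' n) + seminorm (X n - X' n) * B2) \<longlonglongrightarrow> 0"
    using tendsto_add by fastforce
  moreover have "seminorm (X n * Y n - X' n * Y' n)
                   \<le> B1 * seminorm (Y n - Y' n) + seminorm (X n - X' n) * B2" for n
  proof -
    have "seminorm (X n) * seminorm (Y n - Y' n) + seminorm (X n - X' n) * seminorm (Y' n)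
        \<le> B1 * seminorm (Y n - Y' n) + seminorm (X n - X' n) * B2"
      by (intro add_mono mult_right_mono mult_left_mono B1 B2) auto
    then show ?thesis using seminorm_mult_diff order_trans by blast
  qed
  ultimately have "(\<lambda>n. seminorm (X n * Y n - X' n * Y' n)) \<longlonglongrightarrow> 0"
    by - (rule null_le[of _ "\<lambda>n. B1 * seminorm (Y n - Y' n) + seminorm (X n - X' n) * B2"], auto)
  then show ?thesis
    using assms by (auto simp: completion_rel_def intro!: seminorm_Cauchy_mult)
qed

lemma seminorm_Cauchy_convergent:
  assumes "seminorm_Cauchy X"
  shows "convergent (\<lambda>n. seminorm (X n))"
proof -
  have "Cauchy (\<lambda>n. seminorm (X n))"
  proof (rule metric_CauchyI)
    fix e :: real assume "e > 0"
    then obtain M where "\<forall>m\<ge>M. \<forall>n\<ge>M. seminorm (X m - X n) < e"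
      using assms unfolding seminorm_Cauchy_def by blast
    then have "\<forall>m\<ge>M. \<forall>n\<ge>M. dist (seminorm (X m)) (seminorm (X n)) < e"
      unfolding dist_real_def by (meson seminorm_abs_diff order_le_less_trans)
    then show "\<exists>M. \<forall>m\<ge>M. \<forall>n\<ge>M. dist (seminorm (X m)) (seminorm (X n)) < e"
      by blast
  qed
  then show ?thesis by (simp add: Cauchy_convergent_iff)
qed

lemma completion_rel_lim:
  assumes "completion_rel X Y"
  shows "lim (\<lambda>n. seminorm (X n)) = lim (\<lambda>n. seminorm (Y n))"
proof -
  have "seminorm_Cauchy X" "seminorm_Cauchy Y"
    using assms by (simp_all add: completion_rel_def)
  note X = seminorm_Cauchy_convergent[OF this(1), unfolded convergent_LIMSEQ_iff]
    and Y = seminorm_Cauchy_convergent[OF this(2), unfolded convergent_LIMSEQ_iff]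
  have "(\<lambda>n. \<bar>seminorm (X n) - seminorm (Y n)\<bar>) \<longlonglongrightarrow> 0"
    using assms
    by - (rule null_le[of _ "\<lambda>n. seminorm (X n - Y n)"], auto simp: completion_rel_def seminorm_abs_diff)
  then have "(\<lambda>n. seminorm (X n) - seminorm (Y n)) \<longlonglongrightarrow> 0"
    by (simp add: tendsto_rabs_zero_iff)
  moreover have "(\<lambda>n. seminorm (X n) - seminorm (Y n))
      \<longlonglongrightarrow> lim (\<lambda>n. seminorm (X n)) - lim (\<lambda>n. seminorm (Y n))"
    using X Y by (rule tendsto_diff)
  ultimately show ?thesis
    using LIMSEQ_unique by fastforce
qed

quotient_type (overloaded) 'v completion =
  "nat \<Rightarrow> 'v::complex_seminormed_algebra_1" / partial: completion_rel
  by (rule part_equivp_completion_rel)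

instantiation completion :: (complex_seminormed_algebra_1) complex_algebra_1
begin

lift_definition zero_completion :: "'a completion" is "\<lambda>n. 0"
  by (simp add: completion_rel_refl seminorm_Cauchy_const)

lift_definition one_completion :: "'a completion" is "\<lambda>n. 1"
  by (simp add: completion_rel_refl seminorm_Cauchy_const)

lift_definition plus_completion :: "'a completion \<Rightarrow> 'a completion \<Rightarrow> 'a completion"
  is "\<lambda>X Y n. X n + Y n"
  by (rule completion_rel_add)

lift_definition uminus_completion :: "'a completion \<Rightarrow> 'a completion" is "\<lambda>X n. - X n"
  by (rule completion_rel_minus)

lift_definition times_completion :: "'a completion \<Rightarrow> 'a completion \<Rightarrow> 'a completion"
  is "\<lambda>X Y n. X n * Y n"
  by (rule completion_rel_mult)

lift_definition scaleC_completion :: "complex \<Rightarrow> 'a completion \<Rightarrow> 'a completion"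
  is "\<lambda>c X n. c *\<^sub>C X n"
  by (rule completion_rel_scaleC)

definition minus_completion :: "'a completion \<Rightarrow> 'a completion \<Rightarrow> 'a completion" where
  "minus_completion x y = x + - y"

definition scaleR_completion :: "real \<Rightarrow> 'a completion \<Rightarrow> 'a completion" where
  "scaleR_completion r x = complex_of_real r *\<^sub>C x"

instance
proof
  fix x y z :: "'a completion" and c d :: complex and r s :: real
  note Cauchy_intros = seminorm_Cauchy_add seminorm_Cauchy_mult
    seminorm_Cauchy_scaleC seminorm_Cauchy_const
  show "x + y + z = x + (y + z)"
    by transfer (auto simp: completion_rel_refl add.assoc intro!: Cauchy_intros)
  show "x + y = y + x"
    by transfer (auto simp: completion_rel_refl add.commute intro!: Cauchy_intros)
  show "0 + x = x"
    by transfer (auto simp: completion_rel_refl)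
  show "- x + x = 0"
    by transfer (auto simp: completion_rel_refl seminorm_Cauchy_const)
  show "x - y = x + - y"
    by (rule minus_completion_def)
  show "x * y * z = x * (y * z)"
    by transfer (auto simp: completion_rel_refl mult.assoc intro!: Cauchy_intros)
  show "1 * x = x" "x * 1 = x"
    by (transfer; auto simp: completion_rel_refl)+
  show "(x + y) * z = x * z + y * z"
    by transfer (auto simp: completion_rel_refl distrib_right intro!: Cauchy_intros)
  show "x * (y + z) = x * y + x * z"
    by transfer (auto simp: completion_rel_refl distrib_left intro!: Cauchy_intros)
  show "(0::'a completion) \<noteq> 1"
    by transfer (auto simp: completion_rel_def seminorm_one LIMSEQ_const_iff)
  show *: "c *\<^sub>C (x + y) = c *\<^sub>C x + c *\<^sub>C y" for c x and y :: "'a completion"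
    by transfer (auto simp: completion_rel_refl scaleC_add_right intro!: Cauchy_intros)
  show **: "(c + d) *\<^sub>C x = c *\<^sub>C x + d *\<^sub>C x" for c d and x :: "'a completion"
    by transfer (auto simp: completion_rel_refl scaleC_add_left intro!: Cauchy_intros)
  show ***: "c *\<^sub>C d *\<^sub>C x = (c * d) *\<^sub>C x" for c d and x :: "'a completion"
    by transfer (auto simp: completion_rel_refl scaleC_scaleC intro!: Cauchy_intros)
  show ml: "(c *\<^sub>C x) * y = c *\<^sub>C (x * y)" for c and x y :: "'a completion"
    by transfer (auto simp: completion_rel_refl mult_scaleC_left intro!: Cauchy_intros)
  show mr: "x * (c *\<^sub>C y) = c *\<^sub>C (x * y)" for c and x y :: "'a completion"
    by transfer (auto simp: completion_rel_refl mult_scaleC_right intro!: Cauchy_intros)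
  show "complex_of_real r *\<^sub>C x = r *\<^sub>R x"
    by (simp add: scaleR_completion_def)
  show "r *\<^sub>R (x + y) = r *\<^sub>R x + r *\<^sub>R y"
    by (simp add: scaleR_completion_def *)
  show "(r + s) *\<^sub>R x = r *\<^sub>R x + s *\<^sub>R x"
    by (simp add: scaleR_completion_def **)
  show "r *\<^sub>R s *\<^sub>R x = (r * s) *\<^sub>R x"
    by (simp add: scaleR_completion_def ***)
  show "1 *\<^sub>R x = x"
    unfolding scaleR_completion_def
    by transfer (auto simp: completion_rel_refl)
  show "r *\<^sub>R x * y = r *\<^sub>R (x * y)" "x * r *\<^sub>R y = r *\<^sub>R (x * y)"
    by (simp_all add: scaleR_completion_def ml mr)
qed

end

lift_definition to_completion :: "'v::complex_seminormed_algebra_1 \<Rightarrow> 'v completion" is "\<lambda>v n. v"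
  by (simp add: completion_rel_refl seminorm_Cauchy_const)

instantiation completion :: (complex_seminormed_algebra_1) real_normed_algebra_1
begin

lift_definition norm_completion :: "'a completion \<Rightarrow> real" is "\<lambda>X. lim (\<lambda>n. seminorm (X n))"
  by (rule completion_rel_lim)

definition dist_completion :: "'a completion \<Rightarrow> 'a completion \<Rightarrow> real" where
  "dist_completion x y = norm (x - y)"

definition sgn_completion :: "'a completion \<Rightarrow> 'a completion" where
  "sgn_completion x = x /\<^sub>R norm x"

definition uniformity_completion :: "('a completion \<times> 'a completion) filter" where
  "uniformity_completion = (INF e\<in>{0<..}. principal {(x, y). dist x y < e})"

definition open_completion :: "'a completion set \<Rightarrow> bool" where
  "open_completion S \<longleftrightarrow> (\<forall>x\<in>S. \<forall>\<^sub>F (x', y) in uniformity. x' = x \<longrightarrow> y \<in> S)"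

lemma seminorm_tendsto_lim:
  fixes X :: "nat \<Rightarrow> 'v::complex_seminormed_algebra_1"
  shows "seminorm_Cauchy X \<Longrightarrow> (\<lambda>n. seminorm (X n)) \<longlonglongrightarrow> lim (\<lambda>n. seminorm (X n))"
  using seminorm_Cauchy_convergent convergent_LIMSEQ_iff by blast

lemma norm_completion_scaleC: "norm (c *\<^sub>C x) = cmod c * norm x" for x :: "'a completion"
proof transfer
  fix c and X :: "nat \<Rightarrow> 'a" assume "completion_rel X X"
  then have X: "seminorm_Cauchy X" by (simp add: completion_rel_refl)
  show "lim (\<lambda>n. seminorm (c *\<^sub>C X n)) = cmod c * lim (\<lambda>n. seminorm (X n))"
    unfolding seminorm_scaleC
    by (intro limI tendsto_mult tendsto_const seminorm_tendsto_lim X)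
qed

instance
proof
  fix x y :: "'a completion" and r :: real
  show "dist x y = norm (x - y)" by (rule dist_completion_def)
  show "sgn x = x /\<^sub>R norm x" by (rule sgn_completion_def)
  show "uniformity = (INF e\<in>{0<..}. principal {(x :: 'a completion, y). dist x y < e})"
    by (rule uniformity_completion_def)
  show "open S \<longleftrightarrow> (\<forall>x\<in>S. \<forall>\<^sub>F (x', y) in uniformity. x' = x \<longrightarrow> y \<in> S)" for S :: "'a completion set"
    by (rule open_completion_def)
  show "norm x = 0 \<longleftrightarrow> x = 0"
  proof transfer
    fix X :: "nat \<Rightarrow> 'a" assume "completion_rel X X"
    then have X: "seminorm_Cauchy X" by (simp add: completion_rel_refl)
    show "lim (\<lambda>n. seminorm (X n)) = 0 \<longleftrightarrow> completion_rel X (\<lambda>n. 0)"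
      using X seminorm_tendsto_lim[OF X] seminorm_Cauchy_const[of 0]
      by (auto simp: completion_rel_def dest: limI)
  qed
  show "norm (x + y) \<le> norm x + norm y"
  proof transfer
    fix X Y :: "nat \<Rightarrow> 'a" assume "completion_rel X X" "completion_rel Y Y"
    then have XY: "seminorm_Cauchy X" "seminorm_Cauchy Y" by (simp_all add: completion_rel_refl)
    show "lim (\<lambda>n. seminorm (X n + Y n)) \<le> lim (\<lambda>n. seminorm (X n)) + lim (\<lambda>n. seminorm (Y n))"
      by (rule LIMSEQ_le[OF seminorm_tendsto_lim[OF seminorm_Cauchy_add[OF XY]]
            tendsto_add[OF seminorm_tendsto_lim[OF XY(1)] seminorm_tendsto_lim[OF XY(2)]]])
         (auto intro: seminorm_triangle)
  qed
  show "norm (r *\<^sub>R x) = \<bar>r\<bar> * norm x"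
    by (simp add: scaleR_completion_def norm_completion_scaleC)
  show "norm (x * y) \<le> norm x * norm y"
  proof transfer
    fix X Y :: "nat \<Rightarrow> 'a" assume "completion_rel X X" "completion_rel Y Y"
    then have XY: "seminorm_Cauchy X" "seminorm_Cauchy Y" by (simp_all add: completion_rel_refl)
    show "lim (\<lambda>n. seminorm (X n * Y n)) \<le> lim (\<lambda>n. seminorm (X n)) * lim (\<lambda>n. seminorm (Y n))"
      by (rule LIMSEQ_le[OF seminorm_tendsto_lim[OF seminorm_Cauchy_mult[OF XY]]
            tendsto_mult[OF seminorm_tendsto_lim[OF XY(1)] seminorm_tendsto_lim[OF XY(2)]]])
         (auto intro: seminorm_mult)
  qed
  show "norm (1 :: 'a completion) = 1"
    by transfer (simp add: seminorm_one limI)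
qed

end

lemma norm_to_completion: "norm (to_completion v) = seminorm v"
  by transfer (simp add: limI)

lemma to_completion_diff: "to_completion (v - w) = to_completion v - to_completion w"
  unfolding minus_completion_def
  by transfer (auto simp: completion_rel_refl seminorm_Cauchy_const)

lemma to_completion_mult: "to_completion (v * w) = to_completion v * to_completion w"
  by transfer (auto simp: completion_rel_refl seminorm_Cauchy_const)

lemma to_completion_one: "to_completion 1 = 1"
  by transfer (auto simp: completion_rel_refl seminorm_Cauchy_const)

lemma to_completion_approx:
  fixes X :: "nat \<Rightarrow> 'v::complex_seminormed_algebra_1"
  assumes X: "seminorm_Cauchy X" and "e > 0"
  shows "\<exists>M. \<forall>m\<ge>M. norm (abs_completion X - to_completion (X m)) < e"
proof -
  obtain M where M: "\<And>m n. m \<ge> M \<Longrightarrow> n \<ge> M \<Longrightarrow> seminorm (X m - X n) < e / 2"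
    using X \<open>e > 0\<close> unfolding seminorm_Cauchy_def by (meson half_gt_zero)
  have "norm (abs_completion X - to_completion (X m)) < e" if m: "m \<ge> M" for m
  proof -
    have cau: "seminorm_Cauchy (\<lambda>n. X n + - X m)"
      by (intro seminorm_Cauchy_add X seminorm_Cauchy_const)
    have "abs_completion X - to_completion (X m) = abs_completion (\<lambda>n. X n + - X m)"
      unfolding minus_completion_def to_completion.abs_eq
      using X by (simp add: uminus_completion.abs_eq plus_completion.abs_eq completion_rel_refl
          seminorm_Cauchy_const)
    then have "norm (abs_completion X - to_completion (X m)) = lim (\<lambda>n. seminorm (X n + - X m))"
      using cau by (simp add: norm_completion.abs_eq completion_rel_refl)
    also have "\<dots> \<le> e / 2"
      by (rule LIMSEQ_le_const2[OF seminorm_tendsto_lim[OF cau]])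
         (use M m in \<open>auto intro!: exI[of _ M] less_imp_le\<close>)
    finally show ?thesis using \<open>e > 0\<close> by simp
  qed
  then show ?thesis by blast
qed

lemma to_completion_dense:
  fixes x :: "'v::complex_seminormed_algebra_1 completion"
  assumes "e > 0"
  shows "\<exists>v. norm (x - to_completion v) < e"
proof -
  obtain X where "completion_rel X X" "x = abs_completion X"
    using Quotient_abs_rep[OF Quotient_completion, of x] Quotient_rep_reflp[OF Quotient_completion, of x]
    by metis
  then show ?thesis
    using to_completion_approx[of X e] assms by (auto simp: completion_rel_refl)
qed

instance completion :: (complex_seminormed_algebra_1) complex_banach_algebra_1
proof
  fix c and x :: "'a completion"
  show "norm (c *\<^sub>C x) = cmod c * norm x" by (rule norm_completion_scaleC)
next
  fix X :: "nat \<Rightarrow> 'a completion" assume "Cauchy X"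
  have "\<forall>n. \<exists>v. norm (X n - to_completion v) < inverse (real (Suc n))"
    by (intro allI to_completion_dense) simp
  then obtain v where v: "\<And>n. norm (X n - to_completion (v n)) < inverse (real (Suc n))"
    by metis
  have null: "(\<lambda>n. X n - to_completion (v n)) \<longlonglongrightarrow> 0"
    by (rule Lim_null_comparison[OF _ LIMSEQ_inverse_real_of_nat])
       (intro always_eventually allI less_imp_le v)
  have "Cauchy (\<lambda>n. to_completion (v n))"
  proof (rule metric_CauchyI)
    fix e :: real assume "e > 0"
    then have e3: "e / 3 > 0" by simp
    obtain M1 where M1: "\<And>m n. m \<ge> M1 \<Longrightarrow> n \<ge> M1 \<Longrightarrow> norm (X m - X n) < e / 3"
      using metric_CauchyD[OF \<open>Cauchy X\<close> e3] by (auto simp: dist_norm)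
    obtain M2 where M2: "\<And>n. n \<ge> M2 \<Longrightarrow> norm (X n - to_completion (v n)) < e / 3"
      using LIMSEQ_D[OF null e3] by auto
    have "dist (to_completion (v m)) (to_completion (v n)) < e"
      if "m \<ge> max M1 M2" "n \<ge> max M1 M2" for m n
    proof -
      have "to_completion (v m) - to_completion (v n)
          = (X m - X n) + (X n - to_completion (v n)) - (X m - to_completion (v m))"
        by simp
      then have "dist (to_completion (v m)) (to_completion (v n))
          \<le> norm (X m - X n) + norm (X n - to_completion (v n)) + norm (X m - to_completion (v m))"
        using norm_triangle_ineq4[of "(X m - X n) + (X n - to_completion (v n))" "X m - to_completion (v m)"]
          norm_triangle_ineq[of "X m - X n" "X n - to_completion (v n)"]
        unfolding dist_norm by (simp only:)
      then show ?thesis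
        using M1[of m n] M2[of m] M2[of n] that by simp
    qed
    then show "\<exists>M. \<forall>m\<ge>M. \<forall>n\<ge>M. dist (to_completion (v m)) (to_completion (v n)) < e"
      by blast
  qed
  then have cau: "seminorm_Cauchy v"
    unfolding Cauchy_def seminorm_Cauchy_def dist_norm to_completion_diff[symmetric]
      norm_to_completion .
  have "(\<lambda>n. to_completion (v n)) \<longlonglongrightarrow> abs_completion v"
    unfolding LIMSEQ_def dist_norm using to_completion_approx[OF cau]
    by (simp add: norm_minus_commute)
  from tendsto_add[OF null this] have "X \<longlonglongrightarrow> abs_completion v" by simp
  then show "convergent X" by (auto simp: convergent_def)
qed

section \<open>The projective tensor power\<close>

text \<open>Tuples of algebra elements with componentwise multiplication.  The monoid of tuples is
  written additively because the multiplication of the type \<open>'m \<Rightarrow>\<^sub>0 complex\<close> is convolution with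
  respect to addition on \<open>'m\<close>; thus \<open>('b, 'n) tuple \<Rightarrow>\<^sub>0 complex\<close> is the free vector space on
  tuples with the bilinear product determined by componentwise multiplication of tuples.\<close>

datatype ('b, 'n) tuple = Tuple (entry: "'n \<Rightarrow> 'b")

instantiation tuple :: (monoid_mult, type) monoid_add
begin

definition zero_tuple :: "('a, 'b) tuple" where
  "zero_tuple = Tuple (\<lambda>i. 1)"

definition plus_tuple :: "('a, 'b) tuple \<Rightarrow> ('a, 'b) tuple \<Rightarrow> ('a, 'b) tuple" where
  "plus_tuple s t = Tuple (\<lambda>i. entry s i * entry t i)"

instance
  by standard (auto simp: zero_tuple_def plus_tuple_def mult.assoc)

end

lemma entry_zero [simp]: "entry 0 i = 1"
  by (simp add: zero_tuple_def)

abbreviation free_scale :: "complex \<Rightarrow> (('b::monoid_mult, 'n) tuple \<Rightarrow>\<^sub>0 complex) \<Rightarrow> (('b, 'n) tuple \<Rightarrow>\<^sub>0 complex)" where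
  "free_scale c v \<equiv> Poly_Mapping.single 0 c * v"

text \<open>The span of the multilinearity relations; the algebraic tensor power is the quotient of the
  free vector space by it.\<close>

inductive_set multilin_rel ::
  "(('b::complex_banach_algebra_1, 'n) tuple \<Rightarrow>\<^sub>0 complex) set" where
  zero: "0 \<in> multilin_rel"
| add: "v \<in> multilin_rel \<Longrightarrow> w \<in> multilin_rel \<Longrightarrow> v + w \<in> multilin_rel"
| scale: "v \<in> multilin_rel \<Longrightarrow> free_scale c v \<in> multilin_rel"
| slot_add: "Poly_Mapping.single (Tuple (t(i := x + y))) 1 - Poly_Mapping.single (Tuple (t(i := x))) 1
     - Poly_Mapping.single (Tuple (t(i := y))) 1 \<in> multilin_rel"
| slot_scale: "Poly_Mapping.single (Tuple (t(i := c *\<^sub>C x))) 1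
     - Poly_Mapping.single (Tuple (t(i := x))) c \<in> multilin_rel"

lemma free_eq_sum:
  "v = (\<Sum>t\<in>Poly_Mapping.keys v. Poly_Mapping.single t (Poly_Mapping.lookup v t))"
  by (rule poly_mapping_eqI) (auto simp: lookup_sum lookup_single when_def in_keys_iff)

lemma free_scale_minus_one: "free_scale (- 1) v = - v"
  by (simp add: single_uminus)

lemma free_scale_commute: "v * Poly_Mapping.single 0 c = free_scale c (v :: ('b::monoid_mult, 'n) tuple \<Rightarrow>\<^sub>0 complex)"
proof -
  have "(\<Sum>t\<in>Poly_Mapping.keys v. Poly_Mapping.single t (Poly_Mapping.lookup v t)) * Poly_Mapping.single 0 c
      = Poly_Mapping.single 0 c * (\<Sum>t\<in>Poly_Mapping.keys v. Poly_Mapping.single t (Poly_Mapping.lookup v t))"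
    unfolding sum_distrib_left sum_distrib_right by (simp add: mult_single mult.commute)
  then show ?thesis using free_eq_sum[of v] by simp
qed

lemma multilin_rel_uminus: "v \<in> multilin_rel \<Longrightarrow> - v \<in> multilin_rel"
  using multilin_rel.scale[of v "- 1"] by (simp add: free_scale_minus_one)

lemma multilin_rel_diff: "v \<in> multilin_rel \<Longrightarrow> w \<in> multilin_rel \<Longrightarrow> v - w \<in> multilin_rel"
  using multilin_rel.add[OF _ multilin_rel_uminus, of v w] by simp

lemma multilin_rel_sum: "(\<And>i. i \<in> A \<Longrightarrow> g i \<in> multilin_rel) \<Longrightarrow> (\<Sum>i\<in>A. g i) \<in> multilin_rel"
  by (induction A rule: infinite_finite_induct) (auto intro: multilin_rel.zero multilin_rel.add)

lemma tuple_plus_upd: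
  "s + Tuple (t(i := x)) = Tuple ((\<lambda>j. entry s j * t j)(i := entry s i * x))"
  "Tuple (t(i := x)) + s = Tuple ((\<lambda>j. t j * entry s j)(i := x * entry s i))"
  by (auto simp: plus_tuple_def fun_eq_iff)

lemma single_conv_free_scale:
  "Poly_Mapping.single t c = free_scale c (Poly_Mapping.single (t :: ('b::monoid_mult, 'n) tuple) 1)"
  by (simp add: mult_single)

lemma multilin_rel_single_left:
  "v \<in> multilin_rel \<Longrightarrow> Poly_Mapping.single s 1 * v \<in> multilin_rel"
proof (induction rule: multilin_rel.induct)
  case (scale v c)
  have "Poly_Mapping.single s 1 * free_scale c v = free_scale c (Poly_Mapping.single s 1 * v)"
    unfolding mult.assoc[symmetric] by (simp add: mult_single)
  then show ?case using multilin_rel.scale[OF scale.IH, of c] by simp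
next
  case (slot_add t i x y)
  show ?case
    using multilin_rel.slot_add[of "\<lambda>j. entry s j * t j" i "entry s i * x" "entry s i * y"]
    by (simp add: right_diff_distrib mult_single tuple_plus_upd distrib_left)
next
  case (slot_scale t i c x)
  show ?case
    using multilin_rel.slot_scale[of "\<lambda>j. entry s j * t j" i c "entry s i * x"]
    by (simp add: right_diff_distrib mult_single tuple_plus_upd mult_scaleC_right)
qed (auto simp: distrib_left intro: multilin_rel.zero multilin_rel.add)

lemma multilin_rel_single_right:
  "v \<in> multilin_rel \<Longrightarrow> v * Poly_Mapping.single s 1 \<in> multilin_rel"
proof (induction rule: multilin_rel.induct)
  case (scale v c)
  then show ?case using multilin_rel.scale[OF scale.IH, of c] by (simp add: mult.assoc)
next
  case (slot_add t i x y)
  show ?case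
    using multilin_rel.slot_add[of "\<lambda>j. t j * entry s j" i "x * entry s i" "y * entry s i"]
    by (simp add: left_diff_distrib mult_single tuple_plus_upd distrib_right)
next
  case (slot_scale t i c x)
  show ?case
    using multilin_rel.slot_scale[of "\<lambda>j. t j * entry s j" i c "x * entry s i"]
    by (simp add: left_diff_distrib mult_single tuple_plus_upd mult_scaleC_left)
qed (auto simp: distrib_right intro: multilin_rel.zero multilin_rel.add)

lemma multilin_rel_mult_left: "v \<in> multilin_rel \<Longrightarrow> u * v \<in> multilin_rel"
proof -
  assume v: "v \<in> multilin_rel"
  have "(\<Sum>t\<in>Poly_Mapping.keys u. free_scale (Poly_Mapping.lookup u t) (Poly_Mapping.single t 1 * v)) \<in> multilin_rel"
    by (intro multilin_rel_sum multilin_rel.scale multilin_rel_single_left v)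
  also have "(\<Sum>t\<in>Poly_Mapping.keys u. free_scale (Poly_Mapping.lookup u t) (Poly_Mapping.single t 1 * v)) = u * v"
    using arg_cong[OF free_eq_sum[of u], of "\<lambda>w. w * v"]
    by (simp add: sum_distrib_right mult.assoc[symmetric] mult_single)
  finally show ?thesis .
qed

lemma multilin_rel_mult_right: "v \<in> multilin_rel \<Longrightarrow> v * u \<in> multilin_rel"
proof -
  assume v: "v \<in> multilin_rel"
  have "(\<Sum>t\<in>Poly_Mapping.keys u. free_scale (Poly_Mapping.lookup u t) (v * Poly_Mapping.single t 1)) \<in> multilin_rel"
    by (intro multilin_rel_sum multilin_rel.scale multilin_rel_single_right v)
  also have "(\<Sum>t\<in>Poly_Mapping.keys u. free_scale (Poly_Mapping.lookup u t) (v * Poly_Mapping.single t 1)) = v * u"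
    using arg_cong[OF free_eq_sum[of u], of "\<lambda>w. v * w"]
    by (simp add: sum_distrib_left mult.assoc[symmetric] mult_single flip: free_scale_commute)
       (simp add: mult.assoc mult_single)
  finally show ?thesis .
qed

quotient_type (overloaded) ('b, 'n) alg_tensor =
  "('b::complex_banach_algebra_1, 'n) tuple \<Rightarrow>\<^sub>0 complex" / "\<lambda>v w. v - w \<in> multilin_rel"
proof (rule equivpI)
  show "reflp (\<lambda>v w. v - w \<in> multilin_rel)"
    by (auto simp: reflp_def intro: multilin_rel.zero)
  show "symp (\<lambda>v w. v - w \<in> multilin_rel)"
    using multilin_rel_uminus by (fastforce simp: symp_def)
  show "transp (\<lambda>v w. v - w \<in> multilin_rel)"
    using multilin_rel.add by (fastforce simp: transp_def)
qed

text \<open>The weighted \<open>\<ell>\<^sup>1\<close>-norm \<open>\<Sum>\<^sub>j |c\<^sub>j| \<parallel>x\<^sub>j\<^sub>1\<parallel>\<cdots>\<parallel>x\<^sub>j\<^sub>n\<parallel>\<close> of a formal sum; the projective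
  seminorm of a tensor is the infimum of this quantity over all its representations.\<close>

definition formal_norm :: "(('b::complex_banach_algebra_1, 'n::finite) tuple \<Rightarrow>\<^sub>0 complex) \<Rightarrow> real" where
  "formal_norm w = (\<Sum>t\<in>Poly_Mapping.keys w. cmod (Poly_Mapping.lookup w t) * (\<Prod>i\<in>UNIV. norm (entry t i)))"

definition proj_seminorm :: "(('b::complex_banach_algebra_1, 'n::finite) tuple \<Rightarrow>\<^sub>0 complex) \<Rightarrow> real" where
  "proj_seminorm v = Inf {formal_norm w |w. w - v \<in> multilin_rel}"

lemma formal_norm_superset:
  assumes "finite S" "Poly_Mapping.keys w \<subseteq> S"
  shows "formal_norm w = (\<Sum>t\<in>S. cmod (Poly_Mapping.lookup w t) * (\<Prod>i\<in>UNIV. norm (entry t i)))"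
  unfolding formal_norm_def by (rule sum.mono_neutral_left) (use assms in \<open>auto simp: in_keys_iff\<close>)

lemma formal_norm_nonneg: "0 \<le> formal_norm w"
  unfolding formal_norm_def by (intro sum_nonneg mult_nonneg_nonneg prod_nonneg) auto

lemma formal_norm_zero [simp]: "formal_norm 0 = 0"
  by (simp add: formal_norm_def)

lemma formal_norm_single: "formal_norm (Poly_Mapping.single t c) = cmod c * (\<Prod>i\<in>UNIV. norm (entry t i))"
  by (simp add: formal_norm_superset[of "{t}"])

lemma formal_norm_add: "formal_norm (v + w) \<le> formal_norm v + formal_norm w"
proof -
  let ?S = "Poly_Mapping.keys v \<union> Poly_Mapping.keys w"
  have "formal_norm (v + w)
      = (\<Sum>t\<in>?S. cmod (Poly_Mapping.lookup v t + Poly_Mapping.lookup w t) * (\<Prod>i\<in>UNIV. norm (entry t i)))"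
    using formal_norm_superset[of ?S "v + w"] keys_add[of v w] by (simp add: lookup_add)
  also have "\<dots> \<le> (\<Sum>t\<in>?S. cmod (Poly_Mapping.lookup v t) * (\<Prod>i\<in>UNIV. norm (entry t i))
                    + cmod (Poly_Mapping.lookup w t) * (\<Prod>i\<in>UNIV. norm (entry t i)))"
    unfolding distrib_right[symmetric]
    by (intro sum_mono mult_right_mono norm_triangle_ineq prod_nonneg) auto
  also have "\<dots> = formal_norm v + formal_norm w"
    using formal_norm_superset[of ?S v] formal_norm_superset[of ?S w] by (simp add: sum.distrib)
  finally show ?thesis .
qed

lemma formal_norm_sum: "formal_norm (\<Sum>i\<in>A. g i) \<le> (\<Sum>i\<in>A. formal_norm (g i))"
proof (induction A rule: infinite_finite_induct)
  case (insert x A)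
  then show ?case using formal_norm_add[of "g x" "\<Sum>i\<in>A. g i"] by simp
qed auto

lemma formal_norm_mult:
  fixes v w :: "('b::complex_banach_algebra_1, 'n::finite) tuple \<Rightarrow>\<^sub>0 complex"
  shows "formal_norm (v * w) \<le> formal_norm v * formal_norm w"
proof -
  let ?l = Poly_Mapping.lookup and ?k = Poly_Mapping.keys and ?s = Poly_Mapping.single
  have "v * w = (\<Sum>s\<in>?k v. \<Sum>t\<in>?k w. ?s (s + t) (?l v s * ?l w t))"
    using arg_cong2[OF free_eq_sum[of v] free_eq_sum[of w], of "(*)"]
    by (simp add: sum_product mult_single)
  then have "formal_norm (v * w) \<le> (\<Sum>s\<in>?k v. \<Sum>t\<in>?k w. formal_norm (?s (s + t) (?l v s * ?l w t)))"
    by (auto intro!: order_trans[OF formal_norm_sum] sum_mono formal_norm_sum)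
  also have "\<dots> \<le> (\<Sum>s\<in>?k v. \<Sum>t\<in>?k w. (cmod (?l v s) * (\<Prod>i\<in>UNIV. norm (entry s i))) *
                                      (cmod (?l w t) * (\<Prod>i\<in>UNIV. norm (entry t i))))"
  proof (intro sum_mono)
    fix s t :: "('b, 'n) tuple"
    have "(\<Prod>i\<in>UNIV. norm (entry (s + t) i)) \<le> (\<Prod>i\<in>UNIV. norm (entry s i) * norm (entry t i))"
      by (intro prod_mono) (auto simp: plus_tuple_def norm_mult_ineq)
    then have "cmod (?l v s) * cmod (?l w t) * (\<Prod>i\<in>UNIV. norm (entry (s + t) i))
        \<le> cmod (?l v s) * cmod (?l w t) * ((\<Prod>i\<in>UNIV. norm (entry s i)) * (\<Prod>i\<in>UNIV. norm (entry t i)))"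
      unfolding prod.distrib by (intro mult_left_mono) auto
    then show "formal_norm (?s (s + t) (?l v s * ?l w t))
        \<le> (cmod (?l v s) * (\<Prod>i\<in>UNIV. norm (entry s i))) * (cmod (?l w t) * (\<Prod>i\<in>UNIV. norm (entry t i)))"
      unfolding formal_norm_single norm_mult by (simp only: mult.assoc mult.left_commute)
  qed
  also have "\<dots> = formal_norm v * formal_norm w"
    by (simp add: formal_norm_def sum_product)
  finally show ?thesis .
qed

lemma formal_norm_scale: "formal_norm (free_scale c v) \<le> cmod c * formal_norm v"
  using formal_norm_mult[of "Poly_Mapping.single 0 c" v]
  by (simp add: formal_norm_single)

lemma proj_seminorm_bdd: "bdd_below {formal_norm w |w. w - v \<in> multilin_rel}"
  by (rule bdd_belowI[of _ 0]) (auto simp: formal_norm_nonneg)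

lemma proj_seminorm_le: "w - v \<in> multilin_rel \<Longrightarrow> proj_seminorm v \<le> formal_norm w"
  unfolding proj_seminorm_def by (rule cInf_lower[OF _ proj_seminorm_bdd]) auto

lemma proj_seminorm_ge:
  assumes "\<And>w. w - v \<in> multilin_rel \<Longrightarrow> c \<le> formal_norm w"
  shows "c \<le> proj_seminorm v"
proof -
  have "v - v \<in> multilin_rel" by (simp add: multilin_rel.zero)
  then have "{formal_norm w |w. w - v \<in> multilin_rel} \<noteq> {}" by blast
  then show ?thesis
    unfolding proj_seminorm_def by (rule cInf_greatest) (use assms in auto)
qed

lemma proj_seminorm_approx:
  assumes "e > 0"
  obtains w where "w - v \<in> multilin_rel" "formal_norm w < proj_seminorm v + e"
proof -
  have "\<not> proj_seminorm v + e \<le> proj_seminorm v" using assms by simp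
  then have "\<exists>w. w - v \<in> multilin_rel \<and> \<not> proj_seminorm v + e \<le> formal_norm w"
    using proj_seminorm_ge[of v "proj_seminorm v + e"] by blast
  then show ?thesis using that by (auto simp: not_le)
qed

lemma proj_seminorm_nonneg: "0 \<le> proj_seminorm v"
  by (intro proj_seminorm_ge formal_norm_nonneg)

lemma proj_seminorm_add: "proj_seminorm (v + w) \<le> proj_seminorm v + proj_seminorm w"
proof (rule field_le_epsilon)
  fix e :: real assume "e > 0"
  then have "e / 2 > 0" by simp
  obtain v' where v': "v' - v \<in> multilin_rel" "formal_norm v' < proj_seminorm v + e / 2"
    using proj_seminorm_approx[OF \<open>e / 2 > 0\<close>] .
  obtain w' where w': "w' - w \<in> multilin_rel" "formal_norm w' < proj_seminorm w + e / 2"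
    using proj_seminorm_approx[OF \<open>e / 2 > 0\<close>] .
  have "(v' + w') - (v + w) \<in> multilin_rel"
    using multilin_rel.add[OF v'(1) w'(1)] by (simp add: algebra_simps)
  then have "proj_seminorm (v + w) \<le> formal_norm (v' + w')" by (rule proj_seminorm_le)
  also have "\<dots> \<le> formal_norm v' + formal_norm w'" by (rule formal_norm_add)
  finally show "proj_seminorm (v + w) \<le> proj_seminorm v + proj_seminorm w + e"
    using v'(2) w'(2) by simp
qed

lemma proj_seminorm_scale_le: "proj_seminorm (free_scale c v) \<le> cmod c * proj_seminorm v"
proof (rule field_le_epsilon)
  fix e :: real assume "e > 0"
  then have e': "e / (cmod c + 1) > 0" by (simp add: add_nonneg_pos)
  obtain w where w: "w - v \<in> multilin_rel" "formal_norm w < proj_seminorm v + e / (cmod c + 1)"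
    using proj_seminorm_approx[OF e'] .
  have "free_scale c w - free_scale c v \<in> multilin_rel"
    using multilin_rel.scale[OF w(1), of c] by (simp add: right_diff_distrib)
  then have "proj_seminorm (free_scale c v) \<le> formal_norm (free_scale c w)"
    by (rule proj_seminorm_le)
  also have "\<dots> \<le> cmod c * formal_norm w" by (rule formal_norm_scale)
  also have "\<dots> \<le> cmod c * (proj_seminorm v + e / (cmod c + 1))"
    using w(2) by (intro mult_left_mono) auto
  also have "\<dots> = cmod c * proj_seminorm v + cmod c * (e / (cmod c + 1))"
    by (rule distrib_left)
  also have "cmod c * (e / (cmod c + 1)) \<le> (cmod c + 1) * (e / (cmod c + 1))"
    using e' by (intro mult_right_mono) auto
  also have "\<dots> = e"
    using norm_ge_zero[of c] by (simp add: add_nonneg_eq_0_iff)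
  finally show "proj_seminorm (free_scale c v) \<le> cmod c * proj_seminorm v + e" by simp
qed

lemma proj_seminorm_scale: "proj_seminorm (free_scale c v) = cmod c * proj_seminorm v"
proof (cases "c = 0")
  case True
  then show ?thesis using proj_seminorm_scale_le[of c v] proj_seminorm_nonneg[of "free_scale c v"] by simp
next
  case False
  have "free_scale (1 / c) (free_scale c v) = v"
    using False by (simp add: mult.assoc[symmetric] mult_single)
  then have "proj_seminorm v \<le> cmod (1 / c) * proj_seminorm (free_scale c v)"
    using proj_seminorm_scale_le[of "1 / c" "free_scale c v"] by simp
  then have "cmod c * proj_seminorm v \<le> proj_seminorm (free_scale c v)"
    using False by (simp add: norm_divide field_simps)
  then show ?thesis using proj_seminorm_scale_le[of c v] by simp
qed

lemma proj_seminorm_mult: "proj_seminorm (v * w) \<le> proj_seminorm v * proj_seminorm w"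
proof -
  let ?p = "proj_seminorm v" and ?q = "proj_seminorm w"
  have *: "proj_seminorm (v * w) \<le> (?p + e) * (?q + e)" if e: "e > 0" for e
  proof -
    obtain v' where v': "v' - v \<in> multilin_rel" "formal_norm v' < ?p + e"
      using proj_seminorm_approx[OF e] .
    obtain w' where w': "w' - w \<in> multilin_rel" "formal_norm w' < ?q + e"
      using proj_seminorm_approx[OF e] .
    have "v' * w' - v * w = v' * (w' - w) + (v' - v) * w"
      by (simp add: algebra_simps)
    then have "v' * w' - v * w \<in> multilin_rel"
      by (simp add: multilin_rel.add multilin_rel_mult_left multilin_rel_mult_right v' w')
    then have "proj_seminorm (v * w) \<le> formal_norm (v' * w')" by (rule proj_seminorm_le)
    also have "\<dots> \<le> formal_norm v' * formal_norm w'" by (rule formal_norm_mult)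
    also have "\<dots> \<le> (?p + e) * (?q + e)"
      using v' w' e by (intro mult_mono) (auto simp: formal_norm_nonneg proj_seminorm_nonneg)
    finally show ?thesis .
  qed
  have "((\<lambda>e. (?p + e) * (?q + e)) \<longlongrightarrow> (?p + 0) * (?q + 0)) (at_right 0)"
    by (intro tendsto_intros)
  moreover have "\<forall>\<^sub>F e in at_right 0. proj_seminorm (v * w) \<le> (?p + e) * (?q + e)"
    using eventually_at_right_less[of "0::real"] by (rule eventually_mono) (rule *)
  ultimately show ?thesis
    using tendsto_lowerbound by fastforce
qed

lemma proj_seminorm_cong: "v - w \<in> multilin_rel \<Longrightarrow> proj_seminorm v = proj_seminorm w"
proof (rule antisym)
  assume vw: "v - w \<in> multilin_rel"
  show "proj_seminorm w \<le> proj_seminorm v"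
  proof (rule proj_seminorm_ge)
    fix u assume "u - v \<in> multilin_rel"
    from multilin_rel.add[OF this vw] have "u - w \<in> multilin_rel" by simp
    then show "proj_seminorm w \<le> formal_norm u" by (rule proj_seminorm_le)
  qed
  show "proj_seminorm v \<le> proj_seminorm w"
  proof (rule proj_seminorm_ge)
    fix u assume "u - w \<in> multilin_rel"
    from multilin_rel_diff[OF this vw] have "u - v \<in> multilin_rel" by simp
    then show "proj_seminorm v \<le> formal_norm u" by (rule proj_seminorm_le)
  qed
qed

text \<open>The linear map sending a tuple to the product of its entries (in the order given by a list)
  respects the multilinearity relations.  It shows that the unit tensor has norm 1.\<close>

definition mult_out :: "'n list \<Rightarrow> (('b::complex_banach_algebra_1, 'n) tuple \<Rightarrow>\<^sub>0 complex) \<Rightarrow> 'b" where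
  "mult_out is v = (\<Sum>t\<in>Poly_Mapping.keys v. Poly_Mapping.lookup v t *\<^sub>C prod_list (map (entry t) is))"

lemma mult_out_superset:
  assumes "finite S" "Poly_Mapping.keys w \<subseteq> S"
  shows "mult_out is w = (\<Sum>t\<in>S. Poly_Mapping.lookup w t *\<^sub>C prod_list (map (entry t) is))"
  unfolding mult_out_def by (rule sum.mono_neutral_left) (use assms in \<open>auto simp: in_keys_iff\<close>)

lemma mult_out_zero: "mult_out is 0 = 0"
  by (simp add: mult_out_def)

lemma mult_out_single: "mult_out is (Poly_Mapping.single t c) = c *\<^sub>C prod_list (map (entry t) is)"
  by (simp add: mult_out_superset[of "{t}"])

lemma mult_out_add: "mult_out is (v + w) = mult_out is v + mult_out is w"
proof -
  let ?S = "Poly_Mapping.keys v \<union> Poly_Mapping.keys w"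
  show ?thesis
    using mult_out_superset[of ?S "v + w"] mult_out_superset[of ?S v] mult_out_superset[of ?S w]
      keys_add[of v w]
    by (simp add: lookup_add scaleC_add_left sum.distrib)
qed

lemma mult_out_sum: "mult_out is (\<Sum>i\<in>A. g i) = (\<Sum>i\<in>A. mult_out is (g i))"
  by (induction A rule: infinite_finite_induct) (auto simp: mult_out_zero mult_out_add)

lemma mult_out_scale: "mult_out is (free_scale c v) = c *\<^sub>C mult_out is v"
proof -
  have "mult_out is (free_scale c v)
      = mult_out is (\<Sum>t\<in>Poly_Mapping.keys v. Poly_Mapping.single t (c * Poly_Mapping.lookup v t))"
    using arg_cong[OF free_eq_sum[of v], of "free_scale c"]
    by (simp add: sum_distrib_left mult_single)
  then show ?thesis
    unfolding mult_out_sum mult_out_single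
    by (simp add: mult_out_def scaleC_sum_right scaleC_scaleC)
qed

lemma mult_out_diff: "mult_out is (v - w) = mult_out is v - mult_out is w"
  using mult_out_add[of "is" "v - w" w] by simp

lemma prod_list_upd_add:
  fixes t :: "'n \<Rightarrow> 'b::complex_banach_algebra_1"
  assumes "distinct is" "i \<in> set is"
  shows "prod_list (map (t(i := x + y)) is) = prod_list (map (t(i := x)) is) + prod_list (map (t(i := y)) is)"
  using assms
proof (induction "is")
  case (Cons j js)
  show ?case
  proof (cases "i = j")
    case True
    then show ?thesis using Cons.prems by (simp add: fun_upd_same distrib_right del: fun_upd_apply)
  next
    case False
    then have "(t(i := z)) j = t j" for z by simp
    moreover from False Cons.prems have "distinct js" "i \<in> set js" by auto
    note Cons.IH[OF this]
    ultimately show ?thesis by (simp only: list.map prod_list.Cons distrib_left)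
  qed
qed simp

lemma prod_list_upd_scale:
  fixes t :: "'n \<Rightarrow> 'b::complex_banach_algebra_1"
  assumes "distinct is" "i \<in> set is"
  shows "prod_list (map (t(i := c *\<^sub>C x)) is) = c *\<^sub>C prod_list (map (t(i := x)) is)"
  using assms
proof (induction "is")
  case (Cons j js)
  show ?case
  proof (cases "i = j")
    case True
    then show ?thesis using Cons.prems by (simp add: fun_upd_same mult_scaleC_left del: fun_upd_apply)
  next
    case False
    then have "(t(i := z)) j = t j" for z by simp
    moreover from False Cons.prems have "distinct js" "i \<in> set js" by auto
    note Cons.IH[OF this]
    ultimately show ?thesis by (simp only: list.map prod_list.Cons mult_scaleC_right)
  qed
qed simp

lemma mult_out_rel:
  assumes "v \<in> multilin_rel" "distinct is" "set is = UNIV"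
  shows "mult_out is v = 0"
  using assms(1)
  by (induction rule: multilin_rel.induct)
     (use assms(2,3) in \<open>auto simp: mult_out_zero mult_out_add mult_out_scale mult_out_diff
        mult_out_single prod_list_upd_add prod_list_upd_scale\<close>)

lemma mult_out_one:
  fixes "is" :: "'n list"
  shows "mult_out is 1 = (1 :: 'b::complex_banach_algebra_1)"
proof -
  have "prod_list (map (entry (0 :: ('b, 'n) tuple)) is) = 1"
    by (induction "is") auto
  then show ?thesis
    using mult_out_single[of "is" "0 :: ('b, 'n) tuple" 1] by simp
qed

lemma norm_prod_list_le:
  "norm (prod_list (map g is) :: 'b::complex_banach_algebra_1) \<le> prod_list (map (\<lambda>i. norm (g i)) is)"
proof (induction "is")
  case (Cons j js)
  have "norm (g j * prod_list (map g js)) \<le> norm (g j) * norm (prod_list (map g js))"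
    by (rule norm_mult_ineq)
  also have "\<dots> \<le> norm (g j) * prod_list (map (\<lambda>i. norm (g i)) js)"
    by (intro mult_left_mono Cons.IH) auto
  finally show ?case by simp
qed simp

lemma norm_mult_out:
  fixes v :: "('b::complex_banach_algebra_1, 'n::finite) tuple \<Rightarrow>\<^sub>0 complex"
  assumes "distinct is" "set is = UNIV"
  shows "norm (mult_out is v) \<le> formal_norm v"
  unfolding mult_out_def formal_norm_def
proof (rule sum_norm_le)
  fix t :: "('b, 'n) tuple"
  have "norm (prod_list (map (entry t) is)) \<le> (\<Prod>i\<in>UNIV. norm (entry t i))"
    using norm_prod_list_le[of "entry t" "is"] assms by (simp add: prod.distinct_set_conv_list[symmetric])
  then show "norm (Poly_Mapping.lookup v t *\<^sub>C prod_list (map (entry t) is))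
      \<le> cmod (Poly_Mapping.lookup v t) * (\<Prod>i\<in>UNIV. norm (entry t i))"
    by (simp add: norm_scaleC mult_left_mono)
qed

lemma proj_seminorm_one: "proj_seminorm (1 :: ('b::complex_banach_algebra_1, 'n::finite) tuple \<Rightarrow>\<^sub>0 complex) = 1"
proof (rule antisym)
  have "formal_norm (1 :: ('b, 'n) tuple \<Rightarrow>\<^sub>0 complex) = 1"
    using formal_norm_single[of "0 :: ('b, 'n) tuple" 1] by simp
  then show "proj_seminorm (1 :: ('b, 'n) tuple \<Rightarrow>\<^sub>0 complex) \<le> 1"
    using proj_seminorm_le[of "1 :: ('b, 'n) tuple \<Rightarrow>\<^sub>0 complex" 1] by (simp add: multilin_rel.zero)
next
  obtain "is" :: "'n list" where "is": "set is = UNIV" "distinct is"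
    using finite_distinct_list[of "UNIV :: 'n set"] by auto
  show "1 \<le> proj_seminorm (1 :: ('b, 'n) tuple \<Rightarrow>\<^sub>0 complex)"
  proof (rule proj_seminorm_ge)
    fix w :: "('b, 'n) tuple \<Rightarrow>\<^sub>0 complex"
    assume "w - 1 \<in> multilin_rel"
    from mult_out_rel[OF this "is"(2,1)] have "mult_out is w = 1"
      by (simp add: mult_out_diff mult_out_one)
    then show "1 \<le> formal_norm w"
      using norm_mult_out[OF "is"(2,1), of w] by simp
  qed
qed

instantiation alg_tensor :: (complex_banach_algebra_1, finite) complex_seminormed_algebra_1
begin

lift_definition zero_alg_tensor :: "('a, 'b) alg_tensor" is 0 .

lift_definition one_alg_tensor :: "('a, 'b) alg_tensor" is 1 .

lift_definition plus_alg_tensor :: "('a, 'b) alg_tensor \<Rightarrow> ('a, 'b) alg_tensor \<Rightarrow> ('a, 'b) alg_tensor"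
  is "(+)"
  by (simp only: add_diff_add multilin_rel.add)

lift_definition uminus_alg_tensor :: "('a, 'b) alg_tensor \<Rightarrow> ('a, 'b) alg_tensor" is uminus
  by (simp only: minus_diff_minus multilin_rel_uminus)

lift_definition minus_alg_tensor :: "('a, 'b) alg_tensor \<Rightarrow> ('a, 'b) alg_tensor \<Rightarrow> ('a, 'b) alg_tensor"
  is "(-)"
proof -
  fix v v' w w' :: "('a, 'b) tuple \<Rightarrow>\<^sub>0 complex"
  assume "v - v' \<in> multilin_rel" "w - w' \<in> multilin_rel"
  moreover have "v - w - (v' - w') = (v - v') - (w - w')" by simp
  ultimately show "v - w - (v' - w') \<in> multilin_rel" by (metis multilin_rel_diff)
qed

lift_definition times_alg_tensor :: "('a, 'b) alg_tensor \<Rightarrow> ('a, 'b) alg_tensor \<Rightarrow> ('a, 'b) alg_tensor"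
  is "(*)"
proof -
  fix v v' w w' :: "('a, 'b) tuple \<Rightarrow>\<^sub>0 complex"
  assume "v - v' \<in> multilin_rel" "w - w' \<in> multilin_rel"
  moreover have "v * w - v' * w' = v * (w - w') + (v - v') * w'"
    by (simp add: algebra_simps)
  ultimately show "v * w - v' * w' \<in> multilin_rel"
    by (simp add: multilin_rel.add multilin_rel_mult_left multilin_rel_mult_right)
qed

lift_definition scaleC_alg_tensor :: "complex \<Rightarrow> ('a, 'b) alg_tensor \<Rightarrow> ('a, 'b) alg_tensor"
  is free_scale
  by (simp only: right_diff_distrib[symmetric] multilin_rel.scale)

definition scaleR_alg_tensor :: "real \<Rightarrow> ('a, 'b) alg_tensor \<Rightarrow> ('a, 'b) alg_tensor" where
  "scaleR_alg_tensor r x = complex_of_real r *\<^sub>C x"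

lift_definition seminorm_alg_tensor :: "('a, 'b) alg_tensor \<Rightarrow> real" is proj_seminorm
  by (rule proj_seminorm_cong)

lemma multilin_relI: "v = w \<Longrightarrow> v - w \<in> multilin_rel"
  by (simp add: multilin_rel.zero)

instance
proof
  fix x y z :: "('a, 'b) alg_tensor" and r s :: real
  show "x + y + z = x + (y + z)" by transfer (rule multilin_relI, simp add: add.assoc)
  show "x + y = y + x" by transfer (rule multilin_relI, simp add: add.commute)
  show "0 + x = x" by transfer (rule multilin_relI, simp)
  show "- x + x = 0" by transfer (rule multilin_relI, simp)
  show "x - y = x + - y" by transfer (rule multilin_relI, simp)
  show "x * y * z = x * (y * z)" by transfer (rule multilin_relI, simp add: mult.assoc)
  show "1 * x = x" by transfer (rule multilin_relI, simp)
  show "x * 1 = x" by transfer (rule multilin_relI, simp)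
  show "(x + y) * z = x * z + y * z" by transfer (rule multilin_relI, simp add: distrib_right)
  show "x * (y + z) = x * y + x * z" by transfer (rule multilin_relI, simp add: distrib_left)
  show "(0 :: ('a, 'b) alg_tensor) \<noteq> 1"
  proof transfer
    show "0 - 1 \<notin> (multilin_rel :: (('a, 'b) tuple \<Rightarrow>\<^sub>0 complex) set)"
    proof
      assume "0 - 1 \<in> (multilin_rel :: (('a, 'b) tuple \<Rightarrow>\<^sub>0 complex) set)"
      then have "proj_seminorm (1 :: ('a, 'b) tuple \<Rightarrow>\<^sub>0 complex) \<le> formal_norm (0 :: ('a, 'b) tuple \<Rightarrow>\<^sub>0 complex)"
        by (rule proj_seminorm_le)
      then show False by (simp add: proj_seminorm_one)
    qed
  qed
  show add_right: "c *\<^sub>C (x + y) = c *\<^sub>C x + c *\<^sub>C y" for c and x y :: "('a, 'b) alg_tensor"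
    by transfer (rule multilin_relI, simp add: distrib_left)
  show add_left: "(c + d) *\<^sub>C x = c *\<^sub>C x + d *\<^sub>C x" for c d and x :: "('a, 'b) alg_tensor"
    by transfer (rule multilin_relI, simp add: single_add distrib_right)
  show scale: "c *\<^sub>C d *\<^sub>C x = (c * d) *\<^sub>C x" for c d and x :: "('a, 'b) alg_tensor"
    by transfer (rule multilin_relI, simp add: mult.assoc[symmetric] mult_single)
  show ml: "(c *\<^sub>C x) * y = c *\<^sub>C (x * y)" for c and x y :: "('a, 'b) alg_tensor"
    by transfer (rule multilin_relI, simp add: mult.assoc)
  show mr: "x * (c *\<^sub>C y) = c *\<^sub>C (x * y)" for c and x y :: "('a, 'b) alg_tensor"
    by transfer (rule multilin_relI, simp add: mult.assoc[symmetric] free_scale_commute)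
  show "complex_of_real r *\<^sub>C x = r *\<^sub>R x" by (simp add: scaleR_alg_tensor_def)
  show "r *\<^sub>R (x + y) = r *\<^sub>R x + r *\<^sub>R y" by (simp add: scaleR_alg_tensor_def add_right)
  show "(r + s) *\<^sub>R x = r *\<^sub>R x + s *\<^sub>R x" by (simp add: scaleR_alg_tensor_def add_left)
  show "r *\<^sub>R s *\<^sub>R x = (r * s) *\<^sub>R x" by (simp add: scaleR_alg_tensor_def scale)
  show "1 *\<^sub>R x = x"
    unfolding scaleR_alg_tensor_def by transfer (rule multilin_relI, simp)
  show "r *\<^sub>R x * y = r *\<^sub>R (x * y)" "x * r *\<^sub>R y = r *\<^sub>R (x * y)"
    by (simp_all add: scaleR_alg_tensor_def ml mr)
  show "seminorm (x + y) \<le> seminorm x + seminorm y"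
    by transfer (rule proj_seminorm_add)
  show "seminorm (c *\<^sub>C x) = cmod c * seminorm x" for c and x :: "('a, 'b) alg_tensor"
    by transfer (rule proj_seminorm_scale)
  show "seminorm (x * y) \<le> seminorm x * seminorm y"
    by transfer (rule proj_seminorm_mult)
  show "seminorm (1 :: ('a, 'b) alg_tensor) = 1"
    by transfer (rule proj_seminorm_one)
qed

end

text \<open>The projective tensor power of \<open>'b\<close> with factors indexed by \<open>'n\<close>.\<close>

type_synonym ('b, 'n) proj_tensor = "('b, 'n) alg_tensor completion"

lift_definition pure_tensor :: "('n \<Rightarrow> 'b::complex_banach_algebra_1) \<Rightarrow> ('b, 'n) alg_tensor"
  is "\<lambda>t. Poly_Mapping.single (Tuple t) 1" .

definition ptensor :: "('n::finite \<Rightarrow> 'b::complex_banach_algebra_1) \<Rightarrow> ('b, 'n) proj_tensor" where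
  "ptensor t = to_completion (pure_tensor t)"

lemma ptensor_mult: "ptensor s * ptensor t = ptensor (\<lambda>i. s i * t i)"
proof -
  have "pure_tensor s * pure_tensor t = pure_tensor (\<lambda>i. s i * t i)"
    by transfer (simp add: mult_single plus_tuple_def multilin_rel.zero)
  then show ?thesis
    unfolding ptensor_def by (metis to_completion_mult)
qed

lemma ptensor_one: "ptensor (\<lambda>i. 1) = 1"
proof -
  have "pure_tensor (\<lambda>i. 1) = 1"
    by transfer (simp add: multilin_rel.zero zero_tuple_def flip: single_one)
  then show ?thesis
    unfolding ptensor_def by (metis to_completion_one)
qed

text \<open>The element \<open>1 \<otimes> \<cdots> \<otimes> x \<otimes> \<cdots> \<otimes> 1\<close> with \<open>x\<close> in position \<open>i\<close>.\<close>

definition slot :: "'n::finite \<Rightarrow> 'b::complex_banach_algebra_1 \<Rightarrow> ('b, 'n) proj_tensor" where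
  "slot i x = ptensor ((\<lambda>_. 1)(i := x))"

text \<open>The \<open>j\<close>-th smallest index, counting from 0.  All positions and the numbering of the
  directions \<open>b\<close> below start at 0.\<close>

definition nth_index :: "nat \<Rightarrow> 'n::{finite, linorder}" where
  "nth_index j = sorted_list_of_set UNIV ! j"

text \<open>With \<open>k + 1\<close> tensor factors, the map \<open>u \<mapsto> u # [b\<^sub>0, \<dots>, b\<^sub>k\<^sub>-\<^sub>1]\<close> is the bounded complex linear
  map sending \<open>t\<^sub>0 \<otimes> \<cdots> \<otimes> t\<^sub>k\<close> to \<open>t\<^sub>0 b\<^sub>0 \<cdots> t\<^sub>k\<^sub>-\<^sub>1 b\<^sub>k\<^sub>-\<^sub>1 t\<^sub>k\<close>.\<close>

definition sharp ::
  "('b::complex_banach_algebra_1, 'n::{finite, linorder}) proj_tensor \<Rightarrow> (nat \<Rightarrow> 'b) \<Rightarrow> 'b" where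
  "sharp u b = (THE L :: ('b, 'n) proj_tensor \<Rightarrow> 'b.
      bounded_linear L \<and> (\<forall>c v. L (c *\<^sub>C v) = c *\<^sub>C L v) \<and>
      (\<forall>t. L (ptensor t) =
         prod_list (map (\<lambda>j. t (nth_index j) * b j) [0..<CARD('n) - 1]) * t (nth_index (CARD('n) - 1)))) u"


section \<open>Spectrum, cycles and the holomorphic functional calculus in one variable\<close>

definition is_inverse :: "'a::monoid_mult \<Rightarrow> 'a \<Rightarrow> bool" where
  "is_inverse x y \<longleftrightarrow> x * y = 1 \<and> y * x = 1"

definition spectrum :: "'a::complex_algebra_1 \<Rightarrow> complex set" where
  "spectrum a = {z. \<nexists>y. is_inverse (z *\<^sub>C 1 - a) y}"

definition resolvent :: "'a::complex_algebra_1 \<Rightarrow> complex \<Rightarrow> 'a" where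
  "resolvent a z = (THE y. is_inverse (z *\<^sub>C 1 - a) y)"

definition cycle_in :: "(real \<Rightarrow> complex) list \<Rightarrow> complex set \<Rightarrow> bool" where
  "cycle_in \<Gamma> U \<longleftrightarrow>
     (\<forall>\<gamma>\<in>set \<Gamma>. valid_path \<gamma> \<and> pathfinish \<gamma> = pathstart \<gamma> \<and> path_image \<gamma> \<subseteq> U)"

definition cycle_winding :: "(real \<Rightarrow> complex) list \<Rightarrow> complex \<Rightarrow> complex" where
  "cycle_winding \<Gamma> z = (\<Sum>\<gamma>\<leftarrow>\<Gamma>. winding_number \<gamma> z)"

text \<open>The winding number around a point is only meaningful if the cycle avoids that point, hence
  the requirement that the cycle lies in \<open>U - S\<close>.\<close>

definition surrounds :: "(real \<Rightarrow> complex) list \<Rightarrow> complex set \<Rightarrow> complex set \<Rightarrow> bool" where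
  "surrounds \<Gamma> S U \<longleftrightarrow> cycle_in \<Gamma> (U - S) \<and>
     (\<forall>z\<in>- U. cycle_winding \<Gamma> z = 0) \<and> (\<forall>z\<in>S. cycle_winding \<Gamma> z = 1)"

definition cycle_integral ::
  "(real \<Rightarrow> complex) list \<Rightarrow> (complex \<Rightarrow> 'a::complex_banach_algebra_1) \<Rightarrow> 'a" where
  "cycle_integral \<Gamma> F =
     (\<Sum>\<gamma>\<leftarrow>\<Gamma>. integral {0..1} (\<lambda>t. vector_derivative \<gamma> (at t within {0..1}) *\<^sub>C F (\<gamma> t)))"

definition holomorphic_calculus ::
  "complex set \<Rightarrow> (complex \<Rightarrow> complex) \<Rightarrow> 'a::complex_banach_algebra_1 \<Rightarrow> 'a" where
  "holomorphic_calculus U f a = (THE x. \<exists>\<Gamma>. surrounds \<Gamma> (spectrum a) U \<and>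
     x = (1 / (2 * pi * \<i>)) *\<^sub>C cycle_integral \<Gamma> (\<lambda>z. f z *\<^sub>C resolvent a z))"


section \<open>Divided differences and the multivariate holomorphic functional calculus\<close>

definition power_set :: "complex set \<Rightarrow> (complex^'n) set" where
  "power_set U = {s. \<forall>i. s $ i \<in> U}"

definition multi_holomorphic_on :: "(complex^'n \<Rightarrow> complex) \<Rightarrow> (complex^'n) set \<Rightarrow> bool"
    (infix \<open>multi'_holomorphic'_on\<close> 50) where
  "\<phi> multi_holomorphic_on S \<longleftrightarrow>
     (\<forall>s\<in>S. \<exists>D. (\<phi> has_derivative D) (at s within S) \<and> (\<forall>c v. D (c *s v) = c * D v))"

text \<open>The divided difference of the points \<open>s 0, \<dots>, s k\<close>.\<close>

fun distinct_divided_diff :: "(complex \<Rightarrow> complex) \<Rightarrow> nat \<Rightarrow> (nat \<Rightarrow> complex) \<Rightarrow> complex" where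
  "distinct_divided_diff f 0 s = f (s 0)"
| "distinct_divided_diff f (Suc k) s =
     (distinct_divided_diff f k s - distinct_divided_diff f k (s(k := s (Suc k)))) / (s k - s (Suc k))"

text \<open>The order of the divided difference is one less than the number of variables.  The value 0
  outside the domain only serves to make the function unique.\<close>

definition divided_diff :: "complex set \<Rightarrow> (complex \<Rightarrow> complex) \<Rightarrow> complex^'n::{finite, linorder} \<Rightarrow> complex" where
  "divided_diff U f = (THE g. g multi_holomorphic_on power_set U \<and>
     (\<forall>s\<in>power_set U. inj (($) s) \<longrightarrow>
        g s = distinct_divided_diff f (CARD('n) - 1) (\<lambda>j. s $ nth_index j)) \<and>
     (\<forall>s. s \<notin> power_set U \<longrightarrow> g s = 0))"

definition rational_on :: "complex set \<Rightarrow> (complex \<Rightarrow> complex) \<Rightarrow> bool" where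
  "rational_on U r \<longleftrightarrow>
     (\<exists>p q. q \<noteq> 0 \<and> (\<forall>z\<in>U. poly q z \<noteq> 0) \<and> r = (\<lambda>z. poly p z / poly q z))"

definition rational_span :: "complex set \<Rightarrow> (complex^'n::finite \<Rightarrow> complex) set" where
  "rational_span U = {(\<lambda>s. \<Sum>j<m. c j * (\<Prod>i\<in>UNIV. r j i (s $ i))) | (m::nat) c r.
     \<forall>j<m. \<forall>i. rational_on U (r j i)}"

text \<open>Functions on the power of \<open>U\<close> are represented by total functions whose values elsewhere are
  arbitrary.  A basic neighbourhood for locally uniform convergence is given by a compact set and a
  bound for the deviation on it.\<close>

definition Hol0 :: "complex set \<Rightarrow> (complex^'n::finite \<Rightarrow> complex) set" where
  "Hol0 U = {\<phi>. \<phi> multi_holomorphic_on power_set U \<and>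
     (\<forall>K e. compact K \<and> K \<subseteq> power_set U \<and> 0 < e \<longrightarrow>
        (\<exists>\<psi>\<in>rational_span U. \<forall>s\<in>K. cmod (\<phi> s - \<psi> s) < e))}"

text \<open>Continuity forces the image of a function to depend only on its values on the power
  of \<open>U\<close>.\<close>

definition is_multi_calculus ::
  "complex set \<Rightarrow> ('n::finite \<Rightarrow> 'd::complex_banach_algebra_1) \<Rightarrow> ((complex^'n \<Rightarrow> complex) \<Rightarrow> 'd) \<Rightarrow> bool" where
  "is_multi_calculus U c \<Phi> \<longleftrightarrow>
     (\<forall>\<phi>\<in>Hol0 U. \<forall>\<psi>\<in>Hol0 U. \<Phi> (\<lambda>s. \<phi> s + \<psi> s) = \<Phi> \<phi> + \<Phi> \<psi>) \<and>
     (\<forall>\<phi>\<in>Hol0 U. \<forall>\<alpha>. \<Phi> (\<lambda>s. \<alpha> * \<phi> s) = \<alpha> *\<^sub>C \<Phi> \<phi>) \<and>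
     (\<forall>\<phi>\<in>Hol0 U. \<forall>\<psi>\<in>Hol0 U. \<Phi> (\<lambda>s. \<phi> s * \<psi> s) = \<Phi> \<phi> * \<Phi> \<psi>) \<and>
     \<Phi> (\<lambda>s. 1) = 1 \<and>
     (\<forall>i. \<Phi> (\<lambda>s. s $ i) = c i) \<and>
     (\<forall>\<phi>\<in>Hol0 U. \<forall>e>0. \<exists>K d. compact K \<and> K \<subseteq> power_set U \<and> 0 < d \<and>
        (\<forall>\<psi>\<in>Hol0 U. (\<forall>s\<in>K. cmod (\<psi> s - \<phi> s) < d) \<longrightarrow> norm (\<Phi> \<psi> - \<Phi> \<phi>) < e))"

definition multi_calculus ::
  "complex set \<Rightarrow> (complex^'n::finite \<Rightarrow> complex) \<Rightarrow> ('n \<Rightarrow> 'd::complex_banach_algebra_1) \<Rightarrow> 'd" where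
  "multi_calculus U \<phi> c = (THE x. \<exists>\<Phi>. is_multi_calculus U c \<Phi> \<and> x = \<Phi> \<phi>)"

definition tensor_divided_diff ::
  "complex set \<Rightarrow> (complex \<Rightarrow> complex) \<Rightarrow> ('n::{finite, linorder} \<Rightarrow> 'b::complex_banach_algebra_1) \<Rightarrow>
     ('b, 'n) proj_tensor" where
  "tensor_divided_diff U f a = multi_calculus U (divided_diff U f) (\<lambda>i. slot i (a i))"


section \<open>Directional derivatives\<close>

definition dir_deriv :: "'a::real_normed_vector \<Rightarrow> ('a \<Rightarrow> 'a) \<Rightarrow> 'a \<Rightarrow> 'a" where
  "dir_deriv b F a = vector_derivative (\<lambda>t. F (a + t *\<^sub>R b)) (at 0)"

definition dir_differentiable :: "'a::real_normed_vector \<Rightarrow> ('a \<Rightarrow> 'a) \<Rightarrow> 'a \<Rightarrow> bool" where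
  "dir_differentiable b F a \<longleftrightarrow> (\<lambda>t::real. F (a + t *\<^sub>R b)) differentiable (at 0)"

text \<open>\<open>iter_dir_deriv b k F\<close> is \<open>\<partial>\<^bsub>b (k - 1)\<^esub> \<cdots> \<partial>\<^bsub>b 0\<^esub> F\<close>.\<close>

primrec iter_dir_deriv :: "(nat \<Rightarrow> 'a::real_normed_vector) \<Rightarrow> nat \<Rightarrow> ('a \<Rightarrow> 'a) \<Rightarrow> 'a \<Rightarrow> 'a" where
  "iter_dir_deriv b 0 F = F"
| "iter_dir_deriv b (Suc j) F = dir_deriv (b j) (iter_dir_deriv b j F)"

end

theory Submission imports Defs begin

text \<open>Everything rests on one integral.  For points \<open>s\<^sub>1, \<dots>, s\<^sub>n\<close> enclosed by a cycle in \<open>U\<close>, the divided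
  difference of \<open>f\<close> is \<open>1 / (2 \<pi> \<i>) \<integral> f z / ((z - s\<^sub>1) \<cdots> (z - s\<^sub>n)) dz\<close>.  For distinct points this follows
  by induction from Cauchy's formula and partial fractions (\<open>distinct_divided_diff_integral\<close>); the
  integral is holomorphic in all the points and tuples of distinct points are dense, so it is the
  divided difference everywhere (\<open>divided_diff_eq\<close>).  A Riemann sum of the integral is a sum of
  products \<open>\<Prod> 1 / (z\<^sub>j - s\<^sub>i)\<close> with \<open>z\<^sub>j\<close> on the cycle.  Substituting commuting elements \<open>c\<^sub>i\<close> of a
  Banach algebra for the \<open>s\<^sub>i\<close> turns such a product into a product of resolvents, so that the Riemann
  sums of the scalar integral become those of the integral in the theorem.  Passing to the limit
  yields the formula (\<open>approximates_divided_diff\<close>, \<open>multi_calculus_divided_diff\<close>).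

  The limit is justified by an estimate for the functional calculus.  On sums of products of
  one-variable rational functions the value at \<open>c\<close> is forced by the algebra axioms.  Writing one
  factor after the other as an integral of a resolvent over a chain around the spectra bounds the
  norm of this value by a constant times the supremum of the function over the product of the chains
  (\<open>evaluates_bound\<close>).  Hence the value extends to the closure of these functions, the extension is
  a calculus and it agrees with every other calculus
  (\<open>is_multi_calculus_approximates\<close>, \<open>multi_calculus_eqI\<close>).  Divided differences lie in this
  closure: the poles of the Riemann sums are moved out of \<open>U\<close> by Runge's argument
  (\<open>removable_poles\<close>, \<open>divided_diff_Hol0\<close>).

  For elements \<open>a\<close> of \<open>\<B>\<close> placed in the \<open>i\<close>-th tensor factor, the spectrum does not change
  (\<open>spectrum_slot\<close>) and the product of the resolvents is the elementary tensor of the resolvents of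
  the given elements.  Contracting it with \<open>b\<^sub>1, \<dots>, b\<^sub>k\<close> gives the word
  \<open>R b\<^sub>1 R b\<^sub>2 \<cdots> b\<^sub>k R\<close> with \<open>R = (z - a)\<^sup>-\<^sup>1\<close> (\<open>sharp_tensor_divided_diff\<close>).  On the other hand
  the derivative of \<open>(z - a)\<^sup>-\<^sup>1\<close> in the direction \<open>b\<close> is \<open>(z - a)\<^sup>-\<^sup>1 b (z - a)\<^sup>-\<^sup>1\<close>, so each
  differentiation under the integral inserts the new direction at every possible place of such a
  word, and after \<open>k\<close> steps every order of the directions has been produced exactly once
  (\<open>iter_dir_deriv_holomorphic_calculus\<close>).

  Two tools make the integrals manageable.  Arbitrary cycles are replaced by finite families of line
  segments, obtained from a square grid, for which Cauchy's formula is immediate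
  (\<open>Cauchy_chain_exists\<close>); the homology form of Cauchy's theorem follows from them by interchanging
  two integrals (\<open>Cauchy_theorem_C1_cycle\<close>).  Identities between integrals with values in a Banach
  algebra are reduced to complex ones by continuous linear functionals, of which there are enough by
  the Hahn-Banach theorem (\<open>functionals_separate\<close>, \<open>cycle_integral_eq_weak\<close>).\<close>

section \<open>Polygonal chains and the homology form of Cauchy's theorem\<close>

lemma cycle_integral_complex:
  "cycle_integral \<Gamma> (g :: complex \<Rightarrow> complex) = (\<Sum>\<gamma>\<leftarrow>\<Gamma>. contour_integral \<gamma> g)"
proof -
  have "contour_integral \<gamma> g
      = integral {0..1} (\<lambda>t. vector_derivative \<gamma> (at t within {0..1}) *\<^sub>C g (\<gamma> t))" for \<gamma>
  proof -
    let ?h = "\<lambda>t. g (\<gamma> t) * vector_derivative \<gamma> (at t within {0..1})"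
    have eq: "(\<lambda>t. vector_derivative \<gamma> (at t within {0..1}) *\<^sub>C g (\<gamma> t)) = ?h"
      by (simp add: scaleC_complex_def mult.commute)
    show ?thesis
    proof (cases "g contour_integrable_on \<gamma>")
      case True
      then have "(?h has_integral contour_integral \<gamma> g) {0..1}"
        using has_contour_integral_integral has_contour_integral_def by blast
      then show ?thesis by (simp add: eq integral_unique)
    next
      case False
      then have "\<not> ?h integrable_on {0..1}"
        by (auto simp: contour_integrable_on_def has_contour_integral_def integrable_on_def)
      then show ?thesis
        using False by (simp add: eq not_integrable_contour_integral not_integrable_integral)
    qed
  qed
  then show ?thesis by (simp add: cycle_integral_def)
qed

text \<open>The segments of a chain need not be ordered into closed curves: the second condition, that every
  vertex is as often a start as an end point, is all that is used of closedness.  The two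
  conditions on integrals are Cauchy's theorem and the winding number 1 around \<open>L\<close>.\<close>

definition Cauchy_chain ::
  "(real \<Rightarrow> complex) list \<Rightarrow> complex set \<Rightarrow> complex set \<Rightarrow> bool" where
  "Cauchy_chain E L U \<longleftrightarrow>
     (\<forall>\<gamma>\<in>set E. \<exists>p q. \<gamma> = linepath p q \<and> closed_segment p q \<subseteq> U - L) \<and>
     (\<forall>F :: complex \<Rightarrow> complex. (\<Sum>\<gamma>\<leftarrow>E. F (pathfinish \<gamma>) - F (pathstart \<gamma>)) = 0) \<and>
     (\<forall>g :: complex \<Rightarrow> complex. g holomorphic_on U \<longrightarrow> cycle_integral E g = 0) \<and>
     (\<forall>w\<in>L. cycle_integral E (\<lambda>z. 1 / (z - w)) = 2 * pi * \<i>)"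

text \<open>Applied to the oriented edges of a family of squares, with \<open>\<rho>\<close> reversing an edge: only the edges
  whose reverse is not in the family contribute.\<close>

lemma sum_antisymmetric_involution:
  fixes \<phi> :: "'t \<Rightarrow> complex"
  assumes "finite T" and inv: "\<And>t. t \<in> T \<Longrightarrow> \<rho> (\<rho> t) = t"
    and anti: "\<And>t. t \<in> T \<Longrightarrow> \<phi> (\<rho> t) = - \<phi> t"
  shows "sum \<phi> T = sum \<phi> {t\<in>T. \<rho> t \<notin> T}"
proof -
  let ?T0 = "{t\<in>T. \<rho> t \<in> T}"
  have "bij_betw \<rho> ?T0 ?T0"
    by (rule bij_betw_byWitness[where f' = \<rho>]) (auto simp: inv)
  then have "sum \<phi> ?T0 = sum (\<lambda>t. \<phi> (\<rho> t)) ?T0"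
    by (simp add: sum.reindex_bij_betw)
  also have "\<dots> = - sum \<phi> ?T0"
    by (simp add: anti sum_negf)
  finally have "sum \<phi> ?T0 = 0" by simp
  moreover have "sum \<phi> T = sum \<phi> ?T0 + sum \<phi> {t\<in>T. \<rho> t \<notin> T}"
    using \<open>finite T\<close> by (subst sum.union_disjoint[symmetric]) (auto intro: sum.cong)
  ultimately show ?thesis by simp
qed

lemma primitive_on_convex:
  assumes "convex Q" "closed Q" "open U" "Q \<subseteq> U" "g holomorphic_on U"
  obtains G where "\<And>p q. p \<in> Q \<Longrightarrow> q \<in> Q \<Longrightarrow> contour_integral (linepath p q) g = G q - (G p :: complex)"
proof -
  obtain G where G: "\<And>x. x \<in> Q \<Longrightarrow> (G has_field_derivative g x) (at x within Q)"
  proof (rule holomorphic_convex_primitive[of Q "{}" g])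
    show "continuous_on Q g"
      using assms holomorphic_on_imp_continuous_on holomorphic_on_subset by blast
    show "g field_differentiable at x" if "x \<in> interior Q - {}" for x
      using that assms interior_subset by (meson DiffD1 holomorphic_on_imp_differentiable_at subset_iff)
  qed (use assms in auto)
  have "contour_integral (linepath p q) g = G q - G p" if "p \<in> Q" "q \<in> Q" for p q
    using contour_integral_primitive[of Q G g "linepath p q"] G that assms(1)
    by (simp add: closed_segment_subset contour_integral_unique)
  then show ?thesis using that by blast
qed

text \<open>The squares of a fine grid that meet \<open>L\<close> lie in \<open>U\<close>.  Integrals over all their boundaries vanish for
  holomorphic functions and wind once around interior points.  Edges common to two of the squares
  cancel, and an edge that remains belongs to a square that does not meet \<open>L\<close>, hence avoids \<open>L\<close>.\<close>

lemma Cauchy_chain_exists: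
  assumes L: "compact L" and U: "open U" and LU: "L \<subseteq> U"
  shows "\<exists>E. Cauchy_chain E L U"
proof -
  obtain e where e: "e > 0" "(\<Union>x\<in>L. ball x e) \<subseteq> U"
    using compact_subset_open_imp_ball_epsilon_subset[OF L U LU] by blast
  define d where "d = e / 2"
  have d: "d > 0" using e by (simp add: d_def)
  define P where "P m n = Complex (d * of_int m) (d * of_int n)" for m n :: int
  define Q where "Q m n = cbox (P m n) (P (m+1) (n+1))" for m n
  have Re_P [simp]: "Re (P m n) = d * of_int m" "Im (P m n) = d * of_int n" for m n
    by (simp_all add: P_def)
  have Q_iff: "z \<in> Q m n \<longleftrightarrow> d * m \<le> Re z \<and> Re z \<le> d * (m + 1) \<and> d * n \<le> Im z \<and> Im z \<le> d * (n + 1)"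
    for z m n by (auto simp: Q_def in_cbox_complex_iff)
  define S where "S = {(m, n). Q m n \<inter> L \<noteq> {}}"
  have Q_sub: "Q m n \<subseteq> U" if mn: "(m, n) \<in> S" for m n
  proof
    fix z assume z: "z \<in> Q m n"
    obtain x where x: "x \<in> L" "x \<in> Q m n" using mn by (auto simp: S_def)
    have "\<bar>Re (x - z)\<bar> \<le> d" "\<bar>Im (x - z)\<bar> \<le> d"
      using z x by (auto simp: Q_iff algebra_simps)
    then have "cmod (x - z) \<le> sqrt (d\<^sup>2 + d\<^sup>2)"
      unfolding cmod_def using d
      by (intro real_sqrt_le_mono add_mono) (metis abs_ge_zero power2_abs power_mono)+
    also have "\<dots> < sqrt ((2 * d)\<^sup>2)"
      using d by (intro real_sqrt_less_mono) (simp add: power2_eq_square)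
    also have "\<dots> = e" using d by (simp add: d_def)
    finally have "z \<in> ball x e" by (simp add: dist_norm)
    then show "z \<in> U" using e x by blast
  qed
  have "finite S"
  proof -
    obtain B where B: "\<And>x. x \<in> L \<Longrightarrow> cmod x \<le> B"
      using compact_imp_bounded[OF L] by (auto simp: bounded_iff)
    define N where "N = \<lceil>B / d\<rceil> + 1"
    have bnd: "-N \<le> i \<and> i \<le> N" if "d * real_of_int i \<le> r" "r \<le> d * (real_of_int i + 1)" "\<bar>r\<bar> \<le> B" for i r
    proof -
      have "d * real_of_int i \<le> B" "- B \<le> d * (real_of_int i + 1)" using that by linarith+
      then have "real_of_int i \<le> B / d" "- (B / d) \<le> real_of_int i + 1"
        using d by (simp_all add: field_simps)
      then show ?thesis unfolding N_def by linarith
    qed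
    have "S \<subseteq> {-N..N} \<times> {-N..N}"
    proof
      fix mn assume "mn \<in> S"
      then obtain m n x where mn: "mn = (m, n)" and x: "x \<in> L" "x \<in> Q m n"
        by (auto simp: S_def)
      have "\<bar>Re x\<bar> \<le> B" "\<bar>Im x\<bar> \<le> B"
        using B[OF x(1)] abs_Re_le_cmod[of x] abs_Im_le_cmod[of x] by linarith+
      then show "mn \<in> {-N..N} \<times> {-N..N}"
        using bnd[of m "Re x"] bnd[of n "Im x"] x(2) by (auto simp: mn Q_iff)
    qed
    then show ?thesis by (rule finite_subset) simp
  qed
  \<comment> \<open>Oriented edges: \<open>((m, n), k)\<close> is the \<open>k\<close>-th edge of the square \<open>Q m
    n\<close>, counted anticlockwise from the lower one; \<open>rv\<close> is the same edge in the
    opposite direction, as an edge of the neighbouring square.\<close>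
  define T where "T = S \<times> {..<4::nat}"
  have "finite T" using \<open>finite S\<close> by (simp add: T_def)
  define st where "st = (\<lambda>((m, n), k :: nat). if k = 0 then P m n else if k = 1 then P (m+1) n
     else if k = 2 then P (m+1) (n+1) else P m (n+1 :: int))"
  define en where "en = (\<lambda>((m, n), k :: nat). if k = 0 then P (m+1) n else if k = 1 then P (m+1) (n+1)
     else if k = 2 then P m (n+1) else P m (n :: int))"
  define rv where "rv = (\<lambda>((m :: int, n), k :: nat). if k = 0 then ((m, n - 1), 2) else if k = 1 then ((m+1, n), 3)
     else if k = 2 then ((m, n+1), 0) else ((m - 1, n :: int), 1 :: nat))"
  have rv: "rv (rv t) = t" "st (rv t) = en t" "en (rv t) = st t" if "t \<in> T" for t
    using that by (auto simp: T_def rv_def st_def en_def split: prod.splits)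
  have seg: "closed_segment (st (mn, k)) (en (mn, k)) \<subseteq> Q (fst mn) (snd mn)" for mn k
  proof (rule closed_segment_subset)
    show "st (mn, k) \<in> Q (fst mn) (snd mn)" "en (mn, k) \<in> Q (fst mn) (snd mn)"
      using d by (auto simp: st_def en_def Q_iff algebra_simps split: prod.splits)
    show "convex (Q (fst mn) (snd mn))" by (simp add: Q_def convex_box)
  qed
  \<comment> \<open>The edges that are not cancelled.\<close>
  define T1 where "T1 = {t\<in>T. rv t \<notin> T}"
  have seg1: "closed_segment (st t) (en t) \<subseteq> U - L" if t: "t \<in> T1" for t
  proof -
    obtain m n k where t': "t = ((m, n), k)" by (metis surj_pair)
    obtain m' n' k' where r: "rv t = ((m', n'), k')" by (metis surj_pair)
    have "(m, n) \<in> S" using t by (auto simp: T1_def T_def t')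
    moreover have "(m', n') \<notin> S"
      using t r by (auto simp: T1_def T_def t' rv_def split: if_splits)
    moreover have "closed_segment (st t) (en t) \<subseteq> Q m' n'"
      using seg[of "(m', n')" k'] rv[of t] t by (simp add: T1_def flip: r) (metis closed_segment_commute)
    ultimately show ?thesis
      using seg[of "(m, n)" k] Q_sub[of m n] by (auto simp: t' S_def)
  qed
  define \<phi> where "\<phi> g t = contour_integral (linepath (st t) (en t)) g" for g t
  \<comment> \<open>An edge shared by two squares of the family is traversed once in each direction.\<close>
  have cancel: "sum (\<phi> g) T1 = (\<Sum>mn\<in>S. \<Sum>k<4. \<phi> g (mn, k))" for g
  proof -
    have "sum (\<phi> g) T = sum (\<phi> g) T1"
      unfolding T1_def
    proof (rule sum_antisymmetric_involution)
      show "\<phi> g (rv t) = - \<phi> g t" if "t \<in> T" for t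
        using contour_integral_reversepath[of "linepath (st t) (en t)" g]
        by (simp add: \<phi>_def rv[OF that])
    qed (use \<open>finite T\<close> rv in auto)
    then show ?thesis by (simp add: T_def sum.cartesian_product)
  qed
  have sum4: "(\<Sum>k<4. h k) = h 0 + h 1 + h 2 + h (3::nat)" for h :: "nat \<Rightarrow> complex"
    by (simp add: eval_nat_numeral)
  have square: "(\<Sum>k<4. \<phi> g ((m, n), k)) = 0" if V: "open V" "Q m n \<subseteq> V" "g holomorphic_on V" for g V m n
  proof -
    obtain G where G: "\<And>p q. p \<in> Q m n \<Longrightarrow> q \<in> Q m n \<Longrightarrow> contour_integral (linepath p q) g = G q - G p"
      using primitive_on_convex[of "Q m n" V g] V unfolding Q_def
      by (metis convex_box(1) closed_cbox)
    have "P m n \<in> Q m n" "P (m+1) n \<in> Q m n" "P (m+1) (n+1) \<in> Q m n" "P m (n+1) \<in> Q m n"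
      using d by (auto simp: Q_iff algebra_simps)
    then show ?thesis by (simp add: sum4 \<phi>_def st_def en_def G)
  qed
  obtain ts where ts: "set ts = T1" "distinct ts"
    using finite_distinct_list[of T1] \<open>finite T\<close> by (auto simp: T1_def)
  define E where "E = map (\<lambda>t. linepath (st t) (en t)) ts"
  have E_sum: "(\<Sum>\<gamma>\<leftarrow>E. h \<gamma>) = (\<Sum>t\<in>T1. h (linepath (st t) (en t)))" for h :: "_ \<Rightarrow> complex"
    using ts by (simp add: E_def sum_list_distinct_conv_sum_set comp_def)
  have E_int: "cycle_integral E g = sum (\<phi> g) T1" for g
    by (simp add: cycle_integral_complex E_sum \<phi>_def)
  have wind: "(\<Sum>t\<in>T1. winding_number (linepath (st t) (en t)) w) = cycle_integral E (\<lambda>z. 1 / (z - w)) / (2 * pi * \<i>)"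
    if "\<And>t. t \<in> T1 \<Longrightarrow> w \<notin> closed_segment (st t) (en t)" for w
    using that by (simp add: E_int \<phi>_def winding_number_valid_path sum_divide_distrib)
  have inner: "cycle_integral E (\<lambda>z. 1 / (z - w)) = 2 * pi * \<i>"
    if mn: "(m, n) \<in> S" and w: "w \<in> box (P m n) (P (m+1) (n+1))" for m n w
  proof -
    have w': "d * m < Re w" "Re w < d * (m + 1)" "d * n < Im w" "Im w < d * (n + 1)"
      using w by (auto simp: in_box_complex_iff)
    have other: "(\<Sum>k<4. \<phi> (\<lambda>z. 1 / (z - w)) (mn', k)) = 0" if ne: "mn' \<noteq> (m, n)" for mn'
    proof -
      obtain m' n' where mn': "mn' = (m', n')" by (metis surj_pair)
      have int_eq: "i = j" if "d * real_of_int i < r" "r < d * (real_of_int i + 1)"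
        "d * real_of_int j \<le> r" "r \<le> d * (real_of_int j + 1)" for i j r
      proof -
        have "d * real_of_int i < d * (real_of_int j + 1)" "d * real_of_int j < d * (real_of_int i + 1)"
          using that by linarith+
        then have "real_of_int i < real_of_int j + 1" "real_of_int j < real_of_int i + 1"
          using d by simp_all
        then show ?thesis by linarith
      qed
      have "w \<notin> Q m' n'"
        using int_eq[of m "Re w" m'] int_eq[of n "Im w" n'] w' ne by (auto simp: Q_iff mn')
      then show ?thesis
        unfolding mn' by (intro square[of "- {w}"]) (auto intro!: holomorphic_intros)
    qed
    have pi: "w \<notin> path_image (rectpath (P m n) (P (m+1) (n+1)))"
      using w d by (auto simp: path_image_rectpath_cbox_minus_box in_box_complex_iff algebra_simps)
    have "Complex (d * (real_of_int m + 1)) (d * real_of_int n) = P (m+1) n"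
      "Complex (d * real_of_int m) (d * (real_of_int n + 1)) = P m (n+1)"
      by (simp_all add: P_def)
    then have "(\<Sum>k<4. winding_number (linepath (st ((m, n), k)) (en ((m, n), k))) w)
        = winding_number (rectpath (P m n) (P (m+1) (n+1))) w"
      using pi unfolding rectpath_def Let_def sum4
      by (simp add: st_def en_def winding_number_join path_image_join)
    also have "\<dots> = 1" by (rule winding_number_rectpath[OF w])
    finally have one: "(\<Sum>k<4. winding_number (linepath (st ((m, n), k)) (en ((m, n), k))) w) = 1" .
    have off: "w \<notin> closed_segment (st ((m, n), k)) (en ((m, n), k))" if "k < 4" for k
    proof -
      from that consider "k = 0" | "k = 1" | "k = 2" | "k = 3" by linarith
      then show ?thesis
        using pi \<open>Complex _ _ = P (m+1) n\<close> \<open>Complex _ _ = P m (n+1)\<close>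
        unfolding rectpath_def Let_def
        by cases (auto simp: st_def en_def path_image_join)
    qed
    have "(\<Sum>k<4. \<phi> (\<lambda>z. 1 / (z - w)) ((m, n), k)) = 2 * pi * \<i> *
        (\<Sum>k<4. winding_number (linepath (st ((m, n), k)) (en ((m, n), k))) w)"
      unfolding sum_distrib_left
      by (intro sum.cong refl) (use off in \<open>simp add: \<phi>_def winding_number_valid_path\<close>)
    then have "(\<Sum>k<4. \<phi> (\<lambda>z. 1 / (z - w)) ((m, n), k)) = 2 * pi * \<i>"
      using one by simp
    moreover have "(\<Sum>mn\<in>S. \<Sum>k<4. \<phi> (\<lambda>z. 1 / (z - w)) (mn, k))
        = (\<Sum>mn\<in>{(m, n)}. \<Sum>k<4. \<phi> (\<lambda>z. 1 / (z - w)) (mn, k))"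
      by (rule sum.mono_neutral_right) (use \<open>finite S\<close> mn other in auto)
    ultimately show ?thesis by (simp add: E_int cancel)
  qed
  have "Cauchy_chain E L U"
    unfolding Cauchy_chain_def
  proof (intro conjI allI impI ballI)
    show "\<exists>p q. \<gamma> = linepath p q \<and> closed_segment p q \<subseteq> U - L" if "\<gamma> \<in> set E" for \<gamma>
      using that seg1 ts unfolding E_def set_map by blast
    fix F :: "complex \<Rightarrow> complex"
    have "(\<Sum>t\<in>T1. F (en t) - F (st t)) = (\<Sum>t\<in>T. F (en t) - F (st t))"
      unfolding T1_def
      by (rule sum_antisymmetric_involution[symmetric]) (use \<open>finite T\<close> rv in auto)
    also have "\<dots> = (\<Sum>mn\<in>S. \<Sum>k<4. F (en (mn, k)) - F (st (mn, k)))"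
      by (simp add: T_def sum.cartesian_product)
    also have "\<dots> = 0" by (rule sum.neutral) (auto simp: sum4 st_def en_def)
    finally show "(\<Sum>\<gamma>\<leftarrow>E. F (pathfinish \<gamma>) - F (pathstart \<gamma>)) = 0" by (simp add: E_sum)
  next
    fix g :: "complex \<Rightarrow> complex" assume "g holomorphic_on U"
    then show "cycle_integral E g = 0"
      unfolding E_int cancel using square[OF U] Q_sub by (intro sum.neutral) auto
  next
    fix w assume w: "w \<in> L"
    define m n where "m = \<lfloor>Re w / d\<rfloor>" and "n = \<lfloor>Im w / d\<rfloor>"
    have "real_of_int m \<le> Re w / d" "Re w / d \<le> m + 1" "real_of_int n \<le> Im w / d" "Im w / d \<le> n + 1"
      unfolding m_def n_def by linarith+
    then have wQ: "w \<in> Q m n" using d by (simp add: Q_iff field_simps)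
    then have mn: "(m, n) \<in> S" using w by (auto simp: S_def)
    let ?B = "box (P m n) (P (m+1) (n+1))"
    let ?W = "\<lambda>w. \<Sum>t\<in>T1. winding_number (linepath (st t) (en t)) w"
    have off: "x \<notin> closed_segment (st t) (en t)" if "x \<in> L" "t \<in> T1" for x t
      using seg1 that by blast
    show "cycle_integral E (\<lambda>z. 1 / (z - w)) = 2 * pi * \<i>"
    proof (cases "w \<in> ?B")
      case False
      \<comment> \<open>A point on the grid lines is a limit of interior points of a square that meets \<open>L\<close>.\<close>
      have "P m n + (1/2) *\<^sub>R Complex d d \<in> ?B"
        using d by (simp add: in_box_complex_iff algebra_simps)
      then have "closure ?B = Q m n" unfolding Q_def by (intro closure_box) auto
      then have lim: "w islimpt ?B" using wQ False by (metis UnE closure_def mem_Collect_eq)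
      have "((\<lambda>w. winding_number (linepath (st t) (en t)) w)
          \<longlongrightarrow> winding_number (linepath (st t) (en t)) w) (at w within ?B)" if "t \<in> T1" for t
        using continuous_at_imp_continuous_at_within[OF continuous_at_winding_number[of "linepath (st t) (en t)" w]]
          off[OF w that] by (simp add: continuous_within)
      then have cont: "(?W \<longlongrightarrow> ?W w) (at w within ?B)"
        by (rule tendsto_sum)
      have avoid: "\<forall>\<^sub>F x in at w within ?B. \<forall>t\<in>T1. x \<notin> closed_segment (st t) (en t)"
      proof (rule eventually_ball_finite)
        show "finite T1" using \<open>finite T\<close> by (simp add: T1_def)
        show "\<forall>t\<in>T1. \<forall>\<^sub>F x in at w within ?B. x \<notin> closed_segment (st t) (en t)"
        proof
          fix t assume "t \<in> T1"
          then have "w \<in> - closed_segment (st t) (en t)" using off[OF w] by simp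
          then have "\<forall>\<^sub>F x in at w within ?B. x \<in> - closed_segment (st t) (en t)"
            using open_Compl[OF closed_segment] by (auto simp: eventually_at_topological)
          then show "\<forall>\<^sub>F x in at w within ?B. x \<notin> closed_segment (st t) (en t)" by simp
        qed
      qed
      have in_B: "\<forall>\<^sub>F x in at w within ?B. x \<in> ?B"
        by (simp add: eventually_at_filter)
      have "\<forall>\<^sub>F x in at w within ?B. ?W x = 1"
        using avoid in_B
      proof eventually_elim
        case (elim x)
        then show ?case using wind[of x] inner[OF mn, of x] by simp
      qed
      then have "(?W \<longlongrightarrow> 1) (at w within ?B)" by (simp add: tendsto_eventually)
      then have "?W w = 1"
        using tendsto_unique[OF _ cont] lim by (simp add: trivial_limit_within)
      then show ?thesis using wind[of w] off[OF w] by (simp add: field_simps)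
    qed (use inner[OF mn] in simp)
  qed
  then show ?thesis by blast
qed


lemma Cauchy_chain_linepath:
  assumes "Cauchy_chain E L U" "\<gamma> \<in> set E"
  obtains p q where "\<gamma> = linepath p q" "closed_segment p q \<subseteq> U - L"
  using assms unfolding Cauchy_chain_def by metis

text \<open>The difference quotient of \<open>g\<close> at \<open>w\<close> is holomorphic and therefore has integral 0.\<close>

lemma Cauchy_chain_formula:
  assumes E: "Cauchy_chain E L U" and U: "open U" and g: "g holomorphic_on U" and w: "w \<in> L"
  shows "cycle_integral E (\<lambda>z. g z / (z - w)) = 2 * pi * \<i> * g w"
proof -
  define k where "k = (\<lambda>z. if z = w then deriv g w else (g z - g w) / (z - w))"
  have "k holomorphic_on U" unfolding k_def using g U by (rule pole_lemma_open)
  then have "0 = cycle_integral E k" using E by (simp add: Cauchy_chain_def)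
  also have "\<dots> = (\<Sum>\<gamma>\<leftarrow>E. contour_integral \<gamma> (\<lambda>z. g z / (z - w)) - contour_integral \<gamma> (\<lambda>z. 1 / (z - w)) * g w)"
    unfolding cycle_integral_complex
  proof (intro arg_cong[of _ _ sum_list] map_cong refl)
    fix \<gamma> assume "\<gamma> \<in> set E"
    then obtain p q where pq: "\<gamma> = linepath p q" "closed_segment p q \<subseteq> U - L"
      using Cauchy_chain_linepath[OF E] by metis
    then have nw: "z \<noteq> w" if "z \<in> closed_segment p q" for z using w that by auto
    have cont: "continuous_on (closed_segment p q) g"
      using g pq holomorphic_on_imp_continuous_on continuous_on_subset by blast
    have "contour_integral \<gamma> k = contour_integral \<gamma> (\<lambda>z. g z / (z - w) - 1 / (z - w) * g w)"
      by (rule contour_integral_eq) (use nw pq in \<open>auto simp: k_def diff_divide_distrib\<close>)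
    also have "\<dots> = contour_integral \<gamma> (\<lambda>z. g z / (z - w)) - contour_integral \<gamma> (\<lambda>z. 1 / (z - w) * g w)"
      unfolding pq(1)
      by (intro contour_integral_diff contour_integrable_continuous_linepath continuous_intros cont)
         (use nw in auto)
    also have "contour_integral \<gamma> (\<lambda>z. 1 / (z - w) * g w) = contour_integral \<gamma> (\<lambda>z. 1 / (z - w)) * g w"
      unfolding pq(1)
      by (intro contour_integral_rmul contour_integrable_continuous_linepath continuous_intros)
         (use nw in auto)
    finally show "contour_integral \<gamma> k = contour_integral \<gamma> (\<lambda>z. g z / (z - w)) - contour_integral \<gamma> (\<lambda>z. 1 / (z - w)) * g w" .
  qed
  also have "\<dots> = cycle_integral E (\<lambda>z. g z / (z - w)) - cycle_integral E (\<lambda>z. 1 / (z - w)) * g w"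
    by (simp add: cycle_integral_complex sum_list_subtractf sum_list_mult_const)
  also have "cycle_integral E (\<lambda>z. 1 / (z - w)) = 2 * pi * \<i>"
    using E w by (simp add: Cauchy_chain_def)
  finally show ?thesis by simp
qed

text \<open>Each component of \<open>U - L\<close> gets a base point, and each segment is completed to a loop by paths from
  and to the base point that depend only on the vertex.  Since the chain is balanced at every vertex,
  the contributions of the added paths cancel.\<close>

lemma cycle_of_Cauchy_chain:
  assumes E: "Cauchy_chain E L U" and U: "open U" and L: "compact L"
  obtains \<Gamma> where "cycle_in \<Gamma> (U - L)"
    "\<And>g :: complex \<Rightarrow> complex. g holomorphic_on (U - L) \<Longrightarrow> cycle_integral \<Gamma> g = cycle_integral E g"
proof -
  let ?W = "U - L"
  have W: "open ?W" using U L compact_imp_closed by blast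
  define b where "b v = (SOME x. x \<in> connected_component_set ?W v)" for v
  have b: "b v \<in> connected_component_set ?W v" if "v \<in> ?W" for v
    unfolding b_def using someI[of "\<lambda>x. x \<in> connected_component_set ?W v" v] that
    by (simp add: connected_component_refl_eq)
  have "\<exists>c. polynomial_function c \<and> path_image c \<subseteq> ?W \<and> pathstart c = b v \<and> pathfinish c = v"
    if v: "v \<in> ?W" for v
  proof -
    have "open (connected_component_set ?W v)" "connected (connected_component_set ?W v)"
      using W by (simp_all add: open_connected_component)
    moreover have "v \<in> connected_component_set ?W v" using v by (simp add: connected_component_refl_eq)
    ultimately obtain c where c: "polynomial_function c" "path_image c \<subseteq> connected_component_set ?W v"
      "pathstart c = b v" "pathfinish c = v"
      using connected_open_polynomial_connected[of "connected_component_set ?W v" "b v" v] b[OF v] by blast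
    then show ?thesis using connected_component_subset[of ?W v] by blast
  qed
  then obtain c where c: "\<And>v. v \<in> ?W \<Longrightarrow> polynomial_function (c v)" "\<And>v. v \<in> ?W \<Longrightarrow> path_image (c v) \<subseteq> ?W"
    "\<And>v. v \<in> ?W \<Longrightarrow> pathstart (c v) = b v" "\<And>v. v \<in> ?W \<Longrightarrow> pathfinish (c v) = v"
    by metis
  have b_eq: "b p = b q" if "closed_segment p q \<subseteq> ?W" for p q
  proof -
    have "connected_component ?W p q"
      unfolding connected_component_def using that by (intro exI[of _ "closed_segment p q"]) auto
    then show ?thesis by (simp add: b_def connected_component_eq)
  qed
  define loop where "loop \<gamma> = c (pathstart \<gamma>) +++ (\<gamma> +++ reversepath (c (pathfinish \<gamma>)))" for \<gamma>
  have cyc: "cycle_in (map loop E) ?W"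
    unfolding cycle_in_def
  proof
    fix \<delta> assume "\<delta> \<in> set (map loop E)"
    then obtain \<gamma> where \<gamma>: "\<gamma> \<in> set E" "\<delta> = loop \<gamma>" by auto
    then obtain p q where pq: "\<gamma> = linepath p q" "closed_segment p q \<subseteq> ?W"
      using Cauchy_chain_linepath[OF E] by metis
    then have "p \<in> ?W" "q \<in> ?W" by auto
    note c' = this[THEN c(1)] this[THEN c(2)] this[THEN c(3)] this[THEN c(4)] b_eq[OF pq(2)]
    show "valid_path \<delta> \<and> pathfinish \<delta> = pathstart \<delta> \<and> path_image \<delta> \<subseteq> ?W"
      using c' pq(2) unfolding \<gamma>(2) loop_def pq(1)
      by (auto intro!: valid_path_join simp: valid_path_polynomial_function path_image_join)
  qed
  have int: "cycle_integral (map loop E) g = cycle_integral E g" if g: "g holomorphic_on ?W" for g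
  proof -
    have "contour_integral (loop \<gamma>) g
        = contour_integral \<gamma> g - (contour_integral (c (pathfinish \<gamma>)) g - contour_integral (c (pathstart \<gamma>)) g)"
      if \<gamma>: "\<gamma> \<in> set E" for \<gamma>
    proof -
      obtain p q where pq: "\<gamma> = linepath p q" "closed_segment p q \<subseteq> ?W"
        using Cauchy_chain_linepath[OF E \<gamma>] by metis
      then have "p \<in> ?W" "q \<in> ?W" by auto
      note c' = this[THEN c(1), THEN valid_path_polynomial_function] this[THEN c(2)] this[THEN c(3)] this[THEN c(4)]
      have "g contour_integrable_on c p" "g contour_integrable_on c q" "g contour_integrable_on linepath p q"
        using contour_integrable_holomorphic_simple[OF g W] c' pq by auto
      then show ?thesis
        using c' unfolding loop_def pq(1)
        by (simp add: contour_integrable_reversepath contour_integral_reversepath)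
    qed
    then have "cycle_integral (map loop E) g
        = (\<Sum>\<gamma>\<leftarrow>E. contour_integral \<gamma> g - (contour_integral (c (pathfinish \<gamma>)) g - contour_integral (c (pathstart \<gamma>)) g))"
      unfolding cycle_integral_complex by (auto simp: comp_def intro!: arg_cong[of _ _ sum_list] map_cong)
    also have "\<dots> = cycle_integral E g
        - (\<Sum>\<gamma>\<leftarrow>E. contour_integral (c (pathfinish \<gamma>)) g - contour_integral (c (pathstart \<gamma>)) g)"
      by (simp only: sum_list_subtractf cycle_integral_complex)
    \<comment> \<open>The balance condition for the vertex function \<open>v \<mapsto> \<integral> g\<close> along
      \<open>c v\<close>.\<close>
    also have "(\<Sum>\<gamma>\<leftarrow>E. contour_integral (c (pathfinish \<gamma>)) g - contour_integral (c (pathstart \<gamma>)) g) = 0"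
      using E[unfolded Cauchy_chain_def, THEN conjunct2, THEN conjunct1,
          THEN spec[where x = "\<lambda>v. contour_integral (c v) g"]] .
    finally show ?thesis by simp
  qed
  show ?thesis using that[OF cyc int] by blast
qed

lemma cycle_winding_integral:
  assumes "cycle_in \<Gamma> W" "z \<notin> W"
  shows "cycle_winding \<Gamma> z = cycle_integral \<Gamma> (\<lambda>w. 1 / (w - z)) / (2 * pi * \<i>)"
  using assms
proof (induction \<Gamma>)
  case (Cons \<gamma> \<Gamma>)
  then have "valid_path \<gamma>" "z \<notin> path_image \<gamma>" by (auto simp: cycle_in_def)
  moreover have "cycle_in \<Gamma> W" using Cons.prems by (simp add: cycle_in_def)
  ultimately show ?case
    using Cons by (simp add: cycle_winding_def cycle_integral_complex winding_number_valid_path add_divide_distrib)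
qed (simp add: cycle_winding_def cycle_integral_def)

lemma surrounds_of_Cauchy_chain:
  assumes E: "Cauchy_chain E L U" and "open U" "compact L"
  obtains \<Gamma> where "surrounds \<Gamma> L U"
    "\<And>g :: complex \<Rightarrow> complex. g holomorphic_on (U - L) \<Longrightarrow> cycle_integral \<Gamma> g = cycle_integral E g"
proof -
  obtain \<Gamma> where cyc: "cycle_in \<Gamma> (U - L)"
    and int: "\<And>g. g holomorphic_on (U - L) \<Longrightarrow> cycle_integral \<Gamma> g = (cycle_integral E g :: complex)"
    using cycle_of_Cauchy_chain[OF assms] by blast
  have hol: "(\<lambda>w. 1 / (w - z)) holomorphic_on V" if "z \<notin> V" for z V
    using that by (auto intro!: holomorphic_intros)
  have w: "cycle_winding \<Gamma> z = cycle_integral E (\<lambda>w. 1 / (w - z)) / (2 * pi * \<i>)" if "z \<notin> U - L" for z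
    using cycle_winding_integral[OF cyc that] int[OF hol[OF that]] by simp
  have "cycle_integral E (\<lambda>w. 1 / (w - z)) = 0" if "z \<notin> U" for z
    using E hol[OF that] unfolding Cauchy_chain_def by blast
  then have "surrounds \<Gamma> L U"
    using cyc w E unfolding surrounds_def by (auto simp: Cauchy_chain_def)
  then show ?thesis using that int by blast
qed

text \<open>Continuously differentiable paths: along them every continuous function is integrable and
  integrals may be interchanged.\<close>

definition C1_path :: "(real \<Rightarrow> complex) \<Rightarrow> bool" where
  "C1_path \<gamma> \<longleftrightarrow> valid_path \<gamma> \<and> continuous_on {0..1} (\<lambda>t. vector_derivative \<gamma> (at t))"

lemma C1_path_linepath: "C1_path (linepath p q)"
  by (simp add: C1_path_def)

lemma C1_path_polynomial:
  fixes p :: "real \<Rightarrow> complex"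
  assumes "polynomial_function p" shows "C1_path p"
proof -
  obtain p' where "polynomial_function p'" "\<And>x. (p has_vector_derivative (p' x)) (at x)"
    using has_vector_derivative_polynomial_function[OF assms] by blast
  moreover from this have "(\<lambda>t. vector_derivative p (at t)) = p'"
    by (intro ext vector_derivative_at)
  ultimately show ?thesis
    using assms by (simp add: C1_path_def valid_path_polynomial_function continuous_on_polymonial_function)
qed

lemma C1_path_integrable:
  assumes "C1_path \<gamma>" "continuous_on (path_image \<gamma>) g"
  shows "g contour_integrable_on \<gamma>"
  unfolding contour_integrable_on
proof (rule integrable_continuous_real)
  have "continuous_on {0..1} \<gamma>"
    using assms valid_path_imp_path by (auto simp: C1_path_def path_def)
  then have "continuous_on {0..1} (\<lambda>t. g (\<gamma> t))"
    using continuous_on_compose2[OF assms(2), of "{0..1}" \<gamma>] by (simp add: path_image_def)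
  then show "continuous_on {0..1} (\<lambda>t. g (\<gamma> t) * vector_derivative \<gamma> (at t))"
    using assms by (intro continuous_intros) (auto simp: C1_path_def)
qed

lemma C1_path_continuous_param:
  assumes \<gamma>: "C1_path \<gamma>" and F: "continuous_on (A \<times> path_image \<gamma>) (\<lambda>(w, z). F w z)"
  shows "continuous_on A (\<lambda>w. contour_integral \<gamma> (F w))"
proof -
  have \<gamma>c: "continuous_on {0..1} \<gamma>" "continuous_on {0..1} (\<lambda>t. vector_derivative \<gamma> (at t))"
    using assms valid_path_imp_path by (auto simp: C1_path_def path_def)
  have 1: "continuous_on (A \<times> {0..1}) (\<lambda>x. \<gamma> (snd x))"
    "continuous_on (A \<times> {0..1}) (\<lambda>x. vector_derivative \<gamma> (at (snd x)))"
    by (rule continuous_on_compose2[OF \<gamma>c(1)], auto intro!: continuous_intros)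
       (rule continuous_on_compose2[OF \<gamma>c(2)], auto intro!: continuous_intros)
  have "continuous_on (A \<times> {0..1}) (\<lambda>x. (\<lambda>(w, z). F w z) (fst x, \<gamma> (snd x)))"
    by (rule continuous_on_compose2[OF F]) (auto intro!: continuous_intros 1 simp: path_image_def)
  then have "continuous_on (A \<times> {0..1}) (\<lambda>x. F (fst x) (\<gamma> (snd x)) * vector_derivative \<gamma> (at (snd x)))"
    by (intro continuous_intros 1) simp
  then have "continuous_on (A \<times> cbox 0 1) (\<lambda>(w, t). F w (\<gamma> t) * vector_derivative \<gamma> (at t))"
    by (simp add: case_prod_unfold)
  from integral_continuous_on_param[OF this] show ?thesis
    by (simp add: contour_integral_integral)
qed

lemma contour_integral_sum_list:
  assumes "\<And>e. e \<in> set E \<Longrightarrow> h e contour_integrable_on \<gamma>"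
  shows "(\<lambda>w. \<Sum>e\<leftarrow>E. h e w) contour_integrable_on \<gamma> \<and>
    contour_integral \<gamma> (\<lambda>w. \<Sum>e\<leftarrow>E. h e w) = (\<Sum>e\<leftarrow>E. contour_integral \<gamma> (h e))"
  using assms
proof (induction E)
  case Nil
  then show ?case
    using has_contour_integral_0 by (auto simp: contour_integrable_on_def)
next
  case (Cons e E)
  then show ?case
    using contour_integrable_add[of "h e" \<gamma> "\<lambda>w. \<Sum>e\<leftarrow>E. h e w"] by (simp add: contour_integral_add)
qed

text \<open>Fubini's theorem for the two cycles.\<close>

lemma cycle_integral_swap:
  fixes F :: "complex \<Rightarrow> complex \<Rightarrow> complex"
  assumes \<Gamma>: "\<And>\<gamma>. \<gamma> \<in> set \<Gamma> \<Longrightarrow> C1_path \<gamma> \<and> path_image \<gamma> \<subseteq> A"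
    and E: "\<And>\<gamma>. \<gamma> \<in> set E \<Longrightarrow> C1_path \<gamma> \<and> path_image \<gamma> \<subseteq> B"
    and F: "continuous_on (A \<times> B) (\<lambda>(w, z). F w z)"
  shows "cycle_integral \<Gamma> (\<lambda>w. cycle_integral E (F w)) = cycle_integral E (\<lambda>z. cycle_integral \<Gamma> (\<lambda>w. F w z))"
proof -
  have F': "continuous_on (B \<times> A) (\<lambda>(z, w). F w z)"
    using continuous_on_compose2[OF F, of "B \<times> A" "\<lambda>x. (snd x, fst x)"]
    by (force simp: case_prod_unfold intro!: continuous_intros)
  have "cycle_integral \<Gamma> (\<lambda>w. cycle_integral E (F w)) = (\<Sum>\<gamma>\<leftarrow>\<Gamma>. \<Sum>e\<leftarrow>E. contour_integral \<gamma> (\<lambda>w. contour_integral e (F w)))"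
    unfolding cycle_integral_complex
  proof (intro arg_cong[of _ _ sum_list] map_cong refl conjunct2[OF contour_integral_sum_list])
    fix \<gamma> e assume "\<gamma> \<in> set \<Gamma>" "e \<in> set E"
    then show "(\<lambda>w. contour_integral e (F w)) contour_integrable_on \<gamma>"
      using \<Gamma> E
      by (intro C1_path_integrable C1_path_continuous_param continuous_on_subset[OF F]) auto
  qed
  also have "\<dots> = (\<Sum>\<gamma>\<leftarrow>\<Gamma>. \<Sum>e\<leftarrow>E. contour_integral e (\<lambda>z. contour_integral \<gamma> (\<lambda>w. F w z)))"
  proof (intro arg_cong[of _ _ sum_list] map_cong refl)
    fix \<gamma> e assume "\<gamma> \<in> set \<Gamma>" "e \<in> set E"
    then show "contour_integral \<gamma> (\<lambda>w. contour_integral e (F w)) = contour_integral e (\<lambda>z. contour_integral \<gamma> (\<lambda>w. F w z))"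
      using \<Gamma> E by (intro contour_integral_swap continuous_on_subset[OF F]) (auto simp: C1_path_def)
  qed
  also have "\<dots> = (\<Sum>e\<leftarrow>E. \<Sum>\<gamma>\<leftarrow>\<Gamma>. contour_integral e (\<lambda>z. contour_integral \<gamma> (\<lambda>w. F w z)))"
    by (induction \<Gamma>) (auto simp: sum_list_addf)
  also have "\<dots> = cycle_integral E (\<lambda>z. cycle_integral \<Gamma> (\<lambda>w. F w z))"
    unfolding cycle_integral_complex
  proof (intro arg_cong[of _ _ sum_list] map_cong refl conjunct2[OF contour_integral_sum_list, symmetric])
    fix \<gamma> e assume "\<gamma> \<in> set \<Gamma>" "e \<in> set E"
    then show "(\<lambda>z. contour_integral \<gamma> (\<lambda>w. F w z)) contour_integrable_on e"
      using \<Gamma> E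
      by (intro C1_path_integrable C1_path_continuous_param continuous_on_subset[OF F']) auto
  qed
  finally show ?thesis .
qed

text \<open>Let \<open>L\<close> consist of the cycle and of the points around which it winds.  Then \<open>L\<close> is compact and
  contained in \<open>W\<close>, and on \<open>L\<close> the function \<open>g\<close> is given by Cauchy's integral over a chain \<open>E\<close> in \<open>W - L\<close>.
  Integrate this over the cycle and interchange the integrals: the inner integral is then a winding
  number around a point of \<open>E\<close>, which is 0 by the choice of \<open>L\<close>.\<close>

lemma Cauchy_theorem_C1_cycle:
  assumes W: "open W" and g: "g holomorphic_on W" and \<Gamma>: "cycle_in \<Gamma> W"
    and C1: "\<And>\<gamma>. \<gamma> \<in> set \<Gamma> \<Longrightarrow> C1_path \<gamma>" and wind: "\<And>z. z \<notin> W \<Longrightarrow> cycle_winding \<Gamma> z = 0"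
  shows "cycle_integral \<Gamma> g = 0"
proof -
  define A where "A = (\<Union>\<gamma>\<in>set \<Gamma>. path_image \<gamma>)"
  define L where "L = - {z. z \<notin> A \<and> cycle_winding \<Gamma> z = 0}"
  have path: "path \<gamma>" "pathfinish \<gamma> = pathstart \<gamma>" "path_image \<gamma> \<subseteq> W" if "\<gamma> \<in> set \<Gamma>" for \<gamma>
    using \<Gamma> that valid_path_imp_path by (auto simp: cycle_in_def)
  have LW: "L \<subseteq> W" using wind path(3) by (auto simp: L_def A_def dest!: subsetD)
  have "open {z. z \<notin> A \<and> cycle_winding \<Gamma> z = 0}"
  proof (subst open_subopen, intro ballI)
    fix z assume "z \<in> {z. z \<notin> A \<and> cycle_winding \<Gamma> z = 0}"
    then have z: "z \<notin> A" "cycle_winding \<Gamma> z = 0" by auto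
    let ?T = "\<Inter>\<gamma>\<in>set \<Gamma>. {x. x \<notin> path_image \<gamma> \<and> winding_number \<gamma> x = winding_number \<gamma> z}"
    have "open ?T" using path by (intro open_INT ballI open_winding_number_levelsets) auto
    moreover have "z \<in> ?T" using z by (auto simp: A_def)
    moreover have "x \<in> {z. z \<notin> A \<and> cycle_winding \<Gamma> z = 0}" if x: "x \<in> ?T" for x
    proof -
      have "cycle_winding \<Gamma> x = cycle_winding \<Gamma> z"
        unfolding cycle_winding_def using x by (intro arg_cong[of _ _ sum_list] map_cong) auto
      then show ?thesis using z x by (auto simp: A_def)
    qed
    ultimately show "\<exists>T. open T \<and> z \<in> T \<and> T \<subseteq> {z. z \<notin> A \<and> cycle_winding \<Gamma> z = 0}" by blast
  qed
  then have "closed L" by (simp add: L_def closed_def)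
  moreover have "bounded L"
  proof -
    have "\<exists>B. \<forall>\<gamma>\<in>set \<Gamma>. \<forall>z. B \<le> cmod z \<longrightarrow> z \<notin> path_image \<gamma> \<and> winding_number \<gamma> z = 0"
    proof -
      have "\<exists>B. \<forall>z. B \<le> cmod z \<longrightarrow> z \<notin> path_image \<gamma> \<and> winding_number \<gamma> z = 0" if \<gamma>: "\<gamma> \<in> set \<Gamma>" for \<gamma>
      proof -
        obtain B where B: "\<And>z. B \<le> cmod z \<Longrightarrow> winding_number \<gamma> z = 0"
          using winding_number_zero_at_infinity path[OF \<gamma>] by blast
        obtain C where C: "\<And>z. z \<in> path_image \<gamma> \<Longrightarrow> cmod z \<le> C"
          using bounded_path_image[OF path(1)[OF \<gamma>]] by (auto simp: bounded_iff)
        have "z \<notin> path_image \<gamma> \<and> winding_number \<gamma> z = 0" if "max B (C + 1) \<le> cmod z" for z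
          using B[of z] C[of z] that by auto
        then show ?thesis by blast
      qed
      then obtain B where B: "\<And>\<gamma> z. \<gamma> \<in> set \<Gamma> \<Longrightarrow> B \<gamma> \<le> cmod z \<Longrightarrow> z \<notin> path_image \<gamma> \<and> winding_number \<gamma> z = 0"
        by metis
      have "B \<gamma> \<le> Max (insert 0 (B ` set \<Gamma>))" if "\<gamma> \<in> set \<Gamma>" for \<gamma> using that by simp
      then show ?thesis using B order_trans by meson
    qed
    then obtain B where B: "\<And>\<gamma> z. \<gamma> \<in> set \<Gamma> \<Longrightarrow> B \<le> cmod z \<Longrightarrow> z \<notin> path_image \<gamma> \<and> winding_number \<gamma> z = 0"
      by metis
    have "cmod z \<le> B" if z: "z \<in> L" for z
    proof (rule ccontr)
      assume "\<not> cmod z \<le> B"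
      then have "z \<notin> path_image \<gamma> \<and> winding_number \<gamma> z = 0" if "\<gamma> \<in> set \<Gamma>" for \<gamma> using B that by simp
      then have "z \<notin> A" "cycle_winding \<Gamma> z = 0"
        by (auto simp: A_def cycle_winding_def intro!: sum_list_0 cong: map_cong)
      then show False using z by (simp add: L_def)
    qed
    then show ?thesis by (auto simp: bounded_iff)
  qed
  ultimately have L: "compact L" by (simp add: compact_eq_bounded_closed)
  obtain E where E: "Cauchy_chain E L W" using Cauchy_chain_exists[OF L W LW] by blast
  have AL: "A \<subseteq> L" by (auto simp: L_def)
  have E1: "C1_path \<gamma> \<and> path_image \<gamma> \<subseteq> W - L" if \<gamma>: "\<gamma> \<in> set E" for \<gamma>
    using Cauchy_chain_linepath[OF E \<gamma>] by (metis C1_path_linepath path_image_linepath)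
  let ?F = "\<lambda>w z. g z / (z - w)"
  have cont: "continuous_on (A \<times> (W - L)) (\<lambda>(w, z). ?F w z)"
  proof -
    have "continuous_on (A \<times> (W - L)) (\<lambda>x. g (snd x))"
      by (rule continuous_on_compose2[OF holomorphic_on_imp_continuous_on[OF g]]) (auto intro!: continuous_intros)
    then show ?thesis unfolding case_prod_unfold
      by (intro continuous_intros) (use AL in auto)
  qed
  have sw: "cycle_integral \<Gamma> (\<lambda>w. cycle_integral E (?F w)) = cycle_integral E (\<lambda>z. cycle_integral \<Gamma> (\<lambda>w. ?F w z))"
    by (rule cycle_integral_swap[OF _ _ cont]) (use C1 E1 in \<open>auto simp: A_def\<close>)
  have "cycle_integral \<Gamma> (\<lambda>w. cycle_integral E (?F w)) = cycle_integral \<Gamma> (\<lambda>w. 2 * pi * \<i> * g w)"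
    unfolding cycle_integral_complex[of \<Gamma>]
    by (intro arg_cong[of _ _ sum_list] map_cong refl contour_integral_eq Cauchy_chain_formula[OF E W g])
       (use AL in \<open>unfold A_def, blast\<close>)
  also have "\<dots> = 2 * pi * \<i> * cycle_integral \<Gamma> g"
    unfolding cycle_integral_complex sum_list_const_mult[symmetric]
    by (intro arg_cong[of _ _ sum_list] map_cong refl contour_integral_lmul C1_path_integrable C1
        continuous_on_subset[OF holomorphic_on_imp_continuous_on[OF g]] path)
  finally have eq: "2 * pi * \<i> * cycle_integral \<Gamma> g = cycle_integral E (\<lambda>z. cycle_integral \<Gamma> (\<lambda>w. ?F w z))"
    using sw by simp
  have "cycle_integral \<Gamma> (\<lambda>w. ?F w z) = 0" if z: "z \<in> W - L" for z
  proof -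
    have zA: "z \<notin> A" "cycle_winding \<Gamma> z = 0" using z by (auto simp: L_def)
    have "cycle_in \<Gamma> A" using \<Gamma> by (auto simp: cycle_in_def A_def)
    then have 0: "cycle_integral \<Gamma> (\<lambda>w. 1 / (w - z)) = 0"
      using cycle_winding_integral[of \<Gamma> A z] zA by simp
    have "contour_integral \<gamma> (\<lambda>w. ?F w z) = - g z * contour_integral \<gamma> (\<lambda>w. 1 / (w - z))" if "\<gamma> \<in> set \<Gamma>" for \<gamma>
    proof -
      have zi: "z \<notin> path_image \<gamma>" using zA that by (auto simp: A_def)
      have "contour_integral \<gamma> (\<lambda>w. ?F w z) = contour_integral \<gamma> (\<lambda>w. - g z * (1 / (w - z)))"
        by (simp add: minus_divide_right)
      also have "\<dots> = - g z * contour_integral \<gamma> (\<lambda>w. 1 / (w - z))"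
        by (intro contour_integral_lmul C1_path_integrable C1 that continuous_intros) (use zi in auto)
      finally show ?thesis .
    qed
    then have "cycle_integral \<Gamma> (\<lambda>w. ?F w z) = (\<Sum>\<gamma>\<leftarrow>\<Gamma>. - g z * contour_integral \<gamma> (\<lambda>w. 1 / (w - z)))"
      unfolding cycle_integral_complex by (intro arg_cong[of _ _ sum_list] map_cong) auto
    also have "\<dots> = - g z * cycle_integral \<Gamma> (\<lambda>w. 1 / (w - z))"
      by (simp only: cycle_integral_complex sum_list_const_mult)
    finally show ?thesis using 0 by simp
  qed
  then have "cycle_integral E (\<lambda>z. cycle_integral \<Gamma> (\<lambda>w. ?F w z)) = (\<Sum>\<gamma>\<leftarrow>E. 0)"
    unfolding cycle_integral_complex[of E]
    using E1 by (intro arg_cong[of _ _ sum_list] map_cong refl contour_integral_eq_0) blast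
  with eq show ?thesis by simp
qed

text \<open>A valid path has the same integrals as a nearby polynomial path, which is continuously
  differentiable.\<close>

lemma Cauchy_theorem_cycle:
  assumes W: "open W" and g: "g holomorphic_on W" and \<Gamma>: "cycle_in \<Gamma> W"
    and wind: "\<And>z. z \<notin> W \<Longrightarrow> cycle_winding \<Gamma> z = 0"
  shows "cycle_integral \<Gamma> g = (0 :: complex)"
proof -
  have "\<exists>p. C1_path p \<and> pathfinish p = pathstart p \<and> path_image p \<subseteq> W \<and>
      (\<forall>f. f holomorphic_on W \<longrightarrow> contour_integral p f = contour_integral \<gamma> f)" if "\<gamma> \<in> set \<Gamma>" for \<gamma>
  proof -
    have \<gamma>: "valid_path \<gamma>" "path \<gamma>" "path_image \<gamma> \<subseteq> W" "pathfinish \<gamma> = pathstart \<gamma>"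
      using \<Gamma> that valid_path_imp_path by (auto simp: cycle_in_def)
    obtain d where d: "d > 0" "\<And>p. valid_path p \<Longrightarrow> (\<forall>t\<in>{0..1}. cmod (p t - \<gamma> t) < d) \<Longrightarrow>
        pathstart p = pathstart \<gamma> \<Longrightarrow> pathfinish p = pathfinish \<gamma> \<Longrightarrow>
        path_image p \<subseteq> W \<and> (\<forall>f. f holomorphic_on W \<longrightarrow> contour_integral p f = contour_integral \<gamma> f)"
      using contour_integral_nearby_ends[OF W \<gamma>(2,3)] \<gamma>(1)
      by (metis cancel_comm_monoid_add_class.diff_cancel norm_zero)
    obtain p where p: "polynomial_function p" "pathstart p = pathstart \<gamma>" "pathfinish p = pathfinish \<gamma>"
      "\<And>t. t \<in> {0..1} \<Longrightarrow> cmod (p t - \<gamma> t) < d"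
      using path_approx_polynomial_function[OF \<gamma>(2) d(1)] by metis
    then show ?thesis
      using d(2)[of p] \<gamma>(4) valid_path_polynomial_function[OF p(1)] C1_path_polynomial[OF p(1)] by auto
  qed
  then obtain P where P: "\<And>\<gamma>. \<gamma> \<in> set \<Gamma> \<Longrightarrow> C1_path (P \<gamma>) \<and> pathfinish (P \<gamma>) = pathstart (P \<gamma>) \<and>
      path_image (P \<gamma>) \<subseteq> W \<and> (\<forall>f. f holomorphic_on W \<longrightarrow> contour_integral (P \<gamma>) f = contour_integral \<gamma> f)"
    by metis
  have int: "cycle_integral (map P \<Gamma>) f = cycle_integral \<Gamma> f" if "f holomorphic_on W" for f
    unfolding cycle_integral_complex using P that
    by (auto simp: comp_def intro!: arg_cong[of _ _ sum_list] map_cong)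
  have cyc: "cycle_in (map P \<Gamma>) W" using P by (auto simp: cycle_in_def C1_path_def)
  have "cycle_integral (map P \<Gamma>) g = 0"
  proof (rule Cauchy_theorem_C1_cycle[OF W g cyc])
    fix z assume z: "z \<notin> W"
    then have "(\<lambda>w. 1 / (w - z)) holomorphic_on W" by (auto intro!: holomorphic_intros)
    from int[OF this] show "cycle_winding (map P \<Gamma>) z = 0"
      using wind[OF z] cycle_winding_integral[OF \<Gamma> z] cycle_winding_integral[OF cyc z] by simp
  qed (use P in auto)
  then show ?thesis using int[OF g] by simp
qed

text \<open>Cauchy's theorem for the difference of the two cycles, which winds around no point outside
  \<open>U - S\<close>.\<close>

lemma surrounds_unique_integral:
  assumes U: "open U" and S: "closed S" and g: "g holomorphic_on (U - S)"
    and \<Gamma>1: "surrounds \<Gamma>1 S U" and \<Gamma>2: "surrounds \<Gamma>2 S U"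
  shows "cycle_integral \<Gamma>1 g = (cycle_integral \<Gamma>2 g :: complex)"
proof -
  let ?\<Gamma> = "\<Gamma>1 @ map reversepath \<Gamma>2"
  have cyc: "cycle_in \<Gamma>1 (U - S)" "cycle_in \<Gamma>2 (U - S)" using assms by (auto simp: surrounds_def)
  have rev: "cycle_integral (map reversepath \<Gamma>2) h = - cycle_integral \<Gamma>2 h" for h :: "complex \<Rightarrow> complex"
  proof -
    have "cycle_integral (map reversepath \<Gamma>2) h = (\<Sum>\<gamma>\<leftarrow>\<Gamma>2. - contour_integral \<gamma> h)"
      unfolding cycle_integral_complex using cyc(2)
      by (auto simp: comp_def cycle_in_def contour_integral_reversepath intro!: arg_cong[of _ _ sum_list] map_cong)
    then show ?thesis by (simp add: cycle_integral_complex uminus_sum_list_map comp_def)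
  qed
  have cyc': "cycle_in ?\<Gamma> (U - S)" "cycle_in (map reversepath \<Gamma>2) (U - S)"
    using cyc by (simp_all add: cycle_in_def ball_Un)
  have "cycle_integral ?\<Gamma> g = 0"
  proof (rule Cauchy_theorem_cycle[OF _ g cyc'(1)])
    show "open (U - S)" using U S by blast
    fix z assume z: "z \<notin> U - S"
    have "cycle_winding ?\<Gamma> z = cycle_winding \<Gamma>1 z + cycle_winding (map reversepath \<Gamma>2) z"
      by (simp add: cycle_winding_def)
    also have "cycle_winding (map reversepath \<Gamma>2) z = - cycle_winding \<Gamma>2 z"
      using cycle_winding_integral[OF cyc'(2) z] cycle_winding_integral[OF cyc(2) z] by (simp add: rev)
    finally show "cycle_winding ?\<Gamma> z = 0"
      using z \<Gamma>1 \<Gamma>2 by (auto simp: surrounds_def)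
  qed
  then show ?thesis
    using rev[of g] by (simp add: cycle_integral_complex)
qed

lemma surrounds_antimono:
  assumes "surrounds \<Gamma> L U" "S \<subseteq> L"
  shows "surrounds \<Gamma> S U"
  using assms unfolding surrounds_def cycle_in_def by fastforce

lemma Cauchy_chain_integral_eq:
  fixes g :: "complex \<Rightarrow> complex"
  assumes U: "open U" and L: "compact L" and S: "closed S" "S \<subseteq> L" and E: "Cauchy_chain E L U"
    and \<Gamma>: "surrounds \<Gamma> S U" and g: "g holomorphic_on (U - S)"
  shows "cycle_integral \<Gamma> g = cycle_integral E g"
proof -
  obtain \<Delta> where "surrounds \<Delta> L U"
    and int: "\<And>g :: complex \<Rightarrow> complex. g holomorphic_on (U - L) \<Longrightarrow> cycle_integral \<Delta> g = cycle_integral E g"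
    using surrounds_of_Cauchy_chain[OF E U L] by metis
  then have \<Delta>: "surrounds \<Delta> S U" using S surrounds_antimono by blast
  have "U - L \<subseteq> U - S" using S by blast
  then show ?thesis
    using surrounds_unique_integral[OF U S(1) g \<Gamma> \<Delta>] int holomorphic_on_subset[OF g] by metis
qed


section \<open>Complex linear functionals\<close>

lemma bounded_bilinear_scaleC:
  "bounded_bilinear (scaleC :: complex \<Rightarrow> 'a::complex_banach_algebra_1 \<Rightarrow> 'a)"
proof
  fix c d :: complex and x y :: 'a and r :: real
  show "(c + d) *\<^sub>C x = c *\<^sub>C x + d *\<^sub>C x" "c *\<^sub>C (x + y) = c *\<^sub>C x + c *\<^sub>C y"
    by (rule scaleC_add_left scaleC_add_right)+
  show "(r *\<^sub>R c) *\<^sub>C x = r *\<^sub>R (c *\<^sub>C x)" "c *\<^sub>C (r *\<^sub>R x) = r *\<^sub>R (c *\<^sub>C x)"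
    by (simp_all only: scaleC_of_real[symmetric] scaleC_scaleC scaleC_complex_def mult.commute)
  show "\<exists>K. \<forall>a (b :: 'a). norm (a *\<^sub>C b) \<le> norm a * norm b * K"
    by (intro exI[of _ 1]) (simp add: norm_scaleC)
qed

lemmas continuous_on_scaleC [continuous_intros] =
  bounded_bilinear.continuous_on[OF bounded_bilinear_scaleC]
lemmas tendsto_scaleC [tendsto_intros] = bounded_bilinear.tendsto[OF bounded_bilinear_scaleC]
lemmas scaleC_sum_left = bounded_bilinear.sum_left[OF bounded_bilinear_scaleC]
lemmas scaleC_diff_left = bounded_bilinear.diff_left[OF bounded_bilinear_scaleC]

definition bounded_clinear ::
  "('a::complex_banach_algebra_1 \<Rightarrow> 'c::complex_banach_algebra_1) \<Rightarrow> bool" where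
  "bounded_clinear L \<longleftrightarrow> bounded_linear L \<and> (\<forall>c x. L (c *\<^sub>C x) = c *\<^sub>C L x)"

lemma bounded_clinear_mult:
  "bounded_clinear (\<lambda>x. x * (a :: 'a::complex_banach_algebra_1))" "bounded_clinear (\<lambda>x. a * x)"
  by (simp_all add: bounded_clinear_def bounded_linear_mult_left bounded_linear_mult_right
      mult_scaleC_left mult_scaleC_right)

lemma bounded_clinear_scaleC: "bounded_clinear (\<lambda>x. c *\<^sub>C (x :: 'a::complex_banach_algebra_1))"
  by (simp add: bounded_clinear_def bounded_bilinear.bounded_linear_right[OF bounded_bilinear_scaleC]
      scaleC_scaleC mult.commute)

text \<open>The inequality for positive factors already implies equality.\<close>

definition sublinear :: "('a::real_normed_vector \<Rightarrow> real) \<Rightarrow> bool" where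
  "sublinear p \<longleftrightarrow> (\<forall>x y. p (x + y) \<le> p x + p y) \<and> (\<forall>r>0. \<forall>x. p (r *\<^sub>R x) \<le> r * p x)"

lemma sublinear_zero:
  assumes "sublinear p" shows "p 0 = 0"
proof -
  have r: "p 0 \<le> r * p 0" if "r > 0" for r
    using assms that unfolding sublinear_def by (metis scaleR_zero_right)
  show ?thesis using r[of 2] r[of "1/2"] by simp
qed

lemma sublinear_ge:
  assumes "sublinear p" shows "- p (- x) \<le> p x"
proof -
  have "p (x + - x) \<le> p x + p (- x)" using assms unfolding sublinear_def by blast
  then show ?thesis using sublinear_zero[OF assms] by simp
qed

text \<open>The step of the proof of the Hahn-Banach theorem by minimal sublinear functionals: \<open>q\<close> is the infimum
  over \<open>t \<ge> 0\<close> of \<open>p (x + t y) - t p y\<close>.  If \<open>p\<close> is minimal, then \<open>q = p\<close>, and the last inequality makes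
  \<open>p\<close> additive.\<close>

lemma sublinear_improve:
  fixes p :: "'a::real_normed_vector \<Rightarrow> real"
  assumes p: "sublinear p"
  obtains q where "sublinear q" "\<And>x. q x \<le> p x" "\<And>x. q x \<le> p (x + y) - p y"
proof -
  have add: "p (x + z) \<le> p x + p z" for x z using p by (simp add: sublinear_def)
  have scale: "p (r *\<^sub>R x) \<le> r * p x" if "r > 0" for r x using p that by (simp add: sublinear_def)
  have scale_ge: "r * p x \<le> p (r *\<^sub>R x)" if "r \<ge> 0" for r x
  proof (cases "r = 0")
    case False
    then have "p x \<le> (1 / r) * p (r *\<^sub>R x)" using scale[of "1 / r" "r *\<^sub>R x"] that by simp
    then show ?thesis using that False by (simp add: field_simps)
  qed (use sublinear_zero[OF p] in simp)
  define h where "h x t = p (x + t *\<^sub>R y) - t * p y" for x t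
  define q where "q x = Inf (h x ` {0..})" for x
  have low: "- p (- x) \<le> h x t" if "t \<ge> 0" for x t
    using add[of "x + t *\<^sub>R y" "- x"] scale_ge[OF that, of y] by (simp add: h_def)
  then have bdd: "bdd_below (h x ` {0..})" for x by (auto intro!: bdd_belowI)
  have q_le: "q x \<le> h x t" if "t \<ge> 0" for x t
    unfolding q_def using that by (intro cInf_lower bdd) auto
  have le_q: "c \<le> q x" if "\<And>t. t \<ge> 0 \<Longrightarrow> c \<le> h x t" for c x
    unfolding q_def using that by (intro cInf_greatest) auto
  have "sublinear q"
    unfolding sublinear_def
  proof (intro conjI allI impI)
    fix x z
    have "q (x + z) - h z s \<le> h x t" if "t \<ge> 0" "s \<ge> 0" for t s
    proof -
      have "h (x + z) (t + s) \<le> h x t + h z s"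
        using add[of "x + t *\<^sub>R y" "z + s *\<^sub>R y"] by (simp add: h_def algebra_simps)
      then show ?thesis using q_le[of "t + s" "x + z"] that by simp
    qed
    then have "q (x + z) - h z s \<le> q x" if "s \<ge> 0" for s using that by (intro le_q) auto
    then have "q (x + z) - q x \<le> h z s" if "s \<ge> 0" for s using that by (simp add: algebra_simps)
    then show "q (x + z) \<le> q x + q z" using le_q[of "q (x + z) - q x" z] by simp
  next
    fix r :: real and x assume r: "r > 0"
    have "q (r *\<^sub>R x) / r \<le> h x t" if t: "t \<ge> 0" for t
    proof -
      have "q (r *\<^sub>R x) \<le> h (r *\<^sub>R x) (r * t)" using r t by (intro q_le) simp
      also have "\<dots> \<le> r * h x t"
        using scale[OF r, of "x + t *\<^sub>R y"] by (simp add: h_def algebra_simps)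
      finally show ?thesis using r by (simp add: field_simps)
    qed
    then have "q (r *\<^sub>R x) / r \<le> q x" by (rule le_q)
    then show "q (r *\<^sub>R x) \<le> r * q x" using r by (simp add: field_simps)
  qed
  moreover have "q x \<le> p x" "q x \<le> p (x + y) - p y" for x
    using q_le[of 0 x] q_le[of 1 x] by (simp_all add: h_def)
  ultimately show ?thesis using that by blast
qed

text \<open>By Zorn's lemma there is a minimal sublinear functional below any given one, and minimal ones are
  linear.  Starting below the norm from one that is at most \<open>- norm x0\<close> at \<open>- x0\<close> gives a functional that
  does not vanish at \<open>x0\<close>.\<close>

lemma real_functional_exists:
  fixes x0 :: "'a::real_normed_vector"
  assumes "x0 \<noteq> 0"
  obtains \<phi> :: "'a \<Rightarrow> real" where "bounded_linear \<phi>" "\<phi> x0 \<noteq> 0"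
proof -
  have "sublinear (norm :: 'a \<Rightarrow> real)" by (simp add: sublinear_def norm_triangle_ineq)
  from sublinear_improve[OF this, of x0]
  obtain p0 where p0: "sublinear p0" "\<And>x. p0 x \<le> norm x" "\<And>x. p0 x \<le> norm (x + x0) - norm x0"
    by blast
  define A where "A = {p. sublinear p \<and> (\<forall>x. p x \<le> p0 x)}"
  have "\<exists>m\<in>A. \<forall>a\<in>A. (\<forall>x. a x \<le> m x) \<longrightarrow> a = m"
  proof (rule predicate_Zorn[where P = "\<lambda>p q. \<forall>x. q x \<le> p x"])
    show "partial_order_on A (relation_of (\<lambda>p q. \<forall>x. q x \<le> p x) A)"
    proof (rule partial_order_on_relation_ofI)
      show "a = b" if "\<forall>x. b x \<le> a x" "\<forall>x. a x \<le> b x" for a b :: "'a \<Rightarrow> real"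
        using that by (intro ext antisym) auto
    qed (auto intro: order_trans)
    fix C assume "C \<in> Chains (relation_of (\<lambda>p q. \<forall>x. q x \<le> p x) A)"
    then have CA: "C \<subseteq> A" and chain: "\<And>p q. p \<in> C \<Longrightarrow> q \<in> C \<Longrightarrow> (\<forall>x. q x \<le> p x) \<or> (\<forall>x. p x \<le> q x)"
      by (auto simp: Chains_def relation_of_def)
    show "\<exists>u\<in>A. \<forall>a\<in>C. \<forall>x. u x \<le> a x"
    \<comment> \<open>The pointwise infimum of a chain is sublinear and bounded below by \<open>- norm\<close>.\<close>
    proof (cases "C = {}")
      case True
      then show ?thesis using p0 by (auto simp: A_def)
    next
      case False
      define u where "u x = Inf ((\<lambda>p. p x) ` C)" for x
      have "- norm x \<le> p x" if "p \<in> C" for p x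
      proof -
        have "sublinear p" "p (- x) \<le> p0 (- x)" using that CA by (auto simp: A_def)
        then show ?thesis using sublinear_ge[of p x] p0(2)[of "- x"] by simp
      qed
      then have bdd: "bdd_below ((\<lambda>p. p x) ` C)" for x by (auto intro!: bdd_belowI)
      have u_le: "u x \<le> p x" if "p \<in> C" for p x
        unfolding u_def using that by (intro cInf_lower bdd) auto
      have le_u: "c \<le> u x" if "\<And>p. p \<in> C \<Longrightarrow> c \<le> p x" for c x
        unfolding u_def using that False by (intro cInf_greatest) auto
      have "sublinear u"
        unfolding sublinear_def
      proof (intro conjI allI impI)
        fix x y
        have "u (x + y) - q y \<le> p x" if "p \<in> C" "q \<in> C" for p q
        proof -
          have "\<exists>r\<in>C. (\<forall>x. r x \<le> p x) \<and> (\<forall>x. r x \<le> q x)" using chain[OF that] that by blast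
          then obtain r where r: "r \<in> C" "r x \<le> p x" "r y \<le> q y" by blast
          have "r (x + y) \<le> r x + r y" using r CA by (auto simp: A_def sublinear_def)
          then show ?thesis using u_le[OF r(1), of "x + y"] r by simp
        qed
        then have "u (x + y) - q y \<le> u x" if "q \<in> C" for q using that by (intro le_u) auto
        then have "u (x + y) - u x \<le> q y" if "q \<in> C" for q using that by (simp add: algebra_simps)
        then show "u (x + y) \<le> u x + u y" using le_u[of "u (x + y) - u x" y] by simp
      next
        fix r :: real and x assume r: "r > 0"
        have "u (r *\<^sub>R x) / r \<le> p x" if p: "p \<in> C" for p
        proof -
          have "u (r *\<^sub>R x) \<le> p (r *\<^sub>R x)" using u_le[OF p] .
          also have "\<dots> \<le> r * p x" using p CA r by (auto simp: A_def sublinear_def)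
          finally show ?thesis using r by (simp add: field_simps)
        qed
        then have "u (r *\<^sub>R x) / r \<le> u x" by (rule le_u)
        then show "u (r *\<^sub>R x) \<le> r * u x" using r by (simp add: field_simps)
      qed
      moreover have "u x \<le> p0 x" for x
      proof -
        obtain q where "q \<in> C" using False by blast
        then have "u x \<le> q x" "q x \<le> p0 x" using u_le CA by (auto simp: A_def)
        then show ?thesis by simp
      qed
      ultimately have "u \<in> A" by (simp add: A_def)
      then show ?thesis using u_le by blast
    qed
  qed
  then obtain p where pA: "p \<in> A" and pm: "\<And>a. a \<in> A \<Longrightarrow> \<forall>x. a x \<le> p x \<Longrightarrow> a = p"
    by blast
  have p: "sublinear p" "\<And>x. p x \<le> p0 x" using pA by (auto simp: A_def)
  have min: "q = p" if "sublinear q" "\<And>x. q x \<le> p x" for q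
  proof (rule pm)
    show "q \<in> A" using that p(2) by (auto simp: A_def intro: order_trans)
  qed (use that in blast)
  have add: "p (x + y) = p x + p y" for x y
  proof -
    obtain q where q: "sublinear q" "\<And>x. q x \<le> p x" "\<And>x. q x \<le> p (x + y) - p y"
      using sublinear_improve[OF p(1), of y] by blast
    then have "p x \<le> p (x + y) - p y" using min[of q] by metis
    moreover have "p (x + y) \<le> p x + p y" using p(1) unfolding sublinear_def by blast
    ultimately show ?thesis by simp
  qed
  have minus: "p (- x) = - p x" for x
    using add[of x "- x"] sublinear_zero[OF p(1)] by simp
  have pos: "p (r *\<^sub>R x) = r * p x" if "r > 0" for r x
  proof -
    have "p (r *\<^sub>R x) \<le> r * p x" "p (r *\<^sub>R (- x)) \<le> r * p (- x)"
      using p(1) that unfolding sublinear_def by blast+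
    then show ?thesis by (simp add: minus)
  qed
  have scale: "p (r *\<^sub>R x) = r * p x" for r x
  proof -
    consider "r > 0" | "r = 0" | "r < 0" by linarith
    then show ?thesis
    proof cases
      case 3
      then show ?thesis using pos[of "- r" x] by (simp add: minus)
    qed (use pos sublinear_zero[OF p(1)] in auto)
  qed
  have "bounded_linear p"
  proof (rule bounded_linear_intro[where K = 1])
    show "norm (p x) \<le> norm x * 1" for x
      using p(2)[of x] p0(2)[of x] p(2)[of "- x"] p0(2)[of "- x"] minus[of x] by simp
  qed (use add scale in auto)
  moreover have "p x0 \<noteq> 0"
  proof -
    have "p (- x0) \<le> - norm x0" using p(2)[of "- x0"] p0(3)[of "- x0"] by simp
    then have "norm x0 \<le> p x0" using minus[of x0] by simp
    then show ?thesis using assms by (metis norm_le_zero_iff)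
  qed
  ultimately show ?thesis using that by blast
qed

text \<open>The usual complexification \<open>\<phi> x - \<i> \<phi> (\<i> x)\<close> of a real functional.\<close>

lemma complex_functional_exists:
  fixes x0 :: "'a::complex_banach_algebra_1"
  assumes "x0 \<noteq> 0"
  obtains l :: "'a \<Rightarrow> complex" where "bounded_clinear l" "l x0 \<noteq> 0"
proof -
  obtain \<phi> :: "'a \<Rightarrow> real" where \<phi>: "bounded_linear \<phi>" "\<phi> x0 \<noteq> 0"
    using real_functional_exists[OF assms] .
  interpret bounded_linear \<phi> by fact
  define l where "l x = complex_of_real (\<phi> x) - \<i> * complex_of_real (\<phi> (\<i> *\<^sub>C x))" for x
  have i: "bounded_linear (\<lambda>x :: 'a. \<i> *\<^sub>C x)"
    by (rule bounded_bilinear.bounded_linear_right[OF bounded_bilinear_scaleC])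
  have bl: "bounded_linear l"
    unfolding l_def
    by (intro bounded_linear_sub bounded_linear_compose[OF bounded_linear_of_real \<phi>(1)]
        bounded_linear_const_mult bounded_linear_compose[OF bounded_linear_of_real]
        bounded_linear_compose[OF \<phi>(1) i])
  have "l (c *\<^sub>C x) = c *\<^sub>C l x" for c x
  proof -
    have "c *\<^sub>C x = Re c *\<^sub>R x + Im c *\<^sub>R (\<i> *\<^sub>C x)"
    proof -
      have "c = complex_of_real (Re c) + complex_of_real (Im c) * \<i>"
        by (simp add: complex_eq_iff)
      then have "c *\<^sub>C x = (complex_of_real (Re c) + complex_of_real (Im c) * \<i>) *\<^sub>C x" by simp
      then show ?thesis by (simp add: scaleC_add_left scaleC_of_real flip: scaleC_scaleC)
    qed
    moreover have "\<i> *\<^sub>C c *\<^sub>C x = Re c *\<^sub>R (\<i> *\<^sub>C x) - Im c *\<^sub>R x"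
    proof -
      have "\<i> * c = complex_of_real (Re c) * \<i> - complex_of_real (Im c)"
        by (simp add: complex_eq_iff)
      then show ?thesis by (simp add: scaleC_scaleC flip: scaleC_of_real scaleC_diff_left)
    qed
    ultimately have "\<phi> (c *\<^sub>C x) = Re c * \<phi> x + Im c * \<phi> (\<i> *\<^sub>C x)"
      "\<phi> (\<i> *\<^sub>C c *\<^sub>C x) = Re c * \<phi> (\<i> *\<^sub>C x) - Im c * \<phi> x"
      by (simp_all add: add diff scaleR)
    then show ?thesis by (simp add: l_def scaleC_complex_def complex_eq_iff)
  qed
  moreover have "l x0 \<noteq> 0" using \<phi>(2) by (auto simp: l_def complex_eq_iff)
  ultimately show ?thesis using that bl by (auto simp: bounded_clinear_def)
qed

lemma functionals_separate:
  fixes x y :: "'a::complex_banach_algebra_1"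
  assumes "\<And>l :: 'a \<Rightarrow> complex. bounded_clinear l \<Longrightarrow> l x = l y"
  shows "x = y"
proof (rule ccontr)
  assume "x \<noteq> y"
  then have "x - y \<noteq> 0" by simp
  then obtain l :: "'a \<Rightarrow> complex" where "bounded_clinear l" "l (x - y) \<noteq> 0"
    using complex_functional_exists by blast
  then show False
    using assms by (simp add: bounded_clinear_def linear_diff bounded_linear.linear)
qed


section \<open>Holomorphic functions with values in a Banach algebra\<close>

text \<open>Complex differentiability, expressed by a real derivative of a special form because the values live
  in a class whose complex scalar multiplication is not part of the normed space structure.\<close>

definition vholomorphic_on :: "(complex \<Rightarrow> 'a::complex_banach_algebra_1) \<Rightarrow> complex set \<Rightarrow> bool"
    (infix \<open>vholomorphic'_on\<close> 50) where
  "F vholomorphic_on S \<longleftrightarrow> (\<forall>z\<in>S. \<exists>D. (F has_derivative (\<lambda>h. h *\<^sub>C D)) (at z within S))"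

lemma vholomorphic_on_const: "(\<lambda>z. c) vholomorphic_on S"
  unfolding vholomorphic_on_def by (auto intro!: exI[of _ 0])

lemma vholomorphic_on_subset: "F vholomorphic_on S \<Longrightarrow> T \<subseteq> S \<Longrightarrow> F vholomorphic_on T"
  unfolding vholomorphic_on_def by (meson has_derivative_subset subset_iff)

lemma vholomorphic_on_imp_continuous_on: "F vholomorphic_on S \<Longrightarrow> continuous_on S F"
  unfolding vholomorphic_on_def continuous_on_eq_continuous_within
  by (meson has_derivative_continuous)

lemma vholomorphic_on_mult:
  assumes "F vholomorphic_on S" "G vholomorphic_on S"
  shows "(\<lambda>z. F z * G z) vholomorphic_on S"
  unfolding vholomorphic_on_def
proof
  fix z assume "z \<in> S"
  then obtain C D where "(F has_derivative (\<lambda>h. h *\<^sub>C C)) (at z within S)"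
    "(G has_derivative (\<lambda>h. h *\<^sub>C D)) (at z within S)"
    using assms unfolding vholomorphic_on_def by blast
  from has_derivative_mult[OF this]
  have "((\<lambda>z. F z * G z) has_derivative (\<lambda>h. h *\<^sub>C (F z * D + C * G z))) (at z within S)"
    by (simp add: mult_scaleC_left mult_scaleC_right scaleC_add_right)
  then show "\<exists>D. ((\<lambda>z. F z * G z) has_derivative (\<lambda>h. h *\<^sub>C D)) (at z within S)" by blast
qed

lemma vholomorphic_on_prod_list:
  "(\<And>x. x \<in> set xs \<Longrightarrow> F x vholomorphic_on S) \<Longrightarrow> (\<lambda>z. prod_list (map (\<lambda>x. F x z) xs)) vholomorphic_on S"
  by (induction xs) (auto intro: vholomorphic_on_const vholomorphic_on_mult)

lemma vholomorphic_on_scaleC: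
  assumes "f holomorphic_on S" "G vholomorphic_on S"
  shows "(\<lambda>z. f z *\<^sub>C G z) vholomorphic_on S"
  unfolding vholomorphic_on_def
proof
  fix z assume z: "z \<in> S"
  then obtain D where D: "(G has_derivative (\<lambda>h. h *\<^sub>C D)) (at z within S)"
    using assms unfolding vholomorphic_on_def by blast
  obtain d where d: "(f has_field_derivative d) (at z within S)"
    using assms(1) z by (auto simp: holomorphic_on_def field_differentiable_def)
  have "((\<lambda>z. f z *\<^sub>C G z) has_derivative (\<lambda>h. f z *\<^sub>C h *\<^sub>C D + (d * h) *\<^sub>C G z)) (at z within S)"
    using bounded_bilinear.FDERIV[OF bounded_bilinear_scaleC d[unfolded has_field_derivative_def] D] .
  then have "((\<lambda>z. f z *\<^sub>C G z) has_derivative (\<lambda>h. h *\<^sub>C (f z *\<^sub>C D + d *\<^sub>C G z))) (at z within S)"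
    by (simp add: scaleC_add_right scaleC_scaleC mult.commute)
  then show "\<exists>D. ((\<lambda>z. f z *\<^sub>C G z) has_derivative (\<lambda>h. h *\<^sub>C D)) (at z within S)" by blast
qed

lemma vholomorphic_on_compose_clinear:
  assumes "F vholomorphic_on S" "bounded_clinear L"
  shows "(\<lambda>z. L (F z)) vholomorphic_on S"
  unfolding vholomorphic_on_def
proof
  fix z assume "z \<in> S"
  then obtain D where D: "(F has_derivative (\<lambda>h. h *\<^sub>C D)) (at z within S)"
    using assms unfolding vholomorphic_on_def by blast
  have "bounded_linear L" using assms(2) by (simp add: bounded_clinear_def)
  then have "((\<lambda>z. L (F z)) has_derivative (\<lambda>h. L (h *\<^sub>C D))) (at z within S)"
    using D by (rule bounded_linear.has_derivative)
  then show "\<exists>D. ((\<lambda>z. L (F z)) has_derivative (\<lambda>h. h *\<^sub>C D)) (at z within S)"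
    using assms(2) by (auto simp: bounded_clinear_def)
qed

lemma vholomorphic_on_complex: "F vholomorphic_on S \<longleftrightarrow> (F :: complex \<Rightarrow> complex) holomorphic_on S"
proof -
  have "(\<lambda>h. h *\<^sub>C D) = (*) D" for D :: complex by (auto simp: scaleC_complex_def)
  then show ?thesis
    by (simp add: vholomorphic_on_def holomorphic_on_def field_differentiable_def has_field_derivative_def)
qed

abbreviation path_integrand :: "(real \<Rightarrow> complex) \<Rightarrow> (complex \<Rightarrow> 'a::complex_banach_algebra_1) \<Rightarrow> real \<Rightarrow> 'a" where
  "path_integrand \<gamma> F \<equiv> \<lambda>t. vector_derivative \<gamma> (at t within {0..1}) *\<^sub>C F (\<gamma> t)"

lemma path_integrand_clinear:
  assumes L: "bounded_clinear L" and int: "path_integrand \<gamma> F integrable_on {0..1}"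
  shows "path_integrand \<gamma> (\<lambda>z. L (F z)) integrable_on {0..1}"
    "integral {0..1} (path_integrand \<gamma> (\<lambda>z. L (F z))) = L (integral {0..1} (path_integrand \<gamma> F))"
proof -
  have eq: "path_integrand \<gamma> (\<lambda>z. L (F z)) = L \<circ> path_integrand \<gamma> F"
    using L by (auto simp: bounded_clinear_def)
  have "bounded_linear L" using L by (simp add: bounded_clinear_def)
  then show "path_integrand \<gamma> (\<lambda>z. L (F z)) integrable_on {0..1}"
    "integral {0..1} (path_integrand \<gamma> (\<lambda>z. L (F z))) = L (integral {0..1} (path_integrand \<gamma> F))"
    unfolding eq using int by (auto intro: integrable_linear integral_linear)
qed

lemma cycle_integral_clinear:
  assumes L: "bounded_clinear L" and int: "\<And>\<gamma>. \<gamma> \<in> set \<Gamma> \<Longrightarrow> path_integrand \<gamma> F integrable_on {0..1}"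
  shows "cycle_integral \<Gamma> (\<lambda>z. L (F z)) = L (cycle_integral \<Gamma> F)"
proof -
  have lin: "L (x + y) = L x + L y" "L 0 = 0" for x y
    using L by (auto simp: bounded_clinear_def linear_add linear_0 dest!: bounded_linear.linear)
  show ?thesis
    using int by (induction \<Gamma>) (auto simp: cycle_integral_def lin path_integrand_clinear[OF L])
qed

lemma path_integrand_linepath:
  "t \<in> {0..1} \<Longrightarrow> path_integrand (linepath p q) F t = (q - p) *\<^sub>C F (linepath p q t)"
  by (simp add: vector_derivative_linepath_within)

lemma path_integrand_linepath_continuous:
  fixes F :: "complex \<Rightarrow> 'a::complex_banach_algebra_1"
  assumes "continuous_on (closed_segment p q) F"
  shows "continuous_on {0..1} (path_integrand (linepath p q) F)"
proof -
  have "continuous_on {0..1} (\<lambda>t. F (linepath p q t))"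
    by (rule continuous_on_compose2[OF assms]) (auto simp: linepath_in_path)
  then have "continuous_on {0..1} (\<lambda>t. (q - p) *\<^sub>C F (linepath p q t))"
    by (intro continuous_intros)
  then show ?thesis by (rule continuous_on_eq) (simp add: path_integrand_linepath)
qed

text \<open>The integral along the segment from the centre.  That the integrals along the sides of a triangle
  add up to 0 is known for complex functions and transfers through the functionals.\<close>

lemma vholomorphic_primitive_ball:
  fixes F :: "complex \<Rightarrow> 'a::complex_banach_algebra_1"
  assumes F: "F vholomorphic_on ball z0 r"
  obtains P where "\<And>w. w \<in> ball z0 r \<Longrightarrow> (P has_derivative (\<lambda>h. h *\<^sub>C F w)) (at w)"
proof -
  let ?B = "ball z0 r"
  define I where "I p q = integral {0..1} (path_integrand (linepath p q) F)" for p q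
  have cont: "continuous_on ?B F" using F by (rule vholomorphic_on_imp_continuous_on)
  have seg: "closed_segment p q \<subseteq> ?B" if "p \<in> ?B" "q \<in> ?B" for p q
    using that by (intro closed_segment_subset convex_ball)
  have int: "path_integrand (linepath p q) F integrable_on {0..1}" if "p \<in> ?B" "q \<in> ?B" for p q
    by (intro integrable_continuous_real path_integrand_linepath_continuous continuous_on_subset[OF cont] seg that)
  have tri: "I z0 w' = I z0 w + I w w'" if w: "w \<in> ?B" "w' \<in> ?B" for w w'
  proof (rule functionals_separate)
    fix l :: "'a \<Rightarrow> complex" assume l: "bounded_clinear l"
    have z0: "z0 \<in> ?B" using w(1) by (auto simp: le_less_trans[OF zero_le_dist])
    have "(\<lambda>z. l (F z)) holomorphic_on ?B"
      using vholomorphic_on_compose_clinear[OF F l] by (simp add: vholomorphic_on_complex)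
    then obtain G where G: "\<And>x. x \<in> ?B \<Longrightarrow> (G has_field_derivative l (F x)) (at x within ?B)"
      using holomorphic_convex_primitive'[OF convex_ball open_ball] by metis
    have lI: "l (I p q) = G q - G p" if "p \<in> ?B" "q \<in> ?B" for p q
    proof -
      have "l (I p q) = cycle_integral [linepath p q] (\<lambda>z. l (F z))"
        unfolding I_def using path_integrand_clinear[OF l int[OF that]] by (simp add: cycle_integral_def)
      also have "\<dots> = contour_integral (linepath p q) (\<lambda>z. l (F z))"
        by (simp add: cycle_integral_complex)
      also have "\<dots> = G q - G p"
        using contour_integral_primitive[OF G, of "linepath p q"] seg[OF that]
        by (simp add: contour_integral_unique)
      finally show ?thesis .
    qed
    have "l (I z0 w + I w w') = l (I z0 w) + l (I w w')"
      using l by (simp add: bounded_clinear_def linear_add bounded_linear.linear)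
    then show "l (I z0 w') = l (I z0 w + I w w')" using lI w z0 by simp
  qed
  have "((\<lambda>w. I z0 w) has_derivative (\<lambda>h. h *\<^sub>C F w)) (at w)" if w: "w \<in> ?B" for w
    unfolding has_derivative_within_alt
  proof (intro conjI allI impI)
    show "bounded_linear (\<lambda>h. h *\<^sub>C F w)"
      by (rule bounded_bilinear.bounded_linear_left[OF bounded_bilinear_scaleC])
    fix e :: real assume e: "e > 0"
    have "isCont F w" using cont w by (simp add: continuous_on_eq_continuous_at)
    then obtain d1 where d1: "d1 > 0" "\<And>x. dist x w < d1 \<Longrightarrow> dist (F x) (F w) < e"
      using e unfolding continuous_at_eps_delta by metis
    obtain d2 where d2: "d2 > 0" "ball w d2 \<subseteq> ?B" using w open_ball open_contains_ball by metis
    have "norm (I z0 y - I z0 w - (y - w) *\<^sub>C F w) \<le> e * norm (y - w)" if y: "norm (y - w) < min d1 d2" for y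
    proof -
      have yB: "y \<in> ?B" using y d2 by (auto simp: dist_norm norm_minus_commute)
      have "I z0 y - I z0 w - (y - w) *\<^sub>C F w = I w y - integral {0..1} (\<lambda>t::real. (y - w) *\<^sub>C F w)"
        using tri[OF w yB] by simp
      also have "\<dots> = integral {0..1} (\<lambda>t. path_integrand (linepath w y) F t - (y - w) *\<^sub>C F w)"
        unfolding I_def by (rule integral_diff[symmetric]) (use int[OF w yB] in auto)
      finally have eq: "I z0 y - I z0 w - (y - w) *\<^sub>C F w
        = integral {0..1} (\<lambda>t. path_integrand (linepath w y) F t - (y - w) *\<^sub>C F w)" .
      have "norm (integral {0..1} (\<lambda>t. path_integrand (linepath w y) F t - (y - w) *\<^sub>C F w)) \<le> (e * norm (y - w)) * (1 - 0)"
      proof (rule integral_bound)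
        show "continuous_on {0..1} (\<lambda>t. path_integrand (linepath w y) F t - (y - w) *\<^sub>C F w)"
          by (intro continuous_on_diff path_integrand_linepath_continuous continuous_on_subset[OF cont] seg w yB)
             auto
        fix t :: real assume t: "t \<in> {0..1}"
        have "dist (linepath w y t) w \<le> dist y w"
        proof -
          have "linepath w y t - w = t *\<^sub>R (y - w)" by (simp add: linepath_def algebra_simps)
          then show ?thesis using t by (simp add: dist_norm mult_left_le_one_le)
        qed
        then have "norm (F (linepath w y t) - F w) \<le> e"
          using d1(2)[of "linepath w y t"] y by (auto simp: dist_norm less_imp_le)
        moreover have "path_integrand (linepath w y) F t - (y - w) *\<^sub>C F w = (y - w) *\<^sub>C (F (linepath w y t) - F w)"
          using t by (simp add: path_integrand_linepath scaleC_diff_right)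
        ultimately show "norm (path_integrand (linepath w y) F t - (y - w) *\<^sub>C F w) \<le> e * norm (y - w)"
          by (simp add: norm_scaleC mult_left_mono mult.commute[of e])
      qed simp
      then show ?thesis by (simp add: eq)
    qed
    then show "\<exists>d>0. \<forall>y\<in>UNIV. norm (y - w) < d \<longrightarrow> norm (I z0 y - I z0 w - (y - w) *\<^sub>C F w) \<le> e * norm (y - w)"
      using d1 d2 by (intro exI[of _ "min d1 d2"]) auto
  qed
  then show ?thesis using that by blast
qed

text \<open>A valid path need not be rectifiable, so that continuity of the integrand would not suffice
  here; holomorphy does because of the local primitives.\<close>

lemma path_integrand_integrable:
  fixes F :: "complex \<Rightarrow> 'a::complex_banach_algebra_1"
  assumes S: "open S" and F: "F vholomorphic_on S" and \<gamma>: "valid_path \<gamma>" "path_image \<gamma> \<subseteq> S"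
  shows "path_integrand \<gamma> F integrable_on {0..1}"
proof -
  obtain K where K: "finite K" "continuous_on {0..1} \<gamma>" "\<And>t. t \<in> {0..1} - K \<Longrightarrow> \<gamma> differentiable (at t)"
    using \<gamma>(1) unfolding valid_path_def piecewise_C1_differentiable_on_def C1_differentiable_on_eq by blast
  have "path_integrand \<gamma> F integrable_on cbox 0 1"
  proof (rule integrable_on_little_subintervals, rule ballI)
    fix x :: real assume x: "x \<in> cbox 0 1"
    have "\<gamma> x \<in> S" using x \<gamma>(2) by (auto simp: path_image_def)
    then obtain r where r: "r > 0" "ball (\<gamma> x) r \<subseteq> S" using S open_contains_ball by metis
    obtain d where d: "d > 0" "\<And>t. t \<in> {0..1} \<Longrightarrow> dist t x < d \<Longrightarrow> dist (\<gamma> t) (\<gamma> x) < r"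
      using K(2) x r(1) unfolding continuous_on_iff by (metis box_real(2))
    obtain P where P: "\<And>w. w \<in> ball (\<gamma> x) r \<Longrightarrow> (P has_derivative (\<lambda>h. h *\<^sub>C F w)) (at w)"
      using vholomorphic_primitive_ball[OF vholomorphic_on_subset[OF F r(2)]] by blast
    \<comment> \<open>On a short interval the integrand is the derivative of \<open>P \<circ> \<gamma>\<close> except at
      finitely many points.\<close>
    have "path_integrand \<gamma> F integrable_on cbox u v"
      if uv: "x \<in> cbox u v" "cbox u v \<subseteq> ball x d" "cbox u v \<subseteq> cbox 0 1" for u v
    proof -
      have uv': "u \<le> v" using uv(1) by auto
      have in_ball: "\<gamma> t \<in> ball (\<gamma> x) r" if "t \<in> {u..v}" for t
        using d(2)[of t] uv that by (force simp: dist_commute)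
      have "(path_integrand \<gamma> F has_integral P (\<gamma> v) - P (\<gamma> u)) {u..v}"
      proof (rule fundamental_theorem_of_calculus_interior_strong[OF K(1) uv', where f = "\<lambda>t. P (\<gamma> t)"])
        have "continuous_on (ball (\<gamma> x) r) P"
          using P has_derivative_continuous by (blast intro: continuous_at_imp_continuous_on)
        then show "continuous_on {u..v} (\<lambda>t. P (\<gamma> t))"
          by (rule continuous_on_compose2) (use uv in_ball continuous_on_subset[OF K(2)] in auto)
        fix t assume t: "t \<in> {u<..<v} - K"
        have t01: "t \<in> {0<..<1}" "t \<in> {u..v}" using t uv uv' by auto
        have "\<gamma> differentiable (at t)" using K(3)[of t] t t01 by auto
        then have g: "(\<gamma> has_vector_derivative vector_derivative \<gamma> (at t)) (at t)"
          by (simp add: vector_derivative_works)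
        have vd: "vector_derivative \<gamma> (at t within {0..1}) = vector_derivative \<gamma> (at t)"
          using t01 by (intro vector_derivative_at_within_ivl[OF g]) auto
        have "((\<lambda>t. P (\<gamma> t)) has_derivative (\<lambda>s. (s *\<^sub>R vector_derivative \<gamma> (at t)) *\<^sub>C F (\<gamma> t))) (at t)"
          using has_derivative_compose[OF g[unfolded has_vector_derivative_def] P[OF in_ball[OF t01(2)]]] .
        then show "((\<lambda>t. P (\<gamma> t)) has_vector_derivative path_integrand \<gamma> F t) (at t)"
          unfolding has_vector_derivative_def vd
          by (simp add: bounded_bilinear.scaleR_left[OF bounded_bilinear_scaleC])
      qed
      then show ?thesis by (auto simp: integrable_on_def)
    qed
    then show "\<exists>d>0. \<forall>u v. x \<in> cbox u v \<and> cbox u v \<subseteq> ball x d \<and> cbox u v \<subseteq> cbox 0 1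
        \<longrightarrow> path_integrand \<gamma> F integrable_on cbox u v"
      using d(1) by blast
  qed
  then show ?thesis by simp
qed

text \<open>Functionals commute with the integrals and map \<open>F\<close> to complex holomorphic functions.\<close>

lemma cycle_integral_eq_weak:
  fixes F :: "complex \<Rightarrow> 'a::complex_banach_algebra_1"
  assumes S: "open S" and F: "F vholomorphic_on S"
    and \<Gamma>1: "\<And>\<gamma>. \<gamma> \<in> set \<Gamma>1 \<Longrightarrow> valid_path \<gamma> \<and> path_image \<gamma> \<subseteq> S"
    and \<Gamma>2: "\<And>\<gamma>. \<gamma> \<in> set \<Gamma>2 \<Longrightarrow> valid_path \<gamma> \<and> path_image \<gamma> \<subseteq> S"
    and eq: "\<And>g :: complex \<Rightarrow> complex. g holomorphic_on S \<Longrightarrow> cycle_integral \<Gamma>1 g = cycle_integral \<Gamma>2 g"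
  shows "cycle_integral \<Gamma>1 F = cycle_integral \<Gamma>2 F"
proof (rule functionals_separate)
  fix l :: "'a \<Rightarrow> complex" assume l: "bounded_clinear l"
  have "(\<lambda>z. l (F z)) holomorphic_on S"
    using vholomorphic_on_compose_clinear[OF F l] by (simp add: vholomorphic_on_complex)
  from eq[OF this] show "l (cycle_integral \<Gamma>1 F) = l (cycle_integral \<Gamma>2 F)"
    using \<Gamma>1 \<Gamma>2 cycle_integral_clinear[OF l path_integrand_integrable[OF S F]] by metis
qed

text \<open>The singularities of the integrand are confined to \<open>S\<close>, and the chain may go around a larger set.  Thus
  one chain can serve all elements whose spectrum lies in \<open>L\<close>.\<close>

lemma vCauchy_chain_integral_eq:
  fixes F :: "complex \<Rightarrow> 'a::complex_banach_algebra_1"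
  assumes U: "open U" and L: "compact L" and S: "closed S" "S \<subseteq> L" and E: "Cauchy_chain E L U"
    and \<Gamma>: "surrounds \<Gamma> S U" and F: "F vholomorphic_on (U - S)"
  shows "cycle_integral \<Gamma> F = cycle_integral E F"
proof (rule cycle_integral_eq_weak[OF _ F])
  show "open (U - S)" using U S by blast
  show "valid_path \<gamma> \<and> path_image \<gamma> \<subseteq> U - S" if "\<gamma> \<in> set \<Gamma>" for \<gamma>
    using \<Gamma> that by (auto simp: surrounds_def cycle_in_def)
  show "valid_path \<gamma> \<and> path_image \<gamma> \<subseteq> U - S" if \<gamma>: "\<gamma> \<in> set E" for \<gamma>
    using Cauchy_chain_linepath[OF E \<gamma>] S(2) by (metis Diff_mono order_refl order_trans path_image_linepath valid_path_linepath)
qed (rule Cauchy_chain_integral_eq[OF U L S E \<Gamma>])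

lemma Cauchy_chains_integral_eq:
  fixes F :: "complex \<Rightarrow> 'a::complex_banach_algebra_1"
  assumes U: "open U" and S: "closed S" "S \<subseteq> L" "S \<subseteq> M" and L: "compact L" "Cauchy_chain E L U"
    and M: "compact M" "Cauchy_chain E' M U" and F: "F vholomorphic_on (U - S)"
  shows "cycle_integral E F = cycle_integral E' F"
proof -
  obtain \<Gamma> where "surrounds \<Gamma> L U" using surrounds_of_Cauchy_chain[OF L(2) U L(1)] by metis
  then have "surrounds \<Gamma> S U" using S(2) by (rule surrounds_antimono)
  then show ?thesis
    using vCauchy_chain_integral_eq[OF U _ S(1) _ _ _ F] S L M by metis
qed


section \<open>Integrals along polygonal chains\<close>

definition polygonal :: "(real \<Rightarrow> complex) list \<Rightarrow> complex set \<Rightarrow> bool" where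
  "polygonal E A \<longleftrightarrow> (\<forall>\<gamma>\<in>set E. \<exists>p q. \<gamma> = linepath p q \<and> closed_segment p q \<subseteq> A)"

definition chain_length :: "(real \<Rightarrow> complex) list \<Rightarrow> real" where
  "chain_length E = (\<Sum>\<gamma>\<leftarrow>E. cmod (pathfinish \<gamma> - pathstart \<gamma>))"

definition chain_image :: "(real \<Rightarrow> complex) list \<Rightarrow> complex set" where
  "chain_image E = (\<Union>\<gamma>\<in>set E. path_image \<gamma>)"

lemma polygonal_Cauchy_chain: "Cauchy_chain E L U \<Longrightarrow> polygonal E (U - L)"
  by (simp add: Cauchy_chain_def polygonal_def)

lemma polygonal_chain_image: "polygonal E A \<longleftrightarrow> polygonal E UNIV \<and> chain_image E \<subseteq> A"
  unfolding polygonal_def chain_image_def by fastforce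

lemma polygonal_Cons: "polygonal (\<gamma> # E) A \<longleftrightarrow> (\<exists>p q. \<gamma> = linepath p q \<and> closed_segment p q \<subseteq> A) \<and> polygonal E A"
  by (simp add: polygonal_def)

lemma compact_chain_image: "polygonal E A \<Longrightarrow> compact (chain_image E)"
  unfolding chain_image_def polygonal_def by (intro compact_UN) (auto intro: compact_segment)

lemma chain_length_nonneg: "chain_length E \<ge> 0"
  unfolding chain_length_def by (induction E) auto

lemma polygonal_integrable:
  fixes F :: "complex \<Rightarrow> 'a::complex_banach_algebra_1"
  assumes "polygonal E A" "continuous_on A F" "\<gamma> \<in> set E"
  shows "path_integrand \<gamma> F integrable_on {0..1}"
proof -
  obtain p q where pq: "\<gamma> = linepath p q" "closed_segment p q \<subseteq> A"
    using assms unfolding polygonal_def by blast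
  show ?thesis unfolding pq(1)
    by (intro integrable_continuous_real path_integrand_linepath_continuous continuous_on_subset[OF assms(2) pq(2)])
qed

lemma polygonal_integral_clinear:
  assumes "polygonal E A" "continuous_on A F" "bounded_clinear L"
  shows "cycle_integral E (\<lambda>z. L (F z)) = L (cycle_integral E F)"
  using assms by (intro cycle_integral_clinear polygonal_integrable)

lemma polygonal_integral_add:
  fixes F G :: "complex \<Rightarrow> 'a::complex_banach_algebra_1"
  assumes "polygonal E A" "continuous_on A F" "continuous_on A G"
  shows "cycle_integral E (\<lambda>z. F z + G z) = cycle_integral E F + cycle_integral E G"
  using polygonal_integrable[OF assms(1,2)] polygonal_integrable[OF assms(1,3)]
  by (induction E) (auto simp: cycle_integral_def scaleC_add_right integral_add)

lemma polygonal_integral_diff: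
  fixes F G :: "complex \<Rightarrow> 'a::complex_banach_algebra_1"
  assumes "polygonal E A" "continuous_on A F" "continuous_on A G"
  shows "cycle_integral E (\<lambda>z. F z - G z) = cycle_integral E F - cycle_integral E G"
  using polygonal_integrable[OF assms(1,2)] polygonal_integrable[OF assms(1,3)]
  by (induction E) (auto simp: cycle_integral_def scaleC_diff_right integral_diff)

lemma cycle_integral_zero: "cycle_integral E (\<lambda>z. 0 :: 'a::complex_banach_algebra_1) = 0"
  by (simp add: cycle_integral_def)

lemma polygonal_integral_sum:
  fixes F :: "'j \<Rightarrow> complex \<Rightarrow> 'a::complex_banach_algebra_1"
  assumes "polygonal E A" "\<And>j. j \<in> J \<Longrightarrow> continuous_on A (F j)"
  shows "cycle_integral E (\<lambda>z. \<Sum>j\<in>J. F j z) = (\<Sum>j\<in>J. cycle_integral E (F j))"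
  using assms(2)
proof (induction J rule: infinite_finite_induct)
  case (insert j J)
  then show ?case
    using polygonal_integral_add[OF assms(1), of "F j" "\<lambda>z. \<Sum>j\<in>J. F j z"]
    by (auto simp: continuous_on_sum)
qed (auto simp: cycle_integral_zero)

lemma polygonal_integral_cong:
  assumes "polygonal E A" "\<And>z. z \<in> A \<Longrightarrow> F z = G z"
  shows "cycle_integral E F = cycle_integral E G"
  unfolding cycle_integral_def
proof (intro arg_cong[of _ _ sum_list] map_cong refl integral_cong)
  fix \<gamma> t assume "\<gamma> \<in> set E" "t \<in> {0..1 :: real}"
  then have "\<gamma> t \<in> A" using assms(1) by (force simp: polygonal_def linepath_in_path)
  then show "path_integrand \<gamma> F t = path_integrand \<gamma> G t" using assms(2) by simp
qed

lemma linepath_integral_bound: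
  fixes F :: "complex \<Rightarrow> 'a::complex_banach_algebra_1"
  assumes "continuous_on (closed_segment p q) F" "\<And>z. z \<in> closed_segment p q \<Longrightarrow> norm (F z) \<le> B"
  shows "norm (integral {0..1} (path_integrand (linepath p q) F)) \<le> B * cmod (q - p)"
proof -
  have "norm (integral {0..1} (path_integrand (linepath p q) F)) \<le> B * cmod (q - p) * (1 - 0)"
  proof (rule integral_bound)
    fix t :: real assume t: "t \<in> {0..1}"
    then have "norm (F (linepath p q t)) \<le> B" by (intro assms(2) linepath_in_path)
    then show "norm (path_integrand (linepath p q) F t) \<le> B * cmod (q - p)"
      using t by (simp add: path_integrand_linepath norm_scaleC mult.commute[of B] mult_left_mono)
  qed (use path_integrand_linepath_continuous[OF assms(1)] in auto)
  then show ?thesis by simp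
qed

lemma polygonal_integral_bound:
  fixes F :: "complex \<Rightarrow> 'a::complex_banach_algebra_1"
  assumes "polygonal E A" "continuous_on A F" "\<And>z. z \<in> A \<Longrightarrow> norm (F z) \<le> B"
  shows "norm (cycle_integral E F) \<le> B * chain_length E"
  using assms(1)
proof (induction E)
  case (Cons \<gamma> E)
  then obtain p q where pq: "\<gamma> = linepath p q" "closed_segment p q \<subseteq> A" by (auto simp: polygonal_Cons)
  have "norm (integral {0..1} (path_integrand \<gamma> F)) \<le> B * cmod (q - p)"
    unfolding pq(1) using assms pq(2) by (intro linepath_integral_bound continuous_on_subset[OF assms(2)]) auto
  moreover have "norm (cycle_integral E F) \<le> B * chain_length E" using Cons by (simp add: polygonal_Cons)
  ultimately show ?case
    using norm_triangle_ineq[of "integral {0..1} (path_integrand \<gamma> F)" "cycle_integral E F"]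
    by (simp add: cycle_integral_def chain_length_def pq(1) algebra_simps)
qed (simp add: cycle_integral_def chain_length_def)

text \<open>The nodes with their weights are listed independently of the integrand because integrands
  with values in different algebras will be approximated simultaneously.\<close>

definition riemann_nodes :: "(real \<Rightarrow> complex) list \<Rightarrow> nat \<Rightarrow> (complex \<times> complex) list" where
  "riemann_nodes E N = concat (map (\<lambda>\<gamma>. map (\<lambda>j.
     ((pathfinish \<gamma> - pathstart \<gamma>) / of_nat N, \<gamma> (real j / real N))) [0..<N]) E)"

definition riemann_sum ::
  "(real \<Rightarrow> complex) list \<Rightarrow> nat \<Rightarrow> (complex \<Rightarrow> 'a::complex_banach_algebra_1) \<Rightarrow> 'a" where
  "riemann_sum E N F = (\<Sum>(w, z)\<leftarrow>riemann_nodes E N. w *\<^sub>C F z)"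

lemma riemann_nodes_subset:
  assumes "polygonal E A" "(w, z) \<in> set (riemann_nodes E N)"
  shows "z \<in> A"
proof -
  obtain \<gamma> j where "\<gamma> \<in> set E" "j < N" "z = \<gamma> (real j / real N)"
    using assms(2) by (auto simp: riemann_nodes_def)
  then show ?thesis
    using assms(1) by (force simp: polygonal_def intro!: linepath_in_path)
qed

lemma scaleC_riemann_sum:
  "a *\<^sub>C riemann_sum E N (\<lambda>z. f z *\<^sub>C G z) = (\<Sum>(w, z)\<leftarrow>riemann_nodes E N. (a * w * f z) *\<^sub>C G z)"
proof -
  have "a *\<^sub>C (\<Sum>(w, z)\<leftarrow>xs. w *\<^sub>C f z *\<^sub>C G z) = (\<Sum>(w, z)\<leftarrow>xs. (a * w * f z) *\<^sub>C G z)" for xs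
    by (induction xs) (auto simp: scaleC_add_right scaleC_scaleC mult.assoc)
  then show ?thesis by (simp add: riemann_sum_def)
qed

text \<open>The segment is cut into \<open>N\<close> equal pieces, and on each of them the integrand is compared with its
  value at the initial point.\<close>

lemma linepath_riemann:
  fixes F :: "complex \<Rightarrow> 'a::complex_banach_algebra_1"
  assumes N: "N > 0" and cont: "continuous_on (closed_segment p q) F"
    and near: "\<And>z z'. z \<in> closed_segment p q \<Longrightarrow> z' \<in> closed_segment p q \<Longrightarrow> cmod (z - z') \<le> cmod (q - p) / N
      \<Longrightarrow> norm (F z - F z') \<le> e"
  shows "norm (integral {0..1} (path_integrand (linepath p q) F)
    - (\<Sum>j<N. ((q - p) / of_nat N) *\<^sub>C F (linepath p q (real j / real N)))) \<le> e * cmod (q - p)"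
proof -
  define f where "f = path_integrand (linepath p q) F"
  have fc: "continuous_on {0..1} f" unfolding f_def by (rule path_integrand_linepath_continuous[OF cont])
  define s where "s j = real j / real N" for j
  have s: "s 0 = 0" "s N = 1" "s j \<le> s (Suc j)" "s (Suc j) - s j = 1 / N" for j
    using N by (auto simp: s_def field_simps)
  have s1: "s j \<le> 1" "0 \<le> s j" if "j \<le> N" for j using that N by (auto simp: s_def)
  have split: "integral {0..s m} f = (\<Sum>j<m. integral {s j..s (Suc j)} f)" if "m \<le> N" for m
    using that
  proof (induction m)
    case (Suc m)
    have "integral {0..s m} f + integral {s m..s (Suc m)} f = integral {0..s (Suc m)} f"
      using Suc.prems s s1[of "Suc m"] s1[of m]
      by (intro Henstock_Kurzweil_Integration.integral_combine integrable_continuous_real continuous_on_subset[OF fc]) auto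
    then show ?case using Suc by simp
  qed (simp add: s)
  have piece: "norm (integral {s j..s (Suc j)} f - ((q - p) / of_nat N) *\<^sub>C F (linepath p q (s j))) \<le> e * cmod (q - p) / N"
    if j: "j < N" for j
  proof -
    have sub: "{s j..s (Suc j)} \<subseteq> {0..1}" using s1[of j] s1[of "Suc j"] j by auto
    let ?c = "(q - p) *\<^sub>C F (linepath p q (s j))"
    have "((q - p) / of_nat N) *\<^sub>C F (linepath p q (s j)) = (1 / real N) *\<^sub>R ?c"
      by (simp add: scaleC_scaleC flip: scaleC_of_real)
    also have "\<dots> = integral {s j..s (Suc j)} (\<lambda>t. ?c)"
      using s(3)[of j] by (simp add: s(4))
    finally have "integral {s j..s (Suc j)} f - ((q - p) / of_nat N) *\<^sub>C F (linepath p q (s j))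
        = integral {s j..s (Suc j)} (\<lambda>t. f t - ?c)"
      using continuous_on_subset[OF fc sub] by (simp add: integral_diff integrable_continuous_real)
    also have "norm \<dots> \<le> e * cmod (q - p) * (s (Suc j) - s j)"
    proof (rule integral_bound[OF s(3)])
      show "continuous_on {s j..s (Suc j)} (\<lambda>t. f t - ?c)"
        by (intro continuous_intros continuous_on_subset[OF fc sub])
      fix t assume t: "t \<in> {s j..s (Suc j)}"
      then have t01: "t \<in> {0..1}" using sub by blast
      have "linepath p q t - linepath p q (s j) = (t - s j) *\<^sub>R (q - p)"
        by (simp add: linepath_def algebra_simps)
      then have "cmod (linepath p q t - linepath p q (s j)) = (t - s j) * cmod (q - p)"
        using t by simp
      also have "\<dots> \<le> 1 / N * cmod (q - p)"
        using t s(4)[of j] by (intro mult_right_mono) auto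
      finally have "norm (F (linepath p q t) - F (linepath p q (s j))) \<le> e"
        using near t01 s1[of j] j by (simp add: linepath_in_path)
      then show "norm (f t - ?c) \<le> e * cmod (q - p)"
        unfolding f_def path_integrand_linepath[OF t01] scaleC_diff_right[symmetric] norm_scaleC
        by (simp add: mult.commute[of e] mult_left_mono)
    qed
    finally show ?thesis by (simp add: s(4))
  qed
  have "integral {0..1} f - (\<Sum>j<N. ((q - p) / of_nat N) *\<^sub>C F (linepath p q (s j)))
      = (\<Sum>j<N. integral {s j..s (Suc j)} f - ((q - p) / of_nat N) *\<^sub>C F (linepath p q (s j)))"
    using split[of N] s(2) by (simp add: sum_subtractf)
  also have "norm \<dots> \<le> (\<Sum>j<N. e * cmod (q - p) / N)"
    by (rule sum_norm_le) (use piece in auto)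
  also have "\<dots> = e * cmod (q - p)" using N by simp
  finally show ?thesis by (simp add: f_def s_def)
qed

lemma polygonal_riemann:
  fixes F :: "complex \<Rightarrow> 'a::complex_banach_algebra_1"
  assumes "polygonal E A" and N: "N > 0" "chain_length E / N < d" and cont: "continuous_on A F"
    and near: "\<And>z z'. z \<in> A \<Longrightarrow> z' \<in> A \<Longrightarrow> cmod (z - z') < d \<Longrightarrow> norm (F z - F z') \<le> e"
  shows "norm (cycle_integral E F - riemann_sum E N F) \<le> e * chain_length E"
  using assms(1) N(2)
proof (induction E)
  case (Cons \<gamma> E)
  then obtain p q where pq: "\<gamma> = linepath p q" "closed_segment p q \<subseteq> A" by (auto simp: polygonal_Cons)
  have len: "chain_length (\<gamma> # E) = cmod (q - p) + chain_length E" by (simp add: chain_length_def pq(1))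
  have "chain_length E / N \<le> chain_length (\<gamma> # E) / N" "cmod (q - p) / N \<le> chain_length (\<gamma> # E) / N"
    using chain_length_nonneg[of E] by (auto simp: len intro!: divide_right_mono)
  then have lt: "chain_length E / N < d" "cmod (q - p) / N < d" using Cons.prems(2) by linarith+
  have 1: "norm (cycle_integral E F - riemann_sum E N F) \<le> e * chain_length E"
    using Cons.IH Cons.prems(1) lt(1) by (simp add: polygonal_Cons)
  have 2: "norm (integral {0..1} (path_integrand \<gamma> F)
    - (\<Sum>j<N. ((q - p) / of_nat N) *\<^sub>C F (linepath p q (real j / real N)))) \<le> e * cmod (q - p)"
    unfolding pq(1) using pq(2) lt(2)
    by (intro linepath_riemann N continuous_on_subset[OF cont] near) (auto simp: subset_iff)
  have "riemann_sum (\<gamma> # E) N F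
      = (\<Sum>j<N. ((q - p) / of_nat N) *\<^sub>C F (linepath p q (real j / real N))) + riemann_sum E N F"
    by (simp add: riemann_sum_def riemann_nodes_def pq(1) comp_def interv_sum_list_conv_sum_set_nat atLeast0LessThan)
  then have "cycle_integral (\<gamma> # E) F - riemann_sum (\<gamma> # E) N F
      = (integral {0..1} (path_integrand \<gamma> F) - (\<Sum>j<N. ((q - p) / of_nat N) *\<^sub>C F (linepath p q (real j / real N))))
        + (cycle_integral E F - riemann_sum E N F)"
    by (simp add: cycle_integral_def)
  then have "norm (cycle_integral (\<gamma> # E) F - riemann_sum (\<gamma> # E) N F) \<le> e * cmod (q - p) + e * chain_length E"
    using norm_triangle_mono[OF 2 1] by simp
  then show ?case by (simp add: len algebra_simps)
qed (simp add: cycle_integral_def riemann_sum_def riemann_nodes_def chain_length_def)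


section \<open>Spectrum and resolvent\<close>

lemma is_inverse_unique: "is_inverse x y \<Longrightarrow> is_inverse x y' \<Longrightarrow> y = y'"
  unfolding is_inverse_def by (metis mult.assoc mult_1 mult_1_right)

lemma is_inverse_mult:
  assumes "is_inverse x x'" "is_inverse y y'" shows "is_inverse (x * y) (y' * x')"
proof -
  have "x * y * (y' * x') = x * (y * y') * x'" "y' * x' * (x * y) = y' * (x' * x) * y"
    by (simp_all only: mult.assoc)
  then show ?thesis using assms by (simp add: is_inverse_def)
qed

lemma is_inverse_commute:
  assumes "is_inverse x y" "x * c = c * x" shows "y * c = c * y"
proof -
  have "y * c = y * (c * x) * y" using assms(1) by (simp add: is_inverse_def mult.assoc)
  also have "\<dots> = y * (x * c) * y" by (simp add: assms(2))
  also have "\<dots> = (y * x) * (c * y)" by (simp only: mult.assoc)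
  finally show ?thesis using assms(1) by (simp add: is_inverse_def)
qed

lemma is_inverse_cancel: "is_inverse x x' \<Longrightarrow> x * y = x * z \<Longrightarrow> y = z"
  unfolding is_inverse_def by (metis mult.assoc mult_1)

lemma resolvent_eqI: "is_inverse (z *\<^sub>C 1 - a) y \<Longrightarrow> resolvent a z = y"
  unfolding resolvent_def by (rule the_equality) (auto intro: is_inverse_unique)

lemma resolvent_is_inverse: "z \<notin> spectrum a \<Longrightarrow> is_inverse (z *\<^sub>C 1 - a) (resolvent a z)"
  using resolvent_eqI unfolding spectrum_def by auto

lemma not_in_spectrumI: "is_inverse (z *\<^sub>C 1 - a) y \<Longrightarrow> z \<notin> spectrum a"
  by (auto simp: spectrum_def)

lemma resolvent_eq_left:
  assumes "z \<notin> spectrum a" shows "z *\<^sub>C resolvent a z = 1 + a * resolvent a z"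
proof -
  have "(z *\<^sub>C 1 - a) * resolvent a z = 1" using resolvent_is_inverse[OF assms] by (simp add: is_inverse_def)
  then show ?thesis by (simp add: left_diff_distrib mult_scaleC_left algebra_simps)
qed

lemma resolvent_eq_right:
  assumes "z \<notin> spectrum a" shows "z *\<^sub>C resolvent a z = 1 + resolvent a z * a"
proof -
  have "resolvent a z * (z *\<^sub>C 1 - a) = 1" using resolvent_is_inverse[OF assms] by (simp add: is_inverse_def)
  then show ?thesis by (simp add: right_diff_distrib mult_scaleC_right algebra_simps)
qed

text \<open>The inverse is the geometric series.\<close>

lemma is_inverse_neumann:
  fixes x :: "'a::complex_banach_algebra_1"
  assumes "norm x < 1"
  obtains y where "is_inverse (1 - x) y" "norm y \<le> 1 / (1 - norm x)"
proof -
  have s: "summable (\<lambda>n. x ^ n)" using assms by (rule complete_algebra_summable_geometric)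
  define y where "y = (suminf (\<lambda>n. x ^ n))"
  have sn: "summable (\<lambda>n. norm x ^ n)" using assms by (intro summable_geometric) simp
  have "y = x ^ 0 + (suminf (\<lambda>n. x ^ Suc n))" unfolding y_def using suminf_split_head[OF s] by simp
  moreover have "(suminf (\<lambda>n. x ^ Suc n)) = x * y" "(suminf (\<lambda>n. x ^ Suc n)) = y * x"
    unfolding y_def using suminf_mult[OF s, of x] suminf_mult2[OF s, of x] by (simp_all add: power_commutes)
  ultimately have "is_inverse (1 - x) y" by (simp add: is_inverse_def algebra_simps)
  moreover have "norm y \<le> (suminf (\<lambda>n. norm x ^ n))"
    unfolding y_def
  proof (rule order_trans[OF summable_norm])
    have sn': "summable (\<lambda>n. norm (x ^ n))"
      by (rule summable_comparison_test'[OF sn, of 0]) (simp add: norm_power_ineq)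
    then show "summable (\<lambda>n. norm (x ^ n))" .
    show "(suminf (\<lambda>n. norm (x ^ n))) \<le> (suminf (\<lambda>n. norm x ^ n))"
      by (rule suminf_le[OF _ sn' sn]) (simp add: norm_power_ineq)
  qed
  moreover have "(suminf (\<lambda>n. norm x ^ n)) = 1 / (1 - norm x)" using assms by (intro suminf_geometric) simp
  ultimately show ?thesis using that by simp
qed

text \<open>The second-order expansion of the inverse around an invertible element, with the explicit
  remainder that allows differentiation under integrals.\<close>

lemma is_inverse_perturb:
  fixes u v h :: "'a::complex_banach_algebra_1"
  assumes uv: "is_inverse u v" and h: "norm v * norm h \<le> 1 / 2"
  obtains w where "is_inverse (u - h) w" "norm w \<le> 2 * norm v"
    "norm (w - v) \<le> 2 * (norm v)\<^sup>2 * norm h"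
    "norm (w - v - v * h * v) \<le> 2 * norm v ^ 3 * (norm h)\<^sup>2"
proof -
  have n: "norm (v * h) \<le> 1 / 2" using norm_mult_ineq[of v h] h by linarith
  then obtain y where y: "is_inverse (1 - v * h) y" "norm y \<le> 1 / (1 - norm (v * h))"
    using is_inverse_neumann[of "v * h"] by auto
  have "norm y \<le> 2" using y(2) n by (rule_tac order_trans[OF y(2)]) (simp add: field_simps)
  define w where "w = y * v"
  have "u * (1 - v * h) = u - h"
    using uv by (simp add: is_inverse_def right_diff_distrib mult.assoc[symmetric])
  then have inv: "is_inverse (u - h) w" unfolding w_def using is_inverse_mult[OF uv y(1)] by simp
  have nw: "norm w \<le> 2 * norm v"
    unfolding w_def using norm_mult_ineq[of y v] mult_right_mono[OF \<open>norm y \<le> 2\<close>, of "norm v"] by simp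
  have "w * (u - (u - h)) * v = w * u * v - w * (u - h) * v"
    by (simp only: right_diff_distrib left_diff_distrib)
  also have "\<dots> = w - v"
    using uv inv by (simp add: is_inverse_def mult.assoc)
  finally have wv: "w - v = w * h * v" by simp
  have nwv: "norm (w - v) \<le> 2 * (norm v)\<^sup>2 * norm h"
  proof -
    have "norm (w * h * v) \<le> norm w * norm h * norm v"
      by (meson norm_mult_ineq mult_right_mono norm_ge_zero order_trans)
    also have "\<dots> \<le> 2 * norm v * norm h * norm v"
      using nw by (intro mult_right_mono) auto
    finally show ?thesis by (simp add: wv power2_eq_square algebra_simps)
  qed
  have "w - v - v * h * v = w * h * v - v * h * v"
    by (simp only: wv)
  also have "\<dots> = (w - v) * h * v"
    by (simp only: left_diff_distrib)
  also have "norm \<dots> \<le> norm (w - v) * norm h * norm v"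
    by (meson norm_mult_ineq mult_right_mono norm_ge_zero order_trans)
  also have "\<dots> \<le> 2 * (norm v)\<^sup>2 * norm h * norm h * norm v"
    using nwv by (intro mult_right_mono) auto
  also have "\<dots> = 2 * norm v ^ 3 * (norm h)\<^sup>2"
    by (simp add: power2_eq_square power3_eq_cube)
  finally show ?thesis using that inv nw nwv by blast
qed

lemma resolvent_perturb:
  fixes a h :: "'a::complex_banach_algebra_1"
  assumes z: "z \<notin> spectrum a" and h: "norm (resolvent a z) * norm h \<le> 1 / 2"
  shows "z \<notin> spectrum (a + h)"
    "norm (resolvent (a + h) z) \<le> 2 * norm (resolvent a z)"
    "norm (resolvent (a + h) z - resolvent a z) \<le> 2 * (norm (resolvent a z))\<^sup>2 * norm h"
    "norm (resolvent (a + h) z - resolvent a z - resolvent a z * h * resolvent a z)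
      \<le> 2 * norm (resolvent a z) ^ 3 * (norm h)\<^sup>2"
proof -
  obtain w where w: "is_inverse (z *\<^sub>C 1 - a - h) w" "norm w \<le> 2 * norm (resolvent a z)"
    "norm (w - resolvent a z) \<le> 2 * (norm (resolvent a z))\<^sup>2 * norm h"
    "norm (w - resolvent a z - resolvent a z * h * resolvent a z) \<le> 2 * norm (resolvent a z) ^ 3 * (norm h)\<^sup>2"
    using is_inverse_perturb[OF resolvent_is_inverse[OF z] h] .
  have "z *\<^sub>C 1 - a - h = z *\<^sub>C 1 - (a + h)" by simp
  with w(1) have inv: "is_inverse (z *\<^sub>C 1 - (a + h)) w" by simp
  then show "z \<notin> spectrum (a + h)" by (rule not_in_spectrumI)
  have "resolvent (a + h) z = w" using inv by (rule resolvent_eqI)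
  with w show "norm (resolvent (a + h) z) \<le> 2 * norm (resolvent a z)"
    "norm (resolvent (a + h) z - resolvent a z) \<le> 2 * (norm (resolvent a z))\<^sup>2 * norm h"
    "norm (resolvent (a + h) z - resolvent a z - resolvent a z * h * resolvent a z)
      \<le> 2 * norm (resolvent a z) ^ 3 * (norm h)\<^sup>2" by simp_all
qed

text \<open>Moving the argument of a resolvent amounts to perturbing the element by a scalar.  This makes the
  perturbation estimates above applicable to the dependence on the argument.\<close>

lemma resolvent_shift:
  fixes a :: "'a::complex_banach_algebra_1"
  shows "resolvent a w = resolvent (a + (z - w) *\<^sub>C 1) z"
    "w \<in> spectrum a \<longleftrightarrow> z \<in> spectrum (a + (z - w) *\<^sub>C 1)"
proof -
  have eq: "z *\<^sub>C 1 - (a + (z - w) *\<^sub>C 1) = w *\<^sub>C 1 - a"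
    by (simp add: scaleC_diff_left)
  show "resolvent a w = resolvent (a + (z - w) *\<^sub>C 1) z"
    "w \<in> spectrum a \<longleftrightarrow> z \<in> spectrum (a + (z - w) *\<^sub>C 1)"
    unfolding resolvent_def spectrum_def mem_Collect_eq eq by (rule refl)+
qed

lemma norm_le_spectrum:
  fixes a :: "'a::complex_banach_algebra_1"
  assumes "z \<in> spectrum a" shows "cmod z \<le> norm a"
proof (rule ccontr)
  assume *: "\<not> cmod z \<le> norm a"
  then have z: "z \<noteq> 0" by auto
  have "norm ((1 / z) *\<^sub>C a) < 1" using * z by (simp add: norm_scaleC norm_divide field_simps)
  then obtain y where y: "is_inverse (1 - (1 / z) *\<^sub>C a) y" using is_inverse_neumann by blast
  have "is_inverse (z *\<^sub>C (1 :: 'a)) ((1 / z) *\<^sub>C 1)"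
    using z by (simp add: is_inverse_def mult_scaleC_left mult_scaleC_right scaleC_scaleC)
  from is_inverse_mult[OF this y] have "is_inverse (z *\<^sub>C 1 - a) (y * ((1 / z) *\<^sub>C 1))"
    using z by (simp add: mult_scaleC_left scaleC_diff_right scaleC_scaleC)
  then show False using assms by (auto simp: spectrum_def)
qed

lemma compact_spectrum: "compact (spectrum (a :: 'a::complex_banach_algebra_1))"
proof -
  have "open (- spectrum a)"
    unfolding open_dist
  proof (intro ballI)
    fix z assume "z \<in> - spectrum a"
    then have z: "z \<notin> spectrum a" by simp
    define e where "e = 1 / (2 * (norm (resolvent a z) + 1))"
    have N: "norm (resolvent a z) + 1 > 0" by (simp add: add_nonneg_pos)
    have e: "e > 0" "norm (resolvent a z) * e \<le> 1 / 2"
      using N by (simp_all add: e_def field_simps)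
    have "w \<in> - spectrum a" if "dist w z < e" for w
    proof -
      have "norm (resolvent a z) * cmod (z - w) \<le> norm (resolvent a z) * e"
        using that by (intro mult_left_mono) (auto simp: dist_norm norm_minus_commute)
      then have "z \<notin> spectrum (a + (z - w) *\<^sub>C 1)"
        using e(2) by (intro resolvent_perturb(1)[OF z]) (simp add: norm_scaleC)
      then show ?thesis using resolvent_shift(2)[of w a z] by simp
    qed
    then show "\<exists>e>0. \<forall>y. dist y z < e \<longrightarrow> y \<in> - spectrum a" using e by blast
  qed
  then show ?thesis
    using norm_le_spectrum[of _ a] by (auto simp: compact_eq_bounded_closed closed_def bounded_iff)
qed

lemma vholomorphic_on_resolvent:
  fixes a :: "'a::complex_banach_algebra_1"
  assumes "S \<inter> spectrum a = {}"
  shows "resolvent a vholomorphic_on S"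
  unfolding vholomorphic_on_def
proof
  fix z assume "z \<in> S"
  then have z: "z \<notin> spectrum a" using assms by blast
  let ?R = "resolvent a z"
  have "(resolvent a has_derivative (\<lambda>h. h *\<^sub>C (- (?R * ?R)))) (at z)"
    unfolding has_derivative_within_alt
  proof (intro conjI allI impI)
    show "bounded_linear (\<lambda>h. h *\<^sub>C (- (?R * ?R)))"
      by (rule bounded_bilinear.bounded_linear_left[OF bounded_bilinear_scaleC])
    fix e :: real assume e: "e > 0"
    define d where "d = min (1 / (2 * (norm ?R + 1))) (e / (2 * norm ?R ^ 3 + 1))"
    have p: "2 * norm ?R ^ 3 + 1 > 0" "2 * (norm ?R + 1) > 0" by (simp_all add: add_nonneg_pos)
    have d: "d > 0" using e p by (simp add: d_def)
    have "norm (resolvent a w - ?R - (w - z) *\<^sub>C (- (?R * ?R))) \<le> e * norm (w - z)"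
      if w: "norm (w - z) < d" for w
    proof -
      let ?h = "(z - w) *\<^sub>C (1 :: 'a)"
      have nh: "norm ?h = norm (w - z)" by (simp add: norm_scaleC norm_minus_commute)
      have "norm ?R * norm (w - z) \<le> norm ?R * (1 / (2 * (norm ?R + 1)))"
        using w by (intro mult_left_mono) (auto simp: d_def)
      also have "\<dots> \<le> 1 / 2" using p by (simp add: field_simps)
      finally have "norm ?R * norm ?h \<le> 1 / 2" by (simp only: nh)
      from resolvent_perturb(4)[OF z this]
      have "norm (resolvent (a + ?h) z - ?R - ?R * ?h * ?R) \<le> 2 * norm ?R ^ 3 * (norm (w - z))\<^sup>2"
        by (simp only: nh)
      also have "resolvent (a + ?h) z = resolvent a w" by (rule resolvent_shift(1)[symmetric])
      also have "?R * ?h * ?R = (w - z) *\<^sub>C (- (?R * ?R))"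
        using scaleC_minus_left[of "w - z" "?R * ?R"]
        by (simp add: mult_scaleC_left mult_scaleC_right scaleC_minus_right)
      finally have "norm (resolvent a w - ?R - (w - z) *\<^sub>C (- (?R * ?R))) \<le> (2 * norm ?R ^ 3 * norm (w - z)) * norm (w - z)"
        by (simp add: power2_eq_square mult.assoc)
      also have "\<dots> \<le> e * norm (w - z)"
      proof (rule mult_right_mono)
        have "2 * norm ?R ^ 3 * norm (w - z) \<le> (2 * norm ?R ^ 3 + 1) * (e / (2 * norm ?R ^ 3 + 1))"
          using w p e by (intro mult_mono) (auto simp: d_def)
        then show "2 * norm ?R ^ 3 * norm (w - z) \<le> e" using p by simp
      qed simp
      finally show ?thesis .
    qed
    then show "\<exists>d>0. \<forall>y\<in>UNIV. norm (y - z) < d \<longrightarrow>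
        norm (resolvent a y - ?R - (y - z) *\<^sub>C (- (?R * ?R))) \<le> e * norm (y - z)"
      using d by blast
  qed
  then show "\<exists>D. (resolvent a has_derivative (\<lambda>h. h *\<^sub>C D)) (at z within S)"
    using has_derivative_at_withinI by blast
qed

lemma continuous_on_resolvent:
  "S \<inter> spectrum a = {} \<Longrightarrow> continuous_on S (resolvent (a :: 'a::complex_banach_algebra_1))"
  by (intro vholomorphic_on_imp_continuous_on vholomorphic_on_resolvent)

lemma norm_resolvent_le:
  fixes a :: "'a::complex_banach_algebra_1"
  assumes "norm a < cmod z"
  shows "norm (resolvent a z) \<le> 1 / (cmod z - norm a)"
proof -
  have "z \<notin> spectrum a" using assms norm_le_spectrum[of z a] by auto
  from resolvent_eq_left[OF this] have "cmod z * norm (resolvent a z) \<le> 1 + norm (a * resolvent a z)"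
    using norm_triangle_ineq[of 1 "a * resolvent a z"] by (simp flip: norm_scaleC)
  then have "cmod z * norm (resolvent a z) \<le> 1 + norm a * norm (resolvent a z)"
    using norm_mult_ineq[of a "resolvent a z"] by linarith
  then show ?thesis using assms by (simp add: field_simps)
qed

lemma Cauchy_chain_mono: "Cauchy_chain E L U \<Longrightarrow> U \<subseteq> V \<Longrightarrow> Cauchy_chain E L V"
  unfolding Cauchy_chain_def by (blast intro: holomorphic_on_subset)

text \<open>The integral of the resolvent does not change when the chain is deformed to a circle of
  large radius, on which the resolvent differs from \<open>1 / z\<close> by a quantity of order
  \<open>1 / |z|\<^sup>2\<close>.\<close>

lemma Cauchy_chain_resolvent:
  fixes a :: "'a::complex_banach_algebra_1"
  assumes E: "Cauchy_chain E L U" and U: "open U" and L: "compact L" "spectrum a \<subseteq> L"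
  shows "cycle_integral E (resolvent a) = (2 * pi * \<i>) *\<^sub>C 1"
proof -
  let ?\<sigma> = "spectrum a"
  have closed: "closed ?\<sigma>" using compact_spectrum compact_imp_closed by blast
  have E': "Cauchy_chain E L UNIV" using E by (rule Cauchy_chain_mono) simp
  have hol: "resolvent a vholomorphic_on (UNIV - ?\<sigma>)" by (rule vholomorphic_on_resolvent) auto
  have bound: "norm (cycle_integral E (resolvent a) - (2 * pi * \<i>) *\<^sub>C 1) \<le> 2 * pi * norm a / (r - norm a)"
    if r: "r > norm a" for r
  proof -
    have r0: "r > 0" using r norm_ge_zero[of a] by linarith
    let ?c = "circlepath 0 r"
    have img: "path_image ?c = sphere 0 r" using r0 by simp
    have off: "z \<notin> ?\<sigma>" if "cmod z = r" for z using norm_le_spectrum[of z a] that r by auto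
    have lt: "cmod z < r" if "z \<in> ?\<sigma>" for z using norm_le_spectrum[OF that] r by linarith
    have "surrounds [?c] ?\<sigma> UNIV"
      unfolding surrounds_def cycle_in_def cycle_winding_def
      using off r0 by (auto intro!: winding_number_circlepath lt)
    then have "cycle_integral E (resolvent a) = cycle_integral [?c] (resolvent a)"
      using vCauchy_chain_integral_eq[OF open_UNIV L(1) closed L(2) E' _ hol] by simp
    also have "\<dots> = integral {0..1} (path_integrand ?c (resolvent a))" by (simp add: cycle_integral_def)
    finally have 1: "cycle_integral E (resolvent a) = integral {0..1} (path_integrand ?c (resolvent a))" .
    have i1: "path_integrand ?c (resolvent a) integrable_on {0..1}"
      by (rule path_integrand_integrable[OF _ hol]) (use closed off img in auto)
    define J where "J t = (2 * pi * \<i>) *\<^sub>C (1 :: 'a)" for t :: real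
    have J: "J integrable_on {0..1}" "integral {0..1} J = (2 * pi * \<i>) *\<^sub>C 1"
      unfolding J_def by auto
    have "norm (integral {0..1} (\<lambda>t. path_integrand ?c (resolvent a) t - J t))
        \<le> integral {0..1} (\<lambda>t::real. 2 * pi * norm a / (r - norm a))"
    proof (rule integral_norm_bound_integral)
      show "(\<lambda>t. path_integrand ?c (resolvent a) t - J t) integrable_on {0..1}"
        using i1 J(1) by (rule integrable_diff)
      fix t :: real assume t: "t \<in> {0..1}"
      let ?z = "?c t" and ?R = "resolvent a (?c t)"
      have z: "cmod ?z = r" using r0 by (simp add: circlepath norm_mult)
      have vd: "vector_derivative ?c (at t within {0..1}) = 2 * pi * \<i> * ?z"
      proof -
        have "?z = r * exp (2 * pi * \<i> * t)" by (simp add: circlepath)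
        then show ?thesis using vector_derivative_circlepath01[of t 0 r] t by simp
      qed
      have "path_integrand ?c (resolvent a) t - J t = (2 * pi * \<i>) *\<^sub>C (?z *\<^sub>C ?R) - (2 * pi * \<i>) *\<^sub>C 1"
        by (simp only: vd J_def scaleC_scaleC)
      also have "\<dots> = (2 * pi * \<i>) *\<^sub>C (a * ?R)"
        unfolding scaleC_diff_right[symmetric] resolvent_eq_left[OF off[OF z]] by simp
      finally have "norm (path_integrand ?c (resolvent a) t - J t) = 2 * pi * norm (a * ?R)"
        by (simp add: norm_scaleC norm_mult)
      also have "\<dots> \<le> 2 * pi * (norm a * (1 / (r - norm a)))"
        using norm_mult_ineq[of a ?R] norm_resolvent_le[of a ?z] r z
        by (intro mult_left_mono order_trans[OF norm_mult_ineq] mult_mono) auto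
      finally show "norm (path_integrand ?c (resolvent a) t - J t) \<le> 2 * pi * norm a / (r - norm a)" by simp
    qed auto
    then show ?thesis
      using integral_diff[OF i1 J(1)] by (simp add: 1 J(2))
  qed
  have "((\<lambda>r. 2 * pi * norm a / (r - norm a)) \<longlongrightarrow> 0) at_top"
    by real_asymp
  moreover have "\<forall>\<^sub>F r in at_top. norm (cycle_integral E (resolvent a) - (2 * pi * \<i>) *\<^sub>C 1) \<le> 2 * pi * norm a / (r - norm a)"
    using eventually_gt_at_top[of "norm a"] by eventually_elim (rule bound)
  ultimately have "norm (cycle_integral E (resolvent a) - (2 * pi * \<i>) *\<^sub>C 1) \<le> 0"
    by (intro tendsto_lowerbound) auto
  then show ?thesis by simp
qed

definition chain_calculus ::
  "(real \<Rightarrow> complex) list \<Rightarrow> 'a::complex_banach_algebra_1 \<Rightarrow> (complex \<Rightarrow> complex) \<Rightarrow> 'a" where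
  "chain_calculus E a g = (1 / (2 * pi * \<i>)) *\<^sub>C cycle_integral E (\<lambda>z. g z *\<^sub>C resolvent a z)"

text \<open>The one-variable calculus of \<open>a\<close> with a fixed chain.  Only its restriction to rational functions has
  to be multiplicative; this is obtained below from the equation \<open>z R = 1 + a R\<close> of the resolvent
  \<open>R\<close>.\<close>

locale spectral_chain =
  fixes U L :: "complex set" and E and a :: "'a::complex_banach_algebra_1"
  assumes U: "open U" and L: "compact L" and E: "Cauchy_chain E L U" and spec: "spectrum a \<subseteq> L"
begin

lemma poly_E: "polygonal E (U - L)"
  using E by (rule polygonal_Cauchy_chain)

lemma cont_res: "continuous_on (U - L) (resolvent a)"
  using spec by (intro continuous_on_resolvent) auto

lemma calculus_cong:
  assumes "\<And>z. z \<in> U \<Longrightarrow> g z = g' z" shows "chain_calculus E a g = chain_calculus E a g'"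
proof -
  have "cycle_integral E (\<lambda>z. g z *\<^sub>C resolvent a z) = cycle_integral E (\<lambda>z. g' z *\<^sub>C resolvent a z)"
    by (rule polygonal_integral_cong[OF poly_E]) (use assms in auto)
  then show ?thesis by (simp add: chain_calculus_def)
qed

lemma cont_integrand:
  "g holomorphic_on U \<Longrightarrow> continuous_on (U - L) (\<lambda>z. g z *\<^sub>C resolvent a z)"
  by (intro continuous_intros cont_res continuous_on_subset[OF holomorphic_on_imp_continuous_on]) auto

lemma calculus_add:
  assumes "g holomorphic_on U" "g' holomorphic_on U"
  shows "chain_calculus E a (\<lambda>z. g z + g' z) = chain_calculus E a g + chain_calculus E a g'"
  unfolding chain_calculus_def scaleC_add_left scaleC_add_right[symmetric]
  using polygonal_integral_add[OF poly_E cont_integrand[OF assms(1)] cont_integrand[OF assms(2)]] by simp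

lemma calculus_scale:
  assumes "g holomorphic_on U"
  shows "chain_calculus E a (\<lambda>z. c * g z) = c *\<^sub>C chain_calculus E a g"
  using polygonal_integral_clinear[OF poly_E cont_integrand[OF assms] bounded_clinear_scaleC[of c]]
  by (simp add: chain_calculus_def scaleC_scaleC mult.commute)

lemma calculus_one: "chain_calculus E a (\<lambda>z. 1) = 1"
  using Cauchy_chain_resolvent[OF E U L spec] by (simp add: chain_calculus_def scaleC_scaleC)

text \<open>Since \<open>z R = 1 + a R\<close> for the resolvent \<open>R\<close>, the two sides differ by the integral of \<open>g\<close>, which is 0.\<close>

lemma calculus_id_mult:
  assumes g: "g holomorphic_on U"
  shows "chain_calculus E a (\<lambda>z. z * g z) = a * chain_calculus E a g"
    "chain_calculus E a (\<lambda>z. z * g z) = chain_calculus E a g * a"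
proof -
  have gc: "continuous_on (U - L) g"
    using g holomorphic_on_imp_continuous_on continuous_on_subset by blast
  have one: "bounded_clinear (\<lambda>c::complex. c *\<^sub>C (1 :: 'a))"
    by (simp add: bounded_clinear_def bounded_bilinear.bounded_linear_left[OF bounded_bilinear_scaleC]
        scaleC_complex_def scaleC_scaleC)
  have "cycle_integral E g = 0" using E g by (simp add: Cauchy_chain_def)
  then have 0: "cycle_integral E (\<lambda>z. g z *\<^sub>C (1 :: 'a)) = 0"
    using polygonal_integral_clinear[OF poly_E gc one] by simp
  have c1: "continuous_on (U - L) (\<lambda>z. g z *\<^sub>C (1 :: 'a))" by (intro continuous_intros gc)
  have *: "cycle_integral E (\<lambda>z. (z * g z) *\<^sub>C resolvent a z) = M (cycle_integral E (\<lambda>z. g z *\<^sub>C resolvent a z))"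
    if M: "bounded_clinear M" "\<And>z. z \<notin> spectrum a \<Longrightarrow> z *\<^sub>C resolvent a z = 1 + M (resolvent a z)" for M
  proof -
    have Mc: "M (c *\<^sub>C x) = c *\<^sub>C M x" for c x using M(1) by (simp add: bounded_clinear_def)
    have cM: "continuous_on (U - L) (\<lambda>z. M (g z *\<^sub>C resolvent a z))"
      by (rule bounded_linear.continuous_on[OF _ cont_integrand[OF g]]) (use M(1) in \<open>simp add: bounded_clinear_def\<close>)
    have "cycle_integral E (\<lambda>z. (z * g z) *\<^sub>C resolvent a z)
        = cycle_integral E (\<lambda>z. g z *\<^sub>C 1 + M (g z *\<^sub>C resolvent a z))"
    proof (rule polygonal_integral_cong[OF poly_E])
      fix z assume "z \<in> U - L"
      then have "z \<notin> spectrum a" using spec by blast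
      have "(z * g z) *\<^sub>C resolvent a z = g z *\<^sub>C (z *\<^sub>C resolvent a z)"
        by (simp add: scaleC_scaleC mult.commute)
      then show "(z * g z) *\<^sub>C resolvent a z = g z *\<^sub>C 1 + M (g z *\<^sub>C resolvent a z)"
        by (simp add: M(2)[OF \<open>z \<notin> spectrum a\<close>] scaleC_add_right Mc)
    qed
    also have "\<dots> = M (cycle_integral E (\<lambda>z. g z *\<^sub>C resolvent a z))"
      using polygonal_integral_add[OF poly_E c1 cM] 0
        polygonal_integral_clinear[OF poly_E cont_integrand[OF g] M(1)] by simp
    finally show ?thesis .
  qed
  show "chain_calculus E a (\<lambda>z. z * g z) = a * chain_calculus E a g"
    using *[OF bounded_clinear_mult(2) resolvent_eq_left] by (simp add: chain_calculus_def mult_scaleC_right)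
  show "chain_calculus E a (\<lambda>z. z * g z) = chain_calculus E a g * a"
    using *[OF bounded_clinear_mult(1) resolvent_eq_right] by (simp add: chain_calculus_def mult_scaleC_left)
qed

text \<open>Both orders of the factors are treated in order to obtain two-sided inverses below.\<close>

lemma calculus_poly_mult:
  assumes g: "g holomorphic_on U"
  shows "chain_calculus E a (\<lambda>z. poly p z * g z) = chain_calculus E a (poly p) * chain_calculus E a g"
    and "chain_calculus E a (\<lambda>z. poly p z * g z) = chain_calculus E a g * chain_calculus E a (poly p)"
proof (induction p)
  case 0
  {
    case 1
    show ?case using calculus_scale[OF g, of 0] calculus_scale[of "\<lambda>z. 1" 0] by (simp add: calculus_one)
  next
    case 2
    show ?case using calculus_scale[OF g, of 0] calculus_scale[of "\<lambda>z. 1" 0] by (simp add: calculus_one)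
  }
next
  case (pCons c p)
  have h: "(\<lambda>z. poly p z * g z) holomorphic_on U" "poly p holomorphic_on U" "(\<lambda>z. c * g z) holomorphic_on U"
    "(\<lambda>z. z * (poly p z * g z)) holomorphic_on U" "(\<lambda>z. z * poly p z) holomorphic_on U"
    "(\<lambda>z. c) holomorphic_on U"
    by (intro holomorphic_intros g)+
  have 1: "chain_calculus E a (\<lambda>z. poly (pCons c p) z * g z)
      = c *\<^sub>C chain_calculus E a g + chain_calculus E a (\<lambda>z. z * (poly p z * g z))"
    using calculus_add[OF h(3,4)] calculus_scale[OF g, of c] by (simp add: algebra_simps)
  have "poly (pCons c p) = (\<lambda>z. c * 1 + z * poly p z)" by auto
  then have 2: "chain_calculus E a (poly (pCons c p)) = c *\<^sub>C 1 + chain_calculus E a (\<lambda>z. z * poly p z)"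
    using calculus_add[of "\<lambda>z. c * 1" "\<lambda>z. z * poly p z"] h calculus_scale[of "\<lambda>z. 1" c]
    by (simp add: calculus_one)
  {
    case 1
    show ?case
      unfolding \<open>chain_calculus E a (\<lambda>z. poly (pCons c p) z * g z) = _\<close> 2 calculus_id_mult(1)[OF h(1)]
        calculus_id_mult(1)[OF h(2)]
      by (simp add: pCons.IH(1) distrib_right mult_scaleC_left mult.assoc)
  next
    case 2
    show ?case
      unfolding 1 \<open>chain_calculus E a (poly (pCons c p)) = _\<close> calculus_id_mult(2)[OF h(1)]
        calculus_id_mult(2)[OF h(2)]
      by (simp add: pCons.IH(2) distrib_left mult_scaleC_right mult.assoc)
  }
qed

lemma calculus_rational_inverse:
  assumes q: "\<And>z. z \<in> U \<Longrightarrow> poly q z \<noteq> 0"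
  shows "is_inverse (chain_calculus E a (poly q)) (chain_calculus E a (\<lambda>z. 1 / poly q z))"
proof -
  have g: "(\<lambda>z. 1 / poly q z) holomorphic_on U" using q by (intro holomorphic_intros) auto
  have "chain_calculus E a (\<lambda>z. poly q z * (1 / poly q z)) = chain_calculus E a (\<lambda>z. 1)"
    by (rule calculus_cong) (use q in auto)
  then show ?thesis
    using calculus_poly_mult[OF g, of q] by (simp add: is_inverse_def calculus_one)
qed

text \<open>Multiply by the value of the denominator, which is invertible.\<close>

lemma calculus_rational_mult:
  assumes r: "rational_on U r" and g: "g holomorphic_on U"
  shows "chain_calculus E a (\<lambda>z. r z * g z) = chain_calculus E a r * chain_calculus E a g"
proof -
  obtain p q where q: "\<And>z. z \<in> U \<Longrightarrow> poly q z \<noteq> 0" and r: "r = (\<lambda>z. poly p z / poly q z)"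
    using r by (auto simp: rational_on_def)
  let ?C = "chain_calculus E a" and ?i = "\<lambda>z. 1 / poly q z"
  have rh: "r holomorphic_on U" unfolding r using q by (intro holomorphic_intros) auto
  have key: "?C (\<lambda>z. r z * h z) = ?C ?i * (?C (poly p) * ?C h)" if h: "h holomorphic_on U" for h
  proof -
    have "?C (poly q) * ?C (\<lambda>z. r z * h z) = ?C (\<lambda>z. poly q z * (r z * h z))"
      using calculus_poly_mult(1)[of "\<lambda>z. r z * h z" q] holomorphic_on_mult[OF rh h] by simp
    also have "\<dots> = ?C (\<lambda>z. poly p z * h z)" by (rule calculus_cong) (use q in \<open>auto simp: r\<close>)
    also have "\<dots> = ?C (poly p) * ?C h" by (rule calculus_poly_mult(1)[OF h])
    finally have "?C ?i * (?C (poly q) * ?C (\<lambda>z. r z * h z)) = ?C ?i * (?C (poly p) * ?C h)" by simp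
    then show ?thesis
      using calculus_rational_inverse[OF q] by (simp add: is_inverse_def mult.assoc[symmetric])
  qed
  have "?C r = ?C ?i * ?C (poly p)"
    using key[of "\<lambda>z. 1"] by (simp add: calculus_one)
  then show ?thesis by (simp add: key[OF g] mult.assoc)
qed

lemma calculus_resolvent:
  assumes "w \<notin> U"
  shows "chain_calculus E a (\<lambda>z. 1 / (w - z)) = resolvent a w"
proof -
  have "chain_calculus E a (poly [:w, -1:]) = chain_calculus E a (\<lambda>z. w * 1 + (-1) * (z * 1))"
    by (rule calculus_cong) simp
  also have "\<dots> = w *\<^sub>C 1 - a"
    using calculus_add[of "\<lambda>z. w * 1" "\<lambda>z. (-1) * (z * 1)"] calculus_scale[of "\<lambda>z. 1" w]
      calculus_scale[of "\<lambda>z. z * 1" "-1"] calculus_id_mult(1)[of "\<lambda>z. 1"]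
    by (simp add: calculus_one scaleC_minus_one holomorphic_intros)
  finally have "is_inverse (w *\<^sub>C 1 - a) (chain_calculus E a (\<lambda>z. 1 / poly [:w, -1:] z))"
    using calculus_rational_inverse[of "[:w, -1:]"] assms by auto
  then show ?thesis by (simp add: resolvent_eqI)
qed

lemma calculus_commute:
  assumes g: "g holomorphic_on U" and c: "a * c = c * a"
  shows "chain_calculus E a g * c = c * chain_calculus E a g"
proof -
  have "cycle_integral E (\<lambda>z. (g z *\<^sub>C resolvent a z) * c) = cycle_integral E (\<lambda>z. c * (g z *\<^sub>C resolvent a z))"
  proof (rule polygonal_integral_cong[OF poly_E])
    fix z assume "z \<in> U - L"
    then have "z \<notin> spectrum a" using spec by blast
    have "(z *\<^sub>C 1 - a) * c = c * (z *\<^sub>C 1 - a)"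
      using c by (simp add: left_diff_distrib right_diff_distrib mult_scaleC_left mult_scaleC_right)
    then have "resolvent a z * c = c * resolvent a z"
      using is_inverse_commute resolvent_is_inverse[OF \<open>z \<notin> spectrum a\<close>] by blast
    then show "(g z *\<^sub>C resolvent a z) * c = c * (g z *\<^sub>C resolvent a z)"
      by (simp add: mult_scaleC_left mult_scaleC_right)
  qed
  then show ?thesis
    using polygonal_integral_clinear[OF poly_E cont_integrand[OF g] bounded_clinear_mult(1)[of c]]
      polygonal_integral_clinear[OF poly_E cont_integrand[OF g] bounded_clinear_mult(2)[of c]]
    by (simp add: chain_calculus_def mult_scaleC_left mult_scaleC_right)
qed

text \<open>The coefficients \<open>y j\<close> stay inside the norm: the sum is the integral of the resolvent times
  \<open>\<Sum> r j z *\<^sub>C y j\<close>.  This form of the estimate can be iterated over several variables.\<close>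

lemma calculus_bound:
  obtains C where "C \<ge> 0" "\<And>J r y B. (\<And>j. j \<in> (J :: nat set) \<Longrightarrow> r j holomorphic_on U) \<Longrightarrow>
    (\<And>z. z \<in> chain_image E \<Longrightarrow> norm (\<Sum>j\<in>J. r j z *\<^sub>C y j) \<le> B) \<Longrightarrow>
    norm (\<Sum>j\<in>J. chain_calculus E a (r j) * y j) \<le> C * B"
proof -
  have K: "compact (chain_image E)" "chain_image E \<subseteq> U - L" "polygonal E (chain_image E)"
    using poly_E compact_chain_image[OF poly_E] polygonal_chain_image by blast+
  have "bounded (resolvent a ` chain_image E)"
    by (intro compact_imp_bounded compact_continuous_image K continuous_on_subset[OF cont_res])
  then obtain B0 where B0: "\<And>z. z \<in> chain_image E \<Longrightarrow> norm (resolvent a z) \<le> B0"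
    by (auto simp: bounded_iff)
  define B1 where "B1 = max B0 0"
  have B1: "B1 \<ge> 0" "\<And>z. z \<in> chain_image E \<Longrightarrow> norm (resolvent a z) \<le> B1"
    using B0 by (auto simp: B1_def le_max_iff_disj)
  define C where "C = B1 * chain_length E / (2 * pi)"
  have "C \<ge> 0" using B1 chain_length_nonneg[of E] by (simp add: C_def)
  moreover have "norm (\<Sum>j\<in>J. chain_calculus E a (r j) * y j) \<le> C * B"
    if r: "\<And>j. j \<in> J \<Longrightarrow> r j holomorphic_on U"
      and B: "\<And>z. z \<in> chain_image E \<Longrightarrow> norm (\<Sum>j\<in>J. r j z *\<^sub>C y j) \<le> B" for J :: "nat set" and r y B
  proof -
    have cj: "continuous_on (U - L) (\<lambda>z. (r j z *\<^sub>C resolvent a z) * y j)" if "j \<in> J" for j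
      by (intro continuous_intros cont_integrand r that)
    have eq: "(\<Sum>j\<in>J. (r j z *\<^sub>C resolvent a z) * y j) = resolvent a z * (\<Sum>j\<in>J. r j z *\<^sub>C y j)" for z
      by (simp add: sum_distrib_left mult_scaleC_left mult_scaleC_right)
    have "(\<Sum>j\<in>J. cycle_integral E (\<lambda>z. r j z *\<^sub>C resolvent a z) * y j)
        = (\<Sum>j\<in>J. cycle_integral E (\<lambda>z. (r j z *\<^sub>C resolvent a z) * y j))"
      by (intro sum.cong refl polygonal_integral_clinear[OF poly_E cont_integrand bounded_clinear_mult(1), symmetric] r)
    also have "\<dots> = cycle_integral E (\<lambda>z. \<Sum>j\<in>J. (r j z *\<^sub>C resolvent a z) * y j)"
      by (rule polygonal_integral_sum[OF poly_E cj, symmetric])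
    finally have "norm (\<Sum>j\<in>J. cycle_integral E (\<lambda>z. r j z *\<^sub>C resolvent a z) * y j)
        = norm (cycle_integral E (\<lambda>z. \<Sum>j\<in>J. (r j z *\<^sub>C resolvent a z) * y j))" by simp
    also have "\<dots> \<le> B1 * B * chain_length E"
    proof (rule polygonal_integral_bound[OF K(3)])
      show "continuous_on (chain_image E) (\<lambda>z. \<Sum>j\<in>J. (r j z *\<^sub>C resolvent a z) * y j)"
        by (intro continuous_on_sum continuous_on_subset[OF cj K(2)])
      fix z assume z: "z \<in> chain_image E"
      show "norm (\<Sum>j\<in>J. (r j z *\<^sub>C resolvent a z) * y j) \<le> B1 * B"
        unfolding eq using B1(2)[OF z] B[OF z] B1(1)
        by (intro order_trans[OF norm_mult_ineq] mult_mono) auto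
    qed
    finally have *: "norm (\<Sum>j\<in>J. cycle_integral E (\<lambda>z. r j z *\<^sub>C resolvent a z) * y j) \<le> B1 * B * chain_length E" .
    have "(\<Sum>j\<in>J. chain_calculus E a (r j) * y j)
        = (1 / (2 * pi * \<i>)) *\<^sub>C (\<Sum>j\<in>J. cycle_integral E (\<lambda>z. r j z *\<^sub>C resolvent a z) * y j)"
      by (simp add: chain_calculus_def mult_scaleC_left scaleC_sum_right)
    also have "norm \<dots> \<le> 1 / (2 * pi) * (B1 * B * chain_length E)"
      unfolding norm_scaleC using * by (intro mult_mono) (auto simp: norm_divide norm_mult)
    finally show ?thesis by (simp add: C_def algebra_simps)
  qed
  ultimately show ?thesis using that by blast
qed

end


section \<open>Linear maps on the projective tensor power\<close>

lemma completion_representative: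
  obtains X where "seminorm_Cauchy X" "x = abs_completion X"
  using Quotient_abs_rep[OF Quotient_completion, of x] Quotient_rep_reflp[OF Quotient_completion, of x]
  by (metis completion_rel_refl)

lemma to_completion_add: "to_completion (v + w) = to_completion v + to_completion w"
  by transfer (auto simp: completion_rel_refl seminorm_Cauchy_const)

lemma to_completion_scaleC: "to_completion (c *\<^sub>C v) = c *\<^sub>C to_completion v"
  by transfer (auto simp: completion_rel_refl seminorm_Cauchy_const)

text \<open>The limits of \<open>T\<close> along Cauchy sequences respect the identification of sequences because \<open>T\<close> is
  dominated by the seminorm.\<close>

lemma completion_extension:
  fixes T :: "'v::complex_seminormed_algebra_1 \<Rightarrow> 'c::complex_banach_algebra_1"
  assumes add: "\<And>v w. T (v + w) = T v + T w" and scale: "\<And>c v. T (c *\<^sub>C v) = c *\<^sub>C T v"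
    and bound: "\<And>v. norm (T v) \<le> seminorm v"
  obtains L :: "'v completion \<Rightarrow> 'c" where "bounded_clinear L" "\<And>v. L (to_completion v) = T v"
proof -
  have minus: "T (v - w) = T v - T w" for v w
    using add[of "v - w" w] by simp
  define L where "L x = lim (\<lambda>n. T (rep_completion x n))" for x :: "'v completion"
  have lim: "(\<lambda>n. T (X n)) \<longlonglongrightarrow> L (abs_completion X)" if X: "seminorm_Cauchy X" for X
  proof -
    have rel: "completion_rel (rep_completion (abs_completion X)) X"
      using Quotient_rep_abs[OF Quotient_completion, of X] X by (simp add: completion_rel_refl)
    have "Cauchy (\<lambda>n. T (X n))"
      unfolding Cauchy_def dist_norm minus[symmetric]
      using X bound unfolding seminorm_Cauchy_def by (meson order_le_less_trans)
    then have conv: "(\<lambda>n. T (X n)) \<longlonglongrightarrow> lim (\<lambda>n. T (X n))"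
      using Cauchy_convergent_iff convergent_LIMSEQ_iff by blast
    have "(\<lambda>n. T (rep_completion (abs_completion X) n - X n)) \<longlonglongrightarrow> 0"
      by (rule Lim_null_comparison[of _ "\<lambda>n. seminorm (rep_completion (abs_completion X) n - X n)"])
         (use rel bound in \<open>auto simp: completion_rel_def\<close>)
    from tendsto_add[OF this conv]
    have "(\<lambda>n. T (rep_completion (abs_completion X) n)) \<longlonglongrightarrow> lim (\<lambda>n. T (X n))"
      by (simp add: minus)
    then have "L (abs_completion X) = lim (\<lambda>n. T (X n))" unfolding L_def by (rule limI)
    then show ?thesis using conv by simp
  qed
  have Ladd: "L (x + y) = L x + L y" for x y
  proof -
    obtain X Y where X: "seminorm_Cauchy X" "x = abs_completion X" and Y: "seminorm_Cauchy Y" "y = abs_completion Y"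
      using completion_representative by metis
    have "x + y = abs_completion (\<lambda>n. X n + Y n)"
      using X Y by (simp add: plus_completion.abs_eq completion_rel_refl)
    then have "(\<lambda>n. T (X n + Y n)) \<longlonglongrightarrow> L (x + y)"
      using lim[OF seminorm_Cauchy_add[OF X(1) Y(1)]] by simp
    moreover have "(\<lambda>n. T (X n + Y n)) \<longlonglongrightarrow> L x + L y"
      using tendsto_add[OF lim[OF X(1)] lim[OF Y(1)]] by (simp add: add X Y)
    ultimately show ?thesis by (rule LIMSEQ_unique)
  qed
  have Lscale: "L (c *\<^sub>C x) = c *\<^sub>C L x" for c x
  proof -
    obtain X where X: "seminorm_Cauchy X" "x = abs_completion X" using completion_representative .
    have "c *\<^sub>C x = abs_completion (\<lambda>n. c *\<^sub>C X n)"
      using X by (simp add: scaleC_completion.abs_eq completion_rel_refl)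
    then have "(\<lambda>n. T (c *\<^sub>C X n)) \<longlonglongrightarrow> L (c *\<^sub>C x)"
      using lim[OF seminorm_Cauchy_scaleC[OF X(1)]] by simp
    moreover have "(\<lambda>n. T (c *\<^sub>C X n)) \<longlonglongrightarrow> c *\<^sub>C L x"
      using tendsto_scaleC[OF tendsto_const lim[OF X(1)], of c] by (simp add: scale X)
    ultimately show ?thesis by (rule LIMSEQ_unique)
  qed
  have Lbound: "norm (L x) \<le> norm x" for x
  proof -
    obtain X where X: "seminorm_Cauchy X" "x = abs_completion X" using completion_representative .
    have 1: "(\<lambda>n. seminorm (X n)) \<longlonglongrightarrow> norm x"
      using seminorm_tendsto_lim[OF X(1)] X by (simp add: norm_completion.abs_eq completion_rel_refl)
    have 2: "(\<lambda>n. norm (T (X n))) \<longlonglongrightarrow> norm (L x)"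
      using tendsto_norm[OF lim[OF X(1)]] X(2) by simp
    show ?thesis by (rule LIMSEQ_le[OF 2 1]) (use bound in auto)
  qed
  have "bounded_linear L"
  proof (rule bounded_linear_intro[where K = 1])
    show "L (r *\<^sub>R x) = r *\<^sub>R L x" for r x
      using Lscale[of "complex_of_real r" x] by (simp add: scaleC_of_real)
  qed (use Ladd Lbound in auto)
  then have "bounded_clinear L" using Lscale by (simp add: bounded_clinear_def)
  moreover have "L (to_completion v) = T v" for v
  proof -
    have "(\<lambda>n. T v) \<longlonglongrightarrow> L (abs_completion (\<lambda>n. v))" using lim[OF seminorm_Cauchy_const] .
    then have "L (abs_completion (\<lambda>n. v)) = T v" using LIMSEQ_unique tendsto_const by blast
    then show ?thesis by (simp add: to_completion.abs_eq)
  qed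
  ultimately show ?thesis using that by blast
qed

text \<open>Multiplication of the factors in any prescribed order is multilinear and is bounded by the projective
  norm.\<close>

lemma tensor_multiplication_map:
  fixes "is" :: "'n::finite list"
  assumes "is": "distinct is" "set is = UNIV"
  obtains M :: "('b::complex_banach_algebra_1, 'n) proj_tensor \<Rightarrow> 'b"
  where "bounded_clinear M" "\<And>t. M (ptensor t) = prod_list (map t is)"
proof -
  define T where "T v = mult_out is (rep_alg_tensor v)" for v :: "('b, 'n) alg_tensor"
  have T: "T (abs_alg_tensor w) = mult_out is w" for w
  proof -
    have "rep_alg_tensor (abs_alg_tensor w) - w \<in> multilin_rel"
      using Quotient_rep_abs[OF Quotient_alg_tensor, of w] by (simp add: multilin_rel.zero)
    from mult_out_rel[OF this "is"] show ?thesis by (simp add: T_def mult_out_diff)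
  qed
  have ab: "\<exists>w. v = abs_alg_tensor w" for v :: "('b, 'n) alg_tensor"
    using Quotient_abs_rep[OF Quotient_alg_tensor, of v] by metis
  obtain L :: "('b, 'n) proj_tensor \<Rightarrow> 'b" where L: "bounded_clinear L" "\<And>v. L (to_completion v) = T v"
  proof (rule completion_extension[of T])
    fix v w :: "('b, 'n) alg_tensor" and c
    obtain v' w' where vw: "v = abs_alg_tensor v'" "w = abs_alg_tensor w'" using ab by metis
    show "T (v + w) = T v + T w" by (simp add: vw plus_alg_tensor.abs_eq T mult_out_add)
    show "T (c *\<^sub>C v) = c *\<^sub>C T v" by (simp add: vw scaleC_alg_tensor.abs_eq T mult_out_scale)
    have "norm (mult_out is v') \<le> proj_seminorm v'"
    proof (rule proj_seminorm_ge)
      fix u assume "u - v' \<in> multilin_rel"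
      from mult_out_rel[OF this "is"] have "mult_out is v' = mult_out is u" by (simp add: mult_out_diff)
      then show "norm (mult_out is v') \<le> formal_norm u" using norm_mult_out[OF "is", of u] by simp
    qed
    then show "norm (T v) \<le> seminorm v" by (simp add: vw T seminorm_alg_tensor.abs_eq)
  qed blast
  have "L (ptensor t) = prod_list (map t is)" for t
    by (simp add: ptensor_def L(2) pure_tensor.abs_eq T mult_out_single)
  then show ?thesis using that L(1) by blast
qed

text \<open>Combinations of elementary tensors are dense.\<close>

lemma bounded_clinear_eqI_ptensor:
  fixes M M' :: "('b::complex_banach_algebra_1, 'n::finite) proj_tensor \<Rightarrow> 'c::complex_banach_algebra_1"
  assumes M: "bounded_clinear M" "bounded_clinear M'" and eq: "\<And>t. M (ptensor t) = M' (ptensor t)"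
  shows "M = M'"
proof -
  have lin: "N (x + y) = N x + N y" "N (c *\<^sub>C x) = c *\<^sub>C N x" if "bounded_clinear N"
    for N :: "('b, 'n) proj_tensor \<Rightarrow> 'c" and x y c
    using that by (auto simp: bounded_clinear_def linear_add bounded_linear.linear)
  have free: "M (to_completion (abs_alg_tensor w)) = M' (to_completion (abs_alg_tensor w))" for w
  proof -
    have single: "M (to_completion (abs_alg_tensor (Poly_Mapping.single t c)))
        = M' (to_completion (abs_alg_tensor (Poly_Mapping.single t c)))" for t c
    proof -
      have "abs_alg_tensor (Poly_Mapping.single t c) = c *\<^sub>C pure_tensor (entry t)"
        using single_conv_free_scale[of t c] by (simp add: pure_tensor.abs_eq scaleC_alg_tensor.abs_eq)
      then show ?thesis
        using eq[of "entry t"] by (simp add: to_completion_scaleC lin[OF M(1)] lin[OF M(2)] ptensor_def)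
    qed
    have "M (to_completion (abs_alg_tensor (\<Sum>t\<in>S. Poly_Mapping.single t (Poly_Mapping.lookup w t))))
        = M' (to_completion (abs_alg_tensor (\<Sum>t\<in>S. Poly_Mapping.single t (Poly_Mapping.lookup w t))))"
      if "finite S" for S
      using that
    proof (induction S)
      case empty
      then show ?case using single[of 0 0] by simp
    next
      case (insert t S)
      then show ?case
        using single[of t "Poly_Mapping.lookup w t"]
        by (simp add: plus_alg_tensor.abs_eq[symmetric] to_completion_add lin[OF M(1)] lin[OF M(2)])
    qed
    from this[of "Poly_Mapping.keys w"] show ?thesis using free_eq_sum[of w] by simp
  qed
  have alg: "M (to_completion v) = M' (to_completion v)" for v
    using free[of "rep_alg_tensor v"] Quotient_abs_rep[OF Quotient_alg_tensor, of v] by simp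
  have bl: "bounded_linear M" "bounded_linear M'" using M by (auto simp: bounded_clinear_def)
  have "bounded_linear (\<lambda>x. M x - M' x)" using bl by (rule bounded_linear_sub)
  then obtain K where K: "K > 0" "\<And>x. norm (M x - M' x) \<le> norm x * K"
    using bounded_linear.pos_bounded by blast
  have "M x = M' x" for x
  proof (rule ccontr)
    assume "M x \<noteq> M' x"
    then have p: "norm (M x - M' x) > 0" by simp
    then have "norm (M x - M' x) / K > 0" using K(1) by simp
    then obtain v where v: "norm (x - to_completion v) < norm (M x - M' x) / K"
      using to_completion_dense by blast
    have "M x - M' x = M (x - to_completion v) - M' (x - to_completion v)"
      using alg[of v] bl by (simp add: linear_diff bounded_linear.linear)
    then have "norm (M x - M' x) \<le> norm (x - to_completion v) * K" using K(2) by metis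
    also have "\<dots> < norm (M x - M' x)" using v K(1) by (simp add: pos_less_divide_eq)
    finally show False by simp
  qed
  then show ?thesis by blast
qed

lemma pure_tensor_upd:
  "pure_tensor (t(i := x + y)) = pure_tensor (t(i := x)) + pure_tensor (t(i := y))"
  "pure_tensor (t(i := c *\<^sub>C x)) = c *\<^sub>C pure_tensor (t(i := x))"
proof -
  show "pure_tensor (t(i := x + y)) = pure_tensor (t(i := x)) + pure_tensor (t(i := y))"
    by transfer (use multilin_rel.slot_add in \<open>simp add: algebra_simps\<close>)
  show "pure_tensor (t(i := c *\<^sub>C x)) = c *\<^sub>C pure_tensor (t(i := x))"
    by transfer (use multilin_rel.slot_scale single_conv_free_scale in metis)
qed

lemma slot_mult: "slot i (x * y) = slot i x * slot i y"
  unfolding slot_def ptensor_mult by (rule arg_cong[of _ _ ptensor]) auto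

lemma slot_one:
  fixes i :: "'n::finite"
  shows "slot i (1 :: 'b::complex_banach_algebra_1) = 1"
proof -
  have "(\<lambda>_. 1)(i := 1) = (\<lambda>_. 1 :: 'b)" by auto
  then show ?thesis by (simp only: slot_def ptensor_one)
qed

lemma slot_add: "slot i (x + y) = slot i x + slot i y"
  by (simp add: slot_def ptensor_def pure_tensor_upd to_completion_add)

lemma slot_scaleC: "slot i (c *\<^sub>C x) = c *\<^sub>C slot i x"
  by (simp add: slot_def ptensor_def pure_tensor_upd to_completion_scaleC)

lemma slot_diff: "slot i (x - y) = slot i x - slot i y"
  using slot_add[of i "x - y" y] by simp

lemma slot_commute: "i \<noteq> j \<Longrightarrow> slot i x * slot j y = slot j y * slot i x"
  unfolding slot_def ptensor_mult by (rule arg_cong[of _ _ ptensor]) auto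

lemma slot_resolvent:
  assumes "z \<notin> spectrum a"
  shows "z \<notin> spectrum (slot i a)" "resolvent (slot i a) z = slot i (resolvent a z)"
proof -
  have "slot i (z *\<^sub>C 1 - a) = z *\<^sub>C 1 - slot i a"
    by (simp add: slot_diff slot_scaleC slot_one)
  moreover have "is_inverse (slot i (z *\<^sub>C 1 - a)) (slot i (resolvent a z))"
    using resolvent_is_inverse[OF assms] unfolding is_inverse_def
    by (simp add: slot_one flip: slot_mult)
  ultimately have "is_inverse (z *\<^sub>C 1 - slot i a) (slot i (resolvent a z))" by simp
  then show "z \<notin> spectrum (slot i a)" "resolvent (slot i a) z = slot i (resolvent a z)"
    by (rule not_in_spectrumI, rule resolvent_eqI)
qed

lemma prod_list_slot:
  fixes x :: "'n::finite \<Rightarrow> 'b::complex_banach_algebra_1"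
  assumes "distinct is"
  shows "prod_list (map (\<lambda>i. slot i (x i)) is) = ptensor (\<lambda>i. if i \<in> set is then x i else 1)"
  using assms
proof (induction "is")
  case Nil
  then show ?case by (simp add: ptensor_one)
next
  case (Cons i "is")
  have "prod_list (map (\<lambda>i. slot i (x i)) (i # is)) = ptensor (\<lambda>j. ((\<lambda>_. 1)(i := x i)) j * (if j \<in> set is then x j else 1))"
    using Cons by (simp add: slot_def ptensor_mult)
  also have "(\<lambda>j. ((\<lambda>_. 1)(i := x i)) j * (if j \<in> set is then x j else 1)) = (\<lambda>j. if j \<in> set (i # is) then x j else 1)"
    using Cons.prems by auto
  finally show ?case .
qed

text \<open>Multiplying out with the \<open>i\<close>-th factor first is a left module map for this factor,
  multiplying out with it last is a right module map.  So an inverse of \<open>z - slot i a\<close> provides a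
  right and a left inverse of \<open>z - a\<close>.\<close>

lemma spectrum_slot:
  fixes a :: "'b::complex_banach_algebra_1" and i :: "'n::finite"
  shows "spectrum (slot i a :: ('b, 'n) proj_tensor) = spectrum a"
proof (intro equalityI subsetI)
  fix z assume "z \<in> spectrum (slot i a :: ('b, 'n) proj_tensor)"
  then show "z \<in> spectrum a" using slot_resolvent(1)[of z a i] by blast
next
  fix z assume z: "z \<in> spectrum a"
  show "z \<in> spectrum (slot i a :: ('b, 'n) proj_tensor)"
  proof (rule ccontr)
    assume "z \<notin> spectrum (slot i a :: ('b, 'n) proj_tensor)"
    then obtain y :: "('b, 'n) proj_tensor" where y: "is_inverse (z *\<^sub>C 1 - slot i a) y"
      using resolvent_is_inverse by blast
    have s: "z *\<^sub>C 1 - slot i a = slot i (z *\<^sub>C 1 - a)"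
      by (simp add: slot_diff slot_scaleC slot_one)
    obtain js where js: "set js = UNIV - {i}" "distinct js"
      using finite_distinct_list[of "UNIV - {i}"] by auto
    have d: "distinct (i # js)" "set (i # js) = UNIV" "distinct (js @ [i])" "set (js @ [i]) = UNIV"
      using js by auto
    obtain M :: "('b, 'n) proj_tensor \<Rightarrow> 'b" where M: "bounded_clinear M" "\<And>t. M (ptensor t) = prod_list (map t (i # js))"
      using tensor_multiplication_map[OF d(1,2)] by blast
    obtain N :: "('b, 'n) proj_tensor \<Rightarrow> 'b" where N: "bounded_clinear N" "\<And>t. N (ptensor t) = prod_list (map t (js @ [i]))"
      using tensor_multiplication_map[OF d(3,4)] by blast
    have js_eq: "map (\<lambda>j. ((\<lambda>_. 1)(i := x)) j * t j) js = map t js" "map (\<lambda>j. t j * ((\<lambda>_. 1)(i := x)) j) js = map t js"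
      for t :: "'n \<Rightarrow> 'b" and x
      using js by auto
    have comp: "bounded_clinear (\<lambda>u. F (G u))" if "bounded_clinear F" "bounded_clinear G"
      for F :: "'x::complex_banach_algebra_1 \<Rightarrow> 'y::complex_banach_algebra_1" and G :: "'z::complex_banach_algebra_1 \<Rightarrow> 'x"
      using that by (simp add: bounded_clinear_def bounded_linear_compose)
    \<comment> \<open>Multiplying out with the \<open>i\<close>-th factor in front, and at the end.\<close>
    have left: "(\<lambda>u. M (slot i x * u)) = (\<lambda>u. x * M u)" for x
    proof (rule bounded_clinear_eqI_ptensor)
      show "M (slot i x * ptensor t) = x * M (ptensor t)" for t
      proof -
        have "M (slot i x * ptensor t) = (x * t i) * prod_list (map (\<lambda>j. ((\<lambda>_. 1)(i := x)) j * t j) js)"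
          by (simp add: slot_def ptensor_mult M(2))
        also have "\<dots> = x * M (ptensor t)" by (simp only: js_eq M(2) list.map prod_list.Cons mult.assoc)
        finally show ?thesis .
      qed
      show "bounded_clinear (\<lambda>u. M (slot i x * u))" by (rule comp[OF M(1) bounded_clinear_mult(2)])
      show "bounded_clinear (\<lambda>u. x * M u)" by (rule comp[OF bounded_clinear_mult(2) M(1)])
    qed
    have right: "(\<lambda>u. N (u * slot i x)) = (\<lambda>u. N u * x)" for x
    proof (rule bounded_clinear_eqI_ptensor)
      show "N (ptensor t * slot i x) = N (ptensor t) * x" for t
      proof -
        have "N (ptensor t * slot i x) = prod_list (map (\<lambda>j. t j * ((\<lambda>_. 1)(i := x)) j) js) * (t i * x)"
          by (simp add: slot_def ptensor_mult N(2))
        also have "\<dots> = N (ptensor t) * x" by (simp add: js_eq N(2) mult.assoc del: fun_upd_apply)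
        finally show ?thesis .
      qed
      show "bounded_clinear (\<lambda>u. N (u * slot i x))" by (rule comp[OF N(1) bounded_clinear_mult(1)])
      show "bounded_clinear (\<lambda>u. N u * x)" by (rule comp[OF bounded_clinear_mult(1) N(1)])
    qed
    have "M 1 = 1" "N 1 = 1"
    proof -
      have "prod_list (map (\<lambda>i. 1) js) = (1 :: 'b)" by (induction js) auto
      then show "M 1 = 1" "N 1 = 1"
        using M(2)[of "\<lambda>_. 1"] N(2)[of "\<lambda>_. 1"] by (simp_all add: ptensor_one)
    qed
    then have R: "(z *\<^sub>C 1 - a) * M y = 1" and Lf: "N y * (z *\<^sub>C 1 - a) = 1"
      using y fun_cong[OF left[of "z *\<^sub>C 1 - a"], of y] fun_cong[OF right[of "z *\<^sub>C 1 - a"], of y]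
      unfolding s is_inverse_def by simp_all
    have "N y = N y * ((z *\<^sub>C 1 - a) * M y)" by (simp add: R)
    also have "\<dots> = M y" by (simp add: Lf mult.assoc[symmetric])
    finally have "is_inverse (z *\<^sub>C 1 - a) (M y)" using R Lf by (simp add: is_inverse_def)
    then show False using z not_in_spectrumI by blast
  qed
qed

lemma nth_index_list:
  "map nth_index [0..<CARD('n)] = sorted_list_of_set (UNIV :: 'n::{finite, linorder} set)"
  by (rule nth_equalityI) (auto simp: nth_index_def)

lemma bij_nth_index: "bij_betw nth_index {..<CARD('n)} (UNIV :: 'n::{finite, linorder} set)"
proof -
  have "distinct (map nth_index [0..<CARD('n)] :: 'n list)" "set (map nth_index [0..<CARD('n)]) = (UNIV :: 'n set)"
    unfolding nth_index_list by auto
  then show ?thesis by (auto simp: bij_betw_def distinct_map atLeast0LessThan)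
qed

text \<open>The map is \<open>u \<mapsto> M (u * (b\<^sub>0 \<otimes> \<cdots> \<otimes> b\<^sub>k\<^sub>-\<^sub>1 \<otimes> 1))\<close>, where \<open>M\<close> multiplies the factors in their order.\<close>

lemma sharp_characterization:
  fixes b :: "nat \<Rightarrow> 'b::complex_banach_algebra_1"
  shows "bounded_clinear (\<lambda>u :: ('b, 'n::{finite, linorder}) proj_tensor. sharp u b)"
    and "sharp (ptensor t :: ('b, 'n) proj_tensor) b
      = prod_list (map (\<lambda>j. t (nth_index j) * b j) [0..<CARD('n) - 1]) * t (nth_index (CARD('n) - 1))"
proof -
  let ?k = "CARD('n) - 1"
  let ?P = "\<lambda>L :: ('b, 'n) proj_tensor \<Rightarrow> 'b. bounded_linear L \<and> (\<forall>c v. L (c *\<^sub>C v) = c *\<^sub>C L v) \<and>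
      (\<forall>t. L (ptensor t) = prod_list (map (\<lambda>j. t (nth_index j) * b j) [0..<?k]) * t (nth_index ?k))"
  have card: "CARD('n) = Suc ?k" using zero_less_card_finite[where 'a = 'n] by simp
  obtain M :: "('b, 'n) proj_tensor \<Rightarrow> 'b" where M: "bounded_clinear M"
    "\<And>t. M (ptensor t) = prod_list (map t (map nth_index [0..<CARD('n)]))"
    using tensor_multiplication_map[of "sorted_list_of_set (UNIV :: 'n set)"] unfolding nth_index_list by auto
  \<comment> \<open>The entry 1 in the last place makes the same multiplication map produce the final factor without a
    direction.\<close>
  define c :: "'n \<Rightarrow> 'b" where "c i = (let j = the_inv_into {..<CARD('n)} nth_index i in if j < ?k then b j else 1)" for i
  have c: "c (nth_index j) = (if j < ?k then b j else 1)" if "j < CARD('n)" for j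
    using the_inv_into_f_f[OF bij_betw_imp_inj_on[OF bij_nth_index[where 'n = 'n]], of j] that by (simp add: c_def)
  define L where "L u = M (u * ptensor c)" for u
  have "?P L"
  proof (intro conjI allI)
    show "bounded_linear L" unfolding L_def
      using bounded_linear_compose[OF _ bounded_linear_mult_left] M(1) by (auto simp: bounded_clinear_def)
    show "L (d *\<^sub>C v) = d *\<^sub>C L v" for d v
      using M(1) by (simp add: L_def bounded_clinear_def mult_scaleC_left)
    fix t :: "'n \<Rightarrow> 'b"
    have "L (ptensor t) = prod_list (map (\<lambda>j. t (nth_index j) * c (nth_index j)) [0..<CARD('n)])"
      by (simp add: L_def ptensor_mult M(2) comp_def)
    also have "[0..<CARD('n)] = [0..<?k] @ [?k]" using card by (metis upt_Suc_append zero_le)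
    also have "map (\<lambda>j. t (nth_index j) * c (nth_index j)) ([0..<?k] @ [?k])
        = map (\<lambda>j. t (nth_index j) * b j) [0..<?k] @ [t (nth_index ?k)]"
      using card by (auto simp: c)
    finally show "L (ptensor t) = prod_list (map (\<lambda>j. t (nth_index j) * b j) [0..<?k]) * t (nth_index ?k)"
      by simp
  qed
  moreover have "L' = L" if "?P L'" for L'
    using that \<open>?P L\<close> by (intro bounded_clinear_eqI_ptensor) (auto simp: bounded_clinear_def)
  ultimately have "(THE L. ?P L) = L" by (rule the_equality)
  then have "sharp u b = L u" for u :: "('b, 'n) proj_tensor" by (simp only: sharp_def)
  then show "bounded_clinear (\<lambda>u :: ('b, 'n::{finite, linorder}) proj_tensor. sharp u b)"
    "sharp (ptensor t :: ('b, 'n) proj_tensor) b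
      = prod_list (map (\<lambda>j. t (nth_index j) * b j) [0..<?k]) * t (nth_index ?k)"
    using \<open>?P L\<close> by (auto simp: bounded_clinear_def)
qed


section \<open>Differentiation under the integral sign\<close>

text \<open>A second-order bound that is uniform in the parameter \<open>z\<close>.  It is preserved by products and
  it is what differentiation under an integral over \<open>z\<close> needs.\<close>

definition expands ::
  "('x::real_normed_vector \<Rightarrow> complex \<Rightarrow> 'a::complex_banach_algebra_1) \<Rightarrow> (complex \<Rightarrow> 'x \<Rightarrow> 'a) \<Rightarrow>
     'x \<Rightarrow> complex set \<Rightarrow> bool" where
  "expands F D x Z \<longleftrightarrow> (\<forall>z\<in>Z. linear (D z)) \<and> (\<forall>h. continuous_on Z (\<lambda>z. D z h)) \<and>
     (\<exists>d>0. \<exists>M\<ge>0. (\<forall>h. norm h < d \<longrightarrow> continuous_on Z (F (x + h)) \<and>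
        (\<forall>z\<in>Z. norm (F (x + h) z - F x z - D z h) \<le> M * (norm h)\<^sup>2)) \<and>
        (\<forall>z\<in>Z. norm (F x z) \<le> M \<and> (\<forall>h. norm (D z h) \<le> M * norm h)))"

lemma expandsE:
  assumes "expands F D x Z"
  obtains d M where "d > 0" "M \<ge> 0" "\<And>h. norm h < d \<Longrightarrow> continuous_on Z (F (x + h))"
    "\<And>h z. norm h < d \<Longrightarrow> z \<in> Z \<Longrightarrow> norm (F (x + h) z - F x z - D z h) \<le> M * (norm h)\<^sup>2"
    "\<And>z. z \<in> Z \<Longrightarrow> norm (F x z) \<le> M" "\<And>z h. z \<in> Z \<Longrightarrow> norm (D z h) \<le> M * norm h"
  using assms unfolding expands_def by metis

lemma expandsI:
  assumes "d > 0" "M \<ge> 0" "\<And>z. z \<in> Z \<Longrightarrow> linear (D z)" "\<And>h. continuous_on Z (\<lambda>z. D z h)"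
    "\<And>h. norm h < d \<Longrightarrow> continuous_on Z (F (x + h))"
    "\<And>h z. norm h < d \<Longrightarrow> z \<in> Z \<Longrightarrow> norm (F (x + h) z - F x z - D z h) \<le> M * (norm h)\<^sup>2"
    "\<And>z. z \<in> Z \<Longrightarrow> norm (F x z) \<le> M" "\<And>z h. z \<in> Z \<Longrightarrow> norm (D z h) \<le> M * norm h"
  shows "expands F D x Z"
  using assms unfolding expands_def by blast

lemma expands_continuous: "expands F D x Z \<Longrightarrow> continuous_on Z (F x)"
  unfolding expands_def by (metis add.right_neutral norm_zero)

lemma expands_const:
  assumes "continuous_on Z C" "compact Z"
  shows "expands (\<lambda>x. C) (\<lambda>z h. 0) x Z"
proof -
  obtain M where "\<And>z. z \<in> Z \<Longrightarrow> norm (C z) \<le> M"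
    using compact_imp_bounded[OF compact_continuous_image[OF assms]] by (auto simp: bounded_iff)
  then have "\<forall>z\<in>Z. norm (C z) \<le> max M 0" by (simp add: le_max_iff_disj)
  then show ?thesis
    using assms(1) by (intro expandsI[of 1 "max M 0"]) (auto simp: linear_zero)
qed

lemma expands_mult:
  assumes F: "expands F DF x Z" and G: "expands G DG x Z"
  shows "expands (\<lambda>x z. F x z * G x z) (\<lambda>z h. F x z * DG z h + DF z h * G x z) x Z"
proof -
  obtain d1 M1 where 1: "d1 > 0" "M1 \<ge> 0" "\<And>h. norm h < d1 \<Longrightarrow> continuous_on Z (F (x + h))"
    "\<And>h z. norm h < d1 \<Longrightarrow> z \<in> Z \<Longrightarrow> norm (F (x + h) z - F x z - DF z h) \<le> M1 * (norm h)\<^sup>2"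
    "\<And>z. z \<in> Z \<Longrightarrow> norm (F x z) \<le> M1" "\<And>z h. z \<in> Z \<Longrightarrow> norm (DF z h) \<le> M1 * norm h"
    using expandsE[OF F] by metis
  obtain d2 M2 where 2: "d2 > 0" "M2 \<ge> 0" "\<And>h. norm h < d2 \<Longrightarrow> continuous_on Z (G (x + h))"
    "\<And>h z. norm h < d2 \<Longrightarrow> z \<in> Z \<Longrightarrow> norm (G (x + h) z - G x z - DG z h) \<le> M2 * (norm h)\<^sup>2"
    "\<And>z. z \<in> Z \<Longrightarrow> norm (G x z) \<le> M2" "\<And>z h. z \<in> Z \<Longrightarrow> norm (DG z h) \<le> M2 * norm h"
    using expandsE[OF G] by metis
  define d where "d = min 1 (min d1 d2)"
  define K where "K = 6 * (M1 * M2)"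
  have K: "K \<ge> 0" "M1 * M2 \<le> K" "2 * (M1 * M2) \<le> K" using 1(2) 2(2) by (simp_all add: K_def)
  have lin: "linear (DF z)" "linear (DG z)" if "z \<in> Z" for z using F G that by (auto simp: expands_def)
  have cont: "continuous_on Z (F x)" "continuous_on Z (G x)"
    "continuous_on Z (\<lambda>z. DF z h)" "continuous_on Z (\<lambda>z. DG z h)" for h
    using expands_continuous[OF F] expands_continuous[OF G] F G by (simp_all add: expands_def)
  have rem: "norm (F (x + h) z * G (x + h) z - F x z * G x z - (F x z * DG z h + DF z h * G x z)) \<le> K * (norm h)\<^sup>2"
    if h: "norm h < d" and z: "z \<in> Z" for h z
  proof -
    define t where "t = norm h"
    have t: "0 \<le> t" "t \<le> 1" "norm h < d1" "norm h < d2" using h by (auto simp: t_def d_def)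
    define f g df dg rf rg where "f = F x z" "g = G x z" "df = DF z h" "dg = DG z h"
      "rf = F (x + h) z - F x z - DF z h" "rg = G (x + h) z - G x z - DG z h"
    note defs = this
    have b: "norm f \<le> M1" "norm g \<le> M2" "norm df \<le> M1 * t" "norm dg \<le> M2 * t" "norm rf \<le> M1 * t\<^sup>2" "norm rg \<le> M2 * t\<^sup>2"
      using 1(4)[OF t(3) z] 1(5)[OF z] 1(6)[OF z, of h] 2(4)[OF t(4) z] 2(5)[OF z] 2(6)[OF z, of h]
      by (simp_all add: defs t_def)
    have mb: "norm (u * v) \<le> M1 * M2 * t\<^sup>2" if "norm u \<le> M1 * t ^ m" "norm v \<le> M2 * t ^ n" "m + n \<ge> 2" for u v :: 'b and m n
    proof -
      have "norm (u * v) \<le> (M1 * t ^ m) * (M2 * t ^ n)"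
        using that 1(2) t by (intro order_trans[OF norm_mult_ineq] mult_mono) auto
      also have "\<dots> = M1 * M2 * t ^ (m + n)" by (simp add: power_add)
      also have "\<dots> \<le> M1 * M2 * t\<^sup>2"
        using 1(2) 2(2) t that(3) by (intro mult_left_mono power_decreasing) auto
      finally show ?thesis .
    qed
    have "F (x + h) z = f + df + rf" "G (x + h) z = g + dg + rg" by (simp_all add: defs)
    then have "F (x + h) z * G (x + h) z - F x z * G x z - (F x z * DG z h + DF z h * G x z)
      = f * rg + df * dg + df * rg + rf * g + rf * dg + rf * rg"
      by (simp add: defs(1-4)[symmetric] algebra_simps)
    also have "norm \<dots> \<le> norm (f * rg) + norm (df * dg) + norm (df * rg) + norm (rf * g) + norm (rf * dg) + norm (rf * rg)"
      by (intro order_trans[OF norm_triangle_ineq] add_right_mono) simp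
    also have "\<dots> \<le> M1 * M2 * t\<^sup>2 + M1 * M2 * t\<^sup>2 + M1 * M2 * t\<^sup>2 + M1 * M2 * t\<^sup>2 + M1 * M2 * t\<^sup>2 + M1 * M2 * t\<^sup>2"
      using mb[of f 0 rg 2] mb[of df 1 dg 1] mb[of df 1 rg 2] mb[of rf 2 g 0] mb[of rf 2 dg 1] mb[of rf 2 rg 2] b
      by (intro add_mono) auto
    finally show ?thesis by (simp add: K_def t_def)
  qed
  show ?thesis
  proof (rule expandsI[of d K])
    show "d > 0" using 1(1) 2(1) by (simp add: d_def)
    show "linear (\<lambda>h. F x z * DG z h + DF z h * G x z)" if "z \<in> Z" for z
      using lin[OF that] by (auto simp: linear_iff algebra_simps)
    show "continuous_on Z (\<lambda>z. F x z * DG z h + DF z h * G x z)" for h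
      by (intro continuous_intros cont)
    show "continuous_on Z (\<lambda>z. F (x + h) z * G (x + h) z)" if "norm h < d" for h
      using that by (intro continuous_intros 1 2) (auto simp: d_def)
    fix z assume z: "z \<in> Z"
    show "norm (F x z * G x z) \<le> K"
      using 1(5)[OF z] 2(5)[OF z] 1(2) K(2)
      by (meson norm_mult_ineq mult_mono norm_ge_zero order_trans)
    fix h
    have "norm (F x z * DG z h) \<le> M1 * (M2 * norm h)" "norm (DF z h * G x z) \<le> M1 * norm h * M2"
      using 1(5)[OF z] 2(5)[OF z] 1(6)[OF z, of h] 2(6)[OF z, of h] 1(2)
      by (intro order_trans[OF norm_mult_ineq] mult_mono; simp)+
    then have "norm (F x z * DG z h + DF z h * G x z) \<le> 2 * (M1 * M2) * norm h"
      by (intro order_trans[OF norm_triangle_ineq]) (simp add: algebra_simps)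
    also have "\<dots> \<le> K * norm h" using K by (intro mult_right_mono) auto
    finally show "norm (F x z * DG z h + DF z h * G x z) \<le> K * norm h" .
  qed (use K rem in auto)
qed

lemma expands_resolvent:
  fixes l :: "'x::real_normed_vector \<Rightarrow> 'a::complex_banach_algebra_1"
  assumes l: "bounded_linear l" and p: "\<And>h. p (x + h) = p x + l h"
    and Z: "compact Z" "Z \<inter> spectrum (p x) = {}"
  shows "expands (\<lambda>x. resolvent (p x)) (\<lambda>z h. resolvent (p x) z * l h * resolvent (p x) z) x Z"
proof -
  let ?R = "resolvent (p x)"
  have cR: "continuous_on Z ?R" using Z(2) by (rule continuous_on_resolvent)
  obtain B0 where "\<And>z. z \<in> Z \<Longrightarrow> norm (?R z) \<le> B0"
    using compact_imp_bounded[OF compact_continuous_image[OF cR Z(1)]] by (auto simp: bounded_iff)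
  then have B: "norm (?R z) \<le> max 1 B0" if "z \<in> Z" for z using that by (simp add: le_max_iff_disj)
  define B where "B = max 1 B0"
  note B = B[folded B_def]
  have B1: "B \<ge> 1" by (simp add: B_def)
  obtain K where K: "K > 0" "\<And>h. norm (l h) \<le> norm h * K"
    using bounded_linear.pos_bounded[OF l] by blast
  define d where "d = 1 / (2 * B * K)"
  define M where "M = 2 * B ^ 3 * K\<^sup>2 + B\<^sup>2 * K + B"
  have d: "d > 0" using B1 K by (simp add: d_def)
  have small: "norm (?R z) * norm (l h) \<le> 1 / 2" if "z \<in> Z" "norm h < d" for z h
  proof -
    have "norm (?R z) * norm (l h) \<le> B * (norm h * K)"
      using B[OF that(1)] K(2)[of h] B1 by (intro mult_mono) auto
    also have "\<dots> \<le> B * (d * K)" using that(2) B1 K(1) by (intro mult_left_mono mult_right_mono) auto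
    also have "\<dots> = 1 / 2" using B1 K(1) by (simp add: d_def)
    finally show ?thesis .
  qed
  have Mp: "2 * B ^ 3 * K\<^sup>2 \<le> M" "B\<^sup>2 * K \<le> M" "B \<le> M" "M \<ge> 0" using B1 K(1) by (auto simp: M_def)
  show ?thesis
  proof (rule expandsI[of d M])
    show "linear (\<lambda>h. ?R z * l h * ?R z)" for z
      using bounded_linear.linear[OF l] by (auto simp: linear_iff algebra_simps)
    show "continuous_on Z (\<lambda>z. ?R z * l h * ?R z)" for h by (intro continuous_intros cR)
    show "continuous_on Z (resolvent (p (x + h)))" if "norm h < d" for h
      using small[OF _ that] resolvent_perturb(1)[of _ "p x" "l h"] Z(2)
      by (intro continuous_on_resolvent) (auto simp: p)
    fix z assume z: "z \<in> Z"
    then have zn: "z \<notin> spectrum (p x)" using Z(2) by blast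
    show "norm (?R z) \<le> M" using B[OF z] Mp by linarith
    show "norm (?R z * l h * ?R z) \<le> M * norm h" for h
    proof -
      have "norm (?R z * l h * ?R z) \<le> norm (?R z) * norm (l h) * norm (?R z)"
        by (meson norm_mult_ineq mult_right_mono norm_ge_zero order_trans)
      also have "\<dots> \<le> B * (norm h * K) * B"
        using B[OF z] K B1 by (intro mult_mono) auto
      also have "\<dots> = (B\<^sup>2 * K) * norm h" by (simp add: power2_eq_square)
      also have "\<dots> \<le> M * norm h" using Mp by (intro mult_right_mono) auto
      finally show ?thesis .
    qed
    show "norm (resolvent (p (x + h)) z - ?R z - ?R z * l h * ?R z) \<le> M * (norm h)\<^sup>2"
      if h: "norm h < d" for h
    proof -
      have "norm (resolvent (p (x + h)) z - ?R z - ?R z * l h * ?R z) \<le> 2 * norm (?R z) ^ 3 * (norm (l h))\<^sup>2"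
        unfolding p using resolvent_perturb(4)[OF zn small[OF z h]] .
      also have "\<dots> \<le> 2 * B ^ 3 * (norm h * K)\<^sup>2"
        using B[OF z] K(2)[of h] B1 by (intro mult_mono power_mono) auto
      also have "\<dots> = 2 * B ^ 3 * K\<^sup>2 * (norm h)\<^sup>2" by (simp add: power_mult_distrib)
      also have "\<dots> \<le> M * (norm h)\<^sup>2" using Mp by (intro mult_right_mono) auto
      finally show ?thesis .
    qed
  qed (use d Mp in auto)
qed

text \<open>The remainder of the integrand is of second order uniformly on the chain, hence so is that of the
  integral.\<close>

lemma has_derivative_polygonal_integral:
  assumes E: "polygonal E (chain_image E)" and F: "expands F D x (chain_image E)"
  shows "((\<lambda>x. cycle_integral E (F x)) has_derivative (\<lambda>h. cycle_integral E (\<lambda>z. D z h))) (at x)"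
proof -
  let ?Z = "chain_image E"
  obtain d M where 1: "d > 0" "M \<ge> 0" "\<And>h. norm h < d \<Longrightarrow> continuous_on ?Z (F (x + h))"
    "\<And>h z. norm h < d \<Longrightarrow> z \<in> ?Z \<Longrightarrow> norm (F (x + h) z - F x z - D z h) \<le> M * (norm h)\<^sup>2"
    "\<And>z. z \<in> ?Z \<Longrightarrow> norm (F x z) \<le> M" "\<And>z h. z \<in> ?Z \<Longrightarrow> norm (D z h) \<le> M * norm h"
    using expandsE[OF F] by metis
  have lin: "linear (D z)" if "z \<in> ?Z" for z using F that by (auto simp: expands_def)
  have cD: "continuous_on ?Z (\<lambda>z. D z h)" for h using F by (auto simp: expands_def)
  have cF: "continuous_on ?Z (F x)" using F by (rule expands_continuous)
  have len: "chain_length E \<ge> 0" by (rule chain_length_nonneg)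
  let ?D = "\<lambda>h. cycle_integral E (\<lambda>z. D z h)"
  have bl: "bounded_linear ?D"
  proof (rule bounded_linear_intro[where K = "M * chain_length E"])
    fix h h' and r :: real
    show "?D (h + h') = ?D h + ?D h'"
      unfolding polygonal_integral_add[OF E cD cD, symmetric]
      by (rule polygonal_integral_cong[OF E]) (use lin in \<open>auto simp: linear_add\<close>)
    have "?D (r *\<^sub>R h) = cycle_integral E (\<lambda>z. complex_of_real r *\<^sub>C D z h)"
      by (rule polygonal_integral_cong[OF E]) (use lin in \<open>auto simp: linear_scale scaleC_of_real\<close>)
    also have "\<dots> = r *\<^sub>R ?D h"
      using polygonal_integral_clinear[OF E cD bounded_clinear_scaleC[of "complex_of_real r"]] by (simp add: scaleC_of_real)
    finally show "?D (r *\<^sub>R h) = r *\<^sub>R ?D h" .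
    show "norm (?D h) \<le> norm h * (M * chain_length E)"
      using polygonal_integral_bound[OF E cD 1(6)] by (simp add: mult_ac)
  qed
  have rem: "norm (cycle_integral E (F (x + h)) - cycle_integral E (F x) - ?D h) \<le> M * (norm h)\<^sup>2 * chain_length E"
    if h: "norm h < d" for h
  proof -
    have "cycle_integral E (F (x + h)) - cycle_integral E (F x) - ?D h
        = cycle_integral E (\<lambda>z. F (x + h) z - F x z - D z h)"
      using polygonal_integral_diff[OF E 1(3)[OF h] cF]
        polygonal_integral_diff[OF E continuous_on_diff[OF 1(3)[OF h] cF] cD] by simp
    then show ?thesis
      using polygonal_integral_bound[OF E _ 1(4)[OF h]] continuous_on_diff[OF continuous_on_diff[OF 1(3)[OF h] cF] cD] by simp
  qed
  show ?thesis
    unfolding has_derivative_within_alt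
  proof (intro conjI bl allI impI)
    fix e :: real assume e: "e > 0"
    define c where "c = M * chain_length E + 1"
    have c: "c > 0" using 1(2) len by (simp add: c_def add_nonneg_pos)
    have "norm (cycle_integral E (F y) - cycle_integral E (F x) - ?D (y - x)) \<le> e * norm (y - x)"
      if y: "norm (y - x) < min d (e / c)" for y
    proof -
      have "norm (cycle_integral E (F y) - cycle_integral E (F x) - ?D (y - x)) \<le> (M * chain_length E * norm (y - x)) * norm (y - x)"
        using rem[of "y - x"] y by (simp add: power2_eq_square mult_ac)
      also have "\<dots> \<le> (c * (e / c)) * norm (y - x)"
        using y c 1(2) len by (intro mult_right_mono mult_mono) (auto simp: c_def)
      finally show ?thesis using c by simp
    qed
    then show "\<exists>d>0. \<forall>y\<in>UNIV. norm (y - x) < d \<longrightarrow>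
        norm (cycle_integral E (F y) - cycle_integral E (F x) - ?D (y - x)) \<le> e * norm (y - x)"
      using 1(1) e c by (intro exI[of _ "min d (e / c)"]) auto
  qed
qed


section \<open>Divided differences\<close>

lemma spectrum_complex: "spectrum (a :: complex) = {a}"
proof -
  have "(\<exists>y. is_inverse (z - a) y) \<longleftrightarrow> z \<noteq> a" for z
  proof
    assume "z \<noteq> a"
    then show "\<exists>y. is_inverse (z - a) y"
      by (intro exI[of _ "1 / (z - a)"]) (simp add: is_inverse_def)
  qed (auto simp: is_inverse_def)
  then show ?thesis by (auto simp: spectrum_def scaleC_complex_def)
qed

lemma resolvent_complex: "z \<noteq> a \<Longrightarrow> resolvent (a :: complex) z = 1 / (z - a)"
  by (rule resolvent_eqI) (simp add: is_inverse_def scaleC_complex_def)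

lemma polygonal_integral_cmult:
  fixes F :: "complex \<Rightarrow> complex"
  assumes "polygonal E A" "continuous_on A F"
  shows "cycle_integral E (\<lambda>z. c * F z) = c * cycle_integral E F"
  using polygonal_integral_clinear[OF assms bounded_clinear_scaleC[of c]] by (simp add: scaleC_complex_def)

text \<open>The recursion for divided differences is the partial fraction identity
  \<open>1 / ((z - s)(z - t)) = (1 / (z - s) - 1 / (z - t)) / (s - t)\<close> under the integral.\<close>

lemma distinct_divided_diff_integral:
  assumes U: "open U" and f: "f holomorphic_on U" and E: "Cauchy_chain E L U"
    and s: "\<And>j. j \<le> k \<Longrightarrow> s j \<in> L" "inj_on s {..k}"
  shows "distinct_divided_diff f k s
    = 1 / (2 * pi * \<i>) * cycle_integral E (\<lambda>z. f z * (\<Prod>j\<le>k. 1 / (z - s j)))"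
  using s
proof (induction k arbitrary: s)
  case 0
  then show ?case using Cauchy_chain_formula[OF E U f, of "s 0"] by simp
next
  case (Suc k)
  have P: "polygonal E (U - L)" using E by (rule polygonal_Cauchy_chain)
  have fc: "continuous_on (U - L) f"
    using f holomorphic_on_imp_continuous_on continuous_on_subset by blast
  let ?s' = "s(k := s (Suc k))"
  define G where "G = (\<lambda>t z. f z * (\<Prod>j\<le>k. 1 / (z - t j)))"
  have ne: "z - s j \<noteq> 0" if "z \<in> U - L" "j \<le> Suc k" for z j using that Suc.prems(1)[of j] by auto
  have ne': "z - ?s' j \<noteq> 0" if "z \<in> U - L" "j \<le> k" for z j
    using ne[OF that(1), of j] ne[OF that(1), of "Suc k"] that(2) by auto
  have cG: "continuous_on (U - L) (G s)" "continuous_on (U - L) (G ?s')"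
    unfolding G_def by (intro continuous_intros fc; use ne ne' in fastforce)+
  have d: "s k \<noteq> s (Suc k)" using Suc.prems(2) by (auto dest!: inj_onD)
  have i1: "distinct_divided_diff f k s = 1 / (2 * pi * \<i>) * cycle_integral E (G s)"
    unfolding G_def using Suc.prems by (intro Suc.IH) (auto intro: inj_on_subset)
  have i2: "distinct_divided_diff f k ?s' = 1 / (2 * pi * \<i>) * cycle_integral E (G ?s')"
    unfolding G_def
  proof (rule Suc.IH)
    show "?s' j \<in> L" if "j \<le> k" for j using Suc.prems(1)[of j] Suc.prems(1)[of "Suc k"] that by auto
    have "s (Suc k) \<noteq> s j" if "j \<le> k" for j
      using inj_onD[OF Suc.prems(2), of "Suc k" j] that by auto
    moreover have "inj_on s {..k}" using Suc.prems(2) by (rule inj_on_subset) auto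
    ultimately show "inj_on ?s' {..k}" by (auto simp: inj_on_def) metis
  qed
  have "cycle_integral E (\<lambda>z. f z * (\<Prod>j\<le>Suc k. 1 / (z - s j)))
      = cycle_integral E (\<lambda>z. 1 / (s k - s (Suc k)) * (G s z - G ?s' z))"
  proof (rule polygonal_integral_cong[OF P])
    fix z assume z: "z \<in> U - L"
    define A where "A = (\<Prod>j<k. 1 / (z - s j))"
    have "(\<Prod>j<k. 1 / (z - ?s' j)) = A" unfolding A_def by (intro prod.cong) auto
    then have "G s z = f z * (A * (1 / (z - s k)))" "G ?s' z = f z * (A * (1 / (z - s (Suc k))))"
      by (simp_all add: G_def A_def flip: lessThan_Suc_atMost)
    moreover have "(\<Prod>j\<le>Suc k. 1 / (z - s j)) = A * (1 / (z - s k)) * (1 / (z - s (Suc k)))"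
      by (simp add: A_def flip: lessThan_Suc_atMost)
    moreover have "f z * (A * (1 / x) * (1 / y)) = 1 / (y - x) * (f z * (A * (1 / x)) - f z * (A * (1 / y)))"
      if "x \<noteq> 0" "y \<noteq> 0" "x \<noteq> y" for x y using that by (simp add: field_simps)
    from this[of "z - s k" "z - s (Suc k)"]
    have "f z * (A * (1 / (z - s k)) * (1 / (z - s (Suc k))))
        = 1 / (s k - s (Suc k)) * (f z * (A * (1 / (z - s k))) - f z * (A * (1 / (z - s (Suc k)))))"
      using ne[OF z, of k] ne[OF z, of "Suc k"] d by simp
    ultimately show "f z * (\<Prod>j\<le>Suc k. 1 / (z - s j)) = 1 / (s k - s (Suc k)) * (G s z - G ?s' z)"
      by simp
  qed
  also have "\<dots> = 1 / (s k - s (Suc k)) * (cycle_integral E (G s) - cycle_integral E (G ?s'))"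
    using polygonal_integral_cmult[OF P continuous_on_diff[OF cG], of "1 / (s k - s (Suc k))"]
      polygonal_integral_diff[OF P cG] by simp
  finally show ?case by (simp add: i1 i2 diff_divide_distrib mult_ac)
qed

text \<open>The chain depends on the points; by \<open>divided_diff_integral_eq\<close> below, every chain around them gives
  the same value, so that one chain serves all points near a given one.\<close>

definition divided_diff_integral :: "complex set \<Rightarrow> (complex \<Rightarrow> complex) \<Rightarrow> complex^'n::finite \<Rightarrow> complex" where
  "divided_diff_integral U f s = 1 / (2 * pi * \<i>) *
     cycle_integral (SOME E. Cauchy_chain E (range (($) s)) U) (\<lambda>z. f z * (\<Prod>i\<in>UNIV. 1 / (z - s $ i)))"

lemma divided_diff_integral_eq:
  fixes s :: "complex^'n::finite"
  assumes U: "open U" and f: "f holomorphic_on U" and L: "compact L" "L \<subseteq> U" and E: "Cauchy_chain E L U"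
    and s: "\<And>i. s $ i \<in> L"
  shows "divided_diff_integral U f s = 1 / (2 * pi * \<i>) * cycle_integral E (\<lambda>z. f z * (\<Prod>i\<in>UNIV. 1 / (z - s $ i)))"
proof -
  let ?S = "range (($) s)" and ?g = "\<lambda>z. f z * (\<Prod>i\<in>UNIV. 1 / (z - s $ i))"
  have S: "compact ?S" "?S \<subseteq> L" using s by (auto intro: finite_imp_compact)
  then have ex: "\<exists>E. Cauchy_chain E ?S U" using Cauchy_chain_exists[OF S(1) U] L(2) by blast
  have "?g vholomorphic_on (U - ?S)"
    unfolding vholomorphic_on_complex by (intro holomorphic_intros holomorphic_on_subset[OF f]) auto
  then have "cycle_integral E ?g = cycle_integral (SOME E. Cauchy_chain E ?S U) ?g"
    by (rule Cauchy_chains_integral_eq[OF U compact_imp_closed[OF S(1)] S(2) order_refl L(1) E S(1) someI_ex[OF ex]])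
  then show ?thesis by (simp add: divided_diff_integral_def)
qed

lemma open_power_set: "open U \<Longrightarrow> open (power_set U :: (complex^'n::finite) set)"
proof -
  assume U: "open U"
  have "power_set U = (\<Inter>i. (\<lambda>s :: complex^'n. s $ i) -` U)" by (auto simp: power_set_def)
  then show "open (power_set U :: (complex^'n) set)"
    using U by (auto intro!: open_INT open_vimage continuous_intros)
qed

lemma multi_holomorphic_on_imp_continuous_on: "\<phi> multi_holomorphic_on S \<Longrightarrow> continuous_on S \<phi>"
  unfolding multi_holomorphic_on_def continuous_on_eq_continuous_within by (meson has_derivative_continuous)

lemma multi_holomorphic_on_cong:
  assumes "\<phi> multi_holomorphic_on S" "\<And>s. s \<in> S \<Longrightarrow> \<phi> s = \<psi> s"
  shows "\<psi> multi_holomorphic_on S"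
  unfolding multi_holomorphic_on_def
proof
  fix s assume s: "s \<in> S"
  then obtain D where "(\<phi> has_derivative D) (at s within S)" "\<forall>c v. D (c *s v) = c * D v"
    using assms(1) by (auto simp: multi_holomorphic_on_def)
  then show "\<exists>D. (\<psi> has_derivative D) (at s within S) \<and> (\<forall>c v. D (c *s v) = c * D v)"
    using has_derivative_transform[OF s, of \<psi> \<phi>] assms(2) by metis
qed

text \<open>Near a given point all coordinates stay inside one fixed chain, and the product of the complex
  resolvents \<open>1 / (z - s $ i)\<close> can be differentiated under the integral.\<close>

lemma divided_diff_integral_holomorphic:
  fixes f :: "complex \<Rightarrow> complex"
  assumes U: "open U" and f: "f holomorphic_on U"
  shows "(divided_diff_integral U f :: complex^'n::finite \<Rightarrow> complex) multi_holomorphic_on power_set U"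
  unfolding multi_holomorphic_on_def
proof
  fix s :: "complex^'n" assume s: "s \<in> power_set U"
  have "\<exists>r>0. cball (s $ i) r \<subseteq> U" for i
    using s U by (auto simp: power_set_def open_contains_cball)
  then obtain r where r: "\<And>i. r i > 0" "\<And>i. cball (s $ i) (r i) \<subseteq> U" by metis
  define \<rho> where "\<rho> = Min (range r)"
  have \<rho>: "\<rho> > 0" "\<And>i. \<rho> \<le> r i" using r by (auto simp: \<rho>_def)
  define L where "L = (\<Union>i. cball (s $ i) \<rho>)"
  have "cball (s $ i) \<rho> \<subseteq> U" for i
    using r(2)[of i] \<rho>(2)[of i] by (meson order_trans subset_cball)
  then have L: "compact L" "L \<subseteq> U" by (auto simp: L_def)
  obtain E where E: "Cauchy_chain E L U" using Cauchy_chain_exists[OF L(1) U L(2)] by blast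
  have P: "polygonal E (U - L)" using E by (rule polygonal_Cauchy_chain)
  let ?Z = "chain_image E"
  have Z: "compact ?Z" "?Z \<subseteq> U - L" "polygonal E ?Z"
    using P compact_chain_image[OF P] polygonal_chain_image by blast+
  have inL: "t $ i \<in> L" if "dist t s < \<rho>" for t :: "complex^'n" and i
  proof -
    have "cmod (t $ i - s $ i) \<le> norm (t - s)" using Finite_Cartesian_Product.norm_nth_le[of "t - s" i] by simp
    then show ?thesis using that by (auto simp: L_def dist_norm norm_minus_commute intro!: exI[of _ i])
  qed
  obtain js :: "'n list" where js: "set js = UNIV" "distinct js" using finite_distinct_list[OF finite[of "UNIV :: 'n set"]] by blast
  let ?G = "\<lambda>js (t :: complex^'n) z. prod_list (map (\<lambda>i. resolvent (t $ i) z) js)"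
  have fac: "expands (\<lambda>t. resolvent (t $ i)) (\<lambda>z h. resolvent (s $ i) z * h $ i * resolvent (s $ i) z) s ?Z" for i
  proof (rule expands_resolvent)
    show "?Z \<inter> spectrum (s $ i) = {}" using Z(2) inL[of s i] \<rho> by (auto simp: spectrum_complex)
  qed (use Z in \<open>auto intro: bounded_linear_vec_nth\<close>)
  have "\<exists>D. expands (?G js) D s ?Z \<and> (\<forall>z c v. D z (c *s v) = c * D z v)" for js
  proof (induction js)
    case Nil
    then show ?case using expands_const[of ?Z "\<lambda>z. 1", OF _ Z(1)] by (intro exI[of _ "\<lambda>z h. 0"]) auto
  next
    case (Cons i js)
    then obtain D where D: "expands (?G js) D s ?Z" "\<And>z c v. D z (c *s v) = c * D z v" by blast
    show ?case
      using expands_mult[OF fac[of i] D(1)]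
      by (intro exI[of _ "\<lambda>z h. resolvent (s $ i) z * D z h + resolvent (s $ i) z * h $ i * resolvent (s $ i) z * ?G js s z"])
         (auto simp: D(2) algebra_simps)
  qed
  then obtain D where D: "expands (?G js) D s ?Z" "\<And>z c v. D z (c *s v) = c * D z v" by blast
  have fc: "continuous_on ?Z f" using f Z(2) holomorphic_on_imp_continuous_on continuous_on_subset by blast
  have ex: "expands (\<lambda>t z. f z * ?G js t z) (\<lambda>z h. f z * D z h) s ?Z"
    using expands_mult[OF expands_const[OF fc Z(1)] D(1)] by simp
  have cD: "continuous_on ?Z (\<lambda>z. f z * D z v)" for v using ex by (auto simp: expands_def)
  define I where "I h = 1 / (2 * pi * \<i>) * cycle_integral E (\<lambda>z. f z * D z h)" for h
  have "((\<lambda>t. 1 / (2 * pi * \<i>) * cycle_integral E (\<lambda>z. f z * ?G js t z)) has_derivative I) (at s)"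
    unfolding I_def by (intro has_derivative_mult_right has_derivative_polygonal_integral[OF Z(3) ex])
  then have "(divided_diff_integral U f has_derivative I) (at s)"
  proof (rule has_derivative_transform_within[OF _ \<rho>(1)])
    fix t :: "complex^'n" assume t: "dist t s < \<rho>"
    have "cycle_integral E (\<lambda>z. f z * ?G js t z) = cycle_integral E (\<lambda>z. f z * (\<Prod>i\<in>UNIV. 1 / (z - t $ i)))"
    proof (rule polygonal_integral_cong[OF P])
      fix z assume z: "z \<in> U - L"
      have "?G js t z = (\<Prod>i\<in>UNIV. resolvent (t $ i) z)"
        using js by (simp add: prod.distinct_set_conv_list[symmetric])
      also have "\<dots> = (\<Prod>i\<in>UNIV. 1 / (z - t $ i))"
        using inL[OF t] z by (intro prod.cong resolvent_complex) auto
      finally show "f z * ?G js t z = f z * (\<Prod>i\<in>UNIV. 1 / (z - t $ i))" by simp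
    qed
    then show "1 / (2 * pi * \<i>) * cycle_integral E (\<lambda>z. f z * ?G js t z) = divided_diff_integral U f t"
      using divided_diff_integral_eq[OF U f L E inL[OF t]] by simp
  qed simp
  moreover have "I (c *s v) = c * I v" for c v
    using polygonal_integral_cmult[OF Z(3) cD[of v], of c] by (simp add: I_def D(2) mult_ac)
  ultimately show "\<exists>D. (divided_diff_integral U f has_derivative D) (at s within power_set U) \<and> (\<forall>c v. D (c *s v) = c * D v)"
    using has_derivative_at_withinI by blast
qed

lemma divided_diff_integral_distinct:
  fixes s :: "complex^'n::{finite, linorder}"
  assumes U: "open U" and f: "f holomorphic_on U" and s: "s \<in> power_set U" "inj (($) s)"
  shows "divided_diff_integral U f s = distinct_divided_diff f (CARD('n) - 1) (\<lambda>j. s $ nth_index j)"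
proof -
  let ?S = "range (($) s)" and ?k = "CARD('n) - 1"
  have S: "compact ?S" "?S \<subseteq> U" using s(1) by (auto simp: power_set_def intro: finite_imp_compact)
  obtain E where E: "Cauchy_chain E ?S U" using Cauchy_chain_exists[OF S(1) U S(2)] by blast
  have "CARD('n) = Suc ?k" using zero_less_card_finite[where 'a = 'n] by simp
  then have "{..?k} = {..<CARD('n)}" by (metis lessThan_Suc_atMost)
  then have bij: "bij_betw nth_index {..?k} (UNIV :: 'n set)" using bij_nth_index by simp
  have "inj_on (\<lambda>j. s $ nth_index j) {..?k}"
    using comp_inj_on[OF bij_betw_imp_inj_on[OF bij], of "($) s"] s(2) by (auto simp: comp_def inj_on_subset)
  from distinct_divided_diff_integral[OF U f E _ this]
  have "distinct_divided_diff f ?k (\<lambda>j. s $ nth_index j)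
      = 1 / (2 * pi * \<i>) * cycle_integral E (\<lambda>z. f z * (\<Prod>j\<le>?k. 1 / (z - s $ nth_index j)))" by simp
  also have "(\<lambda>z. f z * (\<Prod>j\<le>?k. 1 / (z - s $ nth_index j))) = (\<lambda>z. f z * (\<Prod>i\<in>UNIV. 1 / (z - s $ i)))"
    by (intro ext arg_cong2[of _ _ _ _ "(*)"] refl prod.reindex_bij_betw[OF bij])
  finally show ?thesis using divided_diff_integral_eq[OF U f S E rangeI] by simp
qed

text \<open>The points with pairwise distinct coordinates are dense.\<close>

lemma eq_on_power_set:
  fixes \<phi> \<psi> :: "complex^'n::{finite, linorder} \<Rightarrow> complex"
  assumes U: "open U" and cont: "continuous_on (power_set U) \<phi>" "continuous_on (power_set U) \<psi>"
    and eq: "\<And>s. s \<in> power_set U \<Longrightarrow> inj (($) s) \<Longrightarrow> \<phi> s = \<psi> s" and s: "s \<in> power_set U"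
  shows "\<phi> s = \<psi> s"
proof -
  obtain \<nu> :: "'n \<Rightarrow> nat" where \<nu>: "inj \<nu>" using finite_imp_inj_to_nat_seg[of "UNIV :: 'n set"] by auto
  \<comment> \<open>On the line through \<open>s\<close> in a direction with distinct coordinates, any two coordinates
    agree for at most one parameter.\<close>
  define v :: "(complex, 'n) vec" where "v = (\<chi> i. of_nat (\<nu> i))"
  define p where "p t = s + t *\<^sub>R v" for t :: real
  have "((\<lambda>t. s + t *\<^sub>R v) \<longlongrightarrow> s + 0 *\<^sub>R v) (at_right 0)" by (intro tendsto_intros)
  then have p: "(p \<longlongrightarrow> s) (at_right 0)" by (simp add: p_def[abs_def])
  have inU: "\<forall>\<^sub>F t in at_right 0. p t \<in> power_set U"
    using topological_tendstoD[OF p open_power_set[OF U] s] .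
  have ne: "\<forall>\<^sub>F t in at_right 0. p t $ i \<noteq> p t $ j" if "i \<noteq> j" for i j
  proof -
    define c where "c = (s $ j - s $ i) / (of_nat (\<nu> i) - of_nat (\<nu> j))"
    have n: "(of_nat (\<nu> i) :: complex) - of_nat (\<nu> j) \<noteq> 0" using \<nu> that by (auto dest: injD)
    have "\<forall>\<^sub>F t in at_right 0. t \<noteq> Re c" by (rule eventually_neq_at_within)
    then show ?thesis
    proof eventually_elim
      case (elim t)
      have "complex_of_real t = c" if "p t $ i = p t $ j"
      proof -
        have "s $ i + t *\<^sub>R of_nat (\<nu> i) = s $ j + t *\<^sub>R (of_nat (\<nu> j) :: complex)"
          using that by (simp add: p_def v_def)
        then have "complex_of_real t * (of_nat (\<nu> i) - of_nat (\<nu> j)) = s $ j - s $ i"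
          by (simp add: scaleR_conv_of_real algebra_simps)
        then show ?thesis using n by (simp add: c_def nonzero_eq_divide_eq)
      qed
      then show ?case using elim by (metis Re_complex_of_real)
    qed
  qed
  have "\<forall>\<^sub>F t in at_right 0. \<forall>i. \<forall>j. i \<noteq> j \<longrightarrow> p t $ i \<noteq> p t $ j"
  proof (intro eventually_all_finite)
    show "\<forall>\<^sub>F t in at_right 0. i \<noteq> j \<longrightarrow> p t $ i \<noteq> p t $ j" for i j
      by (cases "i = j") (use ne[of i j] in auto)
  qed
  with inU have ev: "\<forall>\<^sub>F t in at_right 0. \<phi> (p t) = \<psi> (p t)"
    by eventually_elim (auto intro!: eq injI)
  have "((\<lambda>t. \<phi> (p t)) \<longlongrightarrow> \<phi> s) (at_right 0)" "((\<lambda>t. \<psi> (p t)) \<longlongrightarrow> \<psi> s) (at_right 0)"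
    using continuous_on_tendsto_compose[OF cont(1) p s inU] continuous_on_tendsto_compose[OF cont(2) p s inU] .
  then show ?thesis
    using tendsto_cong[OF ev] tendsto_unique[of "at_right (0::real)"] by auto
qed

lemma divided_diff_eq:
  fixes f :: "complex \<Rightarrow> complex"
  assumes U: "open U" and f: "f holomorphic_on U"
  shows "(divided_diff U f :: complex^'n::{finite, linorder} \<Rightarrow> complex)
    = (\<lambda>s. if s \<in> power_set U then divided_diff_integral U f s else 0)"
  unfolding divided_diff_def
proof (rule the_equality)
  let ?g = "\<lambda>s :: (complex, 'n) vec. if s \<in> power_set U then divided_diff_integral U f s else 0"
  have hol: "?g multi_holomorphic_on power_set U"
    by (rule multi_holomorphic_on_cong[OF divided_diff_integral_holomorphic[OF U f]]) simp
  then show *: "?g multi_holomorphic_on power_set U \<and>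
     (\<forall>s\<in>power_set U. inj (($) s) \<longrightarrow> ?g s = distinct_divided_diff f (CARD('n) - 1) (\<lambda>j. s $ nth_index j)) \<and>
     (\<forall>s. s \<notin> power_set U \<longrightarrow> ?g s = 0)"
    using divided_diff_integral_distinct[OF U f] by auto
  fix g :: "(complex, 'n) vec \<Rightarrow> complex"
  assume g: "g multi_holomorphic_on power_set U \<and>
     (\<forall>s\<in>power_set U. inj (($) s) \<longrightarrow> g s = distinct_divided_diff f (CARD('n) - 1) (\<lambda>j. s $ nth_index j)) \<and>
     (\<forall>s. s \<notin> power_set U \<longrightarrow> g s = 0)"
  have "g s = ?g s" if s: "s \<in> power_set U" for s
    by (rule eq_on_power_set[OF U multi_holomorphic_on_imp_continuous_on[OF conjunct1[OF g]]
          multi_holomorphic_on_imp_continuous_on[OF hol] _ s])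
       (use g * in auto)
  then show "g = ?g" using g by auto
qed


section \<open>Rational approximation\<close>

lemma rational_on_poly: "rational_on U (poly p)"
  unfolding rational_on_def by (intro exI[of _ p] exI[of _ 1]) auto

lemma rational_on_const: "rational_on U (\<lambda>z. c)"
proof -
  have "poly [:c:] = (\<lambda>z. c)" by auto
  then show ?thesis using rational_on_poly[of U "[:c:]"] by metis
qed

lemma rational_on_id: "rational_on U (\<lambda>z. z)"
proof -
  have "poly [:0, 1:] = (\<lambda>z :: complex. z)" by auto
  then show ?thesis using rational_on_poly[of U "[:0, 1:]"] by metis
qed

lemma rational_on_pole: "w \<notin> U \<Longrightarrow> rational_on U (\<lambda>z. 1 / (w - z))"
  unfolding rational_on_def by (intro exI[of _ 1] exI[of _ "[:w, -1:]"]) auto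

lemma rational_on_mult: "rational_on U r \<Longrightarrow> rational_on U r' \<Longrightarrow> rational_on U (\<lambda>z. r z * r' z)"
  unfolding rational_on_def
proof (elim exE conjE)
  fix p q p' q'
  assume "q \<noteq> 0" "q' \<noteq> 0" "\<forall>z\<in>U. poly q z \<noteq> 0" "\<forall>z\<in>U. poly q' z \<noteq> 0"
    "r = (\<lambda>z. poly p z / poly q z)" "r' = (\<lambda>z. poly p' z / poly q' z)"
  then show "\<exists>p q. q \<noteq> 0 \<and> (\<forall>z\<in>U. poly q z \<noteq> 0) \<and> (\<lambda>z. r z * r' z) = (\<lambda>z. poly p z / poly q z)"
    by (intro exI[of _ "p * p'"] exI[of _ "q * q'"]) auto
qed

lemma rational_on_add_ex:
  assumes "rational_on U r" "rational_on U r'"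
  shows "\<exists>t. rational_on U t \<and> (\<forall>z\<in>U. t z = r z + r' z)"
proof -
  obtain p q where 1: "q \<noteq> 0" "\<forall>z\<in>U. poly q z \<noteq> 0" "r = (\<lambda>z. poly p z / poly q z)"
    using assms(1) by (auto simp: rational_on_def)
  obtain p' q' where 2: "q' \<noteq> 0" "\<forall>z\<in>U. poly q' z \<noteq> 0" "r' = (\<lambda>z. poly p' z / poly q' z)"
    using assms(2) by (auto simp: rational_on_def)
  let ?t = "\<lambda>z. poly (p * q' + p' * q) z / poly (q * q') z"
  have "rational_on U ?t"
    unfolding rational_on_def using 1 2 by (intro exI[of _ "p * q' + p' * q"] exI[of _ "q * q'"]) auto
  moreover have "\<forall>z\<in>U. ?t z = r z + r' z" using 1 2 by (auto simp: add_frac_eq)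
  ultimately show ?thesis by blast
qed

lemma rational_on_mono: "rational_on U r \<Longrightarrow> V \<subseteq> U \<Longrightarrow> rational_on V r"
  unfolding rational_on_def by blast

lemma rational_on_holomorphic: "rational_on U r \<Longrightarrow> r holomorphic_on U"
  unfolding rational_on_def by (auto intro!: holomorphic_intros)

definition rational_approx :: "complex set \<Rightarrow> complex set \<Rightarrow> (complex \<Rightarrow> complex) \<Rightarrow> bool" where
  "rational_approx U K g \<longleftrightarrow> (\<forall>e>0. \<exists>r. rational_on U r \<and> (\<forall>z\<in>K. cmod (g z - r z) \<le> e))"

lemma rational_approx_rational: "rational_on U r \<Longrightarrow> rational_approx U K r"
  unfolding rational_approx_def by force

lemma rational_approx_add:
  assumes K: "K \<subseteq> U" and "rational_approx U K g" "rational_approx U K g'"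
  shows "rational_approx U K (\<lambda>z. g z + g' z)"
  unfolding rational_approx_def
proof (intro allI impI)
  fix e :: real assume "e > 0"
  then have "e / 2 > 0" by simp
  then obtain r r' where r: "rational_on U r" "\<And>z. z \<in> K \<Longrightarrow> cmod (g z - r z) \<le> e / 2"
    "rational_on U r'" "\<And>z. z \<in> K \<Longrightarrow> cmod (g' z - r' z) \<le> e / 2"
    using assms(2,3) unfolding rational_approx_def by metis
  obtain t where t: "rational_on U t" "\<And>z. z \<in> U \<Longrightarrow> t z = r z + r' z"
    using rational_on_add_ex[OF r(1,3)] by blast
  have "cmod (g z + g' z - t z) \<le> e" if z: "z \<in> K" for z
  proof -
    have eq: "g z + g' z - t z = (g z - r z) + (g' z - r' z)" using t(2)[of z] z K by auto
    show ?thesis unfolding eq using norm_triangle_mono[OF r(2)[OF z] r(4)[OF z]] by simp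
  qed
  then show "\<exists>r. rational_on U r \<and> (\<forall>z\<in>K. cmod (g z + g' z - r z) \<le> e)" using t(1) by blast
qed

lemma rational_approx_mult:
  assumes "rational_approx U K g" "rational_approx U K g'"
    and B: "\<And>z. z \<in> K \<Longrightarrow> cmod (g z) \<le> B" "\<And>z. z \<in> K \<Longrightarrow> cmod (g' z) \<le> B"
  shows "rational_approx U K (\<lambda>z. g z * g' z)"
  unfolding rational_approx_def
proof (intro allI impI)
  fix e :: real assume e: "e > 0"
  define C where "C = max B 0 + 1"
  have C: "C \<ge> 1" "B \<le> C" by (auto simp: C_def)
  define d where "d = min 1 (e / (2 * C + 1))"
  have d: "d > 0" "d \<le> 1" "d * (2 * C + 1) \<le> e"
  proof -
    have p: "2 * C + 1 > 0" using C by simp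
    show "d > 0" "d \<le> 1" using e p by (auto simp: d_def)
    have "d * (2 * C + 1) \<le> e / (2 * C + 1) * (2 * C + 1)"
      using p by (intro mult_right_mono) (auto simp: d_def)
    then show "d * (2 * C + 1) \<le> e" using p by simp
  qed
  obtain r r' where r: "rational_on U r" "\<And>z. z \<in> K \<Longrightarrow> cmod (g z - r z) \<le> d"
    "rational_on U r'" "\<And>z. z \<in> K \<Longrightarrow> cmod (g' z - r' z) \<le> d"
    using assms(1,2) d(1) unfolding rational_approx_def by metis
  have "cmod (g z * g' z - r z * r' z) \<le> e" if z: "z \<in> K" for z
  proof -
    have rb: "cmod (r z) \<le> C + 1"
      using norm_triangle_ineq4[of "g z" "g z - r z"] r(2)[OF z] B(1)[OF z] C d by simp
    have "g z * g' z - r z * r' z = (g z - r z) * g' z + r z * (g' z - r' z)" by (simp add: algebra_simps)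
    also have "cmod \<dots> \<le> d * C + (C + 1) * d"
      using r(2)[OF z] r(4)[OF z] B(2)[OF z] rb C d
      by (intro norm_triangle_mono) (auto simp: norm_mult intro!: mult_mono)
    also have "\<dots> = d * (2 * C + 1)" by (simp add: algebra_simps)
    finally show ?thesis using d(3) by simp
  qed
  then show "\<exists>r. rational_on U r \<and> (\<forall>z\<in>K. cmod (g z * g' z - r z) \<le> e)"
    using rational_on_mult[OF r(1,3)] by (intro exI[of _ "\<lambda>z. r z * r' z"]) auto
qed

lemma rational_approx_limit:
  assumes "\<And>e. e > 0 \<Longrightarrow> \<exists>h. rational_approx U K h \<and> (\<forall>z\<in>K. cmod (g z - h z) \<le> e)"
  shows "rational_approx U K g"
  unfolding rational_approx_def
proof (intro allI impI)
  fix e :: real assume "e > 0"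
  then have e: "e / 2 > 0" by simp
  then obtain h where h: "rational_approx U K h" "\<And>z. z \<in> K \<Longrightarrow> cmod (g z - h z) \<le> e / 2"
    using assms by blast
  then obtain r where r: "rational_on U r" "\<And>z. z \<in> K \<Longrightarrow> cmod (h z - r z) \<le> e / 2"
    using e unfolding rational_approx_def by blast
  have "cmod (g z - r z) \<le> e" if z: "z \<in> K" for z
    using norm_triangle_mono[OF h(2)[OF z] r(2)[OF z]] by simp
  then show "\<exists>r. rational_on U r \<and> (\<forall>z\<in>K. cmod (g z - r z) \<le> e)" using r(1) by blast
qed

text \<open>Partial sums of the geometric series, whose error is uniformly small.\<close>

lemma rational_approx_geometric:
  assumes K: "K \<subseteq> U" and app: "rational_approx U K \<alpha>" "rational_approx U K \<beta>"
    and b: "\<And>z. z \<in> K \<Longrightarrow> cmod (\<alpha> z) \<le> C" "\<And>z. z \<in> K \<Longrightarrow> cmod (\<beta> z) \<le> 1 / 2"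
  shows "rational_approx U K (\<lambda>z. \<alpha> z / (1 - \<beta> z))"
proof (rule rational_approx_limit)
  fix e :: real assume e: "e > 0"
  have pow: "rational_approx U K (\<lambda>z. \<beta> z ^ m)" "\<forall>z\<in>K. cmod (\<beta> z ^ m) \<le> 1" for m
  proof -
    show le: "\<forall>z\<in>K. cmod (\<beta> z ^ m) \<le> 1" for m
      using b(2) by (fastforce simp: norm_power intro!: power_le_one)
    show "rational_approx U K (\<lambda>z. \<beta> z ^ m)"
    proof (induction m)
      case (Suc m)
      have "cmod (\<beta> z) \<le> 1" if "z \<in> K" for z using b(2)[OF that] by simp
      then show ?case
        using rational_approx_mult[OF app(2) Suc, of 1] le[of m] by auto
    qed (auto intro: rational_approx_rational rational_on_const)
  qed
  have summand: "rational_approx U K (\<lambda>z. \<alpha> z * \<beta> z ^ m)" for m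
    using pow[of m] b(1)
    by (intro rational_approx_mult[OF app(1) pow(1), of "max C 1"]) (auto simp: le_max_iff_disj)
  have S: "rational_approx U K (\<lambda>z. \<Sum>m<n. \<alpha> z * \<beta> z ^ m)" for n
  proof (induction n)
    case (Suc n)
    then show ?case using rational_approx_add[OF K Suc summand[of n]] by simp
  qed (auto intro: rational_approx_rational rational_on_const)
  have C0: "2 * max C 0 + 1 > 0" by simp
  then have "e / (2 * max C 0 + 1) > 0" using e by simp
  then obtain n where n: "(1 / 2) ^ n < e / (2 * max C 0 + 1)"
    using real_arch_pow_inv[of "e / (2 * max C 0 + 1)" "1 / 2"] by auto
  have "cmod (\<alpha> z / (1 - \<beta> z) - (\<Sum>m<n. \<alpha> z * \<beta> z ^ m)) \<le> e" if z: "z \<in> K" for z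
  proof -
    have b1: "1 / 2 \<le> cmod (1 - \<beta> z)"
      using norm_triangle_ineq2[of 1 "\<beta> z"] b(2)[OF z] by simp
    then have ne: "1 - \<beta> z \<noteq> 0" by auto
    have "(\<Sum>m<n. \<alpha> z * \<beta> z ^ m) = \<alpha> z * ((1 - \<beta> z ^ n) / (1 - \<beta> z))"
      using one_diff_power_eq[of "\<beta> z" n] ne by (simp add: sum_distrib_left[symmetric])
    then have "\<alpha> z / (1 - \<beta> z) - (\<Sum>m<n. \<alpha> z * \<beta> z ^ m) = \<alpha> z * \<beta> z ^ n / (1 - \<beta> z)"
      using ne by (simp add: field_simps)
    also have "cmod \<dots> \<le> max C 0 * (1 / 2) ^ n / (1 / 2)"
      unfolding norm_divide norm_mult norm_power
      using b1 b(1)[OF z] b(2)[OF z] by (intro frac_le mult_mono power_mono) auto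
    also have "\<dots> \<le> (2 * max C 0 + 1) * (1 / 2) ^ n" by (simp add: algebra_simps)
    also have "\<dots> \<le> (2 * max C 0 + 1) * (e / (2 * max C 0 + 1))"
      using n C0 by (intro mult_left_mono) auto
    also have "\<dots> = e" using C0 by simp
    finally show ?thesis .
  qed
  then show "\<exists>h. rational_approx U K h \<and> (\<forall>z\<in>K. cmod (\<alpha> z / (1 - \<beta> z) - h z) \<le> e)"
    using S by blast
qed

text \<open>The set of poles \<open>w\<close> for which \<open>1 / (w - z)\<close> is approximable on \<open>K\<close> is open, contains the
  complement of \<open>U\<close> and a neighbourhood of infinity.  A chain around its complement therefore only
  meets poles that can be removed.\<close>

lemma removable_poles:
  assumes K: "compact K" "K \<subseteq> U"
  obtains L where "compact L" "K \<subseteq> L" "L \<subseteq> U" "\<And>w. w \<notin> L \<Longrightarrow> rational_approx U K (\<lambda>z. 1 / (w - z))"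
proof -
  define G where "G = {w. w \<notin> K \<and> rational_approx U K (\<lambda>z. 1 / (w - z))}"
  have "open G"
    unfolding open_dist
  proof
    fix w assume w: "w \<in> G"
    then have "w \<in> - K" by (simp add: G_def)
    then obtain d where d: "d > 0" "ball w d \<subseteq> - K"
      using K(1) compact_imp_closed open_Compl open_contains_ball by metis
    have dK: "d \<le> cmod (w - z)" if "z \<in> K" for z
      using d(2) that by (auto simp: dist_norm subset_iff not_less[symmetric])
    have "u \<in> G" if u: "dist u w < d / 2" for u
    proof -
      have uw: "cmod (w - u) < d / 2" using u by (simp add: dist_norm norm_minus_commute)
      have uK: "u \<notin> K" using dK[of u] uw d(1) by auto
      \<comment> \<open>The expansion of \<open>1 / (u - z)\<close> in powers of \<open>1 / (w - z)\<close>.\<close>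
      have "rational_approx U K (\<lambda>z. (1 / (w - z)) / (1 - (w - u) * (1 / (w - z))))"
      proof (rule rational_approx_geometric[OF K(2), where C = "1 / d"])
        show a: "rational_approx U K (\<lambda>z. 1 / (w - z))" using w by (simp add: G_def)
        show le: "cmod (1 / (w - z)) \<le> 1 / d" if "z \<in> K" for z
          using dK[OF that] d(1) by (auto simp: norm_divide intro!: frac_le)
        show "rational_approx U K (\<lambda>z. (w - u) * (1 / (w - z)))"
          by (rule rational_approx_mult[OF rational_approx_rational[OF rational_on_const] a, where B = "max (cmod (w - u)) (1 / d)"])
             (use le in \<open>auto simp: le_max_iff_disj\<close>)
        show "cmod ((w - u) * (1 / (w - z))) \<le> 1 / 2" if "z \<in> K" for z
        proof -
          have "cmod ((w - u) * (1 / (w - z))) \<le> (d / 2) * (1 / d)"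
            unfolding norm_mult using uw le[OF that] d(1) by (intro mult_mono) auto
          then show ?thesis using d(1) by simp
        qed
      qed
      moreover have "(1 / (w - z)) / (1 - (w - u) * (1 / (w - z))) = 1 / (u - z)" if "z \<in> K" for z
      proof -
        have "w - z \<noteq> 0" "u - z \<noteq> 0" using dK[OF that] d(1) uK that by auto
        then have "1 - (w - u) * (1 / (w - z)) = (u - z) / (w - z)" by (simp add: field_simps)
        then show ?thesis using \<open>w - z \<noteq> 0\<close> by simp
      qed
      ultimately show ?thesis using uK by (simp add: G_def rational_approx_def)
    qed
    then show "\<exists>e>0. \<forall>y. dist y w < e \<longrightarrow> y \<in> G" using d(1) by (intro exI[of _ "d / 2"]) auto
  qed
  have outside: "w \<in> G" if "w \<notin> U" for w
    using that K(2) rational_approx_rational[OF rational_on_pole[OF that]] by (auto simp: G_def)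
  obtain B0 where "\<And>z. z \<in> K \<Longrightarrow> cmod z \<le> B0" using compact_imp_bounded[OF K(1)] by (auto simp: bounded_iff)
  then have B: "cmod z \<le> max B0 1" if "z \<in> K" for z using that by (simp add: le_max_iff_disj)
  define B where "B = max B0 1"
  note B = B[folded B_def]
  have B1: "B \<ge> 1" by (simp add: B_def)
  \<comment> \<open>For a distant pole the geometric series in \<open>z / w\<close> converges uniformly.\<close>
  have infinity: "w \<in> G" if w: "cmod w > 2 * B" for w
  proof -
    have wK: "w \<notin> K" using B[of w] w B1 by auto
    have w0: "w \<noteq> 0" using w B1 by auto
    have "rational_approx U K (\<lambda>z. (1 / w) / (1 - (1 / w) * z))"
    proof (rule rational_approx_geometric[OF K(2) _ _ order_refl])
      show "rational_approx U K (\<lambda>z. 1 / w)" by (intro rational_approx_rational rational_on_const)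
      show "rational_approx U K (\<lambda>z. 1 / w * z)"
        by (intro rational_approx_rational rational_on_mult rational_on_const rational_on_id)
      show "cmod (1 / w * z) \<le> 1 / 2" if "z \<in> K" for z
        using B[OF that] w B1 w0 by (simp add: norm_mult norm_divide field_simps)
    qed
    moreover have "(1 / w) / (1 - (1 / w) * z) = 1 / (w - z)" if "z \<in> K" for z
      using w0 wK that by (auto simp: field_simps)
    ultimately show ?thesis using wK by (simp add: G_def rational_approx_def)
  qed
  have "compact (- G)"
    unfolding compact_eq_bounded_closed
  proof
    show "closed (- G)" using \<open>open G\<close> by blast
    show "bounded (- G)" unfolding bounded_iff using infinity by (intro exI[of _ "2 * B"]) (auto simp: not_less[symmetric])
  qed
  moreover have "K \<subseteq> - G" "- G \<subseteq> U" using outside by (auto simp: G_def)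
  moreover have "rational_approx U K (\<lambda>z. 1 / (w - z))" if "w \<notin> - G" for w using that by (auto simp: G_def)
  ultimately show ?thesis using that by blast
qed

lemma compact_power_set:
  assumes "compact K" shows "compact (power_set K :: (complex^'n::finite) set)"
proof -
  have "power_set K = (\<Inter>i. (\<lambda>s :: complex^'n. s $ i) -` K)" by (auto simp: power_set_def)
  then have "closed (power_set K :: (complex^'n) set)"
    using compact_imp_closed[OF assms] by (auto intro!: closed_INT closed_vimage continuous_intros)
  moreover have "bounded (power_set K :: (complex^'n) set)"
  proof -
    obtain B where B: "\<And>z. z \<in> K \<Longrightarrow> cmod z \<le> B" using compact_imp_bounded[OF assms] by (auto simp: bounded_iff)
    have "norm s \<le> (\<Sum>i\<in>(UNIV :: 'n set). B)" if "s \<in> power_set K" for s :: "complex^'n"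
    proof -
      have "norm s \<le> (\<Sum>i\<in>UNIV. cmod (s $ i))" unfolding norm_vec_def by (rule L2_set_le_sum) simp
      also have "\<dots> \<le> (\<Sum>i\<in>(UNIV :: 'n set). B)" by (rule sum_mono) (use that B in \<open>auto simp: power_set_def\<close>)
      finally show ?thesis .
    qed
    then show ?thesis by (auto simp: bounded_iff)
  qed
  ultimately show ?thesis by (simp add: compact_eq_bounded_closed)
qed

lemma rational_span_zero: "(\<lambda>s. 0) \<in> rational_span U"
  unfolding rational_span_def by (intro CollectI exI[of _ 0] exI[of _ "\<lambda>_. 0"] exI[of _ "\<lambda>_ _ _. 0"]) auto

lemma rational_span_add_term:
  fixes \<psi> :: "complex^'n::finite \<Rightarrow> complex"
  assumes "\<psi> \<in> rational_span U" "\<And>i. rational_on U (r i)"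
  shows "(\<lambda>s. \<psi> s + a * (\<Prod>i\<in>UNIV. r i (s $ i))) \<in> rational_span U"
proof -
  obtain m :: nat and c r' where 1: "\<psi> = (\<lambda>s. \<Sum>j<m. c j * (\<Prod>i\<in>UNIV. r' j i (s $ i)))" "\<forall>j<m. \<forall>i. rational_on U (r' j i)"
    using assms(1) by (auto simp: rational_span_def)
  let ?c = "c(m := a)" and ?r = "r'(m := r)"
  have "(\<Sum>j<m. ?c j * (\<Prod>i\<in>UNIV. ?r j i (s $ i))) = \<psi> s" for s
    unfolding 1(1) by (intro sum.cong) auto
  then have "(\<lambda>s. \<psi> s + a * (\<Prod>i\<in>UNIV. r i (s $ i))) = (\<lambda>s. \<Sum>j<Suc m. ?c j * (\<Prod>i\<in>UNIV. ?r j i (s $ i)))"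
    by simp
  moreover have "\<forall>j<Suc m. \<forall>i. rational_on U (?r j i)" using 1(2) assms(2) by (auto simp: less_Suc_eq)
  ultimately show ?thesis unfolding rational_span_def by blast
qed

lemma prod_norm_diff_le:
  fixes x y :: "'i \<Rightarrow> complex"
  assumes "B \<ge> 1" "\<And>i. i \<in> I \<Longrightarrow> cmod (x i) \<le> B" "\<And>i. i \<in> I \<Longrightarrow> cmod (y i) \<le> B"
    "\<And>i. i \<in> I \<Longrightarrow> cmod (x i - y i) \<le> d" "finite I"
  shows "cmod ((\<Prod>i\<in>I. x i) - (\<Prod>i\<in>I. y i)) \<le> real (card I) * B ^ card I * d"
  using assms(5,2-4)
proof (induction I)
  case (insert i I)
  have d: "d \<ge> 0" using insert.prems(3)[of i] norm_ge_zero order_trans by blast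
  have IH: "cmod ((\<Prod>i\<in>I. x i) - (\<Prod>i\<in>I. y i)) \<le> real (card I) * B ^ card I * d"
    using insert.prems by (intro insert.IH) auto
  have "cmod (\<Prod>i\<in>I. y i) \<le> (\<Prod>i\<in>I. B)"
    unfolding prod_norm[symmetric] using insert.prems by (intro prod_mono) auto
  then have yB: "cmod (\<Prod>i\<in>I. y i) \<le> B ^ card I" by simp
  have "x i * prod x I - y i * prod y I = x i * (prod x I - prod y I) + (x i - y i) * prod y I"
    by (simp add: algebra_simps)
  also have "cmod \<dots> \<le> B * (real (card I) * B ^ card I * d) + d * B ^ card I"
    unfolding norm_mult[symmetric]
    using insert.prems IH yB d assms(1)
    by (intro norm_triangle_mono) (auto simp: norm_mult intro!: mult_mono)
  also have "\<dots> \<le> B * (real (card I) * B ^ card I * d) + B * (d * B ^ card I)"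
    using assms(1) d mult_right_mono[of 1 B "d * B ^ card I"] by simp
  finally show ?case using insert.hyps by (simp add: algebra_simps)
qed simp

definition span_approx :: "complex set \<Rightarrow> (complex^'n::finite) set \<Rightarrow> (complex^'n \<Rightarrow> complex) \<Rightarrow> bool" where
  "span_approx U K \<phi> \<longleftrightarrow> (\<forall>e>0. \<exists>\<psi>\<in>rational_span U. \<forall>s\<in>K. cmod (\<phi> s - \<psi> s) \<le> e)"

lemma span_approx_add_prod:
  fixes \<phi> :: "complex^'n::finite \<Rightarrow> complex"
  assumes \<phi>: "span_approx U K \<phi>" and g: "rational_approx U K' g" and B: "\<And>z. z \<in> K' \<Longrightarrow> cmod (g z) \<le> B"
    and K: "\<And>(s :: complex^'n) i. s \<in> K \<Longrightarrow> s $ i \<in> K'"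
  shows "span_approx U K (\<lambda>s. \<phi> s + a * (\<Prod>i\<in>UNIV. g (s $ i)))"
  unfolding span_approx_def
proof (intro allI impI)
  fix e :: real assume e: "e > 0"
  define C where "C = max B 0 + 1"
  define M where "M = cmod a * (real CARD('n) * C ^ CARD('n)) + 1"
  have M: "M > 0" by (simp add: M_def C_def add_nonneg_pos)
  define d where "d = min 1 (e / 2 / M)"
  have d: "d > 0" "d \<le> 1" using e M by (auto simp: d_def)
  obtain r where r: "rational_on U r" "\<And>z. z \<in> K' \<Longrightarrow> cmod (g z - r z) \<le> d"
    using g d(1) unfolding rational_approx_def by blast
  have "e / 2 > 0" using e by simp
  then obtain \<psi> where \<psi>: "\<psi> \<in> rational_span U" "\<And>s. s \<in> K \<Longrightarrow> cmod (\<phi> s - \<psi> s) \<le> e / 2"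
    using \<phi> unfolding span_approx_def by blast
  let ?\<psi> = "\<lambda>s. \<psi> s + a * (\<Prod>i\<in>UNIV. r (s $ i))"
  have "cmod (\<phi> s + a * (\<Prod>i\<in>UNIV. g (s $ i)) - ?\<psi> s) \<le> e" if s: "s \<in> K" for s
  proof -
    have gC: "cmod (g (s $ i)) \<le> C" "cmod (r (s $ i)) \<le> C" for i
    proof -
      have "cmod (g (s $ i)) \<le> B" "cmod (g (s $ i) - r (s $ i)) \<le> 1"
        using B[OF K[OF s]] r(2)[OF K[OF s], of i] d(2) by auto
      then show "cmod (g (s $ i)) \<le> C" "cmod (r (s $ i)) \<le> C"
        using norm_triangle_ineq4[of "g (s $ i)" "g (s $ i) - r (s $ i)"] by (auto simp: C_def max_def)
    qed
    have "cmod ((\<Prod>i\<in>UNIV. g (s $ i)) - (\<Prod>i\<in>UNIV. r (s $ i))) \<le> real CARD('n) * C ^ CARD('n) * d"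
      by (rule prod_norm_diff_le) (use gC r(2) K[OF s] in \<open>auto simp: C_def\<close>)
    then have "cmod (a * ((\<Prod>i\<in>UNIV. g (s $ i)) - (\<Prod>i\<in>UNIV. r (s $ i)))) \<le> cmod a * (real CARD('n) * C ^ CARD('n) * d)"
      unfolding norm_mult by (intro mult_left_mono) auto
    also have "\<dots> \<le> M * d" using d by (simp add: M_def algebra_simps)
    also have "\<dots> \<le> M * (e / 2 / M)" using M by (intro mult_left_mono) (auto simp: d_def)
    also have "\<dots> = e / 2" using M by simp
    finally have "cmod (a * ((\<Prod>i\<in>UNIV. g (s $ i)) - (\<Prod>i\<in>UNIV. r (s $ i)))) \<le> e / 2" .
    from norm_triangle_mono[OF \<psi>(2)[OF s] this] show ?thesis by (simp add: algebra_simps)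
  qed
  then show "\<exists>\<psi>\<in>rational_span U. \<forall>s\<in>K. cmod (\<phi> s + a * (\<Prod>i\<in>UNIV. g (s $ i)) - \<psi> s) \<le> e"
    using rational_span_add_term[OF \<psi>(1), of "\<lambda>_. r" a] r(1) by (intro bexI[of _ ?\<psi>]) auto
qed

lemma riemann_step:
  assumes "chain_length E \<ge> 0" "d > 0"
  obtains N :: nat where "N > 0" "chain_length E / N < d"
proof -
  obtain N :: nat where N: "chain_length E / d < N" using reals_Archimedean2 by blast
  have "chain_length E / d < Suc N" using N by simp
  then have "chain_length E / Suc N < d" using assms(2) by (simp add: field_simps)
  then show ?thesis using that[of "Suc N"] by blast
qed

text \<open>The kernel of the integral representation is uniformly continuous on the compact product of the
  chain and the set of points.\<close>

lemma divided_diff_kernel_equicontinuous: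
  fixes K :: "(complex^'n::finite) set"
  assumes A: "compact A" and K: "compact K" and f: "continuous_on A f"
    and off: "\<And>z (s :: complex^'n) i. z \<in> A \<Longrightarrow> s \<in> K \<Longrightarrow> z \<noteq> s $ i" and e: "e > 0"
  obtains d where "d > 0" "\<And>(s :: complex^'n) z z'. s \<in> K \<Longrightarrow> z \<in> A \<Longrightarrow> z' \<in> A \<Longrightarrow> cmod (z - z') < d \<Longrightarrow>
    cmod (f z * (\<Prod>i\<in>UNIV. 1 / (z - s $ i)) - f z' * (\<Prod>i\<in>UNIV. 1 / (z' - s $ i))) \<le> e"
proof -
  let ?H = "\<lambda>x :: complex \<times> (complex, 'n) vec. f (fst x) * (\<Prod>i\<in>UNIV. 1 / (fst x - snd x $ i))"
  have "continuous_on (A \<times> K) (\<lambda>x. f (fst x))"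
    by (rule continuous_on_compose2[OF f]) (auto intro!: continuous_intros)
  then have "continuous_on (A \<times> K) ?H"
    by (intro continuous_intros) (use off in auto)
  then have "uniformly_continuous_on (A \<times> K) ?H"
    using compact_Times[OF A K] by (intro compact_uniformly_continuous)
  then obtain d where d: "d > 0" "\<And>x x'. x \<in> A \<times> K \<Longrightarrow> x' \<in> A \<times> K \<Longrightarrow> dist x' x < d \<Longrightarrow> dist (?H x') (?H x) < e"
    using e unfolding uniformly_continuous_on_def by metis
  show ?thesis
  proof (rule that[OF d(1)])
    fix s :: "complex^'n" and z z' assume "s \<in> K" "z \<in> A" "z' \<in> A" "cmod (z - z') < d"
    then show "cmod (f z * (\<Prod>i\<in>UNIV. 1 / (z - s $ i)) - f z' * (\<Prod>i\<in>UNIV. 1 / (z' - s $ i))) \<le> e"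
      using d(2)[of "(z', s)" "(z, s)"] by (simp add: dist_Pair_Pair dist_norm)
  qed
qed

text \<open>On a compact set \<open>K\<close> approximate the integral over a chain by a Riemann sum.  Its poles lie on the
  chain, hence outside the set \<open>L\<close> of \<open>removable_poles\<close>, so each factor is approximable by rational
  functions without poles in \<open>U\<close>.\<close>

lemma divided_diff_Hol0:
  fixes f :: "complex \<Rightarrow> complex"
  assumes U: "open U" and f: "f holomorphic_on U"
  shows "(divided_diff U f :: complex^'n::{finite, linorder} \<Rightarrow> complex) \<in> Hol0 U"
proof -
  let ?\<phi> = "divided_diff U f :: (complex, 'n) vec \<Rightarrow> complex"
  have "?\<phi> multi_holomorphic_on power_set U"
    unfolding divided_diff_eq[OF U f]
    by (rule multi_holomorphic_on_cong[OF divided_diff_integral_holomorphic[OF U f]]) simp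
  moreover have "\<exists>\<psi>\<in>rational_span U. \<forall>s\<in>K. cmod (?\<phi> s - \<psi> s) < e"
    if K: "compact K" "K \<subseteq> power_set U" and e: "e > 0" for K :: "(complex, 'n) vec set" and e
  proof -
    define K' where "K' = (\<Union>i. (\<lambda>s :: (complex, 'n) vec. s $ i) ` K)"
    have K': "compact K'" "K' \<subseteq> U" "\<And>(s :: (complex, 'n) vec) i. s \<in> K \<Longrightarrow> s $ i \<in> K'"
      using K by (auto simp: K'_def power_set_def intro!: compact_UN compact_continuous_image continuous_intros)
    obtain L where L: "compact L" "K' \<subseteq> L" "L \<subseteq> U" "\<And>w. w \<notin> L \<Longrightarrow> rational_approx U K' (\<lambda>z. 1 / (w - z))"
      using removable_poles[OF K'(1,2)] by metis
    obtain E where E: "Cauchy_chain E L U" using Cauchy_chain_exists[OF L(1) U L(3)] by blast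
    have P: "polygonal E (U - L)" using E by (rule polygonal_Cauchy_chain)
    let ?Z = "chain_image E"
    have Z: "compact ?Z" "?Z \<subseteq> U - L" "polygonal E ?Z"
      using P compact_chain_image[OF P] polygonal_chain_image by blast+
    have off: "z \<noteq> s $ i" if "z \<in> ?Z" "s \<in> K" for z i and s :: "(complex, 'n) vec" using that Z(2) K'(3) L(2) by blast
    have fc: "continuous_on ?Z f" using f Z(2) holomorphic_on_imp_continuous_on continuous_on_subset by blast
    define e' where "e' = e / 4 / (chain_length E + 1)"
    have len: "chain_length E \<ge> 0" by (rule chain_length_nonneg)
    have e': "e' > 0" using e len by (simp add: e'_def add_nonneg_pos)
    obtain d where d: "d > 0" "\<And>(s :: (complex, 'n) vec) z z'. s \<in> K \<Longrightarrow> z \<in> ?Z \<Longrightarrow> z' \<in> ?Z \<Longrightarrow> cmod (z - z') < d \<Longrightarrow>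
        cmod (f z * (\<Prod>i\<in>UNIV. 1 / (z - s $ i)) - f z' * (\<Prod>i\<in>UNIV. 1 / (z' - s $ i))) \<le> e'"
      using divided_diff_kernel_equicontinuous[OF Z(1) K(1) fc off e'] by blast
    obtain N :: nat where N: "N > 0" "chain_length E / N < d" using riemann_step[OF len d(1)] .
    let ?k = "\<lambda>(s :: (complex, 'n) vec) z. f z * (\<Prod>i\<in>UNIV. 1 / (z - s $ i))"
    have near: "cmod (?\<phi> s - 1 / (2 * pi * \<i>) * riemann_sum E N (?k s)) \<le> e / 4" if s: "s \<in> K" for s
    proof -
      have kc: "continuous_on ?Z (?k s)" by (intro continuous_intros fc) (use off s in auto)
      have "?\<phi> s = 1 / (2 * pi * \<i>) * cycle_integral E (?k s)"
        using divided_diff_integral_eq[OF U f L(1,3) E, of s] K'(3)[OF s] L(2) K(2) s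
        by (auto simp: divided_diff_eq[OF U f])
      then have "?\<phi> s - 1 / (2 * pi * \<i>) * riemann_sum E N (?k s)
          = 1 / (2 * pi * \<i>) * (cycle_integral E (?k s) - riemann_sum E N (?k s))"
        by (simp add: right_diff_distrib)
      also have "cmod \<dots> \<le> 1 * (e' * chain_length E)"
        unfolding norm_mult
      proof (intro mult_mono)
        show "cmod (1 / (complex_of_real (2 * pi) * \<i>)) \<le> 1"
          using pi_gt3 by (simp add: norm_divide norm_mult)
        show "cmod (cycle_integral E (?k s) - riemann_sum E N (?k s)) \<le> e' * chain_length E"
          by (rule polygonal_riemann[OF Z(3) N kc d(2)[OF s]])
      qed auto
      also have "\<dots> \<le> e' * (chain_length E + 1)" using e' by simp
      also have "\<dots> = e / 4"
      proof -
        have "chain_length E + 1 \<noteq> 0" using len by simp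
        moreover have "x / y * y = x" if "y \<noteq> 0" for x y :: real using that by simp
        ultimately show ?thesis unfolding e'_def by blast
      qed
      finally show ?thesis .
    qed
    have nodes: "z \<notin> L" if "(w, z) \<in> set (riemann_nodes E N)" for w z
      using riemann_nodes_subset[OF P that] by simp
    have "span_approx U K (\<lambda>s :: (complex, 'n) vec. \<Sum>(w, z)\<leftarrow>xs. (1 / (2 * pi * \<i>) * w * f z) * (\<Prod>i\<in>UNIV. 1 / (z - s $ i)))"
      if "set xs \<subseteq> set (riemann_nodes E N)" for xs
      using that
    proof (induction xs)
      case Nil
      then show ?case using rational_span_zero unfolding span_approx_def by force
    next
      case (Cons x xs)
      obtain w z where x: "x = (w, z)" by (metis surj_pair)
      have z: "z \<notin> L" using nodes Cons.prems x by auto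
      then have zK: "z \<notin> K'" using L(2) by blast
      have "continuous_on K' (\<lambda>t. 1 / (z - t))" by (intro continuous_intros) (use zK in auto)
      from compact_imp_bounded[OF compact_continuous_image[OF this K'(1)]]
      obtain B where B: "\<And>t. t \<in> K' \<Longrightarrow> cmod (1 / (z - t)) \<le> B"
        by (auto simp: bounded_iff)
      have "span_approx U K (\<lambda>s :: (complex, 'n) vec. \<Sum>(w, z)\<leftarrow>xs. (1 / (2 * pi * \<i>) * w * f z) * (\<Prod>i\<in>UNIV. 1 / (z - s $ i)))"
        using Cons by simp
      from span_approx_add_prod[OF this L(4)[OF z] B K'(3), of "1 / (2 * pi * \<i>) * w * f z"]
      show ?case by (simp add: x add.commute)
    qed
    from this[OF order_refl]
    have "span_approx U K (\<lambda>s. 1 / (2 * pi * \<i>) * riemann_sum E N (?k s))"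
      by (simp add: riemann_sum_def scaleC_complex_def sum_list_const_mult[symmetric] case_prod_unfold mult_ac)
    moreover have "e / 4 > 0" using e by simp
    ultimately obtain \<psi> where \<psi>: "\<psi> \<in> rational_span U"
      "\<And>s. s \<in> K \<Longrightarrow> cmod (1 / (2 * pi * \<i>) * riemann_sum E N (?k s) - \<psi> s) \<le> e / 4"
      unfolding span_approx_def by blast
    have "cmod (?\<phi> s - \<psi> s) < e" if s: "s \<in> K" for s
      using norm_triangle_mono[OF near[OF s] \<psi>(2)[OF s]] e by simp
    then show ?thesis using \<psi>(1) by blast
  qed
  ultimately show ?thesis by (simp add: Hol0_def)
qed


section \<open>The multivariate holomorphic functional calculus\<close>

lemma multi_holomorphic_on_const: "(\<lambda>s. c) multi_holomorphic_on S"
  unfolding multi_holomorphic_on_def by (auto intro!: exI[of _ "\<lambda>_. 0"])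

lemma multi_holomorphic_on_coordinate:
  fixes i :: "'n::finite"
  assumes g: "g holomorphic_on U" and U: "open U"
  shows "(\<lambda>s :: complex^'n. g (s $ i)) multi_holomorphic_on power_set U"
  unfolding multi_holomorphic_on_def
proof
  fix s :: "complex^'n" assume "s \<in> power_set U"
  then have "s $ i \<in> U" by (simp add: power_set_def)
  then obtain d where "(g has_field_derivative d) (at (s $ i))"
    using g U by (metis at_within_open field_differentiable_def holomorphic_on_def)
  then have "((\<lambda>s. g (s $ i)) has_derivative (\<lambda>h. d * (h $ i))) (at s)"
    using has_derivative_compose[OF bounded_linear.has_derivative[OF bounded_linear_vec_nth has_derivative_ident]]
    by (simp add: has_field_derivative_def)
  then have "((\<lambda>s. g (s $ i)) has_derivative (\<lambda>h. d * (h $ i))) (at s within power_set U)"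
    by (rule has_derivative_at_withinI)
  then show "\<exists>D. ((\<lambda>s. g (s $ i)) has_derivative D) (at s within power_set U) \<and> (\<forall>c v. D (c *s v) = c * D v)"
    by (intro exI[of _ "\<lambda>h. d * (h $ i)"]) auto
qed

lemma multi_holomorphic_on_add:
  assumes "\<phi> multi_holomorphic_on S" "\<psi> multi_holomorphic_on S"
  shows "(\<lambda>s. \<phi> s + \<psi> s) multi_holomorphic_on S"
  unfolding multi_holomorphic_on_def
proof
  fix s assume "s \<in> S"
  then obtain D D' where D: "(\<phi> has_derivative D) (at s within S)" "\<forall>c v. D (c *s v) = c * D v"
    "(\<psi> has_derivative D') (at s within S)" "\<forall>c v. D' (c *s v) = c * D' v"
    using assms unfolding multi_holomorphic_on_def by blast
  show "\<exists>D. ((\<lambda>s. \<phi> s + \<psi> s) has_derivative D) (at s within S) \<and> (\<forall>c v. D (c *s v) = c * D v)"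
    using has_derivative_add[OF D(1,3)] D(2,4) by (intro exI[of _ "\<lambda>h. D h + D' h"]) (simp add: distrib_left)
qed

lemma multi_holomorphic_on_mult:
  assumes "\<phi> multi_holomorphic_on S" "\<psi> multi_holomorphic_on S"
  shows "(\<lambda>s. \<phi> s * \<psi> s) multi_holomorphic_on S"
  unfolding multi_holomorphic_on_def
proof
  fix s assume "s \<in> S"
  then obtain D D' where D: "(\<phi> has_derivative D) (at s within S)" "\<forall>c v. D (c *s v) = c * D v"
    "(\<psi> has_derivative D') (at s within S)" "\<forall>c v. D' (c *s v) = c * D' v"
    using assms unfolding multi_holomorphic_on_def by blast
  show "\<exists>D. ((\<lambda>s. \<phi> s * \<psi> s) has_derivative D) (at s within S) \<and> (\<forall>c v. D (c *s v) = c * D v)"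
    using has_derivative_mult[OF D(1,3)] D(2,4)
    by (intro exI[of _ "\<lambda>h. \<phi> s * D' h + D h * \<psi> s"]) (simp add: algebra_simps)
qed

lemma multi_holomorphic_on_sum:
  "(\<And>j. j \<in> J \<Longrightarrow> \<phi> j multi_holomorphic_on S) \<Longrightarrow> (\<lambda>s. \<Sum>j\<in>J. \<phi> j s) multi_holomorphic_on S"
  by (induction J rule: infinite_finite_induct) (auto intro: multi_holomorphic_on_const multi_holomorphic_on_add)

lemma multi_holomorphic_on_prod:
  "(\<And>j. j \<in> J \<Longrightarrow> \<phi> j multi_holomorphic_on S) \<Longrightarrow> (\<lambda>s. \<Prod>j\<in>J. \<phi> j s) multi_holomorphic_on S"
  by (induction J rule: infinite_finite_induct) (auto intro: multi_holomorphic_on_const multi_holomorphic_on_mult)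

lemma rational_span_subset_Hol0:
  assumes U: "open U" shows "rational_span U \<subseteq> (Hol0 U :: (complex^'n::finite \<Rightarrow> complex) set)"
proof
  fix \<psi> :: "complex^'n \<Rightarrow> complex" assume \<psi>: "\<psi> \<in> rational_span U"
  then obtain m :: nat and c r where m: "\<psi> = (\<lambda>s. \<Sum>j<m. c j * (\<Prod>i\<in>UNIV. r j i (s $ i)))" "\<forall>j<m. \<forall>i. rational_on U (r j i)"
    by (auto simp: rational_span_def)
  have "\<psi> multi_holomorphic_on power_set U"
    unfolding m(1) using m(2) rational_on_holomorphic U
    by (auto intro!: multi_holomorphic_on_sum multi_holomorphic_on_mult multi_holomorphic_on_prod
        multi_holomorphic_on_const multi_holomorphic_on_coordinate)
  then show "\<psi> \<in> Hol0 U" using \<psi> by (auto simp: Hol0_def intro!: bexI[of _ \<psi>])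
qed

lemma rational_span_term:
  fixes r :: "'n::finite \<Rightarrow> complex \<Rightarrow> complex"
  assumes "\<And>i. rational_on U (r i)"
  shows "(\<lambda>s :: complex^'n. a * (\<Prod>i\<in>UNIV. r i (s $ i))) \<in> rational_span U"
  using rational_span_add_term[OF rational_span_zero assms, of a] by simp

lemma prod_list_insert_one:
  fixes y :: "'a::monoid_mult"
  assumes "distinct is" "i \<in> set is"
  shows "prod_list (map (\<lambda>j. if j = i then y else 1) is) = y"
  using assms
proof (induction "is")
  case (Cons j js)
  show ?case
  proof (cases "j = i")
    case True
    then have eq: "map (\<lambda>j. if j = i then y else 1) js = map (\<lambda>_. 1) js" using Cons.prems by auto
    have one: "prod_list (map (\<lambda>_. 1 :: 'a) js) = 1" by (induction js) auto
    show ?thesis unfolding list.map prod_list.Cons eq one using True by simp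
  qed (use Cons in auto)
qed simp

lemma prod_list_mult_commuting:
  fixes x y :: "'i \<Rightarrow> 'a::monoid_mult"
  assumes "\<And>i j. i \<in> set is \<Longrightarrow> j \<in> set is \<Longrightarrow> x i * y j = y j * x i"
  shows "prod_list (map (\<lambda>i. x i * y i) is) = prod_list (map x is) * prod_list (map y is)"
  using assms
proof (induction "is")
  case (Cons i "is")
  have c: "y i * prod_list (map x js) = prod_list (map x js) * y i" if "set js \<subseteq> set is" for js
    using that
  proof (induction js)
    case (Cons j js)
    have "x j * y i = y i * x j" using Cons.prems by (intro \<open>\<And>k l. k \<in> set (i # is) \<Longrightarrow> l \<in> set (i # is) \<Longrightarrow> x k * y l = y l * x k\<close>) auto
    moreover have "y i * prod_list (map x js) = prod_list (map x js) * y i" using Cons by simp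
    ultimately show ?case by (metis list.simps(9) mult.assoc prod_list.Cons)
  qed simp
  have "x i * y i * (prod_list (map x is) * prod_list (map y is)) = x i * (y i * prod_list (map x is)) * prod_list (map y is)"
    by (simp only: mult.assoc)
  also have "\<dots> = x i * prod_list (map x is) * (y i * prod_list (map y is))"
    using c[of "is"] by (simp add: mult.assoc)
  finally show ?case using Cons by simp
qed simp

lemma is_multi_calculusD:
  fixes c :: "'n::finite \<Rightarrow> 'd::complex_banach_algebra_1"
  assumes \<Phi>: "is_multi_calculus U c \<Phi>"
  shows "\<phi> \<in> Hol0 U \<Longrightarrow> \<psi> \<in> Hol0 U \<Longrightarrow> \<Phi> (\<lambda>s. \<phi> s + \<psi> s) = \<Phi> \<phi> + \<Phi> \<psi>"
    and "\<phi> \<in> Hol0 U \<Longrightarrow> \<Phi> (\<lambda>s. \<alpha> * \<phi> s) = \<alpha> *\<^sub>C \<Phi> \<phi>"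
    and "\<phi> \<in> Hol0 U \<Longrightarrow> \<psi> \<in> Hol0 U \<Longrightarrow> \<Phi> (\<lambda>s. \<phi> s * \<psi> s) = \<Phi> \<phi> * \<Phi> \<psi>"
    and "\<Phi> (\<lambda>s. 1) = 1" and "\<Phi> (\<lambda>s. s $ i) = c i"
    and "\<phi> \<in> Hol0 U \<Longrightarrow> e > 0 \<Longrightarrow> \<exists>K d. compact K \<and> K \<subseteq> power_set U \<and> 0 < d \<and>
        (\<forall>\<psi>\<in>Hol0 U. (\<forall>s\<in>K. cmod (\<psi> s - \<phi> s) < d) \<longrightarrow> norm (\<Phi> \<psi> - \<Phi> \<phi>) < e)"
proof -
  note d = \<Phi>[unfolded is_multi_calculus_def]
  note d2 = d[THEN conjunct2]
  note d3 = d2[THEN conjunct2]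
  note d4 = d3[THEN conjunct2]
  note d5 = d4[THEN conjunct2]
  note d6 = d5[THEN conjunct2]
  show "\<phi> \<in> Hol0 U \<Longrightarrow> \<psi> \<in> Hol0 U \<Longrightarrow> \<Phi> (\<lambda>s. \<phi> s + \<psi> s) = \<Phi> \<phi> + \<Phi> \<psi>"
    by (rule d[THEN conjunct1, rule_format])
  show "\<phi> \<in> Hol0 U \<Longrightarrow> \<Phi> (\<lambda>s. \<alpha> * \<phi> s) = \<alpha> *\<^sub>C \<Phi> \<phi>"
    by (rule d2[THEN conjunct1, rule_format])
  show "\<phi> \<in> Hol0 U \<Longrightarrow> \<psi> \<in> Hol0 U \<Longrightarrow> \<Phi> (\<lambda>s. \<phi> s * \<psi> s) = \<Phi> \<phi> * \<Phi> \<psi>"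
    by (rule d3[THEN conjunct1, rule_format])
  show "\<Phi> (\<lambda>s. 1) = 1" by (rule d4[THEN conjunct1])
  show "\<Phi> (\<lambda>s. s $ i) = c i" by (rule d5[THEN conjunct1, rule_format])
  show "\<phi> \<in> Hol0 U \<Longrightarrow> e > 0 \<Longrightarrow> \<exists>K d. compact K \<and> K \<subseteq> power_set U \<and> 0 < d \<and>
        (\<forall>\<psi>\<in>Hol0 U. (\<forall>s\<in>K. cmod (\<psi> s - \<phi> s) < d) \<longrightarrow> norm (\<Phi> \<psi> - \<Phi> \<phi>) < e)"
    using d6 by blast
qed

lemma open_between_compact_open:
  fixes L U :: "'a::heine_borel set"
  assumes "compact L" "open U" "L \<subseteq> U"
  obtains V where "open V" "L \<subseteq> V" "compact (closure V)" "closure V \<subseteq> U"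
proof -
  obtain e where e: "e > 0" "(\<Union>x\<in>L. cball x e) \<subseteq> U"
    using compact_subset_open_imp_cball_epsilon_subset[OF assms] .
  let ?C = "\<Union>x\<in>L. cball x e" and ?V = "\<Union>x\<in>L. ball x e"
  have C: "compact ?C" using compact_minkowski_sum_cball[OF assms(1)] .
  have "?V \<subseteq> ?C" by (auto intro: less_imp_le)
  then have cl: "closure ?V \<subseteq> ?C" using compact_imp_closed[OF C] by (rule closure_minimal)
  have "compact (closure ?V)" using compact_imp_bounded[OF C] \<open>?V \<subseteq> ?C\<close> bounded_subset by auto
  moreover have "closure ?V \<subseteq> U" using cl e(2) by (rule order_trans)
  moreover have "open ?V" "L \<subseteq> ?V" using e(1) by auto
  ultimately show ?thesis by (intro that)
qed

text \<open>A simultaneous choice of an inner open set \<open>V\<close>, of a chain in \<open>V\<close> around all the spectra and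
  of an order of the factors.\<close>

locale commuting_spectra =
  fixes U V L :: "complex set" and E and c :: "'n::finite \<Rightarrow> 'd::complex_banach_algebra_1" and "is" :: "'n list"
  assumes U: "open U" and V: "open V" and VU: "V \<subseteq> U" and L: "compact L"
    and E: "Cauchy_chain E L V" and spec: "\<And>i. spectrum (c i) \<subseteq> L"
    and comm: "\<And>i j. c i * c j = c j * c i" and "is": "distinct is" "set is = UNIV"
begin

lemma spectral: "spectral_chain V L E (c i)"
  by unfold_locales (use V L E spec in auto)

abbreviation h where "h i g \<equiv> chain_calculus E (c i) g"

abbreviation K where "K \<equiv> power_set (chain_image E) :: (complex^'n) set"

lemma chain_image_subset: "chain_image E \<subseteq> V"
  using polygonal_Cauchy_chain[OF E] polygonal_chain_image by blast

lemma compact_K: "compact K"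
  using compact_power_set[OF compact_chain_image[OF polygonal_Cauchy_chain[OF E]]] .

lemma K_subset: "K \<subseteq> power_set U"
  using chain_image_subset VU by (auto simp: power_set_def)

lemma h_commute:
  assumes "g holomorphic_on V" "g' holomorphic_on V"
  shows "h i g * h j g' = h j g' * h i g"
proof -
  have "h j g' * c i = c i * h j g'"
    by (rule spectral_chain.calculus_commute[OF spectral assms(2)]) (rule comm)
  then show ?thesis
    using spectral_chain.calculus_commute[OF spectral assms(1), of i "h j g'"] by simp
qed

text \<open>Simultaneous evaluation of a sum of products of rational functions as a function and at
  \<open>c\<close>.\<close>

inductive evaluates :: "(complex^'n \<Rightarrow> complex) \<Rightarrow> 'd \<Rightarrow> bool" where
  zero: "evaluates (\<lambda>s :: complex^'n. 0) 0"
| add_term: "evaluates \<psi> x \<Longrightarrow> (\<And>i. rational_on V (r i)) \<Longrightarrow>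
    evaluates (\<lambda>s :: complex^'n. \<psi> s + a * (\<Prod>i\<in>UNIV. r i (s $ i))) (x + a *\<^sub>C prod_list (map (\<lambda>i. h i (r i)) is))"

lemma evaluates_term:
  "(\<And>i. rational_on V (r i)) \<Longrightarrow>
     evaluates (\<lambda>s :: complex^'n. a * (\<Prod>i\<in>UNIV. r i (s $ i))) (a *\<^sub>C prod_list (map (\<lambda>i. h i (r i)) is))"
  using evaluates.add_term[OF evaluates.zero, of r a] by simp

lemma evaluates_add:
  assumes "evaluates \<psi>' x'" "evaluates \<psi> x"
  shows "evaluates (\<lambda>s :: complex^'n. \<psi> s + \<psi>' s) (x + x')"
  using assms(1)
proof induction
  case zero
  then show ?case using assms(2) by simp
next
  case (add_term \<psi>' x' r a)
  then show ?case using evaluates.add_term[OF add_term.IH, of r a] by (simp add: add.assoc)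
qed

lemma evaluates_scale:
  assumes "evaluates \<psi> x"
  shows "evaluates (\<lambda>s :: complex^'n. b * \<psi> s) (b *\<^sub>C x)"
  using assms
proof induction
  case zero
  then show ?case using evaluates.zero by simp
next
  case (add_term \<psi> x r a)
  then show ?case using evaluates.add_term[OF add_term.IH, of r "b * a"]
    by (simp add: distrib_left mult.assoc scaleC_add_right scaleC_scaleC)
qed

text \<open>The factors of the products commute with each other, and for each variable the one-variable calculus
  is multiplicative on rational functions.\<close>

lemma evaluates_mult:
  assumes "evaluates \<psi>' x'" "evaluates \<psi> x"
  shows "evaluates (\<lambda>s :: complex^'n. \<psi> s * \<psi>' s) (x * x')"
  using assms(1)
proof induction
  case zero
  then show ?case using evaluates.zero by simp
next
  case (add_term \<psi>' x' r' b)
  have "evaluates (\<lambda>s :: complex^'n. \<psi> s * (b * (\<Prod>i\<in>UNIV. r' i (s $ i)))) (x * (b *\<^sub>C prod_list (map (\<lambda>i. h i (r' i)) is)))"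
    using assms(2)
  proof induction
    case zero
    then show ?case using evaluates.zero by simp
  next
    case t: (add_term \<psi> x r a)
    have rr: "rational_on V (\<lambda>z. r i z * r' i z)" for i
      by (rule rational_on_mult[OF t.hyps(2) add_term.hyps(2)])
    have "prod_list (map (\<lambda>i. h i (\<lambda>z. r i z * r' i z)) is) = prod_list (map (\<lambda>i. h i (r i) * h i (r' i)) is)"
      by (simp add: spectral_chain.calculus_rational_mult[OF spectral t.hyps(2) rational_on_holomorphic[OF add_term.hyps(2)]])
    also have "\<dots> = prod_list (map (\<lambda>i. h i (r i)) is) * prod_list (map (\<lambda>i. h i (r' i)) is)"
      by (rule prod_list_mult_commuting)
         (rule h_commute[OF rational_on_holomorphic[OF t.hyps(2)] rational_on_holomorphic[OF add_term.hyps(2)]])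
    finally have eq: "prod_list (map (\<lambda>i. h i (\<lambda>z. r i z * r' i z)) is)
        = prod_list (map (\<lambda>i. h i (r i)) is) * prod_list (map (\<lambda>i. h i (r' i)) is)" .
    let ?P = "prod_list (map (\<lambda>i. h i (r i)) is)" and ?P' = "prod_list (map (\<lambda>i. h i (r' i)) is)"
    have f: "\<psi> s * (b * (\<Prod>i\<in>UNIV. r' i (s $ i))) + a * b * (\<Prod>i\<in>UNIV. r i (s $ i) * r' i (s $ i))
        = (\<psi> s + a * (\<Prod>i\<in>UNIV. r i (s $ i))) * (b * (\<Prod>i\<in>UNIV. r' i (s $ i)))" for s :: "complex^'n"
      by (simp add: prod.distrib algebra_simps)
    have v: "x * (b *\<^sub>C ?P') + (a * b) *\<^sub>C (?P * ?P') = (x + a *\<^sub>C ?P) * (b *\<^sub>C ?P')"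
      by (simp add: distrib_right mult_scaleC_left mult_scaleC_right scaleC_scaleC scaleC_add_right mult.commute[of b])
    show ?case
      using evaluates.add_term[OF t.IH, of "\<lambda>i z. r i z * r' i z" "a * b", OF rr]
      unfolding eq f v .
  qed
  from evaluates_add[OF this add_term.IH] show ?case by (simp add: distrib_left)
qed

lemma evaluates_sum_form:
  assumes "evaluates \<psi> x"
  obtains m :: nat and a r where "\<forall>j<m. \<forall>i. rational_on V (r j i)"
    "\<psi> = (\<lambda>s :: complex^'n. \<Sum>j<m. a j * (\<Prod>i\<in>UNIV. r j i (s $ i)))"
    "x = (\<Sum>j<m. a j *\<^sub>C prod_list (map (\<lambda>i. h i (r j i)) is))"
proof -
  have "\<exists>(m :: nat) a r. (\<forall>j<m. \<forall>i. rational_on V (r j i)) \<and> \<psi> = (\<lambda>s :: complex^'n. \<Sum>j<m. a j * (\<Prod>i\<in>UNIV. r j i (s $ i))) \<and>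
      x = (\<Sum>j<m. a j *\<^sub>C prod_list (map (\<lambda>i. h i (r j i)) is))"
    using assms
  proof induction
    case zero
    then show ?case by (intro exI[of _ 0] exI[of _ "\<lambda>_. 0"] exI[of _ "\<lambda>_ _ _. 0"]) auto
  next
    case (add_term \<psi> x r0 a0)
    then obtain m :: nat and a r where m: "\<forall>j<m. \<forall>i. rational_on V (r j i)"
      "\<psi> = (\<lambda>s :: complex^'n. \<Sum>j<m. a j * (\<Prod>i\<in>UNIV. r j i (s $ i)))"
      "x = (\<Sum>j<m. a j *\<^sub>C prod_list (map (\<lambda>i. h i (r j i)) is))" by blast
    have "(\<Sum>j<m. (a(m := a0)) j * (\<Prod>i\<in>UNIV. (r(m := r0)) j i (s $ i))) = (\<Sum>j<m. a j * (\<Prod>i\<in>UNIV. r j i (s $ i)))"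
      for s :: "complex^'n" by (intro sum.cong) auto
    moreover have "(\<Sum>j<m. (a(m := a0)) j *\<^sub>C prod_list (map (\<lambda>i. h i ((r(m := r0)) j i)) is))
        = (\<Sum>j<m. a j *\<^sub>C prod_list (map (\<lambda>i. h i (r j i)) is))" by (intro sum.cong) auto
    ultimately show ?case
      using m add_term.hyps(2)
      by (intro exI[of _ "Suc m"] exI[of _ "a(m := a0)"] exI[of _ "r(m := r0)"]) (auto simp: less_Suc_eq)
  qed
  then show ?thesis using that by blast
qed

lemma evaluates_sum_formI:
  fixes m :: nat
  assumes "\<And>j i. j < m \<Longrightarrow> rational_on V (r j i)"
  shows "evaluates (\<lambda>s :: complex^'n. \<Sum>j<m. a j * (\<Prod>i\<in>UNIV. r j i (s $ i))) (\<Sum>j<m. a j *\<^sub>C prod_list (map (\<lambda>i. h i (r j i)) is))"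
  using assms
proof (induction m)
  case 0
  then show ?case using evaluates.zero by simp
next
  case (Suc m)
  then show ?case using evaluates.add_term[of _ _ "r m" "a m"] by simp
qed

text \<open>The value at \<open>c\<close> is controlled by the supremum of the function over the product of the chains.
  This is an iterated integral estimate: one factor at a time is written as an integral of the
  resolvent, the other factors being kept inside the norm.\<close>

lemma evaluates_bound_partial:
  assumes "distinct js"
  shows "\<exists>C\<ge>0. \<forall>(J :: nat set) a r B. (\<forall>j\<in>J. \<forall>i. r j i holomorphic_on V) \<longrightarrow>
    (\<forall>s. (\<forall>i. s i \<in> chain_image E) \<longrightarrow> cmod (\<Sum>j\<in>J. a j * (\<Prod>i\<in>set js. r j i (s i))) \<le> B) \<longrightarrow>
    chain_image E \<noteq> {} \<longrightarrow>
    norm (\<Sum>j\<in>J. a j *\<^sub>C prod_list (map (\<lambda>i. h i (r j i)) js)) \<le> C * B"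
  using assms
proof (induction js)
  case Nil
  have "norm (\<Sum>j\<in>J. a j *\<^sub>C (1 :: 'd)) = cmod (\<Sum>j\<in>J. a j)" for J :: "nat set" and a
    by (simp add: scaleC_sum_left[symmetric] norm_scaleC)
  then show ?case by (intro exI[of _ 1]) (auto simp: ex_in_conv[symmetric])
next
  case (Cons i js)
  then have "distinct js" by simp
  from Cons.IH[OF this]
  obtain C where C0: "C \<ge> 0" and Cb: "\<forall>(J :: nat set) a r B. (\<forall>j\<in>J. \<forall>i. r j i holomorphic_on V) \<longrightarrow>
    (\<forall>s. (\<forall>i. s i \<in> chain_image E) \<longrightarrow> cmod (\<Sum>j\<in>J. a j * (\<Prod>i\<in>set js. r j i (s i))) \<le> B) \<longrightarrow>
    chain_image E \<noteq> {} \<longrightarrow>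
    norm (\<Sum>j\<in>J. a j *\<^sub>C prod_list (map (\<lambda>i. h i (r j i)) js)) \<le> C * B"
    by (elim exE conjE)
  note C = C0 Cb[rule_format]
  obtain C' where C': "C' \<ge> 0" "\<And>J r y B. (\<And>j. j \<in> (J :: nat set) \<Longrightarrow> r j holomorphic_on V) \<Longrightarrow>
    (\<And>z. z \<in> chain_image E \<Longrightarrow> norm (\<Sum>j\<in>J. r j z *\<^sub>C y j) \<le> B) \<Longrightarrow>
    norm (\<Sum>j\<in>J. h i (r j) * y j) \<le> C' * B"
  proof (rule spectral_chain.calculus_bound[OF spectral, of i])
    fix C' :: real
    assume "C' \<ge> 0" and "\<And>J r y B. (\<And>j. j \<in> (J :: nat set) \<Longrightarrow> r j holomorphic_on V) \<Longrightarrow>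
      (\<And>z. z \<in> chain_image E \<Longrightarrow> norm (\<Sum>j\<in>J. r j z *\<^sub>C y j) \<le> B) \<Longrightarrow>
      norm (\<Sum>j\<in>J. h i (r j) * y j) \<le> C' * B"
    then show thesis by (rule that)
  qed
  have "norm (\<Sum>j\<in>J. a j *\<^sub>C prod_list (map (\<lambda>i. h i (r j i)) (i # js))) \<le> C' * C * B"
    if hol: "\<And>j i. j \<in> J \<Longrightarrow> r j i holomorphic_on V"
      and bnd: "\<And>s. (\<And>i. s i \<in> chain_image E) \<Longrightarrow> cmod (\<Sum>j\<in>J. a j * (\<Prod>i\<in>set (i # js). r j i (s i))) \<le> B"
      and ne: "chain_image E \<noteq> {}"
    for J :: "nat set" and a r B
  proof -
    let ?y = "\<lambda>j. a j *\<^sub>C prod_list (map (\<lambda>i. h i (r j i)) js)"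
    have "norm (\<Sum>j\<in>J. h i (r j i) * ?y j) \<le> C' * (C * B)"
    proof (rule C'(2))
      fix z assume z: "z \<in> chain_image E"
      have "norm (\<Sum>j\<in>J. (a j * r j i z) *\<^sub>C prod_list (map (\<lambda>i. h i (r j i)) js)) \<le> C * B"
      proof (rule C(2))
        fix s :: "'n \<Rightarrow> complex" assume s: "\<And>i. s i \<in> chain_image E"
        have "(\<Sum>j\<in>J. a j * (\<Prod>k\<in>set (i # js). r j k ((s(i := z)) k))) = (\<Sum>j\<in>J. a j * r j i z * (\<Prod>k\<in>set js. r j k (s k)))"
        proof (intro sum.cong refl)
          fix j
          have "(\<Prod>k\<in>set js. r j k ((s(i := z)) k)) = (\<Prod>k\<in>set js. r j k (s k))"
            using Cons.prems by (intro prod.cong) auto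
          then show "a j * (\<Prod>k\<in>set (i # js). r j k ((s(i := z)) k)) = a j * r j i z * (\<Prod>k\<in>set js. r j k (s k))"
            using Cons.prems by simp
        qed
        then show "cmod (\<Sum>j\<in>J. a j * r j i z * (\<Prod>k\<in>set js. r j k (s k))) \<le> B"
          using bnd[of "s(i := z)"] s z by auto
      qed (use hol ne in auto)
      then show "norm (\<Sum>j\<in>J. r j i z *\<^sub>C ?y j) \<le> C * B"
        by (simp add: scaleC_scaleC mult.commute)
    qed (use hol in auto)
    then show ?thesis by (simp add: mult_scaleC_right mult.assoc)
  qed
  then show ?case using C(1) C'(1) by (intro exI[of _ "C' * C"]) auto
qed

text \<open>Over the empty chain all integrals would vanish, including the one that represents 1.\<close>

lemma chain_image_nonempty: "chain_image E \<noteq> {}"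
proof
  assume "chain_image E = {}"
  then have "E = []" by (cases E) (auto simp: chain_image_def)
  obtain i :: 'n where True by blast
  have "h i (\<lambda>z. 1) = 1" by (rule spectral_chain.calculus_one[OF spectral])
  then show False using \<open>E = []\<close> by (simp add: chain_calculus_def cycle_integral_def)
qed

text \<open>In particular the value depends only on the function, not on its representation as a sum of
  products.\<close>

lemma evaluates_bound:
  obtains C where "C \<ge> 0" "\<And>\<psi> x B. evaluates \<psi> x \<Longrightarrow> (\<And>s. s \<in> K \<Longrightarrow> cmod (\<psi> s) \<le> B) \<Longrightarrow> norm x \<le> C * B"
proof -
  from evaluates_bound_partial[OF "is"(1)]
  obtain C where C0: "C \<ge> 0" and Cb: "\<forall>(J :: nat set) a r B. (\<forall>j\<in>J. \<forall>i. r j i holomorphic_on V) \<longrightarrow>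
    (\<forall>s. (\<forall>i. s i \<in> chain_image E) \<longrightarrow> cmod (\<Sum>j\<in>J. a j * (\<Prod>i\<in>set is. r j i (s i))) \<le> B) \<longrightarrow>
    chain_image E \<noteq> {} \<longrightarrow>
    norm (\<Sum>j\<in>J. a j *\<^sub>C prod_list (map (\<lambda>i. h i (r j i)) is)) \<le> C * B"
    by (elim exE conjE)
  note C = C0 Cb[rule_format, OF _ _ chain_image_nonempty]
  have "norm x \<le> C * B" if ev: "evaluates \<psi> x" and B: "\<And>s. s \<in> K \<Longrightarrow> cmod (\<psi> s) \<le> B" for \<psi> x B
  proof -
    obtain m :: nat and a r where m: "\<forall>j<m. \<forall>i. rational_on V (r j i)"
      "\<psi> = (\<lambda>s :: complex^'n. \<Sum>j<m. a j * (\<Prod>i\<in>UNIV. r j i (s $ i)))"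
      "x = (\<Sum>j<m. a j *\<^sub>C prod_list (map (\<lambda>i. h i (r j i)) is))"
      by (rule evaluates_sum_form[OF ev])
    show ?thesis unfolding m(3)
    proof (rule C(2))
      fix s :: "'n \<Rightarrow> complex" assume "\<And>i. s i \<in> chain_image E"
      then have "(\<chi> i. s i) \<in> K" by (simp add: power_set_def)
      from B[OF this] show "cmod (\<Sum>j<m. a j * (\<Prod>i\<in>set is. r j i (s i))) \<le> B"
        by (simp add: m(2) "is"(2))
    qed (use m(1) rational_on_holomorphic in auto)
  qed
  then show ?thesis using that C(1) by blast
qed

text \<open>The graph of the continuous extension of \<open>evaluates\<close> with respect to the supremum over the product of
  the chains.\<close>

definition approximates :: "(complex^'n \<Rightarrow> complex) \<Rightarrow> 'd \<Rightarrow> bool" where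
  "approximates \<phi> x \<longleftrightarrow> (\<forall>e>0. \<exists>\<psi> y. evaluates \<psi> y \<and> (\<forall>s\<in>K. cmod (\<phi> s - \<psi> s) \<le> e) \<and> norm (x - y) \<le> e)"

lemma approximatesE:
  assumes "approximates \<phi> x" "e > 0"
  obtains \<psi> y where "evaluates \<psi> y" "\<And>s. s \<in> K \<Longrightarrow> cmod (\<phi> s - \<psi> s) \<le> e" "norm (x - y) \<le> e"
  using assms unfolding approximates_def by blast

lemma approximates_evaluates: "evaluates \<psi> x \<Longrightarrow> approximates \<psi> x"
  unfolding approximates_def by (auto intro!: exI[of _ \<psi>] exI[of _ x])

lemma approximates_bound:
  obtains C where "C \<ge> 0" "\<And>\<phi> x \<phi>' x' B. approximates \<phi> x \<Longrightarrow> approximates \<phi>' x' \<Longrightarrow>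
    (\<And>s. s \<in> K \<Longrightarrow> cmod (\<phi> s - \<phi>' s) \<le> B) \<Longrightarrow> norm (x - x') \<le> C * B"
proof -
  obtain C where C: "C \<ge> 0" "\<And>\<psi> x B. evaluates \<psi> x \<Longrightarrow> (\<And>s. s \<in> K \<Longrightarrow> cmod (\<psi> s) \<le> B) \<Longrightarrow> norm x \<le> C * B"
    using evaluates_bound by metis
  have "norm (x - x') \<le> C * B"
    if a: "approximates \<phi> x" "approximates \<phi>' x'" and B: "\<And>s. s \<in> K \<Longrightarrow> cmod (\<phi> s - \<phi>' s) \<le> B" for \<phi> x \<phi>' x' B
  proof (rule field_le_epsilon)
    fix \<epsilon> :: real assume "\<epsilon> > 0"
    define e where "e = \<epsilon> / (2 * C + 2)"
    have p: "2 * C + 2 > 0" using C(1) by simp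
    have e: "e > 0" using \<open>\<epsilon> > 0\<close> p by (simp add: e_def)
    obtain \<psi> y where 1: "evaluates \<psi> y" "\<And>s. s \<in> K \<Longrightarrow> cmod (\<phi> s - \<psi> s) \<le> e" "norm (x - y) \<le> e"
      using approximatesE[OF a(1) e] by metis
    obtain \<psi>' y' where 2: "evaluates \<psi>' y'" "\<And>s. s \<in> K \<Longrightarrow> cmod (\<phi>' s - \<psi>' s) \<le> e" "norm (x' - y') \<le> e"
      using approximatesE[OF a(2) e] by metis
    have "evaluates (\<lambda>s :: complex^'n. \<psi> s + (-1) * \<psi>' s) (y + (-1) *\<^sub>C y')"
      by (rule evaluates_add[OF evaluates_scale[OF 2(1)] 1(1)])
    then have "evaluates (\<lambda>s :: complex^'n. \<psi> s - \<psi>' s) (y - y')" by (simp add: scaleC_minus_one)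
    then have 3: "norm (y - y') \<le> C * (B + 2 * e)"
    proof (rule C(2))
      fix s assume s: "s \<in> K"
      have "\<psi> s - \<psi>' s = (\<phi> s - \<phi>' s) + (\<phi>' s - \<psi>' s) - (\<phi> s - \<psi> s)" by simp
      also have "cmod \<dots> \<le> cmod (\<phi> s - \<phi>' s) + cmod (\<phi>' s - \<psi>' s) + cmod (\<phi> s - \<psi> s)"
        by (meson add_right_mono norm_triangle_ineq norm_triangle_ineq4 order_trans)
      finally show "cmod (\<psi> s - \<psi>' s) \<le> B + 2 * e" using B[OF s] 1(2)[OF s] 2(2)[OF s] by linarith
    qed
    have "x - x' = (x - y) + (y - y') - (x' - y')" by simp
    also have "norm \<dots> \<le> norm (x - y) + norm (y - y') + norm (x' - y')"
      by (meson add_right_mono norm_triangle_ineq norm_triangle_ineq4 order_trans)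
    also have "\<dots> \<le> e + C * (B + 2 * e) + e" using 1(3) 2(3) 3 by linarith
    also have "\<dots> = C * B + e * (2 * C + 2)" by (simp add: algebra_simps)
    also have "e * (2 * C + 2) = \<epsilon>"
    proof -
      have "x / y * y = x" if "y > 0" for x y :: real using that by simp
      then show ?thesis unfolding e_def using p by blast
    qed
    finally show "norm (x - x') \<le> C * B + \<epsilon>" .
  qed
  then show ?thesis using that C(1) by blast
qed

lemma approximates_unique: "approximates \<phi> x \<Longrightarrow> approximates \<phi> x' \<Longrightarrow> x = x'"
proof -
  assume a: "approximates \<phi> x" "approximates \<phi> x'"
  obtain C where "\<And>\<phi> x \<phi>' x' B. approximates \<phi> x \<Longrightarrow> approximates \<phi>' x' \<Longrightarrow>
    (\<And>s. s \<in> K \<Longrightarrow> cmod (\<phi> s - \<phi>' s) \<le> B) \<Longrightarrow> norm (x - x') \<le> C * B"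
    using approximates_bound by metis
  from this[OF a, of 0] show ?thesis by simp
qed

lemma approximates_add:
  assumes a: "approximates \<phi> x" "approximates \<phi>' x'"
  shows "approximates (\<lambda>s :: complex^'n. \<phi> s + \<phi>' s) (x + x')"
  unfolding approximates_def
proof (intro allI impI)
  fix e :: real assume "e > 0"
  then have e: "e / 2 > 0" by simp
  obtain \<psi> y where 1: "evaluates \<psi> y" "\<And>s. s \<in> K \<Longrightarrow> cmod (\<phi> s - \<psi> s) \<le> e / 2" "norm (x - y) \<le> e / 2"
    using approximatesE[OF a(1) e] by metis
  obtain \<psi>' y' where 2: "evaluates \<psi>' y'" "\<And>s. s \<in> K \<Longrightarrow> cmod (\<phi>' s - \<psi>' s) \<le> e / 2" "norm (x' - y') \<le> e / 2"
    using approximatesE[OF a(2) e] by metis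
  have "cmod (\<phi> s + \<phi>' s - (\<psi> s + \<psi>' s)) \<le> e" if s: "s \<in> K" for s
    using norm_triangle_mono[OF 1(2)[OF s] 2(2)[OF s]] by (simp add: add_diff_add)
  moreover have "norm (x + x' - (y + y')) \<le> e"
    using norm_triangle_mono[OF 1(3) 2(3)] by (simp add: add_diff_add)
  ultimately show "\<exists>\<psi> y. evaluates \<psi> y \<and> (\<forall>s\<in>K. cmod (\<phi> s + \<phi>' s - \<psi> s) \<le> e) \<and> norm (x + x' - y) \<le> e"
    using evaluates_add[OF 2(1) 1(1)] by (intro exI[of _ "\<lambda>s :: complex^'n. \<psi> s + \<psi>' s"] exI[of _ "y + y'"]) auto
qed

lemma approximates_mult:
  assumes a: "approximates \<phi> x" "approximates \<phi>' x'"
    and B: "\<And>s. s \<in> K \<Longrightarrow> cmod (\<phi> s) \<le> B" "\<And>s. s \<in> K \<Longrightarrow> cmod (\<phi>' s) \<le> B"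
  shows "approximates (\<lambda>s :: complex^'n. \<phi> s * \<phi>' s) (x * x')"
  unfolding approximates_def
proof (intro allI impI)
  fix e :: real assume e: "e > 0"
  define M where "M = max B 0 + norm x + norm x' + 1"
  have M: "M \<ge> 1" "B \<le> M" "norm x \<le> M" "norm x' \<le> M"
    using norm_ge_zero[of x] norm_ge_zero[of x'] max.cobounded1[of B 0] max.cobounded2[of 0 B]
    unfolding M_def by linarith+
  define d where "d = min 1 (e / (2 * M + 1))"
  have p: "2 * M + 1 > 0" using M by simp
  have d: "d > 0" "d \<le> 1" "d * (2 * M + 1) \<le> e"
  proof -
    show "d > 0" "d \<le> 1" using e p by (auto simp: d_def)
    have "d * (2 * M + 1) \<le> e / (2 * M + 1) * (2 * M + 1)"
      using p by (intro mult_right_mono) (auto simp: d_def)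
    then show "d * (2 * M + 1) \<le> e" using p by simp
  qed
  have key: "norm (u * v - u' * v') \<le> e"
    if "norm u \<le> M" "norm v \<le> M" "norm (u - u') \<le> d" "norm (v - v') \<le> d"
    for u v u' v' :: "'z::real_normed_algebra"
  proof -
    have "norm v' \<le> M + 1"
      using norm_triangle_ineq4[of v "v - v'"] that d(2) by simp
    have "u * v - u' * v' = u * (v - v') + (u - u') * v'" by (simp add: algebra_simps)
    also have "norm \<dots> \<le> M * d + d * (M + 1)"
      using that \<open>norm v' \<le> M + 1\<close> M d
      by (intro norm_triangle_mono order_trans[OF norm_mult_ineq] mult_mono) auto
    also have "\<dots> = d * (2 * M + 1)" by (simp add: algebra_simps)
    finally show ?thesis using d(3) by simp
  qed
  obtain \<psi> y where 1: "evaluates \<psi> y" "\<And>s. s \<in> K \<Longrightarrow> cmod (\<phi> s - \<psi> s) \<le> d" "norm (x - y) \<le> d"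
    using approximatesE[OF a(1) d(1)] by metis
  obtain \<psi>' y' where 2: "evaluates \<psi>' y'" "\<And>s. s \<in> K \<Longrightarrow> cmod (\<phi>' s - \<psi>' s) \<le> d" "norm (x' - y') \<le> d"
    using approximatesE[OF a(2) d(1)] by metis
  have "cmod (\<phi> s * \<phi>' s - \<psi> s * \<psi>' s) \<le> e" if s: "s \<in> K" for s
    using B[OF s] M(2) 1(2)[OF s] 2(2)[OF s] by (intro key) auto
  moreover have "norm (x * x' - y * y') \<le> e" using M 1(3) 2(3) by (intro key) auto
  ultimately show "\<exists>\<psi> y. evaluates \<psi> y \<and> (\<forall>s\<in>K. cmod (\<phi> s * \<phi>' s - \<psi> s) \<le> e) \<and> norm (x * x' - y) \<le> e"
    using evaluates_mult[OF 2(1) 1(1)] by (intro exI[of _ "\<lambda>s :: complex^'n. \<psi> s * \<psi>' s"] exI[of _ "y * y'"]) auto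
qed

lemma rational_span_evaluates:
  assumes "\<psi> \<in> rational_span U" shows "\<exists>x. evaluates \<psi> x"
proof -
  obtain m :: nat and a r where m: "\<psi> = (\<lambda>s :: complex^'n. \<Sum>j<m. a j * (\<Prod>i\<in>UNIV. r j i (s $ i)))" "\<forall>j<m. \<forall>i. rational_on U (r j i)"
    using assms by (auto simp: rational_span_def)
  then show ?thesis using evaluates_sum_formI[of m r a] rational_on_mono[OF _ VU] by blast
qed

text \<open>The values of a sequence of approximating sums form a Cauchy sequence by \<open>evaluates_bound\<close>.\<close>

lemma approximates_exists:
  assumes "\<phi> \<in> Hol0 U" shows "\<exists>x. approximates \<phi> x"
proof -
  obtain C where C: "C \<ge> 0" "\<And>\<psi> x B. evaluates \<psi> x \<Longrightarrow> (\<And>s. s \<in> K \<Longrightarrow> cmod (\<psi> s) \<le> B) \<Longrightarrow> norm x \<le> C * B"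
    using evaluates_bound by metis
  have "\<exists>\<psi> y. evaluates \<psi> y \<and> (\<forall>s\<in>K. cmod (\<phi> s - \<psi> s) \<le> inverse (real (Suc n)))" for n
  proof -
    have "\<exists>\<psi>\<in>rational_span U. \<forall>s\<in>K. cmod (\<phi> s - \<psi> s) < inverse (real (Suc n))"
      using assms compact_K K_subset by (simp add: Hol0_def)
    then show ?thesis using rational_span_evaluates by (meson less_imp_le)
  qed
  then obtain \<psi> y where y: "\<And>n. evaluates (\<psi> n) (y n)" "\<And>n s. s \<in> K \<Longrightarrow> cmod (\<phi> s - \<psi> n s) \<le> inverse (real (Suc n))"
    by metis
  have diff: "norm (y m - y n) \<le> C * (inverse (real (Suc m)) + inverse (real (Suc n)))" for m n
  proof -
    have "evaluates (\<lambda>s :: complex^'n. \<psi> m s + (-1) * \<psi> n s) (y m + (-1) *\<^sub>C y n)"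
      by (rule evaluates_add[OF evaluates_scale[OF y(1)] y(1)])
    then have "evaluates (\<lambda>s :: complex^'n. \<psi> m s - \<psi> n s) (y m - y n)" by (simp add: scaleC_minus_one)
    then show ?thesis
    proof (rule C(2))
      fix s assume s: "s \<in> K"
      have "\<psi> m s - \<psi> n s = (\<phi> s - \<psi> n s) - (\<phi> s - \<psi> m s)" by simp
      then show "cmod (\<psi> m s - \<psi> n s) \<le> inverse (real (Suc m)) + inverse (real (Suc n))"
        using norm_triangle_ineq4[of "\<phi> s - \<psi> n s" "\<phi> s - \<psi> m s"] y(2)[OF s, of m] y(2)[OF s, of n] by simp
    qed
  qed
  have "Cauchy y"
  proof (rule metric_CauchyI)
    fix e :: real assume e: "e > 0"
    have "(\<lambda>n. 2 * C * inverse (real (Suc n))) \<longlonglongrightarrow> 2 * C * 0"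
      by (intro tendsto_intros LIMSEQ_inverse_real_of_nat)
    then have "\<forall>\<^sub>F n in sequentially. 2 * C * inverse (real (Suc n)) < e"
      using e by (intro order_tendstoD) auto
    then obtain M where M: "\<And>n. n \<ge> M \<Longrightarrow> 2 * C * inverse (real (Suc n)) < e"
      by (auto simp: eventually_sequentially)
    have "dist (y m) (y n) < e" if "m \<ge> M" "n \<ge> M" for m n
      using diff[of m n] M[OF that(1)] M[OF that(2)] by (simp add: dist_norm algebra_simps)
    then show "\<exists>M. \<forall>m\<ge>M. \<forall>n\<ge>M. dist (y m) (y n) < e" by blast
  qed
  then obtain x where x: "y \<longlonglongrightarrow> x" using Cauchy_convergent_iff convergent_def by blast
  have "approximates \<phi> x"
    unfolding approximates_def
  proof (intro allI impI)
    fix e :: real assume e: "e > 0"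
    have "\<forall>\<^sub>F n in sequentially. dist (y n) x < e" using x e by (rule tendstoD)
    moreover have "\<forall>\<^sub>F n in sequentially. inverse (real (Suc n)) < e"
      using order_tendstoD(2)[OF LIMSEQ_inverse_real_of_nat e] .
    ultimately have "\<forall>\<^sub>F n in sequentially. dist (y n) x < e \<and> inverse (real (Suc n)) < e" by (rule eventually_conj)
    then obtain n where n: "dist (y n) x < e" "inverse (real (Suc n)) < e"
      using eventually_happens'[OF sequentially_bot] by blast
    have "\<forall>s\<in>K. cmod (\<phi> s - \<psi> n s) \<le> e" using y(2)[of _ n] n(2) by (meson less_imp_le order_trans)
    then show "\<exists>\<psi> y. evaluates \<psi> y \<and> (\<forall>s\<in>K. cmod (\<phi> s - \<psi> s) \<le> e) \<and> norm (x - y) \<le> e"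
      using y(1)[of n] n(1) by (intro exI[of _ "\<psi> n"] exI[of _ "y n"]) (simp add: dist_norm norm_minus_commute)
  qed
  then show ?thesis by blast
qed

lemma evaluates_one: "evaluates (\<lambda>s :: complex^'n. 1) 1"
proof -
  have "prod_list (map (\<lambda>i. h i (\<lambda>z. 1)) is) = 1"
    by (simp add: spectral_chain.calculus_one[OF spectral]) (induction "is", auto)
  then show ?thesis using evaluates_term[of "\<lambda>_ _. 1" 1] by (simp add: rational_on_const)
qed

lemma prod_single:
  fixes s :: "complex^'n"
  shows "(\<Prod>j\<in>UNIV. (if j = i then g else (\<lambda>z. 1)) (s $ j)) = g (s $ i)"
proof -
  have "(\<Prod>j\<in>UNIV. (if j = i then g else (\<lambda>z. 1)) (s $ j)) = (\<Prod>j\<in>UNIV. if j = i then g (s $ j) else 1)"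
    by (intro prod.cong) auto
  then show ?thesis by simp
qed

lemma evaluates_coordinate:
  assumes "rational_on V r" shows "evaluates (\<lambda>s :: complex^'n. r (s $ i)) (h i r)"
proof -
  let ?r = "\<lambda>j. if j = i then r else (\<lambda>z. 1)"
  have "map (\<lambda>j. h j (?r j)) is = map (\<lambda>j. if j = i then h i r else 1) is"
    by (auto simp: spectral_chain.calculus_one[OF spectral])
  then have "prod_list (map (\<lambda>j. h j (?r j)) is) = h i r"
    using prod_list_insert_one[OF "is"(1)] "is"(2) by simp
  then show ?thesis
    using evaluates_term[of ?r 1] assms by (simp add: rational_on_const prod_single)
qed

lemma h_id: "h i (\<lambda>z. z) = c i"
  using spectral_chain.calculus_id_mult(1)[OF spectral, of "\<lambda>z. 1" i] spectral_chain.calculus_one[OF spectral, of i]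
  by simp

lemma Hol0_bounded:
  assumes "\<phi> \<in> Hol0 U" obtains B where "\<And>s. s \<in> K \<Longrightarrow> cmod (\<phi> s) \<le> B"
proof -
  have "continuous_on K \<phi>"
    using assms multi_holomorphic_on_imp_continuous_on continuous_on_subset[OF _ K_subset] by (auto simp: Hol0_def)
  from compact_imp_bounded[OF compact_continuous_image[OF this compact_K]] show ?thesis
    using that by (auto simp: bounded_iff)
qed

lemma is_multi_calculus_approximates:
  "is_multi_calculus U c (\<lambda>\<phi>. THE x. approximates \<phi> x)"
proof -
  have the: "(THE x. approximates \<phi> x) = x" if "approximates \<phi> x" for \<phi> x
    using that approximates_unique by blast
  have app: "approximates \<phi> (THE x. approximates \<phi> x)" if "\<phi> \<in> Hol0 U" for \<phi>
    using approximates_exists[OF that] the by metis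
  obtain C where C: "C \<ge> 0" "\<And>\<phi> x \<phi>' x' B. approximates \<phi> x \<Longrightarrow> approximates \<phi>' x' \<Longrightarrow>
    (\<And>s. s \<in> K \<Longrightarrow> cmod (\<phi> s - \<phi>' s) \<le> B) \<Longrightarrow> norm (x - x') \<le> C * B"
    using approximates_bound by metis
  show ?thesis
    unfolding is_multi_calculus_def
  proof (intro conjI ballI allI impI)
    fix \<phi> :: "complex^'n \<Rightarrow> complex" assume \<phi>: "\<phi> \<in> Hol0 U"
    obtain B where B: "\<And>s. s \<in> K \<Longrightarrow> cmod (\<phi> s) \<le> B" using Hol0_bounded[OF \<phi>] by blast
    {
      fix \<psi> :: "complex^'n \<Rightarrow> complex" assume \<psi>: "\<psi> \<in> Hol0 U"
      obtain B' where B': "\<And>s. s \<in> K \<Longrightarrow> cmod (\<psi> s) \<le> B'" using Hol0_bounded[OF \<psi>] by blast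
      show "(THE x. approximates (\<lambda>s :: complex^'n. \<phi> s + \<psi> s) x) = (THE x. approximates \<phi> x) + (THE x. approximates \<psi> x)"
        by (rule the[OF approximates_add[OF app[OF \<phi>] app[OF \<psi>]]])
      show "(THE x. approximates (\<lambda>s :: complex^'n. \<phi> s * \<psi> s) x) = (THE x. approximates \<phi> x) * (THE x. approximates \<psi> x)"
        by (rule the[OF approximates_mult[OF app[OF \<phi>] app[OF \<psi>], of "max B B'"]])
           (use B B' in \<open>auto simp: le_max_iff_disj\<close>)
    }
    show "(THE x. approximates (\<lambda>s :: complex^'n. \<alpha> * \<phi> s) x) = \<alpha> *\<^sub>C (THE x. approximates \<phi> x)" for \<alpha>
    proof -
      have "approximates (\<lambda>s :: complex^'n. \<alpha>) (\<alpha> *\<^sub>C 1)"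
        using approximates_evaluates[OF evaluates_scale[OF evaluates_one, of \<alpha>]] by simp
      from approximates_mult[OF this app[OF \<phi>], of "max (cmod \<alpha>) B"] show ?thesis
        using B by (intro the) (auto simp: le_max_iff_disj mult_scaleC_left)
    qed
    fix e :: real assume e: "e > 0"
    \<comment> \<open>Continuity with the compact set \<open>K\<close> itself; \<open>C + 1\<close> instead of
      \<open>C\<close> because \<open>C\<close> may be 0.\<close>
    define d where "d = e / (C + 1)"
    have d: "d > 0" "C * d < e" using e C(1) by (auto simp: d_def field_simps)
    have "norm ((THE x. approximates \<psi> x) - (THE x. approximates \<phi> x)) < e"
      if "\<psi> \<in> Hol0 U" "\<forall>s\<in>K. cmod (\<psi> s - \<phi> s) < d" for \<psi>
      using C(2)[OF app[OF that(1)] app[OF \<phi>], of d] that(2) d(2) by (force intro: less_imp_le)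
    then show "\<exists>K d. compact K \<and> K \<subseteq> power_set U \<and> 0 < d \<and>
        (\<forall>\<psi>\<in>Hol0 U. (\<forall>s\<in>K. cmod (\<psi> s - \<phi> s) < d) \<longrightarrow>
          norm ((THE x. approximates \<psi> x) - (THE x. approximates \<phi> x)) < e)"
      using compact_K K_subset d(1) by blast
  next
    show "(THE x. approximates (\<lambda>s :: complex^'n. 1) x) = 1" by (rule the[OF approximates_evaluates[OF evaluates_one]])
    show "(THE x. approximates (\<lambda>s :: complex^'n. s $ i) x) = c i" for i
      using the[OF approximates_evaluates[OF evaluates_coordinate[OF rational_on_id]], of i] by (simp add: h_id)
  qed
qed

text \<open>An algebra homomorphism that maps the coordinates to \<open>c\<close> has no choice: polynomials of one coordinate
  are determined by linearity and multiplicativity, quotients because the denominator is invertible,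
  and then products and sums.\<close>

lemma multi_calculus_on_rational_span:
  assumes \<Phi>: "is_multi_calculus U c \<Phi>" and \<psi>: "\<psi> \<in> rational_span U"
  shows "evaluates \<psi> (\<Phi> \<psi>)"
proof -
  have add: "\<Phi> (\<lambda>s :: complex^'n. \<phi> s + \<psi> s) = \<Phi> \<phi> + \<Phi> \<psi>" and mult: "\<Phi> (\<lambda>s :: complex^'n. \<phi> s * \<psi> s) = \<Phi> \<phi> * \<Phi> \<psi>"
    and scale: "\<Phi> (\<lambda>s :: complex^'n. \<alpha> * \<phi> s) = \<alpha> *\<^sub>C \<Phi> \<phi>" if "\<phi> \<in> rational_span U" "\<psi> \<in> rational_span U" for \<phi> \<psi> \<alpha>
  proof -
    have "\<phi> \<in> Hol0 U" "\<psi> \<in> Hol0 U" using that rational_span_subset_Hol0[OF U] by blast+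
    note H = this
    show "\<Phi> (\<lambda>s. \<phi> s + \<psi> s) = \<Phi> \<phi> + \<Phi> \<psi>" by (rule is_multi_calculusD(1)[OF \<Phi> H])
    show "\<Phi> (\<lambda>s. \<phi> s * \<psi> s) = \<Phi> \<phi> * \<Phi> \<psi>" by (rule is_multi_calculusD(3)[OF \<Phi> H])
    show "\<Phi> (\<lambda>s. \<alpha> * \<phi> s) = \<alpha> *\<^sub>C \<Phi> \<phi>" by (rule is_multi_calculusD(2)[OF \<Phi> H(1)])
  qed
  note one = is_multi_calculusD(4)[OF \<Phi>] and coord = is_multi_calculusD(5)[OF \<Phi>]
  \<comment> \<open>Continuity with respect to compact subsets of the domain.\<close>
  have agree: "\<Phi> \<phi> = \<Phi> \<psi>" if "\<phi> \<in> Hol0 U" "\<psi> \<in> Hol0 U" and agr: "\<And>s. s \<in> power_set U \<Longrightarrow> \<phi> s = \<psi> s" for \<phi> \<psi>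
  proof -
    have "norm (\<Phi> \<psi> - \<Phi> \<phi>) < e" if e: "e > 0" for e
    proof -
      from is_multi_calculusD(6)[OF \<Phi> \<open>\<phi> \<in> Hol0 U\<close> e]
      obtain K d where "compact K" and K: "K \<subseteq> power_set U" "0 < d" and bd:
        "\<forall>\<psi>\<in>Hol0 U. (\<forall>s\<in>K. cmod (\<psi> s - \<phi> s) < d) \<longrightarrow> norm (\<Phi> \<psi> - \<Phi> \<phi>) < e"
        by (elim exE conjE)
      show ?thesis
      proof (rule bd[rule_format, OF \<open>\<psi> \<in> Hol0 U\<close>])
        fix s assume "s \<in> K"
        then have "\<phi> s = \<psi> s" using K(1) by (intro agr) auto
        then show "cmod (\<psi> s - \<phi> s) < d" using K(2) by simp
      qed
    qed
    from this[of "norm (\<Phi> \<psi> - \<Phi> \<phi>)"] have "norm (\<Phi> \<psi> - \<Phi> \<phi>) = 0"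
      using norm_ge_zero[of "\<Phi> \<psi> - \<Phi> \<phi>"] by linarith
    then show ?thesis by simp
  qed
  have prodS: "(\<lambda>s :: complex^'n. \<Prod>i\<in>I. r i (s $ i)) \<in> rational_span U" if "\<And>i. rational_on U (r i)" for r I
  proof -
    have "(\<lambda>s :: complex^'n. 1 * (\<Prod>i\<in>UNIV. (if i \<in> I then r i else (\<lambda>z. 1)) (s $ i))) \<in> rational_span U"
      by (rule rational_span_term) (use that rational_on_const in auto)
    moreover have "(\<Prod>i\<in>UNIV. (if i \<in> I then r i else (\<lambda>z. 1)) (s $ i)) = (\<Prod>i\<in>I. r i (s $ i))" for s :: "complex^'n"
      by (rule prod.mono_neutral_cong_right) auto
    ultimately show ?thesis by simp
  qed
  have coordS: "(\<lambda>s :: complex^'n. r (s $ i)) \<in> rational_span U" if "rational_on U r" for r i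
    using prodS[of "\<lambda>_. r" "{i}"] that by simp
  have hV: "g holomorphic_on V" if "rational_on U g" for g
    using that rational_on_holomorphic rational_on_mono[OF _ VU] by blast
  have \<Phi>_poly: "\<Phi> (\<lambda>s :: complex^'n. poly p (s $ i)) = h i (poly p)" for p i
  proof (induction p)
    case 0
    have "\<Phi> (\<lambda>s :: complex^'n. 0 * 1) = 0 *\<^sub>C \<Phi> (\<lambda>s :: complex^'n. 1)"
      using scale[OF coordS[OF rational_on_const] coordS[OF rational_on_const], of 0 1] by simp
    moreover have "poly 0 = (\<lambda>z :: complex. 0)" by (rule ext) simp
    then have "h i (poly 0) = 0"
      using spectral_chain.calculus_scale[OF spectral, of "\<lambda>z. 1" i 0] by simp
    ultimately show ?case using \<open>poly 0 = (\<lambda>z :: complex. 0)\<close> by (simp only: mult_zero_left scaleC_zero_left poly_0)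
  next
    case (pCons a p)
    have zp: "rational_on U (\<lambda>z. z * poly p z)"
      by (rule rational_on_mult[OF rational_on_id rational_on_poly])
    have "\<Phi> (\<lambda>s :: complex^'n. poly (pCons a p) (s $ i)) = \<Phi> (\<lambda>s :: complex^'n. a + s $ i * poly p (s $ i))" by simp
    also have "\<dots> = \<Phi> (\<lambda>s :: complex^'n. a) + \<Phi> (\<lambda>s :: complex^'n. s $ i * poly p (s $ i))"
      using add[OF coordS[OF rational_on_const] coordS[OF zp, of i], of a] by simp
    also have "\<Phi> (\<lambda>s :: complex^'n. a) = a *\<^sub>C 1"
      using scale[OF coordS[OF rational_on_const] coordS[OF rational_on_const], of a 1] one by simp
    also have "\<Phi> (\<lambda>s :: complex^'n. s $ i * poly p (s $ i)) = c i * h i (poly p)"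
      using mult[OF coordS[OF rational_on_id] coordS[OF rational_on_poly], of i p i] coord pCons.IH by simp
    also have "a *\<^sub>C 1 + c i * h i (poly p) = h i (\<lambda>z. a * 1 + z * poly p z)"
      using spectral_chain.calculus_add[OF spectral, of "\<lambda>z. a * 1" "\<lambda>z. z * poly p z" i]
        spectral_chain.calculus_scale[OF spectral, of "\<lambda>z. 1" i a] spectral_chain.calculus_one[OF spectral, of i]
        spectral_chain.calculus_id_mult(1)[OF spectral, of "poly p" i] hV[OF zp] hV[OF rational_on_poly]
      by simp
    also have "(\<lambda>z. a * 1 + z * poly p z) = poly (pCons a p)" by auto
    finally show ?case .
  qed
  have \<Phi>_rational: "\<Phi> (\<lambda>s :: complex^'n. r (s $ i)) = h i r" if r: "rational_on U r" for r i
  proof -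
    obtain p q where q: "\<And>z. z \<in> U \<Longrightarrow> poly q z \<noteq> 0" and r': "r = (\<lambda>z. poly p z / poly q z)"
      using r by (auto simp: rational_on_def)
    have qr: "rational_on U (\<lambda>z. poly q z * r z)" by (rule rational_on_mult[OF rational_on_poly r])
    have "h i (poly q) * \<Phi> (\<lambda>s :: complex^'n. r (s $ i)) = \<Phi> (\<lambda>s :: complex^'n. poly q (s $ i) * r (s $ i))"
      using mult[OF coordS[OF rational_on_poly] coordS[OF r], of q i i] \<Phi>_poly by simp
    also have "\<dots> = \<Phi> (\<lambda>s :: complex^'n. poly p (s $ i))"
      using coordS[OF qr, of i] coordS[OF rational_on_poly, of p i] rational_span_subset_Hol0[OF U, where 'n = 'n] q
      by (intro agree) (auto simp: r' power_set_def)
    also have "\<dots> = h i (poly p)" by (rule \<Phi>_poly)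
    also have "\<dots> = h i (\<lambda>z. poly q z * r z)"
      by (rule spectral_chain.calculus_cong[OF spectral]) (use q VU in \<open>auto simp: r'\<close>)
    also have "\<dots> = h i (poly q) * h i r"
      by (rule spectral_chain.calculus_poly_mult(1)[OF spectral hV[OF r]])
    finally have "h i (poly q) * \<Phi> (\<lambda>s :: complex^'n. r (s $ i)) = h i (poly q) * h i r" .
    moreover have "is_inverse (h i (poly q)) (h i (\<lambda>z. 1 / poly q z))"
      by (rule spectral_chain.calculus_rational_inverse[OF spectral]) (use q VU in auto)
    ultimately show ?thesis by (rule is_inverse_cancel[rotated])
  qed
  have \<Phi>_prod: "\<Phi> (\<lambda>s :: complex^'n. \<Prod>i\<in>set js. r i (s $ i)) = prod_list (map (\<lambda>i. h i (r i)) js)"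
    if r: "\<And>i. rational_on U (r i)" and "distinct js" for r js
    using \<open>distinct js\<close>
  proof (induction js)
    case Nil
    then show ?case using one by simp
  next
    case (Cons i js)
    then show ?case
      using mult[OF coordS[OF r[of i], of i] prodS[of r "set js", OF r]] \<Phi>_rational[OF r[of i], of i] by simp
  qed
  obtain m :: nat and a r where m: "\<psi> = (\<lambda>s :: complex^'n. \<Sum>j<m. a j * (\<Prod>i\<in>UNIV. r j i (s $ i)))" "\<forall>j<m. \<forall>i. rational_on U (r j i)"
    using \<psi> by (auto simp: rational_span_def)
  have "\<Phi> (\<lambda>s :: complex^'n. \<Sum>j<m'. a j * (\<Prod>i\<in>UNIV. r j i (s $ i))) = (\<Sum>j<m'. a j *\<^sub>C prod_list (map (\<lambda>i. h i (r j i)) is))"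
    if "m' \<le> m" for m'
    using that
  proof (induction m')
    case 0
    have "\<Phi> (\<lambda>s :: complex^'n. 0 * 1) = 0 *\<^sub>C \<Phi> (\<lambda>s :: complex^'n. 1)"
      using scale[OF coordS[OF rational_on_const] coordS[OF rational_on_const], of 0 1] by simp
    then show ?case by simp
  next
    case (Suc k)
    have r: "\<And>i. rational_on U (r k i)" using Suc.prems m(2) by auto
    have S: "(\<lambda>s :: complex^'n. \<Sum>j<k. a j * (\<Prod>i\<in>UNIV. r j i (s $ i))) \<in> rational_span U"
      unfolding rational_span_def using Suc.prems m(2) by (intro CollectI exI[of _ k] exI[of _ a] exI[of _ r]) auto
    have "\<Phi> (\<lambda>s :: complex^'n. a k * (\<Prod>i\<in>UNIV. r k i (s $ i))) = a k *\<^sub>C prod_list (map (\<lambda>i. h i (r k i)) is)"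
      using scale[OF prodS[of "r k" UNIV, OF r] prodS[of "r k" UNIV, OF r], of "a k"] \<Phi>_prod[of "r k" "is", OF r "is"(1)] "is"(2) by simp
    then show ?case
      using add[OF S rational_span_term[of U "r k" "a k", OF r]] Suc by simp
  qed
  from this[of m] have "\<Phi> \<psi> = (\<Sum>j<m. a j *\<^sub>C prod_list (map (\<lambda>i. h i (r j i)) is))" by (simp add: m(1))
  then show ?thesis
    using evaluates_sum_formI[of m r a] m rational_on_mono[OF _ VU] by metis
qed

text \<open>The homomorphism is continuous for the supremum over some compact set \<open>K'\<close>, and the bound of the
  constructed calculus uses the product \<open>K\<close> of the chains.  Sums that approximate \<open>\<phi>\<close> on \<open>K' \<union> K\<close>
  serve both.\<close>

lemma multi_calculus_approximates:
  assumes \<Phi>: "is_multi_calculus U c \<Phi>" and \<phi>: "\<phi> \<in> Hol0 U"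
  shows "approximates \<phi> (\<Phi> \<phi>)"
  unfolding approximates_def
proof (intro allI impI)
  fix e :: real assume e: "e > 0"
  from is_multi_calculusD(6)[OF \<Phi> \<phi> e]
  obtain K' d where K': "compact K'" "K' \<subseteq> power_set U" "0 < d" and bd:
    "\<forall>\<psi>\<in>Hol0 U. (\<forall>s\<in>K'. cmod (\<psi> s - \<phi> s) < d) \<longrightarrow> norm (\<Phi> \<psi> - \<Phi> \<phi>) < e"
    by (elim exE conjE)
  have "compact (K' \<union> K) \<and> K' \<union> K \<subseteq> power_set U \<and> 0 < min d e"
    using K' K_subset e compact_Un[OF K'(1) compact_K] by simp
  note A = this
  have "\<forall>K e. compact K \<and> K \<subseteq> power_set U \<and> 0 < e \<longrightarrow> (\<exists>\<psi>\<in>rational_span U. \<forall>s\<in>K. cmod (\<phi> s - \<psi> s) < e)"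
    using \<phi> by (simp add: Hol0_def)
  from this[rule_format, where K = "K' \<union> K" and e = "min d e", OF A]
  obtain \<psi> where \<psi>: "\<psi> \<in> rational_span U" "\<forall>s\<in>K' \<union> K. cmod (\<phi> s - \<psi> s) < min d e" by (elim bexE)
  have "norm (\<Phi> \<psi> - \<Phi> \<phi>) < e"
  proof (rule bd[rule_format])
    show "\<psi> \<in> Hol0 U" using \<psi>(1) rational_span_subset_Hol0[OF U] by blast
    show "cmod (\<psi> s - \<phi> s) < d" if "s \<in> K'" for s
      using \<psi>(2)[rule_format, of s] that by (simp add: norm_minus_commute)
  qed
  moreover have "\<forall>s\<in>K. cmod (\<phi> s - \<psi> s) \<le> e"
    using \<psi>(2) by (auto intro: less_imp_le)
  ultimately show "\<exists>\<psi> y. evaluates \<psi> y \<and> (\<forall>s\<in>K. cmod (\<phi> s - \<psi> s) \<le> e) \<and> norm (\<Phi> \<phi> - y) \<le> e"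
    using multi_calculus_on_rational_span[OF \<Phi> \<psi>(1)]
    by (intro exI[of _ \<psi>] exI[of _ "\<Phi> \<psi>"]) (simp add: norm_minus_commute)
qed

lemma multi_calculus_eqI:
  assumes "\<phi> \<in> Hol0 U" "approximates \<phi> x"
  shows "multi_calculus U \<phi> c = x"
  unfolding multi_calculus_def
proof (rule the_equality)
  have "x = (THE x. approximates \<phi> x)"
    by (rule the_equality[symmetric, of "approximates \<phi>", OF assms(2)]) (rule approximates_unique[OF _ assms(2)])
  then show "\<exists>\<Phi>. is_multi_calculus U c \<Phi> \<and> x = \<Phi> \<phi>"
    using is_multi_calculus_approximates by (intro exI[of _ "\<lambda>\<phi>. THE x. approximates \<phi> x"] conjI)
  fix y assume "\<exists>\<Phi>. is_multi_calculus U c \<Phi> \<and> y = \<Phi> \<phi>"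
  then obtain \<Phi> where "is_multi_calculus U c \<Phi>" "y = \<Phi> \<phi>" by (elim exE conjE)
  from multi_calculus_approximates[OF this(1) assms(1)] this(2)
  show "y = x" by (intro approximates_unique[OF _ assms(2)]) simp
qed

lemma resolvent_product_vholomorphic:
  fixes f :: "complex \<Rightarrow> complex"
  assumes "f holomorphic_on A" "A \<inter> L = {}"
  shows "(\<lambda>z. f z *\<^sub>C prod_list (map (\<lambda>i. resolvent (c i) z) is)) vholomorphic_on A"
proof (intro vholomorphic_on_scaleC assms(1) vholomorphic_on_prod_list vholomorphic_on_resolvent)
  show "A \<inter> spectrum (c i) = {}" for i using spec[of i] assms(2) by blast
qed

text \<open>Nodes outside \<open>V\<close> give factors \<open>1 / (z - s $ i)\<close> that are rational without poles in \<open>V\<close>, and their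
  values at \<open>c\<close> are resolvents.\<close>

lemma evaluates_riemann_sum:
  assumes "\<And>w z. (w, z) \<in> set xs \<Longrightarrow> z \<notin> V"
  shows "evaluates (\<lambda>s :: complex^'n. \<Sum>(w, z)\<leftarrow>xs. (a * w * f z) * (\<Prod>i\<in>UNIV. 1 / (z - s $ i)))
     (\<Sum>(w, z)\<leftarrow>xs. (a * w * f z) *\<^sub>C prod_list (map (\<lambda>i. resolvent (c i) z) is))"
  using assms
proof (induction xs)
  case Nil
  then show ?case using evaluates.zero by simp
next
  case (Cons x xs)
  obtain w z where x: "x = (w, z)" by (metis surj_pair)
  have z: "z \<notin> V" using Cons.prems x by auto
  have "evaluates (\<lambda>s :: complex^'n. \<Sum>(w, z)\<leftarrow>xs. (a * w * f z) * (\<Prod>i\<in>UNIV. 1 / (z - s $ i)))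
     (\<Sum>(w, z)\<leftarrow>xs. (a * w * f z) *\<^sub>C prod_list (map (\<lambda>i. resolvent (c i) z) is))"
    by (rule Cons.IH) (use Cons.prems in auto)
  from evaluates.add_term[OF this, of "\<lambda>_ t. 1 / (z - t)" "a * w * f z", OF rational_on_pole[OF z]]
  show ?case
    by (simp add: x add.commute spectral_chain.calculus_resolvent[OF spectral z])
qed

text \<open>Two nested chains are in play.  The inner one, in \<open>V\<close>, carries the estimates of the calculus; the
  outer one, around the closure of \<open>V\<close>, carries the integral.  Riemann sums with the same nodes
  approximate the scalar integral uniformly on the product of the inner chains and the integral of the
  resolvents in norm.\<close>

lemma approximates_divided_diff:
  fixes f :: "complex \<Rightarrow> complex"
  assumes f: "f holomorphic_on U" and cV: "compact (closure V)" "closure V \<subseteq> U"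
    and E': "Cauchy_chain E' (closure V) U"
  shows "approximates (divided_diff_integral U f)
    ((1 / (2 * pi * \<i>)) *\<^sub>C cycle_integral E' (\<lambda>z. f z *\<^sub>C prod_list (map (\<lambda>i. resolvent (c i) z) is)))"
  unfolding approximates_def
proof (intro allI impI)
  fix e :: real assume e: "e > 0"
  let ?F = "\<lambda>z. f z *\<^sub>C prod_list (map (\<lambda>i. resolvent (c i) z) is)"
  let ?k = "\<lambda>(s :: complex^'n) z. f z * (\<Prod>i\<in>UNIV. 1 / (z - s $ i))"
  let ?Z = "chain_image E'"
  have P: "polygonal E' (U - closure V)" using E' by (rule polygonal_Cauchy_chain)
  have Z: "compact ?Z" "?Z \<subseteq> U - closure V" "polygonal E' ?Z"
    using P compact_chain_image[OF P] polygonal_chain_image by blast+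
  have KV: "s $ i \<in> closure V" if "s \<in> K" for i and s :: "complex^'n"
    using that chain_image_subset closure_subset by (auto simp: power_set_def)
  have off: "z \<noteq> s $ i" if "z \<in> ?Z" "s \<in> K" for z i and s :: "complex^'n"
    using that(1) Z(2) KV[OF that(2)] by blast
  have fc: "continuous_on ?Z f" using f Z(2) holomorphic_on_imp_continuous_on continuous_on_subset by blast
  \<comment> \<open>The function \<open>1 / (z - w)\<close> with \<open>w\<close> outside \<open>V\<close> is holomorphic
    on \<open>V\<close>, so its integral is 0 and not \<open>2 \<pi> \<i>\<close>.\<close>
  have LV: "L \<subseteq> V"
  proof
    fix w assume w: "w \<in> L"
    show "w \<in> V"
    proof (rule ccontr)
      assume "w \<notin> V"
      then have "(\<lambda>z. 1 / (z - w)) holomorphic_on V" by (intro holomorphic_intros) auto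
      then show False using E w by (auto simp: Cauchy_chain_def)
    qed
  qed
  have Fc: "continuous_on ?Z ?F"
  proof (rule continuous_on_subset[OF vholomorphic_on_imp_continuous_on])
    show "?F vholomorphic_on (U - closure V)"
      by (rule resolvent_product_vholomorphic)
         (use f holomorphic_on_subset LV closure_subset[of V] in \<open>auto\<close>)
  qed (rule Z(2))
  define e' where "e' = e / (chain_length E' + 1)"
  have len: "chain_length E' \<ge> 0" by (rule chain_length_nonneg)
  have e': "e' > 0" using e len by (simp add: e'_def add_nonneg_pos)
  have e'len: "1 * (e' * chain_length E') \<le> e"
  proof -
    have "e' * chain_length E' \<le> e' * (chain_length E' + 1)" using e' by simp
    also have "\<dots> = e" using len by (simp add: e'_def)
    finally show ?thesis by simp
  qed
  obtain d where d: "d > 0" "\<And>(s :: complex^'n) z z'. s \<in> K \<Longrightarrow> z \<in> ?Z \<Longrightarrow> z' \<in> ?Z \<Longrightarrow> cmod (z - z') < d \<Longrightarrow>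
      cmod (?k s z - ?k s z') \<le> e'"
  proof (rule divided_diff_kernel_equicontinuous[OF Z(1) compact_K fc off e'])
    fix d :: real
    assume "d > 0" and "\<And>(s :: complex^'n) z z'. s \<in> K \<Longrightarrow> z \<in> ?Z \<Longrightarrow> z' \<in> ?Z \<Longrightarrow> cmod (z - z') < d \<Longrightarrow>
      cmod (?k s z - ?k s z') \<le> e'"
    then show thesis by (rule that)
  qed
  have "uniformly_continuous_on ?Z ?F" using compact_uniformly_continuous[OF Fc Z(1)] .
  then obtain d' where d': "d' > 0" "\<forall>z\<in>?Z. \<forall>z'\<in>?Z. dist z' z < d' \<longrightarrow> dist (?F z') (?F z) < e'"
    unfolding uniformly_continuous_on_def using e' by blast
  have "min d d' > 0" using d(1) d'(1) by simp
  from riemann_step[OF len this] obtain N :: nat where N: "N > 0" "chain_length E' / N < min d d'" .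
  have c1: "cmod (1 / (2 * pi * \<i>)) \<le> 1" using pi_gt3 by (simp add: norm_divide norm_mult)
  have Ff: "norm ((1 / (2 * pi * \<i>)) *\<^sub>C cycle_integral E' ?F - (1 / (2 * pi * \<i>)) *\<^sub>C riemann_sum E' N ?F) \<le> e"
  proof -
    have "norm (cycle_integral E' ?F - riemann_sum E' N ?F) \<le> e' * chain_length E'"
      by (rule polygonal_riemann[OF Z(3) N(1) _ Fc, of "min d d'"])
         (use N d'(2) in \<open>auto simp: dist_norm intro: less_imp_le\<close>)
    then have "cmod (1 / (2 * pi * \<i>)) * norm (cycle_integral E' ?F - riemann_sum E' N ?F) \<le> 1 * (e' * chain_length E')"
      using c1 by (intro mult_mono) auto
    then show ?thesis unfolding scaleC_diff_right[symmetric] norm_scaleC using e'len by linarith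
  qed
  have kk: "cmod (divided_diff_integral U f s - 1 / (2 * pi * \<i>) * riemann_sum E' N (?k s)) \<le> e" if s: "s \<in> K" for s
  proof -
    have kc: "continuous_on ?Z (?k s)" by (intro continuous_intros fc) (use off s in auto)
    have "cmod (cycle_integral E' (?k s) - riemann_sum E' N (?k s)) \<le> e' * chain_length E'"
      by (rule polygonal_riemann[OF Z(3) N(1) _ kc, of "min d d'"]) (use N d(2)[OF s] in auto)
    then have "cmod (1 / (2 * pi * \<i>)) * cmod (cycle_integral E' (?k s) - riemann_sum E' N (?k s)) \<le> 1 * (e' * chain_length E')"
      using c1 by (intro mult_mono) auto
    moreover have "divided_diff_integral U f s = 1 / (2 * pi * \<i>) * cycle_integral E' (?k s)"
      by (rule divided_diff_integral_eq[OF U f cV E' KV[OF s]])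
    ultimately show ?thesis unfolding norm_mult[symmetric] using e'len by (simp add: right_diff_distrib)
  qed
  have nodes: "z \<notin> V" if "(w, z) \<in> set (riemann_nodes E' N)" for w z
    using riemann_nodes_subset[OF P that] closure_subset[of V] by blast
  have "1 / (2 * pi * \<i>) * riemann_sum E' N (?k s)
      = (\<Sum>(w, z)\<leftarrow>riemann_nodes E' N. (1 / (2 * pi * \<i>) * w * f z) * (\<Prod>i\<in>UNIV. 1 / (z - s $ i)))" for s :: "complex^'n"
    using scaleC_riemann_sum[of "1 / (2 * pi * \<i>)" E' N f "\<lambda>z. \<Prod>i\<in>UNIV. 1 / (z - s $ i)"]
    by (simp add: scaleC_complex_def)
  then have "evaluates (\<lambda>s :: complex^'n. 1 / (2 * pi * \<i>) * riemann_sum E' N (?k s))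
      ((1 / (2 * pi * \<i>)) *\<^sub>C riemann_sum E' N ?F)"
    using evaluates_riemann_sum[of "riemann_nodes E' N" "1 / (2 * pi * \<i>)" f, OF nodes]
    by (simp only: scaleC_riemann_sum)
  then show "\<exists>\<psi> y. evaluates \<psi> y \<and> (\<forall>s\<in>K. cmod (divided_diff_integral U f s - \<psi> s) \<le> e) \<and>
      norm ((1 / (2 * pi * \<i>)) *\<^sub>C cycle_integral E' ?F - y) \<le> e"
    by (intro exI[of _ "\<lambda>s :: complex^'n. 1 / (2 * pi * \<i>) * riemann_sum E' N (?k s)"]
        exI[of _ "(1 / (2 * pi * \<i>)) *\<^sub>C riemann_sum E' N ?F"] conjI ballI kk Ff)
qed

lemma approximates_cong:
  "approximates \<phi> x \<Longrightarrow> (\<And>s. s \<in> K \<Longrightarrow> \<phi> s = \<phi>' s) \<Longrightarrow> approximates \<phi>' x"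
  unfolding approximates_def by simp

end

text \<open>Any cycle may be used: the product of the resolvents is holomorphic outside the spectra.\<close>

lemma multi_calculus_divided_diff:
  fixes c :: "'n::{finite, linorder} \<Rightarrow> 'd::complex_banach_algebra_1" and f :: "complex \<Rightarrow> complex"
  assumes U: "open U" and f: "f holomorphic_on U" and spec: "\<And>i. spectrum (c i) \<subseteq> U"
    and comm: "\<And>i j. c i * c j = c j * c i" and "is": "distinct is" "set is = UNIV"
    and \<Gamma>: "surrounds \<Gamma> (\<Union>i. spectrum (c i)) U"
  shows "multi_calculus U (divided_diff U f) c
    = (1 / (2 * pi * \<i>)) *\<^sub>C cycle_integral \<Gamma> (\<lambda>z. f z *\<^sub>C prod_list (map (\<lambda>i. resolvent (c i) z) is))"
proof -
  let ?L = "\<Union>i. spectrum (c i)"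
  let ?F = "\<lambda>z. f z *\<^sub>C prod_list (map (\<lambda>i. resolvent (c i) z) is)"
  have L: "compact ?L" "?L \<subseteq> U" using spec by (auto intro: compact_UN compact_spectrum)
  obtain V where V: "open V" "?L \<subseteq> V" "compact (closure V)" "closure V \<subseteq> U"
    using open_between_compact_open[OF L(1) U L(2)] .
  obtain E where E: "Cauchy_chain E ?L V" using Cauchy_chain_exists[OF L(1) V(1,2)] by blast
  obtain E' where E': "Cauchy_chain E' (closure V) U" using Cauchy_chain_exists[OF V(3) U V(4)] by blast
  interpret cs: commuting_spectra U V ?L E c "is"
  proof
    show "V \<subseteq> U" using V(4) closure_subset by blast
    show "spectrum (c i) \<subseteq> ?L" for i by blast
  qed (fact U V(1) L(1) E comm "is")+
  have "cs.approximates (divided_diff U f) ((1 / (2 * pi * \<i>)) *\<^sub>C cycle_integral E' ?F)"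
    by (rule cs.approximates_cong[OF cs.approximates_divided_diff[OF f V(3,4) E']])
       (use cs.K_subset in \<open>auto simp: divided_diff_eq[OF U f]\<close>)
  then have "multi_calculus U (divided_diff U f) c = (1 / (2 * pi * \<i>)) *\<^sub>C cycle_integral E' ?F"
    by (rule cs.multi_calculus_eqI[OF divided_diff_Hol0[OF U f]])
  also have "cycle_integral E' ?F = cycle_integral \<Gamma> ?F"
  proof (rule vCauchy_chain_integral_eq[symmetric, OF U V(3) _ _ E' \<Gamma>])
    show "closed ?L" using L(1) by (rule compact_imp_closed)
    show "?L \<subseteq> closure V" using V(2) closure_subset by blast
    show "?F vholomorphic_on U - ?L"
      by (rule cs.resolvent_product_vholomorphic) (use f holomorphic_on_subset in auto)
  qed
  finally show ?thesis .
qed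


section \<open>Differentiating the holomorphic functional calculus\<close>

definition resolvent_word :: "'b::complex_banach_algebra_1 \<Rightarrow> 'b list \<Rightarrow> complex \<Rightarrow> 'b" where
  "resolvent_word a bs z = prod_list (map (\<lambda>b. resolvent a z * b) bs) * resolvent a z"

lemma resolvent_word_simps:
  "resolvent_word a [] = resolvent a"
  "resolvent_word a (b # bs) = (\<lambda>z. resolvent a z * b * resolvent_word a bs z)"
  by (simp_all add: resolvent_word_def mult.assoc fun_eq_iff)

definition insert_at :: "nat \<Rightarrow> 'x \<Rightarrow> 'x list \<Rightarrow> 'x list" where
  "insert_at i x xs = take i xs @ x # drop i xs"

lemma vholomorphic_on_resolvent_word:
  "S \<inter> spectrum a = {} \<Longrightarrow> resolvent_word a bs vholomorphic_on S"
  by (induction bs)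
     (auto simp: resolvent_word_simps intro!: vholomorphic_on_mult vholomorphic_on_const vholomorphic_on_resolvent)

text \<open>Product rule: differentiating the factor \<open>R\<close> at position \<open>i\<close> replaces it by \<open>R b' R\<close>, which inserts \<open>b'\<close>
  into the word.\<close>

lemma expands_resolvent_word:
  fixes a b' :: "'b::complex_banach_algebra_1"
  assumes Z: "compact Z" "Z \<inter> spectrum a = {}"
  shows "expands (\<lambda>t :: real. resolvent_word (a + t *\<^sub>R b') bs)
    (\<lambda>z h. h *\<^sub>R (\<Sum>i\<le>length bs. resolvent_word a (insert_at i b' bs) z)) 0 Z"
proof -
  have "bounded_linear (\<lambda>h. h *\<^sub>R b')" by (rule bounded_linear_scaleR_left)
  from expands_resolvent[OF this, of "\<lambda>t. a + t *\<^sub>R b'" 0 Z] Z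
  have R: "expands (\<lambda>t :: real. resolvent (a + t *\<^sub>R b')) (\<lambda>z h. resolvent a z * (h *\<^sub>R b') * resolvent a z) 0 Z"
    by simp
  show ?thesis
  proof (induction bs)
    case Nil
    show ?case using R by (simp add: resolvent_word_simps insert_at_def mult.assoc)
  next
    case (Cons b bs)
    have "expands (\<lambda>t :: real. \<lambda>z. b) (\<lambda>z h. 0) 0 Z" by (rule expands_const) (use Z in auto)
    from expands_mult[OF expands_mult[OF R this] Cons]
    have "expands (\<lambda>t :: real. resolvent_word (a + t *\<^sub>R b') (b # bs))
      (\<lambda>z h. resolvent a z * b * (h *\<^sub>R (\<Sum>i\<le>length bs. resolvent_word a (insert_at i b' bs) z))
         + resolvent a z * (h *\<^sub>R b') * resolvent a z * b * resolvent_word a bs z) 0 Z"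
      by (simp add: resolvent_word_simps)
    moreover have "resolvent a z * b * (h *\<^sub>R (\<Sum>i\<le>length bs. resolvent_word a (insert_at i b' bs) z))
         + resolvent a z * (h *\<^sub>R b') * resolvent a z * b * resolvent_word a bs z
      = h *\<^sub>R (\<Sum>i\<le>length (b # bs). resolvent_word a (insert_at i b' (b # bs)) z)" for z h
    proof -
      have "(\<Sum>i\<le>length (b # bs). resolvent_word a (insert_at i b' (b # bs)) z)
        = resolvent_word a (b' # b # bs) z + (\<Sum>i\<le>length bs. resolvent_word a (b # insert_at i b' bs) z)"
        by (simp add: sum.atMost_Suc_shift insert_at_def del: sum.atMost_Suc)
      then show ?thesis
        by (simp add: resolvent_word_simps sum_distrib_left scaleR_add_right mult.assoc add.commute scaleR_sum_right)
    qed
    ultimately show ?case by (simp only:)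
  qed
qed

text \<open>The resolvent is bounded outside \<open>V\<close>: by compactness on a large disc and by its decay elsewhere.  So a
  single bound for the perturbation works for all points outside \<open>V\<close>.\<close>

lemma spectrum_upper_semicontinuous:
  fixes a :: "'b::complex_banach_algebra_1"
  assumes V: "open V" "spectrum a \<subseteq> V"
  obtains d where "d > 0" "\<And>h. norm h < d \<Longrightarrow> spectrum (a + h) \<subseteq> V"
proof -
  let ?A = "cball 0 (norm a + 1) - V"
  have A: "compact ?A" using V(1) by (intro compact_diff) auto
  have "continuous_on ?A (resolvent a)" by (rule continuous_on_resolvent) (use V in auto)
  from compact_imp_bounded[OF compact_continuous_image[OF this A]]
  have "\<exists>B. \<forall>z\<in>?A. norm (resolvent a z) \<le> B" by (simp add: bounded_iff)
  then obtain B where B: "\<And>z. z \<in> ?A \<Longrightarrow> norm (resolvent a z) \<le> B" by blast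
  have bound: "norm (resolvent a z) \<le> max 1 B" if "z \<notin> V" for z
  proof (cases "cmod z \<le> norm a + 1")
    case True
    then have "norm (resolvent a z) \<le> B" using that by (intro B) auto
    then show ?thesis by simp
  next
    case False
    then have "1 / (cmod z - norm a) \<le> 1" by simp
    moreover have "norm (resolvent a z) \<le> 1 / (cmod z - norm a)" using False by (intro norm_resolvent_le) simp
    ultimately have "norm (resolvent a z) \<le> 1" by (rule order_trans[rotated])
    then show ?thesis by simp
  qed
  define d where "d = 1 / (2 * max 1 B)"
  have "spectrum (a + h) \<subseteq> V" if h: "norm h < d" for h
  proof
    fix z assume z: "z \<in> spectrum (a + h)"
    show "z \<in> V"
    proof (rule ccontr)
      assume n: "z \<notin> V"
      have "norm (resolvent a z) * norm h \<le> max 1 B * d"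
        using bound[OF n] h by (intro mult_mono) auto
      also have "\<dots> = 1 / 2" by (simp add: d_def max_def)
      finally show False using resolvent_perturb(1)[of z a h] z n V(2) by blast
    qed
  qed
  moreover have "d > 0" by (simp add: d_def less_max_iff_disj)
  ultimately show thesis by (intro that)
qed

definition word_calculus :: "(real \<Rightarrow> complex) list \<Rightarrow> (complex \<Rightarrow> complex) \<Rightarrow> 'b::complex_banach_algebra_1 \<Rightarrow> 'b list \<Rightarrow> 'b" where
  "word_calculus E f a bs = (1 / (2 * pi * \<i>)) *\<^sub>C cycle_integral E (\<lambda>z. f z *\<^sub>C resolvent_word a bs z)"

lemma word_calculus_chain_independent:
  fixes f :: "complex \<Rightarrow> complex"
  assumes U: "open U" and f: "f holomorphic_on U"
    and L: "compact L" "Cauchy_chain E L U" "spectrum a \<subseteq> L" and M: "compact M" "Cauchy_chain E' M U" "spectrum a \<subseteq> M"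
  shows "word_calculus E f a bs = word_calculus E' f a bs"
proof -
  have "(\<lambda>z. f z *\<^sub>C resolvent_word a bs z) vholomorphic_on (U - spectrum a)"
    using f by (intro vholomorphic_on_scaleC vholomorphic_on_resolvent_word holomorphic_on_subset[OF f]) auto
  from Cauchy_chains_integral_eq[OF U compact_imp_closed[OF compact_spectrum] L(3) M(3) L(1,2) M(1,2) this]
  show ?thesis by (simp add: word_calculus_def)
qed

lemma word_calculus_derivative:
  fixes f :: "complex \<Rightarrow> complex" and a b' :: "'b::complex_banach_algebra_1"
  assumes f: "f holomorphic_on U" and E: "Cauchy_chain E L U" "spectrum a \<subseteq> L"
  shows "((\<lambda>t :: real. word_calculus E f (a + t *\<^sub>R b') bs)
    has_vector_derivative (\<Sum>i\<le>length bs. word_calculus E f a (insert_at i b' bs))) (at 0)"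
proof -
  let ?Z = "chain_image E"
  have P: "polygonal E (U - L)" using E(1) by (rule polygonal_Cauchy_chain)
  have Z: "compact ?Z" "?Z \<subseteq> U - L" "polygonal E ?Z"
    using P compact_chain_image[OF P] polygonal_chain_image by blast+
  have Zs: "?Z \<inter> spectrum a = {}" using Z(2) E(2) by blast
  have fc: "continuous_on ?Z (\<lambda>z. f z *\<^sub>C (1 :: 'b))"
    using f Z(2) by (intro continuous_on_scaleC continuous_on_const) (blast intro: holomorphic_on_imp_continuous_on continuous_on_subset)
  let ?S = "\<lambda>z. \<Sum>i\<le>length bs. resolvent_word a (insert_at i b' bs) z"
  have wc: "continuous_on ?Z (\<lambda>z. f z *\<^sub>C resolvent_word a bs' z)" for bs'
    using f Z(2) vholomorphic_on_imp_continuous_on[OF vholomorphic_on_resolvent_word[OF Zs]]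
    by (intro continuous_on_scaleC) (blast intro: holomorphic_on_imp_continuous_on continuous_on_subset)+
  have "expands (\<lambda>t :: real. \<lambda>z. f z *\<^sub>C resolvent_word (a + t *\<^sub>R b') bs z) (\<lambda>z h. h *\<^sub>R (f z *\<^sub>C ?S z)) 0 ?Z"
    using expands_mult[OF expands_const[OF fc Z(1)] expands_resolvent_word[OF Z(1) Zs, of b' bs]]
    by (simp add: mult_scaleC_left scaleC_of_real[symmetric] scaleC_scaleC mult.commute)
  from has_derivative_polygonal_integral[OF Z(3) this]
  have "((\<lambda>t :: real. cycle_integral E (\<lambda>z. f z *\<^sub>C resolvent_word (a + t *\<^sub>R b') bs z))
    has_derivative (\<lambda>h. cycle_integral E (\<lambda>z. h *\<^sub>R (f z *\<^sub>C ?S z)))) (at 0)" .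
  moreover have "cycle_integral E (\<lambda>z. h *\<^sub>R (f z *\<^sub>C ?S z))
      = h *\<^sub>R (\<Sum>i\<le>length bs. cycle_integral E (\<lambda>z. f z *\<^sub>C resolvent_word a (insert_at i b' bs) z))" for h
  proof -
    have "cycle_integral E (\<lambda>z. complex_of_real h *\<^sub>C (\<Sum>i\<le>length bs. f z *\<^sub>C resolvent_word a (insert_at i b' bs) z))
      = complex_of_real h *\<^sub>C cycle_integral E (\<lambda>z. \<Sum>i\<le>length bs. f z *\<^sub>C resolvent_word a (insert_at i b' bs) z)"
      by (rule polygonal_integral_clinear[OF Z(3) continuous_on_sum[OF wc] bounded_clinear_scaleC])
    from this[unfolded scaleC_of_real polygonal_integral_sum[OF Z(3) wc]]
    show ?thesis by (simp only: scaleC_sum_right)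
  qed
  ultimately have "((\<lambda>t :: real. cycle_integral E (\<lambda>z. f z *\<^sub>C resolvent_word (a + t *\<^sub>R b') bs z))
    has_vector_derivative (\<Sum>i\<le>length bs. cycle_integral E (\<lambda>z. f z *\<^sub>C resolvent_word a (insert_at i b' bs) z))) (at 0)"
    by (simp add: has_vector_derivative_def)
  moreover have "bounded_linear (\<lambda>x :: 'b. (1 / (2 * pi * \<i>)) *\<^sub>C x)"
    using bounded_clinear_scaleC by (auto simp: bounded_clinear_def)
  ultimately show ?thesis
    unfolding word_calculus_def scaleC_sum_right[symmetric]
    by (rule bounded_linear.has_vector_derivative[rotated])
qed

abbreviation orderings :: "nat \<Rightarrow> nat list set" where
  "orderings j \<equiv> {xs. distinct xs \<and> set xs = {..<j}}"

lemma length_ordering: "xs \<in> orderings j \<Longrightarrow> length xs = j"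
  using distinct_card[of xs] by simp

text \<open>An ordering of \<open>{..<Suc j}\<close> arises from a unique ordering of \<open>{..<j}\<close> by inserting \<open>j\<close> at a unique
  place.\<close>

lemma sum_orderings_Suc:
  fixes g :: "nat list \<Rightarrow> 'x::comm_monoid_add"
  shows "(\<Sum>xs\<in>orderings j. \<Sum>i\<le>j. g (insert_at i j xs)) = (\<Sum>xs\<in>orderings (Suc j). g xs)"
proof -
  have "(\<Sum>xs\<in>orderings j. \<Sum>i\<le>j. g (insert_at i j xs))
      = (\<Sum>(xs, i)\<in>orderings j \<times> {..j}. g (insert_at i j xs))"
    by (rule sum.cartesian_product)
  also have "\<dots> = (\<Sum>xs\<in>orderings (Suc j). g xs)"
  proof (rule sum.reindex_bij_witness[where j = "\<lambda>(xs, i). insert_at i j xs"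
        and i = "\<lambda>ys. (removeAll j ys, length (takeWhile (\<lambda>x. x \<noteq> j) ys))"])
    fix p assume "p \<in> orderings j \<times> {..j}"
    then obtain xs i where p: "p = (xs, i)" "distinct xs" "set xs = {..<j}" "i \<le> j" by auto
    have len: "length xs = j" using p length_ordering by blast
    have tj: "j \<notin> set (take i xs)" "j \<notin> set (drop i xs)" "j \<notin> set xs"
      using p(3) set_take_subset[of i xs] set_drop_subset[of i xs] by auto
    have "removeAll j (insert_at i j xs) = xs"
      using tj by (simp add: insert_at_def)
    moreover have "takeWhile (\<lambda>x. x \<noteq> j) (insert_at i j xs) = take i xs"
      unfolding insert_at_def using tj(1) by (subst takeWhile_append2) auto
    ultimately show "(removeAll j (case p of (xs, i) \<Rightarrow> insert_at i j xs),
        length (takeWhile (\<lambda>x. x \<noteq> j) (case p of (xs, i) \<Rightarrow> insert_at i j xs))) = p"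
      using p len by simp
    have "set (insert_at i j xs) = insert j (set (take i xs @ drop i xs))"
      unfolding insert_at_def set_append by auto
    then have "set (insert_at i j xs) = {..<Suc j}" using p(3) by auto
    moreover have "distinct (insert_at i j xs)"
    proof -
      have "distinct (take i xs @ drop i xs)" using p(2) by simp
      then show ?thesis using tj(1,2) unfolding insert_at_def distinct_append by auto
    qed
    ultimately show "(case p of (xs, i) \<Rightarrow> insert_at i j xs) \<in> orderings (Suc j)" using p by simp
    show "g (case p of (xs, i) \<Rightarrow> insert_at i j xs) = (case p of (xs, i) \<Rightarrow> g (insert_at i j xs))" using p by simp
  next
    fix ys assume ys: "ys \<in> orderings (Suc j)"
    then have "j \<in> set ys" by auto
    then obtain us vs where uv: "ys = us @ j # vs" "j \<notin> set us" by (meson split_list_first)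
    have vs: "j \<notin> set vs" using ys uv by auto
    have rem: "removeAll j ys = us @ vs" using uv vs by simp
    have tw: "takeWhile (\<lambda>x. x \<noteq> j) ys = us" unfolding uv(1) using uv(2) by (subst takeWhile_append2) auto
    show "(case (removeAll j ys, length (takeWhile (\<lambda>x. x \<noteq> j) ys)) of (xs, i) \<Rightarrow> insert_at i j xs) = ys"
      unfolding rem tw by (simp add: insert_at_def uv(1))
    have ys': "distinct ys" "set ys = {..<Suc j}" using ys by auto
    have "distinct (removeAll j ys)" using ys'(1) by (rule distinct_removeAll)
    moreover have "set (removeAll j ys) = {..<j}" unfolding set_removeAll ys'(2) by (auto simp: less_Suc_eq)
    ultimately have o: "removeAll j ys \<in> orderings j" by (intro CollectI conjI)
    have "length us \<le> length (removeAll j ys)" unfolding rem by simp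
    then have "length us \<le> j" unfolding length_ordering[OF o] .
    with o show "(removeAll j ys, length (takeWhile (\<lambda>x. x \<noteq> j) ys)) \<in> orderings j \<times> {..j}"
      unfolding tw by (intro SigmaI) simp_all
  qed
  finally show ?thesis .
qed

lemma sum_permutes_orderings:
  fixes g :: "nat list \<Rightarrow> 'x::comm_monoid_add"
  shows "(\<Sum>\<pi> | \<pi> permutes {..<k}. g (map \<pi> [0..<k])) = (\<Sum>xs\<in>orderings k. g xs)"
proof (rule sum.reindex_bij_witness[where j = "\<lambda>\<pi>. map \<pi> [0..<k]"
      and i = "\<lambda>xs i. if i < k then xs ! i else i"])
  fix \<pi> assume "\<pi> \<in> {\<pi>. \<pi> permutes {..<k}}"
  then have \<pi>: "\<pi> permutes {..<k}" by simp
  show "(\<lambda>i. if i < k then map \<pi> [0..<k] ! i else i) = \<pi>"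
    using permutes_not_in[OF \<pi>] by (auto simp: fun_eq_iff)
  show "map \<pi> [0..<k] \<in> orderings k"
    using permutes_image[OF \<pi>] permutes_inj_on[OF \<pi>] by (auto simp: distinct_map atLeast0LessThan)
next
  fix xs assume xs: "xs \<in> orderings k"
  then have len: "length xs = k" by (rule length_ordering)
  show "map (\<lambda>i. if i < k then xs ! i else i) [0..<k] = xs"
    using len by (intro nth_equalityI) auto
  have "bij_betw (\<lambda>i. xs ! i) {..<k} {..<k}"
    using xs len by (intro bij_betw_nth) auto
  then have "bij_betw (\<lambda>i. if i < k then xs ! i else i) {..<k} {..<k}"
    by (rule bij_betw_cong[THEN iffD1, rotated]) auto
  then have "(\<lambda>i. if i < k then xs ! i else i) permutes {..<k}"
    by (rule bij_imp_permutes) auto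
  then show "(\<lambda>i. if i < k then xs ! i else i) \<in> {\<pi>. \<pi> permutes {..<k}}" by simp
qed auto

lemma map_insert_at: "map b (insert_at i j xs) = insert_at i (b j) (map b xs)"
  by (simp add: insert_at_def take_map drop_map)

text \<open>Existence and uniqueness of the value in the definition: cycles around the spectrum exist, and all of
  them give the integral over the chain.\<close>

lemma holomorphic_calculus_eq:
  fixes f :: "complex \<Rightarrow> complex" and a :: "'b::complex_banach_algebra_1"
  assumes U: "open U" and f: "f holomorphic_on U" and L: "compact L" "Cauchy_chain E L U" "spectrum a \<subseteq> L" and LU: "L \<subseteq> U"
  shows "holomorphic_calculus U f a = word_calculus E f a []"
  unfolding holomorphic_calculus_def
proof (rule the_equality)
  have F: "(\<lambda>z. f z *\<^sub>C resolvent a z) vholomorphic_on (U - spectrum a)"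
    using f by (intro vholomorphic_on_scaleC vholomorphic_on_resolvent holomorphic_on_subset[OF f]) auto
  have int: "cycle_integral \<Gamma> (\<lambda>z. f z *\<^sub>C resolvent a z) = cycle_integral E (\<lambda>z. f z *\<^sub>C resolvent a z)"
    if "surrounds \<Gamma> (spectrum a) U" for \<Gamma>
    by (rule vCauchy_chain_integral_eq[OF U L(1) compact_imp_closed[OF compact_spectrum] L(3,2) that F])
  obtain E0 where E0: "Cauchy_chain E0 (spectrum a) U"
    using Cauchy_chain_exists[OF compact_spectrum U] L(3) LU by blast
  obtain \<Gamma> where "surrounds \<Gamma> (spectrum a) U"
    using surrounds_of_Cauchy_chain[OF E0 U compact_spectrum] by metis
  then show "\<exists>\<Gamma>. surrounds \<Gamma> (spectrum a) U \<and>
      word_calculus E f a [] = (1 / (2 * pi * \<i>)) *\<^sub>C cycle_integral \<Gamma> (\<lambda>z. f z *\<^sub>C resolvent a z)"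
    using int by (auto simp: word_calculus_def resolvent_word_simps)
  show "x = word_calculus E f a []" if "\<exists>\<Gamma>. surrounds \<Gamma> (spectrum a) U \<and>
      x = (1 / (2 * pi * \<i>)) *\<^sub>C cycle_integral \<Gamma> (\<lambda>z. f z *\<^sub>C resolvent a z)" for x
    using that int by (auto simp: word_calculus_def resolvent_word_simps)
qed

text \<open>The formula for \<open>G\<close> may use a chain around a neighbourhood of the spectrum of \<open>a\<close>.  This chain also
  surrounds the spectra of all nearby elements, so the difference quotients are taken of integrals
  over one fixed chain.\<close>

lemma has_vector_derivative_iter_dir_deriv:
  fixes f :: "complex \<Rightarrow> complex" and a :: "'b::complex_banach_algebra_1"
  assumes U: "open U" and f: "f holomorphic_on U" and a: "spectrum a \<subseteq> U"
    and G: "\<And>a L E. compact L \<Longrightarrow> L \<subseteq> U \<Longrightarrow> Cauchy_chain E L U \<Longrightarrow> spectrum a \<subseteq> L \<Longrightarrow>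
      G a = (\<Sum>xs\<in>orderings j. word_calculus E f a (map b xs))"
    and E: "compact L" "L \<subseteq> U" "Cauchy_chain E L U" "spectrum a \<subseteq> L"
  shows "((\<lambda>t :: real. G (a + t *\<^sub>R b j)) has_vector_derivative
    (\<Sum>xs\<in>orderings (Suc j). word_calculus E f a (map b xs))) (at 0)"
proof -
  obtain V where V: "open V" "spectrum a \<subseteq> V" "compact (closure V)" "closure V \<subseteq> U"
    using open_between_compact_open[OF compact_spectrum U a] .
  obtain E' where E': "Cauchy_chain E' (closure V) U" using Cauchy_chain_exists[OF V(3) U V(4)] by blast
  have aV: "spectrum a \<subseteq> closure V" using V(2) closure_subset by blast
  obtain d where d: "d > 0" "\<And>h. norm h < d \<Longrightarrow> spectrum (a + h) \<subseteq> V"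
    using spectrum_upper_semicontinuous[OF V(1,2)] by metis
  define D where "D = (\<Sum>xs\<in>orderings j. \<Sum>i\<le>length (map b xs). word_calculus E' f a (insert_at i (b j) (map b xs)))"
  have "((\<lambda>t :: real. \<Sum>xs\<in>orderings j. word_calculus E' f (a + t *\<^sub>R b j) (map b xs)) has_vector_derivative D) (at 0)"
    unfolding D_def by (intro has_vector_derivative_sum word_calculus_derivative[OF f E' aV])
  then have "((\<lambda>t :: real. G (a + t *\<^sub>R b j)) has_vector_derivative D) (at 0)"
  proof (rule has_vector_derivative_transform_within_open)
    show "open {t :: real. norm (t *\<^sub>R b j) < d}"
      by (intro open_Collect_less continuous_intros)
    show "(0 :: real) \<in> {t. norm (t *\<^sub>R b j) < d}" using d(1) by simp
    fix t :: real assume "t \<in> {t. norm (t *\<^sub>R b j) < d}"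
    then have "spectrum (a + t *\<^sub>R b j) \<subseteq> closure V" using d(2) closure_subset by blast
    from G[OF V(3,4) E' this]
    show "(\<Sum>xs\<in>orderings j. word_calculus E' f (a + t *\<^sub>R b j) (map b xs)) = G (a + t *\<^sub>R b j)" by simp
  qed
  moreover have "D = (\<Sum>xs\<in>orderings (Suc j). word_calculus E f a (map b xs))"
  proof -
    have "D = (\<Sum>xs\<in>orderings j. \<Sum>i\<le>j. word_calculus E f a (map b (insert_at i j xs)))"
      unfolding D_def
      by (intro sum.cong) (auto simp: map_insert_at length_ordering
          intro!: word_calculus_chain_independent[OF U f V(3) E' aV E(1,3,4)])
    then show ?thesis by (simp only: sum_orderings_Suc[of "\<lambda>xs. word_calculus E f a (map b xs)"])
  qed
  ultimately show ?thesis by simp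
qed

lemma iter_dir_deriv_holomorphic_calculus:
  fixes f :: "complex \<Rightarrow> complex" and a :: "'b::complex_banach_algebra_1"
  assumes U: "open U" and f: "f holomorphic_on U"
    and E: "compact L" "L \<subseteq> U" "Cauchy_chain E L U" "spectrum a \<subseteq> L"
  shows "iter_dir_deriv b j (holomorphic_calculus U f) a = (\<Sum>xs\<in>orderings j. word_calculus E f a (map b xs))"
  using E
proof (induction j arbitrary: a L E)
  case 0
  have "orderings 0 = {[]}" by auto
  then show ?case using holomorphic_calculus_eq[OF U f 0(1,3,4,2)] by simp
next
  case (Suc j)
  have a: "spectrum a \<subseteq> U" using Suc.prems by blast
  have "((\<lambda>t :: real. iter_dir_deriv b j (holomorphic_calculus U f) (a + t *\<^sub>R b j)) has_vector_derivative
    (\<Sum>xs\<in>orderings (Suc j). word_calculus E f a (map b xs))) (at 0)"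
    by (rule has_vector_derivative_iter_dir_deriv[OF U f a Suc.IH Suc.prems])
  from vector_derivative_at[OF this] show ?case by (simp add: dir_deriv_def)
qed

lemma dir_differentiable_iter_dir_deriv:
  fixes f :: "complex \<Rightarrow> complex" and a :: "'b::complex_banach_algebra_1"
  assumes U: "open U" and f: "f holomorphic_on U" and a: "spectrum a \<subseteq> U"
  shows "dir_differentiable (b j) (iter_dir_deriv b j (holomorphic_calculus U f)) a"
proof -
  obtain E where E: "Cauchy_chain E (spectrum a) U"
    using Cauchy_chain_exists[OF compact_spectrum U a] by blast
  have "((\<lambda>t :: real. iter_dir_deriv b j (holomorphic_calculus U f) (a + t *\<^sub>R b j)) has_vector_derivative
    (\<Sum>xs\<in>orderings (Suc j). word_calculus E f a (map b xs))) (at 0)"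
    by (rule has_vector_derivative_iter_dir_deriv[OF U f a iter_dir_deriv_holomorphic_calculus[OF U f]
        compact_spectrum a E order_refl])
  then show ?thesis
    unfolding dir_differentiable_def differentiable_def has_vector_derivative_def by blast
qed

section \<open>The tensor product formula and its contraction\<close>

lemma tensor_divided_diff_integral:
  fixes f :: "complex \<Rightarrow> complex" and as :: "'n::{finite, linorder} \<Rightarrow> 'b::complex_banach_algebra_1"
  assumes U: "open U" and f: "f holomorphic_on U" and as: "\<And>i. spectrum (as i) \<subseteq> U"
    and \<Gamma>: "surrounds \<Gamma> (\<Union>i. spectrum (as i)) U"
  shows "tensor_divided_diff U f as = (1 / (2 * pi * \<i>)) *\<^sub>C cycle_integral \<Gamma> (\<lambda>z. f z *\<^sub>C
     prod_list (map (\<lambda>i. resolvent (slot i (as i)) z) (sorted_list_of_set UNIV)))"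
  unfolding tensor_divided_diff_def
proof (rule multi_calculus_divided_diff[OF U f])
  show "slot i (as i) * slot j (as j) = (slot j (as j) * slot i (as i) :: ('b, 'n) proj_tensor)" for i j
    using slot_commute[of i j] by (cases "i = j") auto
qed (use as \<Gamma> in \<open>auto simp: spectrum_slot\<close>)

text \<open>The contraction is continuous and linear, so it may be applied under the integral, where it meets an
  elementary tensor of resolvents.\<close>

lemma sharp_tensor_divided_diff:
  fixes f :: "complex \<Rightarrow> complex" and a :: "'b::complex_banach_algebra_1"
  assumes U: "open U" and f: "f holomorphic_on U" and a: "spectrum a \<subseteq> U" and E: "Cauchy_chain E (spectrum a) U"
  shows "sharp (tensor_divided_diff U f (\<lambda>i::'n::{finite, linorder}. a)) b
    = word_calculus E f a (map b [0..<CARD('n) - 1])"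
proof -
  let ?F = "\<lambda>z. f z *\<^sub>C prod_list (map (\<lambda>i. resolvent (slot i a :: ('b, 'n) proj_tensor) z) (sorted_list_of_set UNIV))"
  have P: "polygonal E (U - spectrum a)" using E by (rule polygonal_Cauchy_chain)
  have F: "?F vholomorphic_on (U - spectrum a)"
    using f by (intro vholomorphic_on_scaleC vholomorphic_on_prod_list vholomorphic_on_resolvent holomorphic_on_subset[OF f])
      (auto simp: spectrum_slot)
  obtain \<Gamma> where \<Gamma>: "surrounds \<Gamma> (spectrum a) U"
    using surrounds_of_Cauchy_chain[OF E U compact_spectrum] by metis
  then have "tensor_divided_diff U f (\<lambda>i::'n. a) = (1 / (2 * pi * \<i>)) *\<^sub>C cycle_integral \<Gamma> ?F"
    using a by (intro tensor_divided_diff_integral[OF U f]) auto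
  also have "cycle_integral \<Gamma> ?F = cycle_integral E ?F"
    by (rule vCauchy_chain_integral_eq[OF U compact_spectrum compact_imp_closed[OF compact_spectrum] order_refl E \<Gamma> F])
  finally have T: "tensor_divided_diff U f (\<lambda>i::'n. a) = (1 / (2 * pi * \<i>)) *\<^sub>C cycle_integral E ?F" .
  have lin: "sharp (c *\<^sub>C u) b = c *\<^sub>C sharp u b" for c and u :: "('b, 'n) proj_tensor"
    using sharp_characterization(1)[of b, where 'n = 'n] by (simp add: bounded_clinear_def)
  have "cycle_integral E (\<lambda>z. sharp (?F z) b) = sharp (cycle_integral E ?F) b"
    by (rule polygonal_integral_clinear[OF P vholomorphic_on_imp_continuous_on[OF F] sharp_characterization(1)])
  moreover have "cycle_integral E (\<lambda>z. sharp (?F z) b) = cycle_integral E (\<lambda>z. f z *\<^sub>C resolvent_word a (map b [0..<CARD('n) - 1]) z)"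
  proof (rule polygonal_integral_cong[OF P])
    fix z assume "z \<in> U - spectrum a"
    then have "prod_list (map (\<lambda>i. resolvent (slot i a) z) (sorted_list_of_set UNIV))
        = (ptensor (\<lambda>i. resolvent a z) :: ('b, 'n) proj_tensor)"
      using prod_list_slot[of "sorted_list_of_set UNIV" "\<lambda>i :: 'n. resolvent a z"] by (simp add: slot_resolvent(2))
    then show "sharp (?F z) b = f z *\<^sub>C resolvent_word a (map b [0..<CARD('n) - 1]) z"
      by (simp add: lin sharp_characterization(2) resolvent_word_def comp_def)
  qed
  ultimately show ?thesis by (simp add: T lin word_calculus_def)
qed

theorem theorem1p4:
  fixes U :: "complex set" and f :: "complex \<Rightarrow> complex" and k :: nat
    and as :: "'n::{finite, linorder} \<Rightarrow> 'b::complex_banach_algebra_1"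
  assumes "open U" and "f holomorphic_on U" and "CARD('n) = k + 1"
    and "\<And>i. spectrum (as i) \<subseteq> U"
  shows "(\<Union>i. spectrum (as i)) = (\<Union>i. spectrum (slot i (as i) :: ('b, 'n) proj_tensor)) \<and>
    (\<forall>\<Gamma>. surrounds \<Gamma> (\<Union>i. spectrum (as i)) U \<longrightarrow>
       tensor_divided_diff U f as =
         (1 / (2 * pi * \<i>)) *\<^sub>C cycle_integral \<Gamma> (\<lambda>z. f z *\<^sub>C
            prod_list (map (\<lambda>i. resolvent (slot i (as i)) z) (sorted_list_of_set UNIV)))) \<and>
    (\<forall>a b. spectrum (a :: 'b) \<subseteq> U \<longrightarrow>
       (\<forall>j<k. dir_differentiable (b j) (iter_dir_deriv b j (holomorphic_calculus U f)) a) \<and>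
       iter_dir_deriv b k (holomorphic_calculus U f) a =
         (\<Sum>\<pi> | \<pi> permutes {..<k}.
            sharp (tensor_divided_diff U f (\<lambda>i::'n. a)) (\<lambda>j. b (\<pi> j))))"
proof (intro conjI allI impI)
  show "(\<Union>i. spectrum (as i)) = (\<Union>i. spectrum (slot i (as i) :: ('b, 'n) proj_tensor))"
    by (simp add: spectrum_slot)
  show "tensor_divided_diff U f as = (1 / (2 * pi * \<i>)) *\<^sub>C cycle_integral \<Gamma> (\<lambda>z. f z *\<^sub>C
      prod_list (map (\<lambda>i. resolvent (slot i (as i)) z) (sorted_list_of_set UNIV)))"
    if "surrounds \<Gamma> (\<Union>i. spectrum (as i)) U" for \<Gamma>
    using assms(1,2,4) that by (rule tensor_divided_diff_integral)
  fix a :: 'b and b :: "nat \<Rightarrow> 'b" assume a: "spectrum a \<subseteq> U"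
  show "dir_differentiable (b j) (iter_dir_deriv b j (holomorphic_calculus U f)) a" for j
    by (rule dir_differentiable_iter_dir_deriv[OF assms(1,2) a])
  obtain E where E: "Cauchy_chain E (spectrum a) U"
    using Cauchy_chain_exists[OF compact_spectrum assms(1) a] by blast
  have "iter_dir_deriv b k (holomorphic_calculus U f) a = (\<Sum>xs\<in>orderings k. word_calculus E f a (map b xs))"
    by (rule iter_dir_deriv_holomorphic_calculus[OF assms(1,2) compact_spectrum a E order_refl])
  also have "\<dots> = (\<Sum>\<pi> | \<pi> permutes {..<k}. word_calculus E f a (map b (map \<pi> [0..<k])))"
    by (rule sum_permutes_orderings[symmetric])
  also have "\<dots> = (\<Sum>\<pi> | \<pi> permutes {..<k}. sharp (tensor_divided_diff U f (\<lambda>i::'n. a)) (\<lambda>j. b (\<pi> j)))"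
    by (simp add: sharp_tensor_divided_diff[OF assms(1,2) a E] assms(3) comp_def)
  finally show "iter_dir_deriv b k (holomorphic_calculus U f) a
      = (\<Sum>\<pi> | \<pi> permutes {..<k}. sharp (tensor_divided_diff U f (\<lambda>i::'n. a)) (\<lambda>j. b (\<pi> j)))" .
qed


end
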